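(* Let $K$ be a field, let $A$ and $B$ be finite-dimensional $K$-algebras and let $M$ be a finite-dimensional $A\otimes B^o$-module. For every integer $m\geq 1$, $$\chi_{T_m}=\chi_{T_1}+t(m^2-1)\,\Xi\quad\text{in }\mathbf Z[[t]],$$ where $T_m=\begin{pmatrix}A&M^m\\0&B\end{pmatrix}$, $T_1=\begin{pmatrix}A&M\\0&B\end{pmatrix}$ and $\Xi=\sum_{i=0}^\infty t^i\dim_K\mathrm{Ext}^i_{A\otimes B^o}(M,M)$.
   Context: $\otimes=\otimes_K$; algebras are associative unital $K$-algebras, modules are unital left modules, $B^o$ is the opposite algebra. For an $A\otimes B^o$-module $N$, $\begin{pmatrix}A&N\\0&B\end{pmatrix}$ is the triangular matrix algebra with product $\begin{pmatrix}a&n\\0&b\end{pmatrix}\begin{pmatrix}a'&n'\\0&b'\end{pmatrix}=\begin{pmatrix}aa'&an'+nb'\\0&bb'\end{pmatrix}$. For a finite-dimensional algebra $T$, $HH^*T=H^*(T,T)$ is Hochschild cohomology and $\chi_T=\sum_{i=0}^\infty t^i\dim_K(HH^iT)\in\mathbf Z[[t]]$ is the Hilbert–Poincaré series of $T$. *)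

theory Defs
  imports
    "HOL-Library.Function_Algebras"
    "HOL-Library.Product_Plus"
    "HOL-Computational_Algebra.Formal_Power_Series"
begin

section \<open>Algebras and modules over a field\<close>

text \<open>
  A vector space over the field \<^typ>\<open>'k\<close> is a subspace \<open>carrier V\<close> of an ambient vector
  space whose additive group is the type \<^typ>\<open>'a\<close>; carriers rather than whole types are
  used because tensor products and powers \<open>M\<^sup>m\<close> depend on terms. The zero algebra is an algebra.
\<close>

record ('k, 'a) vspace =
  carrier :: "'a set"
  scal :: "'k \<Rightarrow> 'a \<Rightarrow> 'a"

record ('k, 'a) alg = "('k, 'a) vspace" +
  mul :: "'a \<Rightarrow> 'a \<Rightarrow> 'a"
  idt :: 'a

record ('k, 'r, 'a) lmod = "('k, 'a) vspace" +
  act :: "'r \<Rightarrow> 'a \<Rightarrow> 'a"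

locale kspace = vector_space "scal V"
  for V :: "('k::field, 'a::ab_group_add, 'z) vspace_scheme" +
  assumes subspace_carrier: "subspace (carrier V)"

definition fin_dim :: "('k::field, 'a::ab_group_add, 'z) vspace_scheme \<Rightarrow> bool" where
  "fin_dim V \<longleftrightarrow> (\<exists>S. finite S \<and> module.span (scal V) S = carrier V)"

locale kalgebra = kspace A
  for A :: "('k::field, 'a::ab_group_add, 'z) alg_scheme" +
  assumes mul_closed: "\<lbrakk>x \<in> carrier A; y \<in> carrier A\<rbrakk> \<Longrightarrow> mul A x y \<in> carrier A"
    and idt_closed: "idt A \<in> carrier A"
    and mul_assoc: "\<lbrakk>x \<in> carrier A; y \<in> carrier A; z \<in> carrier A\<rbrakk>
      \<Longrightarrow> mul A (mul A x y) z = mul A x (mul A y z)"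
    and mul_idt_left: "x \<in> carrier A \<Longrightarrow> mul A (idt A) x = x"
    and mul_idt_right: "x \<in> carrier A \<Longrightarrow> mul A x (idt A) = x"
    and mul_add_left: "\<lbrakk>x \<in> carrier A; y \<in> carrier A; z \<in> carrier A\<rbrakk>
      \<Longrightarrow> mul A (x + y) z = mul A x z + mul A y z"
    and mul_add_right: "\<lbrakk>x \<in> carrier A; y \<in> carrier A; z \<in> carrier A\<rbrakk>
      \<Longrightarrow> mul A x (y + z) = mul A x y + mul A x z"
    and mul_scal_left: "\<lbrakk>x \<in> carrier A; y \<in> carrier A\<rbrakk>
      \<Longrightarrow> mul A (scal A c x) y = scal A c (mul A x y)"
    and mul_scal_right: "\<lbrakk>x \<in> carrier A; y \<in> carrier A\<rbrakk>
      \<Longrightarrow> mul A x (scal A c y) = scal A c (mul A x y)"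

text \<open>
  Unital left modules over the algebra \<open>R\<close>. By \<open>act_scal_left\<close> and \<open>act_idt\<close>, the vector space
  structure of \<open>M\<close> is the one induced by \<open>R\<close>.
\<close>

locale lmodule = kspace M
  for R :: "('k::field, 'r::ab_group_add, 'y) alg_scheme"
    and M :: "('k, 'r, 'a::ab_group_add, 'z) lmod_scheme" +
  assumes act_closed: "\<lbrakk>r \<in> carrier R; x \<in> carrier M\<rbrakk> \<Longrightarrow> act M r x \<in> carrier M"
    and act_mul: "\<lbrakk>r \<in> carrier R; s \<in> carrier R; x \<in> carrier M\<rbrakk>
      \<Longrightarrow> act M (mul R r s) x = act M r (act M s x)"
    and act_idt: "x \<in> carrier M \<Longrightarrow> act M (idt R) x = x"
    and act_add_left: "\<lbrakk>r \<in> carrier R; s \<in> carrier R; x \<in> carrier M\<rbrakk>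
      \<Longrightarrow> act M (r + s) x = act M r x + act M s x"
    and act_add_right: "\<lbrakk>r \<in> carrier R; x \<in> carrier M; y \<in> carrier M\<rbrakk>
      \<Longrightarrow> act M r (x + y) = act M r x + act M r y"
    and act_scal_left: "\<lbrakk>r \<in> carrier R; x \<in> carrier M\<rbrakk>
      \<Longrightarrow> act M (scal R c r) x = scal M c (act M r x)"
    and act_scal_right: "\<lbrakk>r \<in> carrier R; x \<in> carrier M\<rbrakk>
      \<Longrightarrow> act M r (scal M c x) = scal M c (act M r x)"

definition opposite :: "('k, 'a) alg \<Rightarrow> ('k, 'a) alg" where
  "opposite B = B\<lparr>mul := \<lambda>x y. mul B y x\<rparr>"

definition regular_module :: "('k, 'r) alg \<Rightarrow> ('k, 'r, 'r) lmod" where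
  "regular_module R = \<lparr>carrier = carrier R, scal = scal R, act = mul R\<rparr>"

text \<open>\<open>M\<^sup>m\<close>, realized as the sequences in \<open>M\<close> that vanish from index \<open>m\<close> on.\<close>

definition module_power :: "('k, 'r, 'a::zero) lmod \<Rightarrow> nat \<Rightarrow> ('k, 'r, nat \<Rightarrow> 'a) lmod" where
  "module_power M m =
    \<lparr>carrier = {f. (\<forall>i<m. f i \<in> carrier M) \<and> (\<forall>i\<ge>m. f i = 0)},
     scal = (\<lambda>c f i. scal M c (f i)),
     act = (\<lambda>r f i. if i < m then act M r (f i) else 0)\<rparr>"


section \<open>Tensor product of algebras\<close>

text \<open>
  Over a field, \<open>A \<otimes> B\<close> is the space of functionals on bilinear forms on \<open>A \<times> B\<close> spanned by
  the evaluations \<open>a \<otimes> b = (\<lambda>w. w a b)\<close>. This is Halmos' construction in finite dimension (the dual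
  of the space of bilinear forms), and the canonical map from the usual tensor product onto this
  span is injective in general because bilinear forms separate tensors.
\<close>

definition bilinear_form ::
  "('k::field, 'a::ab_group_add, 'y) vspace_scheme \<Rightarrow> ('k, 'b::ab_group_add, 'z) vspace_scheme
    \<Rightarrow> ('a \<Rightarrow> 'b \<Rightarrow> 'k) \<Rightarrow> bool" where
  "bilinear_form A B w \<longleftrightarrow>
    (\<forall>x\<in>carrier A. \<forall>x'\<in>carrier A. \<forall>y\<in>carrier B. w (x + x') y = w x y + w x' y) \<and>
    (\<forall>x\<in>carrier A. \<forall>y\<in>carrier B. \<forall>y'\<in>carrier B. w x (y + y') = w x y + w x y') \<and>
    (\<forall>c. \<forall>x\<in>carrier A. \<forall>y\<in>carrier B. w (scal A c x) y = c * w x y) \<and>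
    (\<forall>c. \<forall>x\<in>carrier A. \<forall>y\<in>carrier B. w x (scal B c y) = c * w x y)"

definition pure_tensor ::
  "('k::field, 'a::ab_group_add, 'y) vspace_scheme \<Rightarrow> ('k, 'b::ab_group_add, 'z) vspace_scheme
    \<Rightarrow> 'a \<Rightarrow> 'b \<Rightarrow> ('a \<Rightarrow> 'b \<Rightarrow> 'k) \<Rightarrow> 'k" where
  "pure_tensor A B a b = (\<lambda>w. if bilinear_form A B w then w a b else 0)"

text \<open>
  The product below is the bilinear extension of
  \<open>(a \<otimes> b) (a' \<otimes> b') = a a' \<otimes> b b'\<close>.
\<close>

definition tensor_product ::
  "('k::field, 'a::ab_group_add) alg \<Rightarrow> ('k, 'b::ab_group_add) alg
    \<Rightarrow> ('k, ('a \<Rightarrow> 'b \<Rightarrow> 'k) \<Rightarrow> 'k) alg" where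
  "tensor_product A B =
    \<lparr>carrier = module.span (\<lambda>c \<phi> w. c * \<phi> w)
        {pure_tensor A B a b | a b. a \<in> carrier A \<and> b \<in> carrier B},
     scal = (\<lambda>c \<phi> w. c * \<phi> w),
     mul = (\<lambda>\<phi> \<psi> w. if bilinear_form A B w
        then \<phi> (\<lambda>a b. \<psi> (\<lambda>a' b'. w (mul A a a') (mul B b b'))) else 0),
     idt = pure_tensor A B (idt A) (idt B)\<rparr>"


section \<open>Triangular matrix algebras\<close>

text \<open>
  The matrix with rows \<open>(a, n)\<close> and \<open>(0, b)\<close> is the triple \<open>(a, n, b)\<close>. For an
  \<open>A \<otimes> B\<^sup>o\<close>-module \<open>N\<close>, \<open>a n\<close> is \<open>(a \<otimes> 1) n\<close> and \<open>n b\<close> is \<open>(1 \<otimes> b) n\<close>.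
\<close>

definition left_act ::
  "('k::field, 'a::ab_group_add) alg \<Rightarrow> ('k, 'b::ab_group_add) alg
    \<Rightarrow> ('k, ('a \<Rightarrow> 'b \<Rightarrow> 'k) \<Rightarrow> 'k, 'n) lmod \<Rightarrow> 'a \<Rightarrow> 'n \<Rightarrow> 'n" where
  "left_act A B N a n = act N (pure_tensor A (opposite B) a (idt B)) n"

definition right_act ::
  "('k::field, 'a::ab_group_add) alg \<Rightarrow> ('k, 'b::ab_group_add) alg
    \<Rightarrow> ('k, ('a \<Rightarrow> 'b \<Rightarrow> 'k) \<Rightarrow> 'k, 'n) lmod \<Rightarrow> 'n \<Rightarrow> 'b \<Rightarrow> 'n" where
  "right_act A B N n b = act N (pure_tensor A (opposite B) (idt A) b) n"

definition triangular_algebra ::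
  "('k::field, 'a::ab_group_add) alg
    \<Rightarrow> ('k, ('a \<Rightarrow> 'b \<Rightarrow> 'k) \<Rightarrow> 'k, 'n::ab_group_add) lmod
    \<Rightarrow> ('k, 'b::ab_group_add) alg \<Rightarrow> ('k, 'a \<times> 'n \<times> 'b) alg" where
  "triangular_algebra A N B =
    \<lparr>carrier = carrier A \<times> carrier N \<times> carrier B,
     scal = (\<lambda>c (a, n, b). (scal A c a, scal N c n, scal B c b)),
     mul = (\<lambda>(a, n, b) (a', n', b').
        (mul A a a', left_act A B N a n' + right_act A B N n b', mul B b b')),
     idt = (idt A, 0, idt B)\<rparr>"


section \<open>Cohomology of cochain complexes of finite-dimensional spaces\<close>

text \<open>
  \<open>dim H\<^sup>i = dim Z\<^sup>i - dim B\<^sup>i\<close> for a complex of spaces \<open>C i\<close> with differentials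
  \<open>\<delta> i\<close> from \<open>C i\<close> to \<open>C (Suc i)\<close>, with scalar multiplication \<open>s\<close>. This is only meaningful
  for finite-dimensional \<open>C i\<close>, which is the case in both uses below.
\<close>

definition cohomology_dim ::
  "('k::field \<Rightarrow> 'c::ab_group_add \<Rightarrow> 'c) \<Rightarrow> (nat \<Rightarrow> 'c set) \<Rightarrow> (nat \<Rightarrow> 'c \<Rightarrow> 'c) \<Rightarrow> nat \<Rightarrow> nat" where
  "cohomology_dim s C \<delta> i =
    vector_space.dim s {f \<in> C i. \<delta> i f = 0} -
    vector_space.dim s (case i of 0 \<Rightarrow> {0} | Suc j \<Rightarrow> \<delta> j ` C j)"


section \<open>Hochschild cohomology\<close>

text \<open>
  \<open>Hom(T\<^sup>\<otimes>\<^sup>n, T)\<close> as the space of \<open>n\<close>-linear maps, given on lists of length \<open>n\<close>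
  and extended by zero.
\<close>

definition hochschild_cochains ::
  "('k::field, 't::ab_group_add) alg \<Rightarrow> nat \<Rightarrow> ('t list \<Rightarrow> 't) set" where
  "hochschild_cochains T n = {f.
    (\<forall>xs. length xs = n \<and> set xs \<subseteq> carrier T \<longrightarrow> f xs \<in> carrier T) \<and>
    (\<forall>xs. \<not> (length xs = n \<and> set xs \<subseteq> carrier T) \<longrightarrow> f xs = 0) \<and>
    (\<forall>xs. length xs = n \<and> set xs \<subseteq> carrier T \<longrightarrow>
      (\<forall>i<n. \<forall>x\<in>carrier T. \<forall>y\<in>carrier T. \<forall>c.
        f (xs[i := x + y]) = f (xs[i := x]) + f (xs[i := y]) \<and>
        f (xs[i := scal T c x]) = scal T c (f (xs[i := x]))))}"

definition hochschild_diff ::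
  "('k::field, 't::ab_group_add) alg \<Rightarrow> nat \<Rightarrow> ('t list \<Rightarrow> 't) \<Rightarrow> 't list \<Rightarrow> 't" where
  "hochschild_diff T n f = (\<lambda>xs.
    if length xs = Suc n \<and> set xs \<subseteq> carrier T then
      mul T (hd xs) (f (tl xs)) +
      (\<Sum>i<n. scal T ((-1) ^ (i + 1))
        (f (take i xs @ [mul T (xs ! i) (xs ! (i + 1))] @ drop (i + 2) xs))) +
      scal T ((-1) ^ (n + 1)) (mul T (f (butlast xs)) (last xs))
    else 0)"

definition HH_dim :: "('k::field, 't::ab_group_add) alg \<Rightarrow> nat \<Rightarrow> nat" where
  "HH_dim T = cohomology_dim (\<lambda>c f xs. scal T c (f xs)) (hochschild_cochains T) (hochschild_diff T)"

definition hilbert_poincare :: "('k::field, 't::ab_group_add) alg \<Rightarrow> int fps" where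
  "hilbert_poincare T = Abs_fps (\<lambda>i. int (HH_dim T i))"


section \<open>Ext over a finite-dimensional algebra\<close>

definition module_homs ::
  "('k::field, 'r::ab_group_add) alg \<Rightarrow> ('k, 'r, 'm::ab_group_add) lmod
    \<Rightarrow> ('k, 'r, 'n::ab_group_add) lmod \<Rightarrow> ('m \<Rightarrow> 'n) set" where
  "module_homs R M N = {f.
    (\<forall>x\<in>carrier M. f x \<in> carrier N) \<and>
    (\<forall>x. x \<notin> carrier M \<longrightarrow> f x = 0) \<and>
    (\<forall>x\<in>carrier M. \<forall>y\<in>carrier M. f (x + y) = f x + f y) \<and>
    (\<forall>r\<in>carrier R. \<forall>x\<in>carrier M. f (act M r x) = act N r (f x))}"

abbreviation free_module :: "('k::field, 'r::ab_group_add) alg \<Rightarrow> nat \<Rightarrow> ('k, 'r, nat \<Rightarrow> 'r) lmod" where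
  "free_module R n \<equiv> module_power (regular_module R) n"

text \<open>
  An exact sequence \<open>\<dots> \<rightarrow> R\<^sup>n\<^sup>2 \<rightarrow> R\<^sup>n\<^sup>1 \<rightarrow> R\<^sup>n\<^sup>0 \<rightarrow> M \<rightarrow> 0\<close> of \<open>R\<close>-modules, with maps \<open>d i\<close> and
  augmentation \<open>e\<close>. Every finite-dimensional module over a finite-dimensional algebra has such a
  projective resolution.
\<close>

definition free_resolution ::
  "('k::field, 'r::ab_group_add) alg \<Rightarrow> ('k, 'r, 'm::ab_group_add) lmod
    \<Rightarrow> (nat \<Rightarrow> nat) \<Rightarrow> (nat \<Rightarrow> (nat \<Rightarrow> 'r) \<Rightarrow> nat \<Rightarrow> 'r) \<Rightarrow> ((nat \<Rightarrow> 'r) \<Rightarrow> 'm) \<Rightarrow> bool" where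
  "free_resolution R M n d e \<longleftrightarrow>
    e \<in> module_homs R (free_module R (n 0)) M \<and>
    e ` carrier (free_module R (n 0)) = carrier M \<and>
    (\<forall>i. d i \<in> module_homs R (free_module R (n (Suc i))) (free_module R (n i))) \<and>
    d 0 ` carrier (free_module R (n 1)) = {x \<in> carrier (free_module R (n 0)). e x = 0} \<and>
    (\<forall>i. d (Suc i) ` carrier (free_module R (n (Suc (Suc i)))) =
      {x \<in> carrier (free_module R (n (Suc i))). d i x = 0})"

text \<open>
  \<open>Ext\<^sup>i(M, N)\<close> is the cohomology of \<open>Hom(F, N)\<close> for a chosen resolution \<open>F\<close> of \<open>M\<close>; its dimension
  does not depend on the choice.
\<close>

definition Ext_dim ::
  "('k::field, 'r::ab_group_add) alg \<Rightarrow> ('k, 'r, 'm::ab_group_add) lmod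
    \<Rightarrow> ('k, 'r, 'n::ab_group_add) lmod \<Rightarrow> nat \<Rightarrow> nat" where
  "Ext_dim R M N =
    (let (n, d, e) = (SOME (n, d, e). free_resolution R M n d e)
     in cohomology_dim (\<lambda>c f x. scal N c (f x))
          (\<lambda>i. module_homs R (free_module R (n i)) N) (\<lambda>i f. f \<circ> d i))"

definition Ext_series ::
  "('k::field, 'r::ab_group_add) alg \<Rightarrow> ('k, 'r, 'm::ab_group_add) lmod
    \<Rightarrow> ('k, 'r, 'n::ab_group_add) lmod \<Rightarrow> int fps" where
  "Ext_series R M N = Abs_fps (\<lambda>i. int (Ext_dim R M N i))"

end

theory Submission
  imports Defs
begin

text \<open>
  Peirce decomposition along the idempotents of \<open>A\<close> and \<open>B\<close> contracts the Hochschild complex of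
  \<open>T = (A M; 0 B)\<close> onto triples of a cochain of \<open>A\<close>, a cochain of \<open>B\<close> and a map
  \<open>A\<^sup>p \<times> M \<times> B\<^sup>q \<rightarrow> M\<close> multilinear in all entries, the first two being glued to the third by
  their action on \<open>M\<close>. For \<open>M\<^sup>m\<close> the third component is an \<open>m \<times> m\<close> matrix of maps for \<open>M\<close>, and the
  gluing terms are scalar matrices; subtracting the corner entry from the diagonal therefore splits
  the complex into the one for \<open>T\<^sub>1\<close> and \<open>m\<^sup>2 - 1\<close> copies of the complex of the maps
  \<open>A\<^sup>p \<times> M \<times> B\<^sup>q \<rightarrow> M\<close>. The latter computes \<open>Ext(M, M)\<close> in degrees shifted by one, because it is
  acyclic when the source is free, so that dimension shifting along a free resolution applies.
\<close>

section \<open>Dimensions of subspaces\<close>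

text \<open>All homological algebra is done by counting dimensions: where a long exact sequence or a
  quasi-isomorphism would usually appear, rank-nullity is applied to cocycles and coboundaries,
  since \<open>cohomology_dim\<close> is a truncated difference of dimensions and no quotient spaces
  are formed. The obstacle is the bookkeeping of faces and signs, which is done once: the target of
  the maps \<open>A^p x M x B^q -> M\<close> is a bimodule over the triangular algebra of the
  source, on the left through its projection to \<open>A\<close> and on the right through its
  projection to \<open>B\<close>. So their differential is a Hochschild differential read off on
  words, and its square vanishes for that reason. The glued complex of triples is not verified by
  hand either: it is a surjective image of the Hochschild complex. The bimodule entry counts as one
  argument, which is where the factor \<open>t\<close> comes from. Ext is defined from a chosen
  resolution, and its dimension is compared with a cohomology in which no resolution occurs, so the
  choice is harmless.\<close>

definition findim :: "('k::field \<Rightarrow> 'a::ab_group_add \<Rightarrow> 'a) \<Rightarrow> 'a set \<Rightarrow> bool" where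
  "findim s V \<longleftrightarrow> module.subspace s V \<and> (\<exists>S. finite S \<and> V \<subseteq> module.span s S)"

text \<open>Linearity on a subset, because differentials and restrictions are given on a carrier and
  take default values elsewhere. Globally linear maps enter through extension from a basis.\<close>

definition linear_on :: "('k::field \<Rightarrow> 'a::ab_group_add \<Rightarrow> 'a) \<Rightarrow> ('k \<Rightarrow> 'b::ab_group_add \<Rightarrow> 'b)
    \<Rightarrow> 'a set \<Rightarrow> ('a \<Rightarrow> 'b) \<Rightarrow> bool" where
  "linear_on s1 s2 V f \<longleftrightarrow>
    (\<forall>x\<in>V. \<forall>y\<in>V. f (x + y) = f x + f y) \<and> (\<forall>c. \<forall>x\<in>V. f (s1 c x) = s2 c (f x))"

lemma linear_on_add: "linear_on s1 s2 V f \<Longrightarrow> x \<in> V \<Longrightarrow> y \<in> V \<Longrightarrow> f (x + y) = f x + f y"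
  and linear_on_scale: "linear_on s1 s2 V f \<Longrightarrow> x \<in> V \<Longrightarrow> f (s1 c x) = s2 c (f x)"
  by (auto simp: linear_on_def)

lemma linear_on_subset: "linear_on s1 s2 V f \<Longrightarrow> W \<subseteq> V \<Longrightarrow> linear_on s1 s2 W f"
  by (simp add: linear_on_def subset_iff)

lemma vector_space_module: "vector_space s \<Longrightarrow> module s"
  by (simp add: module_iff_vector_space)

lemma vector_space_fun:
  assumes "vector_space s"
  shows "vector_space (\<lambda>c (f :: 'x \<Rightarrow> 'a::ab_group_add) x. s (c::'k::field) (f x))"
proof -
  interpret vector_space s by fact
  show ?thesis
    by unfold_locales (auto simp: fun_eq_iff scale_right_distrib scale_left_distrib)
qed

lemma vector_space_prod:
  assumes "vector_space s" "vector_space t"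
  shows "vector_space (\<lambda>c p. (s (c::'k::field) (fst p :: 'a::ab_group_add), t c (snd p :: 'b::ab_group_add)))"
proof -
  interpret s: vector_space s by fact
  interpret t: vector_space t by fact
  show ?thesis
    by unfold_locales
      (auto simp: s.scale_right_distrib s.scale_left_distrib t.scale_right_distrib t.scale_left_distrib)
qed

lemma linear_on_0:
  assumes "vector_space s1" "vector_space s2" "module.subspace s1 V" "linear_on s1 s2 V f"
  shows "f 0 = 0"
proof -
  interpret vector_space_pair s1 s2 using assms(1,2) by (simp add: vector_space_pair_def)
  have "0 \<in> V" using assms(3) by (rule vs1.subspace_0)
  then show ?thesis using linear_on_scale[OF assms(4), of 0 0] by simp
qed

lemma linear_on_minus:
  assumes "vector_space s1" "vector_space s2" "linear_on s1 s2 V f" "x \<in> V"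
  shows "f (- x) = - f x"
proof -
  interpret vector_space_pair s1 s2 using assms(1,2) by (simp add: vector_space_pair_def)
  show ?thesis using linear_on_scale[OF assms(3,4), of "-1"] by simp
qed

lemma linear_on_diff:
  assumes "vector_space s1" "vector_space s2" "module.subspace s1 V" "linear_on s1 s2 V f" "x \<in> V" "y \<in> V"
  shows "f (x - y) = f x - f y"
proof -
  interpret vector_space_pair s1 s2 using assms(1,2) by (simp add: vector_space_pair_def)
  have "- y \<in> V" using assms vs1.subspace_neg by blast
  then show ?thesis
    using linear_on_add[OF assms(4,5), of "-y"] linear_on_minus[OF assms(1,2,4,6)] by simp
qed

lemma subspace_linear_kernel:
  assumes "vector_space s1" "vector_space s2" "module.subspace s1 V" "linear_on s1 s2 V f"
  shows "module.subspace s1 {x\<in>V. f x = 0}"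
proof -
  interpret vector_space_pair s1 s2 using assms(1,2) by (simp add: vector_space_pair_def)
  show ?thesis
    using assms linear_on_0[OF assms] by (auto simp: vs1.subspace_def linear_on_def)
qed

lemma subspace_linear_image:
  assumes "vector_space s1" "vector_space s2" "module.subspace s1 V" "linear_on s1 s2 V f"
  shows "module.subspace s2 (f ` V)"
proof -
  interpret vector_space_pair s1 s2 using assms(1,2) by (simp add: vector_space_pair_def)
  show ?thesis
  proof (rule vs2.subspaceI)
    have "0 \<in> V" using assms(3) by (rule vs1.subspace_0)
    then show "0 \<in> f ` V" using linear_on_0[OF assms] by (metis image_eqI)
  next
    fix x y assume "x \<in> f ` V" "y \<in> f ` V"
    then obtain a b where ab: "x = f a" "y = f b" "a \<in> V" "b \<in> V" by auto
    then have "x + y = f (a + b)" using linear_on_add[OF assms(4)] by simp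
    then show "x + y \<in> f ` V" using ab vs1.subspace_add[OF assms(3)] by blast
  next
    fix c x assume "x \<in> f ` V"
    then obtain a where ab: "x = f a" "a \<in> V" by auto
    then have "s2 c x = f (s1 c a)" using linear_on_scale[OF assms(4)] by simp
    then show "s2 c x \<in> f ` V" using ab vs1.subspace_scale[OF assms(3)] by blast
  qed
qed

lemma findim_subspace: "findim s V \<Longrightarrow> module.subspace s V"
  by (simp add: findim_def)

text \<open>Immediate because \<open>findim\<close> asks for containment in a finite span, not for a
  finite generating set; \<open>findim_basis\<close> recovers the latter.\<close>

lemma findim_mono:
  assumes "findim s V" "module.subspace s W" "W \<subseteq> V"
  shows "findim s W"
  using assms unfolding findim_def by blast

lemma findim_basis:
  assumes "vector_space s" "findim s V"
  obtains B where "finite B" "\<not> module.dependent s B" "module.span s B = V"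
    "card B = vector_space.dim s V" "B \<subseteq> V"
proof -
  interpret vector_space s by fact
  obtain S where S: "finite S" "V \<subseteq> span S" using assms(2) by (auto simp: findim_def)
  have V: "subspace V" using assms(2) by (rule findim_subspace)
  obtain B where B: "B \<subseteq> V" "independent B" "V \<subseteq> span B" "card B = dim V"
    by (rule basis_exists)
  have "finite B" using independent_span_bound[OF S(1) B(2)] B(1) S(2) by blast
  moreover have "span B = V" using span_subspace[OF B(1,3) V] .
  ultimately show ?thesis using B that by blast
qed

lemma findim_dim_mono:
  assumes "vector_space s" "findim s V" "W \<subseteq> V"
  shows "vector_space.dim s W \<le> vector_space.dim s V"
proof -
  interpret vector_space s by fact
  obtain B where "finite B" "span B = V" "card B = dim V"
    by (rule findim_basis[OF assms(1,2)])
  then show ?thesis using dim_le_card[of W B] assms(3) by simp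
qed

text \<open>Rank-nullity: a basis \<open>B0\<close> of the kernel is extended to a basis
  \<open>B\<close> of \<open>V\<close>, and \<open>B - B0\<close> is mapped bijectively to a basis
  of the image.\<close>

lemma findim_image:
  assumes "vector_space s1" "vector_space s2" "findim s1 V" "linear_on s1 s2 V f"
  shows "findim s2 (f ` V)"
    and "vector_space.dim s1 V =
      vector_space.dim s1 {x\<in>V. f x = 0} + vector_space.dim s2 (f ` V)"
proof -
  interpret vector_space_pair s1 s2 using assms(1,2) by (simp add: vector_space_pair_def)
  let ?N = "{x\<in>V. f x = 0}"
  have V: "vs1.subspace V" using assms(3) by (rule findim_subspace)
  have N: "vs1.subspace ?N" by (rule subspace_linear_kernel[OF assms(1,2) V assms(4)])
  obtain B0 where B0: "B0 \<subseteq> ?N" "vs1.independent B0" "?N \<subseteq> vs1.span B0"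
    by (rule vs1.maximal_independent_subset[of ?N])
  have B0V: "B0 \<subseteq> V" using B0(1) by auto
  obtain B where B: "B0 \<subseteq> B" "B \<subseteq> V" "vs1.independent B" "V \<subseteq> vs1.span B"
    by (rule vs1.maximal_independent_subset_extend[OF B0V B0(2)])
  obtain S where S: "finite S" "V \<subseteq> vs1.span S" using assms(3) by (auto simp: findim_def)
  have "B \<subseteq> vs1.span S" using B(2) S(2) by (rule order_trans)
  then have finB: "finite B" using vs1.independent_span_bound[OF S(1) B(3)] by blast
  have spB: "vs1.span B = V" using vs1.span_subspace[OF B(2,4) V] .
  \<comment> \<open>\<open>f\<close> is linear on \<open>V\<close> only; \<open>g\<close> is a
    globally linear map that agrees with it on \<open>V\<close>.\<close>
  obtain g where g: "Vector_Spaces.linear s1 s2 g" "\<forall>x\<in>B. g x = f x"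
    using linear_independent_extend[OF B(3)] by blast
  interpret g: Vector_Spaces.linear s1 s2 g by fact
  have fg: "f v = g v" if "v \<in> V" for v
  proof -
    have "v \<in> V \<and> f v = g v" if "v \<in> vs1.span B" for v
      using that
    proof (induction rule: vs1.span_induct_alt)
      case base
      show ?case using linear_on_0[OF assms(1,2) V assms(4)] vs1.subspace_0[OF V] g.zero by simp
    next
      case (step c x y)
      then have "x \<in> V" "s1 c x \<in> V" using B(2) vs1.subspace_scale[OF V] by auto
      then show ?case using step g(2) assms(4)
        by (simp add: linear_on_def g.add g.scale vs1.subspace_add[OF V])
    qed
    then show ?thesis using that spB by blast
  qed
  let ?C = "B - B0"
  \<comment> \<open>\<open>q\<close> is the identity on the span of \<open>B0\<close> and 0 on that
    of \<open>B - B0\<close>, so these spans meet only in 0. This gives injectivity of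
    \<open>g\<close> on the second one.\<close>
  obtain q where q: "Vector_Spaces.linear s1 s1 q" "\<forall>x\<in>B. q x = (if x \<in> B0 then x else 0)"
  proof -
    interpret p: vector_space_pair s1 s1 by unfold_locales
    show ?thesis
      using p.linear_independent_extend[OF B(3), of "\<lambda>x. if x \<in> B0 then x else 0"]
      by (elim exE conjE) (rule that)
  qed
  interpret q: Vector_Spaces.linear s1 s1 q by fact
  have q1: "q x = x" if "x \<in> vs1.span B0" for x
    using that by (induction rule: vs1.span_induct_alt) (use q(2) B(1) in \<open>auto simp: q.zero q.add q.scale\<close>)
  have q2: "q x = 0" if "x \<in> vs1.span ?C" for x
    using that by (induction rule: vs1.span_induct_alt) (use q(2) in \<open>auto simp: q.zero q.add q.scale\<close>)
  have CV: "vs1.span ?C \<subseteq> V" using vs1.span_mono[of ?C B] spB by auto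
  have inj: "inj_on g (vs1.span ?C)"
    unfolding g.inj_on_iff_eq_0[OF vs1.subspace_span]
  proof (intro ballI impI)
    fix x assume x: "x \<in> vs1.span ?C" "g x = 0"
    then have "x \<in> ?N" using CV fg by auto
    then have "x \<in> vs1.span B0" using B0 by blast
    then show "x = 0" using q1 q2 x by metis
  qed
  have indC: "vs1.independent ?C" using vs1.independent_mono[OF B(3)] by blast
  have indg: "vs2.independent (g ` ?C)"
    using g.independent_injective_image[OF indC inj] .
  have im: "f ` V = vs2.span (g ` ?C)"
  proof -
    have "f ` V = g ` vs1.span B" using fg spB by (auto simp: image_def)
    also have "\<dots> = vs2.span (g ` B)" by (simp add: g.span_image)
    also have "\<dots> = vs2.span (g ` ?C)"
    proof
      have "g ` B \<subseteq> insert 0 (g ` ?C)"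
        using B0(1) fg g(2) B(1) by auto
      then have "vs2.span (g ` B) \<subseteq> vs2.span (insert 0 (g ` ?C))" by (rule vs2.span_mono)
      then show "vs2.span (g ` B) \<subseteq> vs2.span (g ` ?C)" by (simp add: vs2.span_insert_0)
      show "vs2.span (g ` ?C) \<subseteq> vs2.span (g ` B)" by (rule vs2.span_mono) auto
    qed
    finally show ?thesis .
  qed
  show "findim s2 (f ` V)"
    unfolding findim_def im using finB by (meson finite_Diff finite_imageI order_refl vs2.subspace_span)
  have "vs2.dim (f ` V) = card (g ` ?C)"
    unfolding im using vs2.dim_span_eq_card_independent[OF indg] .
  also have "\<dots> = card ?C"
    using inj vs1.span_superset by (intro card_image) (rule inj_on_subset)
  finally have 1: "vs2.dim (f ` V) = card ?C" .
  have 2: "vs1.dim ?N = card B0"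
    using vs1.basis_card_eq_dim[OF B0(1) B0(3) B0(2)] by simp
  have 3: "vs1.dim V = card B" using vs1.basis_card_eq_dim[OF B(2) B(4) B(3)] by simp
  have "card B = card B0 + card ?C"
    using card_Un_disjoint[of B0 ?C] finB B(1) by (metis Diff_disjoint Un_Diff_cancel Un_absorb1 finite_Diff finite_subset)
  then show "vs1.dim V = vs1.dim ?N + vs2.dim (f ` V)" using 1 2 3 by simp
qed

lemma dim_zero:
  assumes "vector_space s"
  shows "vector_space.dim s {0} = 0"
proof -
  interpret vector_space s by fact
  show ?thesis using dim_unique[of "{}" "{0}" 0] independent_empty by simp
qed

lemma findim_zero:
  assumes "vector_space s"
  shows "findim s {0}"
proof -
  interpret vector_space s by fact
  show ?thesis unfolding findim_def using span_zero by (intro conjI exI[of _ "{}"]) auto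
qed

lemma dim_inj_image:
  assumes "vector_space s1" "vector_space s2" "findim s1 V" "linear_on s1 s2 V f"
    and "\<And>x. x \<in> V \<Longrightarrow> f x = 0 \<Longrightarrow> x = 0"
  shows "vector_space.dim s2 (f ` V) = vector_space.dim s1 V"
proof -
  interpret vector_space_pair s1 s2 using assms(1,2) by (simp add: vector_space_pair_def)
  have V: "vs1.subspace V" using assms(3) by (rule findim_subspace)
  have "{x\<in>V. f x = 0} = {0}"
    using assms(5) linear_on_0[OF assms(1,2) V assms(4)] vs1.subspace_0[OF V] by auto
  then show ?thesis using findim_image(2)[OF assms(1-4)] dim_zero[OF assms(1)] by simp
qed

lemma dim_bij:
  assumes "vector_space s1" "vector_space s2" "findim s1 V" "linear_on s1 s2 V f"
    and "\<And>x. x \<in> V \<Longrightarrow> f x = 0 \<Longrightarrow> x = 0" and "f ` V = W"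
  shows "vector_space.dim s2 W = vector_space.dim s1 V"
  using dim_inj_image[OF assms(1-5)] assms(6) by simp

text \<open>The inverse on the image is linear, so \<open>V\<close> is itself a linear image of a
  subspace of \<open>W\<close>.\<close>

lemma findim_inj:
  assumes "vector_space s1" "vector_space s2" "module.subspace s1 V" "linear_on s1 s2 V f"
    and inj: "\<And>x. x \<in> V \<Longrightarrow> f x = 0 \<Longrightarrow> x = 0" and W: "findim s2 W" "f ` V \<subseteq> W"
  shows "findim s1 V"
proof -
  interpret vector_space_pair s1 s2 using assms(1,2) by (simp add: vector_space_pair_def)
  have injV: "inj_on f V"
  proof (rule inj_onI)
    fix x y assume "x \<in> V" "y \<in> V" "f x = f y"
    then have "f (x - y) = 0" "x - y \<in> V"
      using linear_on_diff[OF assms(1-4)] vs1.subspace_diff[OF assms(3)] by auto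
    then show "x = y" using inj by fastforce
  qed
  have fV: "findim s2 (f ` V)"
    using findim_mono[OF W(1) subspace_linear_image[OF assms(1-4)] W(2)] .
  let ?g = "the_inv_into V f"
  have "linear_on s2 s1 (f ` V) ?g"
    unfolding linear_on_def
  proof (intro conjI ballI allI)
    fix x y assume "x \<in> f ` V" "y \<in> f ` V"
    then obtain a b where ab: "a \<in> V" "b \<in> V" "x = f a" "y = f b" by auto
    then have "x + y = f (a + b)" "a + b \<in> V"
      using linear_on_add[OF assms(4)] vs1.subspace_add[OF assms(3)] by auto
    then show "?g (x + y) = ?g x + ?g y" using ab injV by (simp add: the_inv_into_f_f)
  next
    fix c x assume "x \<in> f ` V"
    then obtain a where ab: "a \<in> V" "x = f a" by auto
    then have "s2 c x = f (s1 c a)" "s1 c a \<in> V"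
      using linear_on_scale[OF assms(4)] vs1.subspace_scale[OF assms(3)] by auto
    then show "?g (s2 c x) = s1 c (?g x)" using ab injV by (simp add: the_inv_into_f_f)
  qed
  then have "findim s1 (?g ` f ` V)" by (rule findim_image(1)[OF assms(2,1) fV])
  moreover have "?g ` f ` V = V" using injV by (auto simp: the_inv_into_f_f image_image)
  ultimately show ?thesis by simp
qed

definition power_space :: "'i set \<Rightarrow> 'a::zero set \<Rightarrow> ('i \<Rightarrow> 'a) set" where
  "power_space I V = {F. (\<forall>i\<in>I. F i \<in> V) \<and> (\<forall>i. i \<notin> I \<longrightarrow> F i = 0)}"

lemma power_spaceD: "F \<in> power_space I V \<Longrightarrow> 0 \<in> V \<Longrightarrow> F i \<in> V"
  by (cases "i \<in> I") (auto simp: power_space_def)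

text \<open>Induction on \<open>I\<close>: evaluation at the new index maps onto \<open>V\<close>,
  and its kernel is the power over the old indices.\<close>

lemma power_space_dim:
  fixes I :: "'i set" and V :: "'a::ab_group_add set" and s :: "'k::field \<Rightarrow> 'a \<Rightarrow> 'a"
  assumes "vector_space s" "findim s V" "finite I"
  shows "findim (\<lambda>c F i. s c (F i)) (power_space I V)
    \<and> vector_space.dim (\<lambda>c F i. s c (F i)) (power_space I V) = card I * vector_space.dim s V"
  using assms(3)
proof (induction I)
  case empty
  have "power_space ({} :: 'i set) V = {0}" by (auto simp: power_space_def fun_eq_iff)
  then show ?case
    using findim_zero[OF vector_space_fun[OF assms(1)]] dim_zero[OF vector_space_fun[OF assms(1)]] by simp
next
  case (insert i I)
  let ?s = "\<lambda>c (F :: 'i \<Rightarrow> 'a) i. s c (F i)"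
  have vs: "vector_space ?s" by (rule vector_space_fun[OF assms(1)])
  interpret s: vector_space s by fact
  interpret f: vector_space ?s by fact
  have V: "s.subspace V" using assms(2) by (rule findim_subspace)
  let ?W = "power_space (insert i I) V"
  have sub: "f.subspace ?W"
    using V by (auto simp: power_space_def f.subspace_def s.subspace_def)
  obtain S where S: "finite S" "s.span S = V" by (rule findim_basis[OF assms(1,2)])
  obtain S' where S': "finite S'" "power_space I V \<subseteq> f.span S'" using insert by (auto simp: findim_def)
  let ?e = "\<lambda>v j. if j = i then v else (0::'a)"
  have e_span: "?e v \<in> f.span (?e ` S)" if "v \<in> s.span S" for v
    using that
  proof (induction rule: s.span_induct_alt)
    case base
    have "?e 0 = 0" by (auto simp: fun_eq_iff)
    then show ?case using f.span_zero[of "?e ` S"] by presburger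
  next
    case (step c x y)
    have "?e (s c x + y) = ?s c (?e x) + ?e y" by (auto simp: fun_eq_iff)
    moreover have "?e x \<in> f.span (?e ` S)" using step(1) by (intro f.span_base) (rule imageI)
    ultimately show ?case using f.span_add[OF f.span_scale step(2)] by presburger
  qed
  have "?W \<subseteq> f.span (?e ` S \<union> S')"
  proof
    fix F assume F: "F \<in> ?W"
    have "F = ?e (F i) + F(i := 0)" by (auto simp: fun_eq_iff)
    moreover have "?e (F i) \<in> f.span (?e ` S)" using F e_span S by (auto simp: power_space_def)
    moreover have "F(i := 0) \<in> f.span S'" using F S' insert(2) by (auto simp: power_space_def)
    ultimately show "F \<in> f.span (?e ` S \<union> S')" unfolding f.span_Un by blast
  qed
  then have fd: "findim ?s ?W" unfolding findim_def using sub S S' by blast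
  have lin: "linear_on ?s s ?W (\<lambda>F. F i)" by (auto simp: linear_on_def)
  have "(\<lambda>F. F i) ` ?W = V"
  proof (intro set_eqI iffI)
    fix v assume "v \<in> V"
    then have "?e v \<in> ?W" using s.subspace_0[OF V] by (auto simp: power_space_def)
    then show "v \<in> (\<lambda>F. F i) ` ?W" by (rule rev_image_eqI) simp
  qed (auto simp: power_space_def)
  moreover have "{F\<in>?W. F i = 0} = power_space I V"
    using insert(2) s.subspace_0[OF V] by (auto simp: power_space_def split: if_splits)
  ultimately show ?case
    using findim_image(2)[OF vs assms(1) fd lin] fd insert by simp
qed

text \<open>Evaluation at the finitely many points of \<open>Y\<close> embeds \<open>V\<close> into
  a power of \<open>U\<close>. For spaces of multilinear maps, \<open>Y\<close> will consist of
  tuples of spanning vectors.\<close>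

lemma findim_by_values:
  assumes "vector_space s" "vector_space t" "module.subspace s V" "findim t U" "finite Y"
    and lin: "\<And>y. y \<in> Y \<Longrightarrow> linear_on s t V (\<lambda>f. ev f y)"
    and U: "\<And>f y. f \<in> V \<Longrightarrow> y \<in> Y \<Longrightarrow> ev f y \<in> U"
    and det: "\<And>f. f \<in> V \<Longrightarrow> (\<And>y. y \<in> Y \<Longrightarrow> ev f y = 0) \<Longrightarrow> f = 0"
  shows "findim s V"
proof (rule findim_inj[OF assms(1) vector_space_fun[OF assms(2)] assms(3)])
  show "findim (\<lambda>c F i. t c (F i)) (power_space Y U)"
    using power_space_dim[OF assms(2,4,5)] by blast
  show "linear_on s (\<lambda>c F i. t c (F i)) V (\<lambda>f y. if y \<in> Y then ev f y else 0)"
  proof -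
    interpret vector_space t by fact
    show ?thesis using lin by (auto simp: linear_on_def fun_eq_iff)
  qed
  show "x = 0" if "x \<in> V" "(\<lambda>y. if y \<in> Y then ev x y else 0) = 0" for x
    using det[OF that(1)] that(2) by (auto simp: fun_eq_iff split: if_splits)
  show "(\<lambda>f y. if y \<in> Y then ev f y else 0) ` V \<subseteq> power_space Y U"
    using U by (auto simp: power_space_def)
qed

section \<open>Cochain complexes\<close>

definition cocycles :: "(nat \<Rightarrow> 'c::zero set) \<Rightarrow> (nat \<Rightarrow> 'c \<Rightarrow> 'c) \<Rightarrow> nat \<Rightarrow> 'c set" where
  "cocycles C \<delta> n = {f \<in> C n. \<delta> n f = 0}"

definition coboundaries :: "(nat \<Rightarrow> 'c::zero set) \<Rightarrow> (nat \<Rightarrow> 'c \<Rightarrow> 'c) \<Rightarrow> nat \<Rightarrow> 'c set" where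
  "coboundaries C \<delta> n = (case n of 0 \<Rightarrow> {0} | Suc j \<Rightarrow> \<delta> j ` C j)"

lemma cohomology_dim_eq:
  "cohomology_dim s C \<delta> n = vector_space.dim s (cocycles C \<delta> n) - vector_space.dim s (coboundaries C \<delta> n)"
  by (simp add: cohomology_dim_def cocycles_def coboundaries_def)

locale cochain_complex =
  fixes s :: "'k::field \<Rightarrow> 'c::ab_group_add \<Rightarrow> 'c" and C :: "nat \<Rightarrow> 'c set" and \<delta> :: "nat \<Rightarrow> 'c \<Rightarrow> 'c"
  assumes vs: "vector_space s"
    and findim_cochains: "findim s (C n)"
    and linear_diff: "linear_on s s (C n) (\<delta> n)"
    and diff_closed: "f \<in> C n \<Longrightarrow> \<delta> n f \<in> C (Suc n)"
    and diff_diff: "f \<in> C n \<Longrightarrow> \<delta> (Suc n) (\<delta> n f) = 0"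
begin

interpretation vector_space s by (rule vs)

lemma subspace_cochains: "subspace (C n)"
  by (rule findim_subspace[OF findim_cochains])

lemma diff_0: "\<delta> n 0 = 0"
  by (rule linear_on_0[OF vs vs subspace_cochains linear_diff])

lemma zero_cochain: "0 \<in> C n"
  by (rule subspace_0[OF subspace_cochains])

lemma findim_cocycles: "findim s (cocycles C \<delta> n)"
  unfolding cocycles_def
  by (rule findim_mono[OF findim_cochains subspace_linear_kernel[OF vs vs subspace_cochains linear_diff]]) auto

lemma coboundaries_subset: "coboundaries C \<delta> n \<subseteq> cocycles C \<delta> n"
  by (cases n) (auto simp: coboundaries_def cocycles_def zero_cochain diff_0 diff_closed diff_diff)

lemma subspace_coboundaries: "subspace (coboundaries C \<delta> n)"
  by (cases n) (auto simp: coboundaries_def intro: subspace_linear_image[OF vs vs subspace_cochains linear_diff])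

lemma findim_coboundaries: "findim s (coboundaries C \<delta> n)"
  by (rule findim_mono[OF findim_cocycles subspace_coboundaries coboundaries_subset])

lemma dim_coboundaries_le: "dim (coboundaries C \<delta> n) \<le> dim (cocycles C \<delta> n)"
  by (rule findim_dim_mono[OF vs findim_cocycles coboundaries_subset])

lemma dim_cochains: "dim (C n) = dim (cocycles C \<delta> n) + dim (coboundaries C \<delta> (Suc n))"
  using findim_image(2)[OF vs vs findim_cochains linear_diff] by (simp add: cocycles_def coboundaries_def)

end

text \<open>The target is not assumed to be a complex: \<open>codomain_complex\<close> deduces this
  when the map is onto in every degree.\<close>

locale cochain_map = dom: cochain_complex s C \<delta> + cod: vector_space t
  for s :: "'k::field \<Rightarrow> 'c::ab_group_add \<Rightarrow> 'c" and C \<delta>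
    and t :: "'k \<Rightarrow> 'd::ab_group_add \<Rightarrow> 'd" and D :: "nat \<Rightarrow> 'd set" and \<epsilon> :: "nat \<Rightarrow> 'd \<Rightarrow> 'd" +
  fixes \<phi> :: "'c \<Rightarrow> 'd"
  assumes linear_map: "linear_on s t (C n) \<phi>"
    and map_closed: "f \<in> C n \<Longrightarrow> \<phi> f \<in> D n"
    and map_diff: "f \<in> C n \<Longrightarrow> \<phi> (\<delta> n f) = \<epsilon> n (\<phi> f)"
begin

lemma map_0: "\<phi> 0 = 0"
  by (rule linear_on_0[OF dom.vs cod.vector_space_axioms dom.subspace_cochains linear_map])

text \<open>The map sends cocycles onto cocycles and coboundaries onto coboundaries, and by
  \<open>ker\<close> both restrictions have the same kernel, whose dimension cancels in the
  difference.\<close>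

lemma cohomology_dim_eq_if_acyclic_kernel:
  assumes surj: "\<And>w n. w \<in> D n \<Longrightarrow> \<exists>f\<in>C n. \<phi> f = w"
    and cocyc: "\<And>w n. w \<in> D n \<Longrightarrow> \<epsilon> n w = 0 \<Longrightarrow> \<exists>f\<in>C n. \<delta> n f = 0 \<and> \<phi> f = w"
    and ker: "\<And>f n. f \<in> C n \<Longrightarrow> \<delta> n f = 0 \<Longrightarrow> \<phi> f = 0 \<Longrightarrow> f \<in> coboundaries C \<delta> n"
  shows "cohomology_dim s C \<delta> n = cohomology_dim t D \<epsilon> n"
proof -
  let ?Z = "cocycles C \<delta> n" and ?B = "coboundaries C \<delta> n"
  have vst: "vector_space t" by unfold_locales
  have BZ: "?B \<subseteq> ?Z" by (rule dom.coboundaries_subset)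
  have ZC: "?Z \<subseteq> C n" by (auto simp: cocycles_def)
  have lZ: "linear_on s t ?Z \<phi>" by (rule linear_on_subset[OF linear_map ZC])
  have lB: "linear_on s t ?B \<phi>" by (rule linear_on_subset[OF lZ BZ])
  have kerZ: "{x\<in>?Z. \<phi> x = 0} = {x\<in>?B. \<phi> x = 0}"
    using ker BZ by (auto simp: cocycles_def)
  have iZ: "\<phi> ` ?Z = cocycles D \<epsilon> n"
  proof (intro set_eqI iffI)
    fix w assume "w \<in> \<phi> ` ?Z"
    then obtain f where f: "f \<in> C n" "\<delta> n f = 0" "w = \<phi> f" by (auto simp: cocycles_def)
    then show "w \<in> cocycles D \<epsilon> n"
      using map_closed[OF f(1)] map_diff[OF f(1)] map_0 by (simp add: cocycles_def)
  next
    fix w assume "w \<in> cocycles D \<epsilon> n"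
    then show "w \<in> \<phi> ` ?Z" using cocyc[of w n] by (auto simp: cocycles_def)
  qed
  have iB: "\<phi> ` ?B = coboundaries D \<epsilon> n"
  proof (cases n)
    case 0 then show ?thesis by (simp add: coboundaries_def map_0)
  next
    case (Suc j)
    have "\<phi> ` \<delta> j ` C j = \<epsilon> j ` \<phi> ` C j" using map_diff by (simp add: image_image)
    moreover have "\<phi> ` C j = D j" using surj map_closed by (auto simp: image_iff)
    ultimately show ?thesis using Suc by (simp add: coboundaries_def)
  qed
  show ?thesis
    using findim_image(2)[OF dom.vs vst dom.findim_cocycles lZ]
      findim_image(2)[OF dom.vs vst dom.findim_coboundaries lB]
    unfolding cohomology_dim_eq iZ iB kerZ by simp
qed

end

text \<open>The pair of maps is an isomorphism onto a product. This is used without forming the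
  product, by restricting the second map to the kernel of the first.\<close>

lemma dim_by_two_maps:
  assumes "vector_space s" "vector_space t" "vector_space u" "findim s V"
    and "linear_on s t V \<phi>" "linear_on s u V \<psi>"
    and inj: "\<And>x. x \<in> V \<Longrightarrow> \<phi> x = 0 \<Longrightarrow> \<psi> x = 0 \<Longrightarrow> x = 0"
    and into: "\<And>x. x \<in> V \<Longrightarrow> \<phi> x \<in> W" "\<And>x. x \<in> V \<Longrightarrow> \<psi> x \<in> U"
    and surj: "\<And>w v. w \<in> W \<Longrightarrow> v \<in> U \<Longrightarrow> \<exists>x\<in>V. \<phi> x = w \<and> \<psi> x = v"
    and "0 \<in> W" "0 \<in> U"
  shows "vector_space.dim s V = vector_space.dim t W + vector_space.dim u U"
proof -
  let ?K = "{x\<in>V. \<phi> x = 0}"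
  have K: "findim s ?K"
    by (rule findim_mono[OF assms(4) subspace_linear_kernel[OF assms(1,2) findim_subspace[OF assms(4)] assms(5)]]) auto
  have "\<phi> ` V = W" using into(1) surj[OF _ assms(12)] by (auto simp: image_iff)
  moreover have "\<psi> ` ?K = U" using into(2) surj[OF assms(11)] by (auto simp: image_iff)
  moreover have "vector_space.dim u (\<psi> ` ?K) = vector_space.dim s ?K"
    by (rule dim_inj_image[OF assms(1,3) K linear_on_subset[OF assms(6)]]) (use inj in auto)
  ultimately show ?thesis using findim_image(2)[OF assms(1,2,4,5)] by simp
qed

lemma cohomology_dim_direct_sum:
  assumes "cochain_map s C \<delta> t D \<epsilon> \<phi>" "cochain_map s C \<delta> u G \<eta> \<psi>"
    and "cochain_complex t D \<epsilon>" "cochain_complex u G \<eta>"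
    and inj: "\<And>x n. x \<in> C n \<Longrightarrow> \<phi> x = 0 \<Longrightarrow> \<psi> x = 0 \<Longrightarrow> x = 0"
    and surj: "\<And>w v n. w \<in> D n \<Longrightarrow> v \<in> G n \<Longrightarrow> \<exists>x\<in>C n. \<phi> x = w \<and> \<psi> x = v"
  shows "cohomology_dim s C \<delta> n = cohomology_dim t D \<epsilon> n + cohomology_dim u G \<eta> n"
proof -
  interpret f: cochain_map s C \<delta> t D \<epsilon> \<phi> by fact
  interpret g: cochain_map s C \<delta> u G \<eta> \<psi> by fact
  interpret D: cochain_complex t D \<epsilon> by fact
  interpret G: cochain_complex u G \<eta> by fact
  have zC: "cocycles C \<delta> n \<subseteq> C n" by (auto simp: cocycles_def)
  have bC: "coboundaries C \<delta> n \<subseteq> C n" using f.dom.coboundaries_subset zC by blast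
  have z: "vector_space.dim s (cocycles C \<delta> n) = vector_space.dim t (cocycles D \<epsilon> n) + vector_space.dim u (cocycles G \<eta> n)"
  proof (rule dim_by_two_maps[OF f.dom.vs D.vs G.vs f.dom.findim_cocycles
        linear_on_subset[OF f.linear_map zC] linear_on_subset[OF g.linear_map zC]])
    show "\<And>x. x \<in> cocycles C \<delta> n \<Longrightarrow> \<phi> x = 0 \<Longrightarrow> \<psi> x = 0 \<Longrightarrow> x = 0" using inj zC by blast
    show "\<phi> x \<in> cocycles D \<epsilon> n" if "x \<in> cocycles C \<delta> n" for x
      using that f.map_closed[of x n] f.map_diff[of x n] f.map_0 by (auto simp: cocycles_def)
    show "\<psi> x \<in> cocycles G \<eta> n" if "x \<in> cocycles C \<delta> n" for x
      using that g.map_closed[of x n] g.map_diff[of x n] g.map_0 by (auto simp: cocycles_def)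
    show "0 \<in> cocycles D \<epsilon> n" "0 \<in> cocycles G \<eta> n"
      by (auto simp: cocycles_def D.zero_cochain D.diff_0 G.zero_cochain G.diff_0)
    fix w v assume w: "w \<in> cocycles D \<epsilon> n" and v: "v \<in> cocycles G \<eta> n"
    then obtain x where x: "x \<in> C n" "\<phi> x = w" "\<psi> x = v" using surj[of w n v] by (auto simp: cocycles_def)
    \<comment> \<open>A common preimage of two cocycles is a cocycle: its differential is killed by
      both maps, which are jointly injective.\<close>
    have "\<phi> (\<delta> n x) = 0" "\<psi> (\<delta> n x) = 0"
      using x w v f.map_diff[OF x(1)] g.map_diff[OF x(1)] by (auto simp: cocycles_def)
    then have "\<delta> n x = 0" using inj[OF f.dom.diff_closed[OF x(1)]] by blast
    then show "\<exists>x\<in>cocycles C \<delta> n. \<phi> x = w \<and> \<psi> x = v" using x by (auto simp: cocycles_def)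
  qed
  have b: "vector_space.dim s (coboundaries C \<delta> n) = vector_space.dim t (coboundaries D \<epsilon> n) + vector_space.dim u (coboundaries G \<eta> n)"
  proof (cases n)
    case 0
    then show ?thesis
      by (simp add: coboundaries_def dim_zero[OF f.dom.vs] dim_zero[OF D.vs] dim_zero[OF G.vs])
  next
    case (Suc j)
    show ?thesis
    proof (rule dim_by_two_maps[OF f.dom.vs D.vs G.vs f.dom.findim_coboundaries
          linear_on_subset[OF f.linear_map bC] linear_on_subset[OF g.linear_map bC]])
      show "\<And>x. x \<in> coboundaries C \<delta> n \<Longrightarrow> \<phi> x = 0 \<Longrightarrow> \<psi> x = 0 \<Longrightarrow> x = 0" using inj bC by blast
      show "\<phi> x \<in> coboundaries D \<epsilon> n" if "x \<in> coboundaries C \<delta> n" for x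
        using that Suc f.map_closed[of _ j] f.map_diff[of _ j] by (auto simp: coboundaries_def)
      show "\<psi> x \<in> coboundaries G \<eta> n" if "x \<in> coboundaries C \<delta> n" for x
        using that Suc g.map_closed[of _ j] g.map_diff[of _ j] by (auto simp: coboundaries_def)
      show "0 \<in> coboundaries D \<epsilon> n" "0 \<in> coboundaries G \<eta> n"
        using module.subspace_0[OF vector_space_module[OF D.vs] D.subspace_coboundaries]
          module.subspace_0[OF vector_space_module[OF G.vs] G.subspace_coboundaries] by auto
      fix w v assume "w \<in> coboundaries D \<epsilon> n" and "v \<in> coboundaries G \<eta> n"
      then obtain a b where ab: "a \<in> D j" "b \<in> G j" "w = \<epsilon> j a" "v = \<eta> j b"
        using Suc by (auto simp: coboundaries_def)
      then obtain x where x: "x \<in> C j" "\<phi> x = a" "\<psi> x = b" using surj by blast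
      then show "\<exists>x\<in>coboundaries C \<delta> n. \<phi> x = w \<and> \<psi> x = v"
        using ab Suc f.map_diff[OF x(1)] g.map_diff[OF x(1)] by (auto simp: coboundaries_def)
    qed
  qed
  \<comment> \<open>The truncated difference is additive because in both summands the coboundaries
    are no larger than the cocycles.\<close>
  show ?thesis
    unfolding cohomology_dim_eq z b using D.dim_coboundaries_le[of n] G.dim_coboundaries_le[of n] by simp
qed

lemma (in cochain_complex) power_complex:
  fixes I :: "'i set"
  assumes "finite I"
  shows "cochain_complex (\<lambda>c F i. s c (F i)) (\<lambda>n. power_space I (C n)) (\<lambda>n F i. \<delta> n (F i))"
proof (rule cochain_complex.intro)
  fix n
  show "vector_space (\<lambda>c (F :: 'i \<Rightarrow> 'c) i. s c (F i))" by (rule vector_space_fun[OF vs])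
  then interpret F: vector_space "\<lambda>c (F :: 'i \<Rightarrow> 'c) i. s c (F i)" .
  show "findim (\<lambda>c F i. s c (F i)) (power_space I (C n))"
    using power_space_dim[OF vs findim_cochains assms] by blast
  show "linear_on (\<lambda>c F i. s c (F i)) (\<lambda>c F i. s c (F i)) (power_space I (C n)) (\<lambda>F i. \<delta> n (F i))"
    unfolding linear_on_def
  proof (intro conjI ballI allI ext)
    fix x y i assume "x \<in> power_space I (C n)" "y \<in> power_space I (C n)"
    then have "x i \<in> C n" "y i \<in> C n" by (blast intro: power_spaceD[OF _ zero_cochain])+
    then show "\<delta> n ((x + y) i) = ((\<lambda>i. \<delta> n (x i)) + (\<lambda>i. \<delta> n (y i))) i"
      using linear_on_add[OF linear_diff] by simp
  next
    fix c x i assume "x \<in> power_space I (C n)"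
    then have "x i \<in> C n" by (rule power_spaceD[OF _ zero_cochain])
    then show "\<delta> n (s c (x i)) = s c (\<delta> n (x i))" using linear_on_scale[OF linear_diff] by simp
  qed
  show "(\<lambda>i. \<delta> n (f i)) \<in> power_space I (C (Suc n))" if "f \<in> power_space I (C n)" for f
    using that by (auto simp: power_space_def diff_closed diff_0)
  show "(\<lambda>i. \<delta> (Suc n) (\<delta> n (f i))) = 0" if "f \<in> power_space I (C n)" for f
  proof (rule ext)
    fix i
    have "f i \<in> C n" using that by (rule power_spaceD[OF _ zero_cochain])
    then show "\<delta> (Suc n) (\<delta> n (f i)) = 0 i" using diff_diff by simp
  qed
qed

text \<open>Cocycles and coboundaries of the power are powers of cocycles and coboundaries; for the
  latter, preimages are chosen index by index and set to 0 outside \<open>I\<close>.\<close>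

lemma (in cochain_complex) cohomology_dim_power:
  assumes "finite I"
  shows "cohomology_dim (\<lambda>c F i. s c (F i)) (\<lambda>n. power_space I (C n)) (\<lambda>n F i. \<delta> n (F i)) n
    = card I * cohomology_dim s C \<delta> n"
proof -
  have z: "cocycles (\<lambda>n. power_space I (C n)) (\<lambda>n F i. \<delta> n (F i)) n = power_space I (cocycles C \<delta> n)"
    using diff_0 by (fastforce simp: cocycles_def power_space_def fun_eq_iff)
  have b: "coboundaries (\<lambda>n. power_space I (C n)) (\<lambda>n F i. \<delta> n (F i)) n = power_space I (coboundaries C \<delta> n)"
  proof (cases n)
    case 0
    then show ?thesis by (fastforce simp: coboundaries_def power_space_def fun_eq_iff)
  next
    case (Suc j)
    have "(\<lambda>F i. \<delta> j (F i)) ` power_space I (C j) = power_space I (\<delta> j ` C j)"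
    proof (intro set_eqI iffI)
      fix F assume "F \<in> power_space I (\<delta> j ` C j)"
      then have F: "\<forall>i\<in>I. \<exists>x. x \<in> C j \<and> F i = \<delta> j x" "\<forall>i. i \<notin> I \<longrightarrow> F i = 0"
        by (auto simp: power_space_def)
      then obtain h where h: "\<forall>i\<in>I. h i \<in> C j \<and> F i = \<delta> j (h i)" by metis
      let ?h = "\<lambda>i. if i \<in> I then h i else 0"
      have "?h \<in> power_space I (C j)" "F = (\<lambda>i. \<delta> j (?h i))"
        using h F by (auto simp: power_space_def fun_eq_iff diff_0)
      then show "F \<in> (\<lambda>F i. \<delta> j (F i)) ` power_space I (C j)" by (rule image_eqI[of F "\<lambda>F i. \<delta> j (F i)" ?h, rotated])
    qed (auto simp: power_space_def diff_0)
    then show ?thesis using Suc by (simp add: coboundaries_def)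
  qed
  show ?thesis
    unfolding cohomology_dim_eq z b
    using power_space_dim[OF vs findim_cocycles assms] power_space_dim[OF vs findim_coboundaries assms]
    by (simp add: diff_mult_distrib2)
qed

section \<open>Multilinear maps on lists and the bar recursion\<close>

lemma (in kspace) zero_mem [simp]: "0 \<in> carrier V"
  and add_mem [simp]: "x \<in> carrier V \<Longrightarrow> y \<in> carrier V \<Longrightarrow> x + y \<in> carrier V"
  and scal_mem [simp]: "x \<in> carrier V \<Longrightarrow> scal V c x \<in> carrier V"
  and uminus_mem [simp]: "x \<in> carrier V \<Longrightarrow> - x \<in> carrier V"
  and diff_mem [simp]: "x \<in> carrier V \<Longrightarrow> y \<in> carrier V \<Longrightarrow> x - y \<in> carrier V"
  and sum_mem: "(\<And>i. i \<in> I \<Longrightarrow> h i \<in> carrier V) \<Longrightarrow> sum h I \<in> carrier V"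
  using subspace_carrier
  by (auto intro: subspace_0 subspace_add subspace_scale subspace_neg subspace_diff subspace_sum)

lemma (in kspace) vector_space_scal: "vector_space (scal V)"
  by unfold_locales

lemma (in kspace) findim_carrier: "fin_dim V \<Longrightarrow> findim (scal V) (carrier V)"
  unfolding fin_dim_def findim_def using subspace_carrier by blast

text \<open>No degree is fixed and positions are named by splitting the list, because the recursions
  below shorten and extend lists. A cochain of degree \<open>n\<close> is such a map that vanishes
  on all other lengths.\<close>

definition multilinear ::
  "('k::field, 'a::ab_group_add, 'y) vspace_scheme \<Rightarrow> ('k, 'b::ab_group_add, 'z) vspace_scheme
    \<Rightarrow> ('a list \<Rightarrow> 'b) \<Rightarrow> bool" where
  "multilinear A U f \<longleftrightarrow>
    (\<forall>xs. set xs \<subseteq> carrier A \<longrightarrow> f xs \<in> carrier U) \<and>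
    (\<forall>xs ys x y. set xs \<subseteq> carrier A \<longrightarrow> set ys \<subseteq> carrier A \<longrightarrow> x \<in> carrier A \<longrightarrow> y \<in> carrier A \<longrightarrow>
      f (xs @ (x + y) # ys) = f (xs @ x # ys) + f (xs @ y # ys)) \<and>
    (\<forall>xs ys x c. set xs \<subseteq> carrier A \<longrightarrow> set ys \<subseteq> carrier A \<longrightarrow> x \<in> carrier A \<longrightarrow>
      f (xs @ scal A c x # ys) = scal U c (f (xs @ x # ys)))"

lemma multilinearI:
  assumes "\<And>xs. set xs \<subseteq> carrier A \<Longrightarrow> f xs \<in> carrier U"
    and "\<And>xs ys x y. set xs \<subseteq> carrier A \<Longrightarrow> set ys \<subseteq> carrier A \<Longrightarrow> x \<in> carrier A \<Longrightarrow> y \<in> carrier A \<Longrightarrow>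
      f (xs @ (x + y) # ys) = f (xs @ x # ys) + f (xs @ y # ys)"
    and "\<And>xs ys x c. set xs \<subseteq> carrier A \<Longrightarrow> set ys \<subseteq> carrier A \<Longrightarrow> x \<in> carrier A \<Longrightarrow>
      f (xs @ scal A c x # ys) = scal U c (f (xs @ x # ys))"
  shows "multilinear A U f"
  using assms by (simp add: multilinear_def)

lemma multilinear_mem: "multilinear A U f \<Longrightarrow> set xs \<subseteq> carrier A \<Longrightarrow> f xs \<in> carrier U"
  and multilinear_add: "multilinear A U f \<Longrightarrow> set xs \<subseteq> carrier A \<Longrightarrow> set ys \<subseteq> carrier A \<Longrightarrow>
      x \<in> carrier A \<Longrightarrow> y \<in> carrier A \<Longrightarrow> f (xs @ (x + y) # ys) = f (xs @ x # ys) + f (xs @ y # ys)"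
  and multilinear_scal: "multilinear A U f \<Longrightarrow> set xs \<subseteq> carrier A \<Longrightarrow> set ys \<subseteq> carrier A \<Longrightarrow>
      x \<in> carrier A \<Longrightarrow> f (xs @ scal A c x # ys) = scal U c (f (xs @ x # ys))"
  by (simp_all add: multilinear_def)

lemma multilinear_Cons_add: "multilinear A U f \<Longrightarrow> set ys \<subseteq> carrier A \<Longrightarrow>
      x \<in> carrier A \<Longrightarrow> y \<in> carrier A \<Longrightarrow> f ((x + y) # ys) = f (x # ys) + f (y # ys)"
  and multilinear_Cons_scal: "multilinear A U f \<Longrightarrow> set ys \<subseteq> carrier A \<Longrightarrow>
      x \<in> carrier A \<Longrightarrow> f (scal A c x # ys) = scal U c (f (x # ys))"
  using multilinear_add[of A U f "[]"] multilinear_scal[of A U f "[]"] by simp_all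

lemma multilinear_Cons:
  assumes "multilinear A U f" "z \<in> carrier A"
  shows "multilinear A U (\<lambda>zs. f (z # zs))"
proof (rule multilinearI, goal_cases)
  case (1 xs)
  then show ?case using multilinear_mem[OF assms(1)] assms(2) by simp
next
  case (2 xs ys x y)
  then show ?case using multilinear_add[OF assms(1), of "z # xs"] assms(2) by simp
next
  case (3 xs ys x c)
  then show ?case using multilinear_scal[OF assms(1), of "z # xs"] assms(2) by simp
qed

locale kspace_pair = A: kspace A + U: kspace U
  for A :: "('k::field, 'a::ab_group_add, 'y) vspace_scheme"
    and U :: "('k, 'n::ab_group_add, 'z) vspace_scheme"
begin

lemma multilinear_0:
  assumes "multilinear A U f" "set xs \<subseteq> carrier A" "set ys \<subseteq> carrier A"
  shows "f (xs @ 0 # ys) = 0"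
  using multilinear_scal[OF assms, of 0 0] by simp

lemma multilinear_Cons_0: "multilinear A U f \<Longrightarrow> set ys \<subseteq> carrier A \<Longrightarrow> f (0 # ys) = 0"
  using multilinear_0[of f "[]"] by simp

lemma multilinear_Cons_sum:
  assumes "multilinear A U f" "set ys \<subseteq> carrier A" "finite I" "\<And>i. i \<in> I \<Longrightarrow> w i \<in> carrier A"
  shows "f (sum w I # ys) = (\<Sum>i\<in>I. f (w i # ys))"
  using assms(3,4)
proof (induction I)
  case empty
  then show ?case using multilinear_Cons_0[OF assms(1,2)] by simp
next
  case (insert i I)
  then show ?case
    using multilinear_Cons_add[OF assms(1,2), of "w i" "sum w I"] A.sum_mem[of I w] by simp
qed

lemma multilinear_zero_map: "multilinear A U (\<lambda>xs. 0)"
  by (rule multilinearI) auto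

lemma multilinear_plus:
  assumes "multilinear A U f" "multilinear A U g"
  shows "multilinear A U (\<lambda>xs. f xs + g xs)"
  using assms unfolding multilinear_def by (auto simp: U.scale_right_distrib)

lemma multilinear_scaled:
  assumes "multilinear A U f"
  shows "multilinear A U (\<lambda>xs. scal U c (f xs))"
  using assms unfolding multilinear_def
  by (auto simp: U.scale_right_distrib mult.commute)

lemma multilinear_truncate:
  assumes "multilinear A U f"
  shows "multilinear A U (\<lambda>xs. if length xs = n \<and> set xs \<subseteq> carrier A then f xs else 0)"
proof (rule multilinearI, goal_cases)
  case (1 xs)
  then show ?case using multilinear_mem[OF assms] by auto
next
  case (2 xs ys x y)
  then show ?case using multilinear_add[OF assms, of xs ys x y] by auto
next
  case (3 xs ys x c)
  then show ?case using multilinear_scal[OF assms, of xs ys x c] by auto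
qed

text \<open>Proved for lists with a prefix of spanning vectors: induction on the remaining entries
  expands one entry at a time and moves its summands into the prefix.\<close>

lemma multilinear_eq_0:
  assumes f: "multilinear A U f" and S: "A.span S = carrier A"
    and 0: "\<And>xs. set xs \<subseteq> S \<Longrightarrow> f xs = 0" and ys: "set ys \<subseteq> carrier A"
  shows "f ys = 0"
proof -
  have SA: "S \<subseteq> carrier A" using S A.span_superset by blast
  have "f (xs @ ys) = 0" if "set xs \<subseteq> S" for xs
    using that ys
  proof (induction ys arbitrary: xs)
    case Nil
    then show ?case using 0 by simp
  next
    case (Cons y ys)
    have xs: "set xs \<subseteq> carrier A" using Cons.prems(1) SA by blast
    have ys: "set ys \<subseteq> carrier A" using Cons.prems(2) by simp
    have "y \<in> A.span S" using Cons.prems S by simp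
    then have "y \<in> carrier A \<and> f (xs @ y # ys) = 0"
    proof (induction rule: A.span_induct_alt)
      case base
      show ?case using multilinear_0[OF f xs ys] by simp
    next
      case (step c x z)
      have "f ((xs @ [x]) @ ys) = 0"
        using Cons.IH[of "xs @ [x]"] Cons.prems step(1) ys by auto
      then have "f (xs @ scal A c x # ys) = 0"
        using multilinear_scal[OF f xs ys, of x c] step(1) SA by auto
      then show ?case
        using step multilinear_add[OF f xs ys, of "scal A c x" z] SA by auto
    qed
    then show ?case by simp
  qed
  from this[of "[]"] show ?thesis by simp
qed

end

text \<open>
  \<open>lead\<close> and \<open>bar\<close> split the Hochschild differential of \<open>f\<close> into its first face and the alternating
  sum of all others; the recursion in \<open>bar\<close> produces the signs.
\<close>

fun bar :: "('a \<Rightarrow> 'a \<Rightarrow> 'a) \<Rightarrow> ('n \<Rightarrow> 'a \<Rightarrow> 'n) \<Rightarrow> ('a list \<Rightarrow> 'n::ab_group_add) \<Rightarrow> 'a list \<Rightarrow> 'n" where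
  "bar \<mu> \<rho> f [] = 0"
| "bar \<mu> \<rho> f [x] = - \<rho> (f []) x"
| "bar \<mu> \<rho> f (x # y # ys) = - f (\<mu> x y # ys) - bar \<mu> \<rho> (\<lambda>zs. f (x # zs)) (y # ys)"

fun lead :: "('a \<Rightarrow> 'n \<Rightarrow> 'n) \<Rightarrow> ('a list \<Rightarrow> 'n::zero) \<Rightarrow> 'a list \<Rightarrow> 'n" where
  "lead l f [] = 0"
| "lead l f (x # xs) = l x (f xs)"

text \<open>Coefficients with a right action only, since \<open>bar\<close> omits the first face; a
  left action enters through \<open>lead\<close>.\<close>

locale right_module = A: kalgebra A + U: kspace U
  for A :: "('k::field, 'a::ab_group_add, 'y) alg_scheme"
    and U :: "('k, 'n::ab_group_add, 'z) vspace_scheme" +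
  fixes \<rho> :: "'n \<Rightarrow> 'a \<Rightarrow> 'n"
  assumes ract_mem [simp]: "\<lbrakk>u \<in> carrier U; x \<in> carrier A\<rbrakk> \<Longrightarrow> \<rho> u x \<in> carrier U"
    and ract_mul: "\<lbrakk>u \<in> carrier U; x \<in> carrier A; y \<in> carrier A\<rbrakk> \<Longrightarrow> \<rho> u (mul A x y) = \<rho> (\<rho> u x) y"
    and ract_add_left: "\<lbrakk>u \<in> carrier U; v \<in> carrier U; x \<in> carrier A\<rbrakk> \<Longrightarrow> \<rho> (u + v) x = \<rho> u x + \<rho> v x"
    and ract_add_right: "\<lbrakk>u \<in> carrier U; x \<in> carrier A; y \<in> carrier A\<rbrakk> \<Longrightarrow> \<rho> u (x + y) = \<rho> u x + \<rho> u y"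
    and ract_scal_left: "\<lbrakk>u \<in> carrier U; x \<in> carrier A\<rbrakk> \<Longrightarrow> \<rho> (scal U c u) x = scal U c (\<rho> u x)"
    and ract_scal_right: "\<lbrakk>u \<in> carrier U; x \<in> carrier A\<rbrakk> \<Longrightarrow> \<rho> u (scal A c x) = scal U c (\<rho> u x)"
begin

sublocale kspace_pair A U ..

declare A.mul_closed [simp]

abbreviation "brr \<equiv> bar (mul A) \<rho>"

lemma ract_0 [simp]: "x \<in> carrier A \<Longrightarrow> \<rho> 0 x = 0"
  using ract_scal_left[of 0 x 0] by simp

lemma ract_0_right [simp]: "u \<in> carrier U \<Longrightarrow> \<rho> u 0 = 0"
  using ract_scal_right[of u 0 0] by simp

lemma ract_minus: "u \<in> carrier U \<Longrightarrow> x \<in> carrier A \<Longrightarrow> \<rho> (- u) x = - \<rho> u x"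
  using ract_scal_left[of u x "-1"] by simp

section \<open>Linearity of the bar recursion and vanishing of its square\<close>

lemma bar_cong:
  assumes "\<And>ys. length xs = Suc (length ys) \<Longrightarrow> set ys \<subseteq> carrier A \<Longrightarrow> f ys = g ys" "set xs \<subseteq> carrier A"
  shows "brr f xs = brr g xs"
  using assms
proof (induction xs arbitrary: f g rule: induct_list012)
  case (3 x y zs)
  have "brr (\<lambda>zs. f (x # zs)) (y # zs) = brr (\<lambda>zs. g (x # zs)) (y # zs)"
    by (rule "3.IH"(2)) (use "3.prems" in auto)
  moreover have "f (mul A x y # zs) = g (mul A x y # zs)"
    by (rule "3.prems"(1)) (use "3.prems"(2) in auto)
  ultimately show ?case by simp
qed simp_all

lemma bar_mem:
  assumes "\<And>ys. set ys \<subseteq> carrier A \<Longrightarrow> f ys \<in> carrier U" "set xs \<subseteq> carrier A"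
  shows "brr f xs \<in> carrier U"
  using assms by (induction xs arbitrary: f rule: induct_list012) auto

lemma bar_add:
  assumes "\<And>ys. set ys \<subseteq> carrier A \<Longrightarrow> f ys \<in> carrier U" "\<And>ys. set ys \<subseteq> carrier A \<Longrightarrow> g ys \<in> carrier U"
    "set xs \<subseteq> carrier A"
  shows "brr (\<lambda>zs. f zs + g zs) xs = brr f xs + brr g xs"
  using assms by (induction xs arbitrary: f g rule: induct_list012) (auto simp: ract_add_left)

lemma bar_scal:
  assumes "\<And>ys. set ys \<subseteq> carrier A \<Longrightarrow> f ys \<in> carrier U" "set xs \<subseteq> carrier A"
  shows "brr (\<lambda>zs. scal U c (f zs)) xs = scal U c (brr f xs)"
  using assms
  by (induction xs arbitrary: f rule: induct_list012) (auto simp: ract_scal_left U.scale_right_diff_distrib)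

lemma bar_minus:
  assumes "\<And>ys. set ys \<subseteq> carrier A \<Longrightarrow> f ys \<in> carrier U" "set xs \<subseteq> carrier A"
  shows "brr (\<lambda>zs. - f zs) xs = - brr f xs"
  using bar_scal[where f = f and xs = xs and c = "-1"] assms by simp

lemma bar_diff:
  assumes "\<And>ys. set ys \<subseteq> carrier A \<Longrightarrow> f ys \<in> carrier U" "\<And>ys. set ys \<subseteq> carrier A \<Longrightarrow> g ys \<in> carrier U"
    "set xs \<subseteq> carrier A"
  shows "brr (\<lambda>zs. f zs - g zs) xs = brr f xs - brr g xs"
  using bar_add[where f = f and g = "\<lambda>zs. - g zs" and xs = xs] bar_minus[where f = g and xs = xs] assms by simp

lemma bar_zero: "set xs \<subseteq> carrier A \<Longrightarrow> brr (\<lambda>zs. 0) xs = 0"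
  using bar_scal[of "\<lambda>_. 0" xs 0] by simp

lemma bar_sum:
  assumes "\<And>i ys. i \<in> I \<Longrightarrow> set ys \<subseteq> carrier A \<Longrightarrow> f i ys \<in> carrier U" "set xs \<subseteq> carrier A" "finite I"
  shows "brr (\<lambda>zs. \<Sum>i\<in>I. f i zs) xs = (\<Sum>i\<in>I. brr (f i) xs)"
  using assms(3,1)
proof (induction I)
  case empty
  then show ?case using bar_zero[OF assms(2)] by simp
next
  case (insert i I)
  then show ?case
    using bar_add[of "f i" "\<lambda>zs. \<Sum>i\<in>I. f i zs" xs] assms(2) by (auto simp: U.sum_mem)
qed

text \<open>Meant for \<open>l\<close> a left multiplication: it acts on values alone and commutes
  with the right action of the last face.\<close>

lemma bar_comm:
  assumes "\<And>ys. set ys \<subseteq> carrier A \<Longrightarrow> f ys \<in> carrier U" "set xs \<subseteq> carrier A"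
    and "l 0 = 0" "\<And>u v. u \<in> carrier U \<Longrightarrow> v \<in> carrier U \<Longrightarrow> l (u - v) = l u - l v"
    and "\<And>u x. u \<in> carrier U \<Longrightarrow> x \<in> carrier A \<Longrightarrow> \<rho> (l u) x = l (\<rho> u x)"
  shows "brr (\<lambda>zs. l (f zs)) xs = l (brr f xs)"
proof -
  have m: "l (- u) = - l u" if "u \<in> carrier U" for u
    using assms(4)[of 0 u] that assms(3) by simp
  have d: "l (- u - v) = - l u - l v" if "u \<in> carrier U" "v \<in> carrier U" for u v
    using assms(4)[of "-u" v] that m by simp
  show ?thesis
    using assms(1,2)
    by (induction xs arbitrary: f rule: induct_list012) (auto simp: assms(3,5) m bar_mem intro!: d[symmetric])
qed

lemma bar_Cons_fun:
  "zs \<noteq> [] \<Longrightarrow> brr f (x # zs) = - f (mul A x (hd zs) # tl zs) - brr (\<lambda>ys. f (x # ys)) zs"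
  by (cases zs) auto

text \<open>The differential without its first face already squares to zero. In the recursion, the
  twofold \<open>bar\<close> that keeps the first entry vanishes by induction, and the terms that
  merge it with the second entry cancel by associativity.\<close>

lemma bar_bar:
  assumes "\<And>ys. set ys \<subseteq> carrier A \<Longrightarrow> f ys \<in> carrier U" "set xs \<subseteq> carrier A"
  shows "brr (brr f) xs = 0"
  using assms
proof (induction xs arbitrary: f)
  case Nil
  then show ?case by simp
next
  case (Cons x xs)
  show ?case
  proof (cases xs)
    case Nil
    then show ?thesis using Cons by simp
  next
    case xs: (Cons y ys)
    show ?thesis
    proof (cases ys)
      case Nil
      then show ?thesis using Cons xs by (simp add: ract_mul ract_minus)
    next
      case ys: (Cons w ws)
      let ?m = "\<lambda>zs. f (mul A x (hd zs) # tl zs)" and ?g = "\<lambda>zs. f (x # zs)"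
      have c: "x \<in> carrier A" "y \<in> carrier A" "w \<in> carrier A" "set ws \<subseteq> carrier A" "set ys \<subseteq> carrier A"
        using Cons xs ys by auto
      \<comment> \<open>\<open>hd (zs @ [0])\<close> equals \<open>hd zs\<close> on the lists that
        occur, and it keeps the term in the carrier for the empty list too, as
        \<open>bar_diff\<close> asks this of all lists.\<close>
      have "brr (\<lambda>zs. brr f (x # zs)) (y # ys) = brr (\<lambda>zs. - f (mul A x (hd (zs @ [0])) # tl zs) - brr ?g zs) (y # ys)"
      proof (rule bar_cong)
        fix zs :: "'a list" assume "length (y # ys) = Suc (length zs)"
        then show "brr f (x # zs) = - f (mul A x (hd (zs @ [0])) # tl zs) - brr ?g zs"
          using ys by (cases zs) auto
      qed (use c in auto)
      also have "\<dots> = brr (\<lambda>zs. - f (mul A x (hd (zs @ [0])) # tl zs)) (y # ys) - brr (brr ?g) (y # ys)"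
      proof (rule bar_diff)
        fix zs assume z: "set zs \<subseteq> carrier A"
        then have "hd (zs @ [0]) \<in> carrier A" "set (tl zs) \<subseteq> carrier A" by (cases zs; simp)+
        then show "- f (mul A x (hd (zs @ [0])) # tl zs) \<in> carrier U" using Cons.prems c by simp
        show "brr ?g zs \<in> carrier U" using z c Cons.prems by (intro bar_mem) auto
      qed (use c in auto)
      also have "brr (brr ?g) (y # ys) = 0"
        using Cons.IH[of ?g] Cons.prems c xs by simp
      also have "brr (\<lambda>zs. - f (mul A x (hd (zs @ [0])) # tl zs)) (y # ys)
          = - brr (\<lambda>zs. f (mul A x (hd (zs @ [0])) # tl zs)) (y # ys)"
      proof (rule bar_minus)
        fix zs assume z: "set zs \<subseteq> carrier A"
        then have "hd (zs @ [0]) \<in> carrier A" "set (tl zs) \<subseteq> carrier A" by (cases zs; simp)+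
        then show "f (mul A x (hd (zs @ [0])) # tl zs) \<in> carrier U" using Cons.prems c by simp
      qed (use c in auto)
      also have "brr (\<lambda>zs. f (mul A x (hd (zs @ [0])) # tl zs)) (y # ys)
        = - f (mul A x (mul A y w) # ws) - brr (\<lambda>zs. f (mul A x y # zs)) ys"
        by (simp add: ys)
      also have "\<dots> = brr f (mul A x y # ys)"
        using ys c by (simp add: A.mul_assoc)
      finally have "brr (\<lambda>zs. brr f (x # zs)) (y # ys) = - brr f (mul A x y # ys)" by simp
      then show ?thesis using xs by simp
    qed
  qed
qed

text \<open>After \<open>bar_bar\<close> only terms with the first face remain. Merging the first
  two entries cancels against acting twice, because \<open>l\<close> is multiplicative, and
  \<open>l\<close> passes through the other faces by \<open>bar_comm\<close>.\<close>

lemma lead_bar_lead_bar: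
  assumes f: "\<And>ys. set ys \<subseteq> carrier A \<Longrightarrow> f ys \<in> carrier U"
    and l: "\<And>x u. x \<in> carrier A \<Longrightarrow> u \<in> carrier U \<Longrightarrow> l x u \<in> carrier U"
      "\<And>x y u. x \<in> carrier A \<Longrightarrow> y \<in> carrier A \<Longrightarrow> u \<in> carrier U \<Longrightarrow> l (mul A x y) u = l x (l y u)"
      "\<And>x u v. x \<in> carrier A \<Longrightarrow> u \<in> carrier U \<Longrightarrow> v \<in> carrier U \<Longrightarrow> l x (u + v) = l x u + l x v"
      "\<And>x u y. x \<in> carrier A \<Longrightarrow> y \<in> carrier A \<Longrightarrow> u \<in> carrier U \<Longrightarrow> \<rho> (l x u) y = l x (\<rho> u y)"
    and xs: "set xs \<subseteq> carrier A"
  defines "g \<equiv> \<lambda>zs. lead l f zs + brr f zs"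
  shows "lead l g xs + brr g xs = 0"
proof -
  have l0: "l x 0 = 0" if "x \<in> carrier A" for x using l(3)[OF that, of 0 0] by simp
  have ld: "l x (u - v) = l x u - l x v" if "x \<in> carrier A" "u \<in> carrier U" "v \<in> carrier U" for x u v
    using l(3)[OF that(1), of "u - v" v] that by simp
  consider "xs = []" | x where "xs = [x]" | x y ys where "xs = x # y # ys"
    by (metis list.exhaust)
  then show ?thesis
  proof cases
    case 1
    then show ?thesis by simp
  next
    case 2
    then show ?thesis using xs l0 by (simp add: g_def)
  next
    case 3
    have c: "x \<in> carrier A" "y \<in> carrier A" "set ys \<subseteq> carrier A" using xs 3 by auto
    have b: "brr f zs \<in> carrier U" if "set zs \<subseteq> carrier A" for zs
      using that f by (intro bar_mem) auto
    have lm: "lead l f zs \<in> carrier U" if "set zs \<subseteq> carrier A" for zs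
      using that f l(1) by (cases zs) auto
    have "brr g xs = brr (lead l f) xs + brr (brr f) xs"
      unfolding g_def using xs b lm by (intro bar_add) auto
    also have "brr (brr f) xs = 0" using xs f by (intro bar_bar) auto
    also have "brr (lead l f) xs = - l (mul A x y) (f ys) - brr (\<lambda>zs. l x (f zs)) (y # ys)"
      by (simp add: 3)
    also have "brr (\<lambda>zs. l x (f zs)) (y # ys) = l x (brr f (y # ys))"
      using c f l0 ld l(4) by (intro bar_comm) auto
    finally have "brr g xs = - l (mul A x y) (f ys) - l x (brr f (y # ys))" by simp
    moreover have "lead l g xs = l (mul A x y) (f ys) + l x (brr f (y # ys))"
      using c b[of "y # ys"] f l(1-3) by (simp add: 3 g_def)
    ultimately show ?thesis by simp
  qed
qed

text \<open>Induction on the entries before the varied one. Bilinearity of the product or of the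
  action is used where that entry meets a neighbour or the value; the other faces are covered by
  linearity of \<open>bar\<close> in \<open>f\<close>.\<close>

lemma multilinear_bar:
  assumes "multilinear A U f"
  shows "multilinear A U (brr f)"
proof (rule multilinearI)
  show "brr f xs \<in> carrier U" if "set xs \<subseteq> carrier A" for xs
    using bar_mem multilinear_mem[OF assms] that by blast
next
  fix xs ys x y
  assume "set xs \<subseteq> carrier A" "set ys \<subseteq> carrier A" and xy: "x \<in> carrier A" "y \<in> carrier A"
  then show "brr f (xs @ (x + y) # ys) = brr f (xs @ x # ys) + brr f (xs @ y # ys)"
    using assms
  proof (induction xs arbitrary: f)
    case Nil
    note [simp] = multilinear_mem[OF Nil(5)]
    show ?case
    proof (cases ys)
      case Nil
      then show ?thesis using xy by (simp add: ract_add_right)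
    next
      case (Cons w ws)
      then have w: "w \<in> carrier A" "set ws \<subseteq> carrier A" using \<open>set ys \<subseteq> carrier A\<close> by auto
      have "brr (\<lambda>zs. f ((x + y) # zs)) ys = brr (\<lambda>zs. f (x # zs) + f (y # zs)) ys"
        using multilinear_Cons_add[OF Nil(5)] Nil by (intro bar_cong) auto
      also have "\<dots> = brr (\<lambda>zs. f (x # zs)) ys + brr (\<lambda>zs. f (y # zs)) ys"
        using Nil by (intro bar_add) auto
      finally show ?thesis
        using Cons w xy multilinear_Cons_add[OF Nil(5) w(2), of "mul A x w" "mul A y w"]
        by (simp add: A.mul_add_left)
    qed
  next
    case (Cons a xs)
    then have a: "a \<in> carrier A" "set xs \<subseteq> carrier A" by auto
    note IH = Cons.IH[OF a(2) Cons.prems(2-4) multilinear_Cons[OF Cons.prems(5) a(1)]]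
    show ?case
    proof (cases xs)
      case Nil
      then show ?thesis
        using IH a xy Cons.prems multilinear_Cons_add[OF Cons.prems(5), of ys "mul A a x" "mul A a y"]
        by (simp add: A.mul_add_right)
    next
      case xs: (Cons b bs)
      then show ?thesis
        using IH a xy Cons.prems multilinear_add[OF Cons.prems(5), of "mul A a b # bs" ys x y]
        by simp
    qed
  qed
next
  fix xs ys x c
  assume "set xs \<subseteq> carrier A" "set ys \<subseteq> carrier A" and x: "x \<in> carrier A"
  then show "brr f (xs @ scal A c x # ys) = scal U c (brr f (xs @ x # ys))"
    using assms
  proof (induction xs arbitrary: f)
    case Nil
    note [simp] = multilinear_mem[OF Nil(4)]
    show ?case
    proof (cases ys)
      case Nil
      then show ?thesis using x by (simp add: ract_scal_right)
    next
      case (Cons w ws)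
      then have w: "w \<in> carrier A" "set ws \<subseteq> carrier A" using \<open>set ys \<subseteq> carrier A\<close> by auto
      have "brr (\<lambda>zs. f (scal A c x # zs)) ys = brr (\<lambda>zs. scal U c (f (x # zs))) ys"
        using multilinear_Cons_scal[OF Nil(4)] Nil by (intro bar_cong) auto
      also have "\<dots> = scal U c (brr (\<lambda>zs. f (x # zs)) ys)"
        using Nil by (intro bar_scal) auto
      finally show ?thesis
        using Cons w x multilinear_Cons_scal[OF Nil(4) w(2), of "mul A x w" c]
        by (simp add: A.mul_scal_left U.scale_right_diff_distrib)
    qed
  next
    case (Cons a xs)
    then have a: "a \<in> carrier A" "set xs \<subseteq> carrier A" by auto
    note IH = Cons.IH[OF a(2) Cons.prems(2-3) multilinear_Cons[OF Cons.prems(4) a(1)]]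
    show ?case
    proof (cases xs)
      case Nil
      then show ?thesis
        using IH a x Cons.prems multilinear_Cons_scal[OF Cons.prems(4), of ys "mul A a x" c]
        by (simp add: A.mul_scal_right U.scale_right_diff_distrib)
    next
      case xs: (Cons b bs)
      then show ?thesis
        using IH a x Cons.prems multilinear_scal[OF Cons.prems(4), of "mul A a b # bs" ys x c]
        by (simp add: U.scale_right_diff_distrib)
    qed
  qed
qed

end

section \<open>The Hochschild complex\<close>

context kalgebra
begin

sublocale self: right_module A A "mul A"
  by unfold_locales
    (simp_all add: mul_closed mul_assoc mul_add_left mul_add_right mul_scal_left mul_scal_right)

lemma mul_minus_right: "x \<in> carrier A \<Longrightarrow> y \<in> carrier A \<Longrightarrow> mul A x (- y) = - mul A x y"
  using mul_scal_right[of x y "-1"] by simp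

lemma mul_diff_right:
  "x \<in> carrier A \<Longrightarrow> y \<in> carrier A \<Longrightarrow> z \<in> carrier A \<Longrightarrow> mul A x (y - z) = mul A x y - mul A x z"
  using mul_add_right[of x y "- z"] mul_minus_right[of x z] by simp

lemma mul_sum_right:
  "x \<in> carrier A \<Longrightarrow> (\<And>i. i \<in> I \<Longrightarrow> w i \<in> carrier A) \<Longrightarrow> finite I \<Longrightarrow>
    mul A x (sum w I) = (\<Sum>i\<in>I. mul A x (w i))"
proof (induction I rule: infinite_finite_induct)
  case (insert i I)
  then show ?case using mul_add_right[of x "w i" "sum w I"] by (simp add: sum_mem)
qed auto

lemma mul_sum_left:
  "x \<in> carrier A \<Longrightarrow> (\<And>i. i \<in> I \<Longrightarrow> w i \<in> carrier A) \<Longrightarrow> finite I \<Longrightarrow>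
    mul A (sum w I) x = (\<Sum>i\<in>I. mul A (w i) x)"
proof (induction I rule: infinite_finite_induct)
  case (insert i I)
  then show ?case using mul_add_left[of "w i" "sum w I" x] by (simp add: sum_mem)
qed auto

lemma multilinear_lead:
  assumes "multilinear A A f"
  shows "multilinear A A (lead (mul A) f)"
proof (rule multilinearI, goal_cases)
  case (1 xs)
  then show ?case using multilinear_mem[OF assms] by (cases xs) auto
next
  case (2 xs ys x y)
  then show ?case using multilinear_mem[OF assms] multilinear_add[OF assms, of "tl xs" ys x y]
    by (cases xs) (auto simp: mul_add_left mul_add_right)
next
  case (3 xs ys x c)
  then show ?case using multilinear_mem[OF assms] multilinear_scal[OF assms, of "tl xs" ys x c]
    by (cases xs) (auto simp: mul_scal_left mul_scal_right)
qed

end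

text \<open>Translates conditions stated with list update into conditions on split lists.
  \<open>P\<close> and \<open>Q\<close> stand for additivity and homogeneity, which are translated
  together.\<close>

lemma list_update_append_iff:
  "(\<forall>xs. length xs = n \<and> set xs \<subseteq> S \<longrightarrow> (\<forall>i<n. \<forall>x\<in>S. \<forall>y\<in>S. \<forall>c. P (xs[i := q x y]) (xs[i := x]) (xs[i := y])
      \<and> Q c (xs[i := r c x]) (xs[i := x])))
  \<longleftrightarrow> (\<forall>xs ys x y c. length xs + length ys + 1 = n \<longrightarrow> set xs \<subseteq> S \<longrightarrow> set ys \<subseteq> S \<longrightarrow> x \<in> S \<longrightarrow> y \<in> S \<longrightarrow>
    P (xs @ q x y # ys) (xs @ x # ys) (xs @ y # ys) \<and> Q c (xs @ r c x # ys) (xs @ x # ys))"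
    (is "?L \<longleftrightarrow> ?R")
proof
  assume L: ?L
  show ?R
  proof (intro allI impI)
    fix xs ys x y c
    assume "length xs + length ys + 1 = n" "set xs \<subseteq> S" "set ys \<subseteq> S" "x \<in> S" "y \<in> S"
    then show "P (xs @ q x y # ys) (xs @ x # ys) (xs @ y # ys) \<and> Q c (xs @ r c x # ys) (xs @ x # ys)"
      using L[rule_format, of "xs @ x # ys" "length xs" x y c] by simp
  qed
next
  assume R: ?R
  show ?L
  proof (intro allI impI ballI)
    fix xs i x y c
    assume a: "length xs = n \<and> set xs \<subseteq> S" "i < n" "x \<in> S" "y \<in> S"
    then have "xs[i := z] = take i xs @ z # drop (Suc i) xs" for z by (simp add: upd_conv_take_nth_drop)
    moreover have "set (take i xs) \<subseteq> S" "set (drop (Suc i) xs) \<subseteq> S"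
      using a set_take_subset set_drop_subset by fast+
    ultimately show "P (xs[i := q x y]) (xs[i := x]) (xs[i := y]) \<and> Q c (xs[i := r c x]) (xs[i := x])"
      using R[rule_format, of "take i xs" "drop (Suc i) xs" x y c] a by simp
  qed
qed

locale hochschild_algebra = kalgebra A for A :: "('k::field, 'a::ab_group_add) alg"
begin

text \<open>Since cochains vanish on lists of other lengths, linearity may be asked for lists of
  every length, as \<open>multilinear\<close> does.\<close>

lemma hochschild_cochains_iff:
  "f \<in> hochschild_cochains A n \<longleftrightarrow>
    multilinear A A f \<and> (\<forall>xs. \<not> (length xs = n \<and> set xs \<subseteq> carrier A) \<longrightarrow> f xs = 0)"
    (is "?L \<longleftrightarrow> ?R")
proof
  assume L: ?L
  then have z: "\<And>xs. \<not> (length xs = n \<and> set xs \<subseteq> carrier A) \<Longrightarrow> f xs = 0"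
    and m: "\<And>xs. length xs = n \<Longrightarrow> set xs \<subseteq> carrier A \<Longrightarrow> f xs \<in> carrier A"
    by (simp_all add: hochschild_cochains_def)
  have "\<forall>xs. length xs = n \<and> set xs \<subseteq> carrier A \<longrightarrow>
      (\<forall>i<n. \<forall>x\<in>carrier A. \<forall>y\<in>carrier A. \<forall>c.
        f (xs[i := x + y]) = f (xs[i := x]) + f (xs[i := y]) \<and>
        f (xs[i := scal A c x]) = scal A c (f (xs[i := x])))"
    using L by (simp add: hochschild_cochains_def)
  from this[unfolded list_update_append_iff[of n "carrier A" "\<lambda>u v w. f u = f v + f w"
      "(+)" "\<lambda>c u v. f u = scal A c (f v)" "scal A"]]
  have l: "length xs + length ys + 1 = n \<Longrightarrow> set xs \<subseteq> carrier A \<Longrightarrow> set ys \<subseteq> carrier A \<Longrightarrow>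
      x \<in> carrier A \<Longrightarrow> y \<in> carrier A \<Longrightarrow>
      f (xs @ (x + y) # ys) = f (xs @ x # ys) + f (xs @ y # ys) \<and>
      f (xs @ scal A c x # ys) = scal A c (f (xs @ x # ys))" for xs ys x y c
    by blast
  have "multilinear A A f"
  proof (rule multilinearI)
    show "f xs \<in> carrier A" if "set xs \<subseteq> carrier A" for xs
      using that m z by (cases "length xs = n") auto
  next
    fix xs ys x y assume "set xs \<subseteq> carrier A" "set ys \<subseteq> carrier A" "x \<in> carrier A" "y \<in> carrier A"
    then show "f (xs @ (x + y) # ys) = f (xs @ x # ys) + f (xs @ y # ys)"
      using l[of xs ys x y] by (cases "length xs + length ys + 1 = n") (auto simp: z)
  next
    fix xs ys x c assume "set xs \<subseteq> carrier A" "set ys \<subseteq> carrier A" "x \<in> carrier A"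
    then show "f (xs @ scal A c x # ys) = scal A c (f (xs @ x # ys))"
      using l[of xs ys x x c] by (cases "length xs + length ys + 1 = n") (auto simp: z)
  qed
  then show ?R using z by blast
next
  assume R: ?R
  have "\<forall>xs. length xs = n \<and> set xs \<subseteq> carrier A \<longrightarrow>
      (\<forall>i<n. \<forall>x\<in>carrier A. \<forall>y\<in>carrier A. \<forall>c.
        f (xs[i := x + y]) = f (xs[i := x]) + f (xs[i := y]) \<and>
        f (xs[i := scal A c x]) = scal A c (f (xs[i := x])))"
    unfolding list_update_append_iff[of n "carrier A" "\<lambda>u v w. f u = f v + f w"
      "(+)" "\<lambda>c u v. f u = scal A c (f v)" "scal A"]
    using R multilinear_add multilinear_scal by blast
  then show ?L using R multilinear_mem[of A A f] by (simp add: hochschild_cochains_def)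
qed

lemma hochschild_cochains_mem: "f \<in> hochschild_cochains A n \<Longrightarrow> f xs \<in> carrier A"
  using multilinear_mem[of A A f xs] hochschild_cochains_iff[of f n] by (metis zero_mem)

text \<open>Dropping the first entry lowers the index of every later face by one; the resulting
  change of sign is the minus sign in the recursion of \<open>bar\<close>.\<close>

lemma hochschild_sum_eq_bar:
  assumes "length xs = Suc n"
  shows "(\<Sum>i<n. scal A ((-1) ^ (i + 1)) (f (take i xs @ [mul A (xs ! i) (xs ! (i + 1))] @ drop (i + 2) xs))) +
      scal A ((-1) ^ (n + 1)) (mul A (f (butlast xs)) (last xs)) = self.brr f xs"
  using assms
proof (induction xs arbitrary: f n)
  case (Cons x xs)
  show ?case
  proof (cases xs)
    case Nil
    then show ?thesis using Cons by simp
  next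
    case xs: (Cons y ys)
    obtain m where m: "n = Suc m" "length xs = Suc m" using Cons.prems xs by (cases n) auto
    have "self.brr f (x # xs) = - f (mul A x y # ys) - self.brr (\<lambda>zs. f (x # zs)) xs"
      using xs by simp
    also have "self.brr (\<lambda>zs. f (x # zs)) xs =
       (\<Sum>i<m. scal A ((-1) ^ (i + 1)) (f (x # take i xs @ [mul A (xs ! i) (xs ! (i + 1))] @ drop (i + 2) xs))) +
      scal A ((-1) ^ (m + 1)) (mul A (f (x # butlast xs)) (last xs))"
      using Cons.IH[OF m(2), of "\<lambda>zs. f (x # zs)"] by simp
    finally show ?thesis
      unfolding m(1) sum.lessThan_Suc_shift using xs by (simp add: sum_negf o_def)
  qed
qed simp

lemma hochschild_diff_eq:
  "hochschild_diff A n f =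
    (\<lambda>xs. if length xs = Suc n \<and> set xs \<subseteq> carrier A then lead (mul A) f xs + self.brr f xs else 0)"
proof (rule ext)
  fix xs
  show "hochschild_diff A n f xs =
    (if length xs = Suc n \<and> set xs \<subseteq> carrier A then lead (mul A) f xs + self.brr f xs else 0)"
  proof (cases "length xs = Suc n")
    case True
    moreover obtain y ys where "xs = y # ys" using True by (cases xs) auto
    ultimately show ?thesis
      using hochschild_sum_eq_bar[of xs n f] by (simp add: hochschild_diff_def add.assoc)
  qed (simp add: hochschild_diff_def)
qed

text \<open>On lists of the wrong length both sides vanish, so later recursions do not have to track
  lengths.\<close>

lemma hochschild_diff_apply:
  "f \<in> hochschild_cochains A n \<Longrightarrow> set xs \<subseteq> carrier A \<Longrightarrow>
    hochschild_diff A n f xs = lead (mul A) f xs + self.brr f xs"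
proof -
  assume f: "f \<in> hochschild_cochains A n" and xs: "set xs \<subseteq> carrier A"
  have "lead (mul A) f xs + self.brr f xs = 0" if l: "length xs \<noteq> Suc n"
  proof -
    have z: "f ys = 0" if "length xs = Suc (length ys)" for ys
      using f that l by (auto simp: hochschild_cochains_iff)
    have "lead (mul A) f xs = 0" using xs z by (cases xs) auto
    moreover have "self.brr f xs = self.brr (\<lambda>_. 0) xs"
      by (rule self.bar_cong) (use z xs in auto)
    ultimately show ?thesis using self.bar_zero[OF xs] by simp
  qed
  then show ?thesis using xs by (auto simp: hochschild_diff_eq)
qed

lemma hochschild_diff_closed:
  assumes "f \<in> hochschild_cochains A n"
  shows "hochschild_diff A n f \<in> hochschild_cochains A (Suc n)"
  using assms unfolding hochschild_diff_eq hochschild_cochains_iff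
  by (intro conjI self.multilinear_truncate self.multilinear_plus multilinear_lead self.multilinear_bar) auto

lemma hochschild_diff_diff:
  assumes "f \<in> hochschild_cochains A n"
  shows "hochschild_diff A (Suc n) (hochschild_diff A n f) = 0"
proof (rule ext)
  fix xs
  note mem [simp] = hochschild_cochains_mem[OF assms]
  note df = hochschild_diff_closed[OF assms]
  let ?g = "\<lambda>zs. lead (mul A) f zs + self.brr f zs"
  show "hochschild_diff A (Suc n) (hochschild_diff A n f) xs = 0 xs"
  proof (cases "set xs \<subseteq> carrier A")
    case True
    have "self.brr (hochschild_diff A n f) xs = self.brr ?g xs"
      using hochschild_diff_apply[OF assms] True by (intro self.bar_cong) auto
    moreover have "lead (mul A) (hochschild_diff A n f) xs = lead (mul A) ?g xs"
      using hochschild_diff_apply[OF assms] True by (cases xs) auto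
    ultimately show ?thesis
      using hochschild_diff_apply[OF df True] True
        self.lead_bar_lead_bar[of f "mul A" xs] by (simp add: mul_assoc mul_add_right)
  next
    case False
    then show ?thesis by (auto simp add: hochschild_diff_eq[of "Suc n"])
  qed
qed

lemma hochschild_diff_linear:
  "linear_on (\<lambda>c f xs. scal A c (f xs)) (\<lambda>c f xs. scal A c (f xs)) (hochschild_cochains A n) (hochschild_diff A n)"
  unfolding linear_on_def
proof (intro conjI ballI allI ext)
  fix f g xs assume f: "f \<in> hochschild_cochains A n" and g: "g \<in> hochschild_cochains A n"
  note [simp] = hochschild_cochains_mem[OF f] hochschild_cochains_mem[OF g]
  show "hochschild_diff A n (f + g) xs = (hochschild_diff A n f + hochschild_diff A n g) xs"
    unfolding hochschild_diff_eq
    using self.bar_add[of f g xs] by (cases xs) (auto simp: mul_add_right plus_fun_def)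
next
  fix c f xs assume f: "f \<in> hochschild_cochains A n"
  note [simp] = hochschild_cochains_mem[OF f]
  show "hochschild_diff A n (\<lambda>xs. scal A c (f xs)) xs = scal A c (hochschild_diff A n f xs)"
    unfolding hochschild_diff_eq
    using self.bar_scal[of f xs c] by (cases xs) (auto simp: mul_scal_right scale_right_distrib)
qed

lemma hochschild_cochains_subspace:
  "module.subspace (\<lambda>c f xs. scal A c (f xs)) (hochschild_cochains A n)"
proof -
  interpret F: vector_space "\<lambda>c (f :: 'a list \<Rightarrow> 'a) xs. scal A c (f xs)"
    by (rule vector_space_fun[OF vector_space_scal])
  show ?thesis
    by (rule F.subspaceI)
      (auto simp: hochschild_cochains_iff zero_fun_def plus_fun_def
        intro: self.multilinear_zero_map self.multilinear_plus self.multilinear_scaled)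
qed

lemma hochschild_cochains_findim:
  assumes "fin_dim A"
  shows "findim (\<lambda>c f xs. scal A c (f xs)) (hochschild_cochains A n)"
proof -
  obtain S where S: "finite S" "span S = carrier A" using assms by (auto simp: fin_dim_def)
  have SA: "S \<subseteq> carrier A" using S span_superset by blast
  let ?Y = "{xs. set xs \<subseteq> S \<and> length xs = n}"
  show ?thesis
  proof (rule findim_by_values[OF vector_space_fun[OF vector_space_scal] vector_space_scal
        hochschild_cochains_subspace findim_carrier[OF assms], where Y = ?Y and ev = "\<lambda>f xs. f xs"])
    show "finite ?Y" using S(1) by (rule finite_lists_length_eq)
    show "linear_on (\<lambda>c f xs. scal A c (f xs)) (scal A) (hochschild_cochains A n) (\<lambda>f. f y)" for y
      by (simp add: linear_on_def)
    show "f y \<in> carrier A" if "f \<in> hochschild_cochains A n" for f y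
      using that by (rule hochschild_cochains_mem)
    fix f assume f: "f \<in> hochschild_cochains A n" and 0: "\<And>y. y \<in> ?Y \<Longrightarrow> f y = 0"
    have m: "multilinear A A f" using f by (simp add: hochschild_cochains_iff)
    have "f xs = 0" if "set xs \<subseteq> S" for xs
      using that 0 f by (cases "length xs = n") (auto simp: hochschild_cochains_iff)
    then have "f xs = 0" if "set xs \<subseteq> carrier A" for xs
      using self.multilinear_eq_0[OF m S(2) _ that] by blast
    then show "f = 0" using f by (fastforce simp: hochschild_cochains_iff fun_eq_iff)
  qed
qed

lemma hochschild_complex:
  assumes "fin_dim A"
  shows "cochain_complex (\<lambda>c f xs. scal A c (f xs)) (hochschild_cochains A) (hochschild_diff A)"
  using vector_space_fun[OF vector_space_scal] hochschild_cochains_findim[OF assms]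
    hochschild_diff_linear hochschild_diff_closed hochschild_diff_diff
  by (intro cochain_complex.intro)

end

section \<open>Contraction onto the Peirce components\<close>

text \<open>
  Unfolded, \<open>peirce_homotopy\<close> is the alternating sum over chains of idempotents
  \<open>e\<^sub>0, \<dots>, e\<^sub>p\<close> of \<open>f (e\<^sub>0 x\<^sub>1 e\<^sub>1, \<dots>, e\<^sub>p\<^sub>-\<^sub>1 x\<^sub>p e\<^sub>p, e\<^sub>p, x\<^sub>p\<^sub>+\<^sub>1, \<dots>)\<close>, and
  \<open>peirce_part\<close> is the sum of \<open>f (e\<^sub>0 x\<^sub>1 e\<^sub>1, \<dots>, e\<^sub>n\<^sub>-\<^sub>1 x\<^sub>n e\<^sub>n) e\<^sub>n\<close>.
\<close>

fun peirce_homotopy :: "('a \<Rightarrow> 'a \<Rightarrow> 'a) \<Rightarrow> ('i::finite \<Rightarrow> 'a) \<Rightarrow> ('a list \<Rightarrow> 'a::ab_group_add) \<Rightarrow> 'i \<Rightarrow> 'a list \<Rightarrow> 'a" where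
  "peirce_homotopy \<mu> e f i [] = f [e i]"
| "peirce_homotopy \<mu> e f i (x # xs) =
    f (e i # x # xs) - (\<Sum>j\<in>UNIV. peirce_homotopy \<mu> e (\<lambda>zs. f (\<mu> (\<mu> (e i) x) (e j) # zs)) j xs)"

fun peirce_part :: "('a \<Rightarrow> 'a \<Rightarrow> 'a) \<Rightarrow> ('i::finite \<Rightarrow> 'a) \<Rightarrow> ('a list \<Rightarrow> 'a::ab_group_add) \<Rightarrow> 'i \<Rightarrow> 'a list \<Rightarrow> 'a" where
  "peirce_part \<mu> e f i [] = \<mu> (f []) (e i)"
| "peirce_part \<mu> e f i (x # xs) =
    (\<Sum>j\<in>UNIV. peirce_part \<mu> e (\<lambda>zs. f (\<mu> (\<mu> (e i) x) (e j) # zs)) j xs)"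

locale algebra_with_idempotents = hochschild_algebra A
  for A :: "('k::field, 'a::ab_group_add) alg" +
  fixes e :: "'i::finite \<Rightarrow> 'a"
  assumes idem_mem [simp]: "e i \<in> carrier A"
    and idem_mul [simp]: "mul A (e i) (e i) = e i"
    and idem_sum: "(\<Sum>i\<in>UNIV. e i) = idt A"
begin

abbreviation "ph \<equiv> peirce_homotopy (mul A) e"
abbreviation "pp \<equiv> peirce_part (mul A) e"

lemma sum_idem_left: "x \<in> carrier A \<Longrightarrow> (\<Sum>i\<in>UNIV. mul A (e i) x) = x"
  using mul_sum_left[of x UNIV e] idem_sum mul_idt_left[of x] by simp

lemma sum_idem_right: "x \<in> carrier A \<Longrightarrow> (\<Sum>i\<in>UNIV. mul A x (e i)) = x"
  using mul_sum_right[of x UNIV e] idem_sum mul_idt_right[of x] by simp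

section \<open>Linearity of the homotopy and its commutation with the faces\<close>

lemma peirce_homotopy_cong:
  assumes "\<And>ys. length ys = Suc (length xs) \<Longrightarrow> set ys \<subseteq> carrier A \<Longrightarrow> f ys = g ys" "set xs \<subseteq> carrier A"
  shows "ph f i xs = ph g i xs"
  using assms
proof (induction xs arbitrary: f g i)
  case (Cons x xs)
  have "ph (\<lambda>zs. f (mul A (mul A (e i) x) (e j) # zs)) j xs = ph (\<lambda>zs. g (mul A (mul A (e i) x) (e j) # zs)) j xs" for j
    by (rule Cons.IH) (use Cons.prems in auto)
  moreover have "f (e i # x # xs) = g (e i # x # xs)" by (rule Cons.prems(1)) (use Cons.prems(2) in auto)
  ultimately show ?case by simp
qed simp

lemma peirce_homotopy_add: "ph (\<lambda>zs. f zs + g zs) i xs = ph f i xs + ph g i xs"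
proof (induction xs arbitrary: f g i)
  case (Cons x xs)
  show ?case by (simp add: Cons sum.distrib)
qed simp

lemma peirce_homotopy_minus: "ph (\<lambda>zs. - f zs) i xs = - ph f i xs"
  by (induction xs arbitrary: f i) (simp_all add: sum_negf)

lemma peirce_homotopy_sum: "finite I \<Longrightarrow> ph (\<lambda>zs. \<Sum>k\<in>I. f k zs) i xs = (\<Sum>k\<in>I. ph (f k) i xs)"
proof (induction I rule: finite_induct)
  case empty
  show ?case by (induction xs arbitrary: i) simp_all
qed (simp add: peirce_homotopy_add)

lemma peirce_homotopy_scal: "ph (\<lambda>zs. scal A c (f zs)) i xs = scal A c (ph f i xs)"
proof (induction xs arbitrary: f i)
  case (Cons x xs)
  show ?case by (simp add: Cons scale_sum_right scale_right_diff_distrib)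
qed simp

lemma peirce_homotopy_mem:
  assumes "\<And>ys. set ys \<subseteq> carrier A \<Longrightarrow> f ys \<in> carrier A" "set xs \<subseteq> carrier A"
  shows "ph f i xs \<in> carrier A"
  using assms
proof (induction xs arbitrary: f i)
  case (Cons x xs)
  have "(\<Sum>j\<in>UNIV. ph (\<lambda>zs. f (mul A (mul A (e i) x) (e j) # zs)) j xs) \<in> carrier A"
    by (rule sum_mem) (use Cons in auto)
  then show ?case using Cons.prems by auto
qed simp

lemma multilinear_peirce_homotopy:
  assumes "multilinear A A f"
  shows "multilinear A A (ph f i)"
proof (rule multilinearI)
  show "ph f i xs \<in> carrier A" if "set xs \<subseteq> carrier A" for xs
    using peirce_homotopy_mem multilinear_mem[OF assms] that by blast
next
  fix xs ys x y
  assume "set xs \<subseteq> carrier A" "set ys \<subseteq> carrier A" and xy: "x \<in> carrier A" "y \<in> carrier A"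
  then show "ph f i (xs @ (x + y) # ys) = ph f i (xs @ x # ys) + ph f i (xs @ y # ys)"
    using assms
  proof (induction xs arbitrary: f i)
    case Nil
    let ?z = "\<lambda>x j. mul A (mul A (e i) x) (e j)"
    have "ph (\<lambda>zs. f (?z (x + y) j # zs)) j ys = ph (\<lambda>zs. f (?z x j # zs)) j ys + ph (\<lambda>zs. f (?z y j # zs)) j ys" for j
    proof -
      have "?z (x + y) j = ?z x j + ?z y j" using xy by (simp add: mul_add_left mul_add_right)
      then have "ph (\<lambda>zs. f (?z (x + y) j # zs)) j ys = ph (\<lambda>zs. f (?z x j # zs) + f (?z y j # zs)) j ys"
        using multilinear_Cons_add[OF Nil(5)] xy Nil(2) by (intro peirce_homotopy_cong) auto
      then show ?thesis by (simp add: peirce_homotopy_add)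
    qed
    then show ?case
      using multilinear_add[OF Nil(5), of "[e i]" ys x y] xy Nil(2) by (simp add: sum.distrib)
  next
    case (Cons a xs)
    then have "ph (\<lambda>zs. f (mul A (mul A (e i) a) (e j) # zs)) j (xs @ (x + y) # ys) =
      ph (\<lambda>zs. f (mul A (mul A (e i) a) (e j) # zs)) j (xs @ x # ys) +
      ph (\<lambda>zs. f (mul A (mul A (e i) a) (e j) # zs)) j (xs @ y # ys)" for j
      by (intro Cons.IH multilinear_Cons) auto
    then show ?case
      using multilinear_add[OF Cons.prems(5), of "e i # a # xs" ys x y] Cons.prems by (simp add: sum.distrib)
  qed
next
  fix xs ys x c
  assume "set xs \<subseteq> carrier A" "set ys \<subseteq> carrier A" and xy: "x \<in> carrier A"
  then show "ph f i (xs @ scal A c x # ys) = scal A c (ph f i (xs @ x # ys))"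
    using assms
  proof (induction xs arbitrary: f i)
    case Nil
    let ?z = "\<lambda>x j. mul A (mul A (e i) x) (e j)"
    have "ph (\<lambda>zs. f (?z (scal A c x) j # zs)) j ys = scal A c (ph (\<lambda>zs. f (?z x j # zs)) j ys)" for j
    proof -
      have "?z (scal A c x) j = scal A c (?z x j)" using xy by (simp add: mul_scal_left mul_scal_right)
      then have "ph (\<lambda>zs. f (?z (scal A c x) j # zs)) j ys = ph (\<lambda>zs. scal A c (f (?z x j # zs))) j ys"
        using multilinear_Cons_scal[OF Nil(4)] xy Nil(2) by (intro peirce_homotopy_cong) auto
      then show ?thesis by (simp add: peirce_homotopy_scal)
    qed
    then show ?case
      using multilinear_scal[OF Nil(4), of "[e i]" ys x c] xy Nil(2)
      by (simp add: scale_sum_right scale_right_diff_distrib)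
  next
    case (Cons a xs)
    then have "ph (\<lambda>zs. f (mul A (mul A (e i) a) (e j) # zs)) j (xs @ scal A c x # ys) =
      scal A c (ph (\<lambda>zs. f (mul A (mul A (e i) a) (e j) # zs)) j (xs @ x # ys))" for j
      by (intro Cons.IH multilinear_Cons) auto
    then show ?case
      using multilinear_scal[OF Cons.prems(4), of "e i # a # xs" ys x c] Cons.prems
      by (simp add: scale_sum_right scale_right_diff_distrib)
  qed
qed

text \<open>The homotopy formula for all faces except the first, by induction with \<open>f\<close>
  and the corner \<open>i\<close> general. Inner faces cancel because inserting the unit, as the sum
  of the \<open>e j\<close>, between two merged entries turns a sum over chains into the chain of
  their product. What survives is the last face after a full chain, which is
  \<open>pp\<close>.\<close>

lemma peirce_homotopy_bar:
  assumes "multilinear A A f" "set xs \<subseteq> carrier A"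
  shows "ph (self.brr f) i xs + self.brr (ph f i) xs = - pp f i xs"
  using assms
proof (induction xs arbitrary: f i)
  case Nil
  then show ?case by simp
next
  case (Cons x xs)
  note f = Cons.prems(1)
  note [simp] = multilinear_mem[OF f]
  let ?z = "\<lambda>j. mul A (mul A (e i) x) (e j)"
  let ?F = "\<lambda>j zs. f (?z j # zs)"
  have x: "x \<in> carrier A" "set xs \<subseteq> carrier A" using Cons.prems by auto
  have ex: "mul A (e i) x \<in> carrier A" using x by simp
  have zm: "?z j \<in> carrier A" for j using x by simp
  have ze: "mul A (?z j) (e j) = ?z j" for j using x by (simp add: mul_assoc)
  have sz: "f (mul A (e i) x # zs) = (\<Sum>j\<in>UNIV. f (?z j # zs))" if "set zs \<subseteq> carrier A" for zs
    using self.multilinear_Cons_sum[OF f that, of UNIV ?z] zm sum_idem_right[OF ex] by simp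
  have F: "multilinear A A (?F j)" for j using multilinear_Cons[OF f zm] .
  have IH: "ph (self.brr (?F j)) j xs + self.brr (ph (?F j) j) xs = - pp (?F j) j xs" for j
    by (rule Cons.IH[OF F x(2)])
  show ?case
  proof (cases xs)
    case Nil
    have "ph (\<lambda>zs. self.brr f (?z j # zs)) j [] = - f [?z j] + mul A (f [?z j]) (e j)" for j
      by (simp add: ze)
    then show ?thesis
      using x Nil sz[of "[]"] by (simp add: ze sum.distrib sum_negf sum_subtractf)
  next
    case xs: (Cons y ys)
    then have y: "y \<in> carrier A" "set ys \<subseteq> carrier A" using x by auto
    let ?M = "\<lambda>j zs. f (mul A (?z j) (hd zs) # tl zs)"
    let ?w = "\<lambda>k. mul A (mul A (e i) (mul A x y)) (e k)"
    have A1: "ph (\<lambda>zs. self.brr f (?z j # zs)) j xs = - ph (?M j) j xs - ph (self.brr (?F j)) j xs" for j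
    proof -
      have "ph (\<lambda>zs. self.brr f (?z j # zs)) j xs = ph (\<lambda>zs. - (?M j zs + self.brr (?F j) zs)) j xs"
        by (rule peirce_homotopy_cong) (use x in \<open>auto simp: length_Suc_conv\<close>)
      also have "\<dots> = - (ph (?M j) j xs + ph (self.brr (?F j)) j xs)"
        unfolding peirce_homotopy_minus peirce_homotopy_add ..
      finally show ?thesis by simp
    qed
    have A2: "ph (?M j) j xs = f (?z j # xs)
      - (\<Sum>k\<in>UNIV. ph (\<lambda>zs. f (mul A (?z j) (mul A (mul A (e j) y) (e k)) # zs)) k ys)" for j
      by (simp add: xs ze)
    \<comment> \<open>Summation over the middle idempotent gives the chain of the product
      \<open>x y\<close>: the repeated \<open>e j\<close> collapses to one, and the
      \<open>e j\<close> add up to the unit.\<close>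
    have A3: "(\<Sum>j\<in>UNIV. ph (\<lambda>zs. f (mul A (?z j) (mul A (mul A (e j) y) (e k)) # zs)) k ys)
      = ph (\<lambda>zs. f (?w k # zs)) k ys" for k
    proof -
      have m: "mul A (?z j) (mul A (mul A (e j) y) (e k)) \<in> carrier A" for j using x y by simp
      have "mul A (?z j) (mul A (mul A (e j) y) (e k)) = mul A (?z j) (mul A y (e k))" for j
        using x y ze[of j] zm[of j] mul_assoc[of "?z j" "e j" "mul A y (e k)"] by (simp add: mul_assoc)
      then have "(\<Sum>j\<in>UNIV. mul A (?z j) (mul A (mul A (e j) y) (e k))) = (\<Sum>j\<in>UNIV. mul A (?z j) (mul A y (e k)))"
        by simp
      also have "\<dots> = mul A (\<Sum>j\<in>UNIV. ?z j) (mul A y (e k))"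
        using y by (intro mul_sum_left[symmetric]) (auto simp: zm)
      also have "\<dots> = ?w k" unfolding sum_idem_right[OF ex] using x y by (simp add: mul_assoc)
      finally have w: "(\<Sum>j\<in>UNIV. mul A (?z j) (mul A (mul A (e j) y) (e k))) = ?w k" .
      have "ph (\<lambda>zs. f (?w k # zs)) k ys = ph (\<lambda>zs. \<Sum>j\<in>UNIV. f (mul A (?z j) (mul A (mul A (e j) y) (e k)) # zs)) k ys"
      proof (rule peirce_homotopy_cong)
        fix zs assume "set zs \<subseteq> carrier A"
        then show "f (?w k # zs) = (\<Sum>j\<in>UNIV. f (mul A (?z j) (mul A (mul A (e j) y) (e k)) # zs))"
          using self.multilinear_Cons_sum[OF f, of zs UNIV "\<lambda>j. mul A (?z j) (mul A (mul A (e j) y) (e k))"] m w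
          by simp
      qed (rule y(2))
      then show ?thesis by (simp add: peirce_homotopy_sum)
    qed
    have A4: "(\<Sum>j\<in>UNIV. ph (?M j) j xs) = f (mul A (e i) x # xs) - (\<Sum>k\<in>UNIV. ph (\<lambda>zs. f (?w k # zs)) k ys)"
    proof -
      have "(\<Sum>j\<in>UNIV. ph (?M j) j xs) = (\<Sum>j\<in>UNIV. f (?z j # xs))
        - (\<Sum>j\<in>UNIV. \<Sum>k\<in>UNIV. ph (\<lambda>zs. f (mul A (?z j) (mul A (mul A (e j) y) (e k)) # zs)) k ys)"
        unfolding A2 by (rule sum_subtractf)
      also have "(\<Sum>j\<in>UNIV. \<Sum>k\<in>UNIV. ph (\<lambda>zs. f (mul A (?z j) (mul A (mul A (e j) y) (e k)) # zs)) k ys)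
        = (\<Sum>k\<in>UNIV. ph (\<lambda>zs. f (?w k # zs)) k ys)"
        by (subst sum.swap) (simp only: A3)
      finally show ?thesis using sz[OF x(2)] by simp
    qed
    have A5: "ph f i (mul A x y # ys) = f (e i # mul A x y # ys) - (\<Sum>k\<in>UNIV. ph (\<lambda>zs. f (?w k # zs)) k ys)"
      by simp
    have A6: "self.brr (\<lambda>zs. ph f i (x # zs)) xs = self.brr (\<lambda>zs. f (e i # x # zs)) xs - (\<Sum>j\<in>UNIV. self.brr (ph (?F j) j) xs)"
    proof -
      have hm: "ph (?F j) j zs \<in> carrier A" if "set zs \<subseteq> carrier A" for j zs
        using multilinear_mem[OF multilinear_peirce_homotopy[OF F] that] .
      have "self.brr (\<lambda>zs. ph f i (x # zs)) xs = self.brr (\<lambda>zs. f (e i # x # zs)) xs - self.brr (\<lambda>zs. \<Sum>j\<in>UNIV. ph (?F j) j zs) xs"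
        unfolding peirce_homotopy.simps using x hm by (intro self.bar_diff) (auto simp: sum_mem)
      also have "self.brr (\<lambda>zs. \<Sum>j\<in>UNIV. ph (?F j) j zs) xs = (\<Sum>j\<in>UNIV. self.brr (ph (?F j) j) xs)"
        using x hm by (intro self.bar_sum) auto
      finally show ?thesis .
    qed
    have T1: "ph (self.brr f) i (x # xs) = - f (mul A (e i) x # xs) + f (e i # mul A x y # ys)
        + self.brr (\<lambda>zs. f (e i # x # zs)) xs
        + (\<Sum>j\<in>UNIV. ph (?M j) j xs) + (\<Sum>j\<in>UNIV. ph (self.brr (?F j)) j xs)"
      unfolding peirce_homotopy.simps A1 by (simp add: xs sum_subtractf sum_negf)
    have T2: "self.brr (ph f i) (x # xs) = - ph f i (mul A x y # ys) - self.brr (\<lambda>zs. ph f i (x # zs)) xs"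
      by (simp add: xs)
    have "ph (self.brr f) i (x # xs) + self.brr (ph f i) (x # xs)
       = (\<Sum>j\<in>UNIV. ph (self.brr (?F j)) j xs) + (\<Sum>j\<in>UNIV. self.brr (ph (?F j) j) xs)"
      unfolding T1 T2 A4 A5 A6 by simp
    also have "\<dots> = (\<Sum>j\<in>UNIV. - pp (?F j) j xs)"
      unfolding sum.distrib[symmetric] IH ..
    finally show ?thesis by (simp add: sum_negf)
  qed
qed

text \<open>The outer factor \<open>e i\<close> is there for the first face: summed over
  \<open>i\<close>, it turns that face into the identity minus a left multiplication on the shorter
  list.\<close>

definition contraction :: "nat \<Rightarrow> ('a list \<Rightarrow> 'a) \<Rightarrow> 'a list \<Rightarrow> 'a" where
  "contraction n f = (\<lambda>xs. if length xs = n \<and> set xs \<subseteq> carrier A then \<Sum>i\<in>UNIV. mul A (e i) (ph f i xs) else 0)"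

definition projection :: "nat \<Rightarrow> ('a list \<Rightarrow> 'a) \<Rightarrow> 'a list \<Rightarrow> 'a" where
  "projection n f = (\<lambda>xs. if length xs = n \<and> set xs \<subseteq> carrier A then \<Sum>i\<in>UNIV. mul A (e i) (pp f i xs) else 0)"

lemma multilinear_mul_left:
  assumes "a \<in> carrier A" "multilinear A A f"
  shows "multilinear A A (\<lambda>xs. mul A a (f xs))"
proof (rule multilinearI, goal_cases)
  case (1 xs)
  then show ?case using multilinear_mem[OF assms(2)] assms(1) by simp
next
  case (2 xs ys x y)
  then show ?case using multilinear_add[OF assms(2), of xs ys x y] multilinear_mem[OF assms(2)] assms(1)
    by (simp add: mul_add_right)
next
  case (3 xs ys x c)
  then show ?case using multilinear_scal[OF assms(2), of xs ys x c] multilinear_mem[OF assms(2)] assms(1)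
    by (simp add: mul_scal_right)
qed

lemma multilinear_sum:
  assumes "finite I" "\<And>i. i \<in> I \<Longrightarrow> multilinear A A (f i)"
  shows "multilinear A A (\<lambda>xs. \<Sum>i\<in>I. f i xs)"
  using assms
proof (induction I rule: finite_induct)
  case empty
  show ?case using self.multilinear_zero_map by simp
next
  case (insert i I)
  then show ?case using self.multilinear_plus[of "f i" "\<lambda>xs. \<Sum>i\<in>I. f i xs"] by simp
qed

lemma contraction_closed:
  assumes "f \<in> hochschild_cochains A (Suc n)"
  shows "contraction n f \<in> hochschild_cochains A n"
  using assms unfolding contraction_def hochschild_cochains_iff
  by (intro conjI self.multilinear_truncate multilinear_sum multilinear_mul_left multilinear_peirce_homotopy) auto

lemma contraction_apply:
  assumes "f \<in> hochschild_cochains A (Suc n)" "set xs \<subseteq> carrier A"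
  shows "contraction n f xs = (\<Sum>i\<in>UNIV. mul A (e i) (ph f i xs))"
proof -
  have "ph f i xs = 0" if "length xs \<noteq> n" for i
  proof -
    have "ph f i xs = ph (\<lambda>_. 0) i xs"
      by (rule peirce_homotopy_cong) (use assms that in \<open>auto simp: hochschild_cochains_iff\<close>)
    also have "\<dots> = 0" using peirce_homotopy_scal[of 0 "\<lambda>_. 0" i xs] by simp
    finally show ?thesis .
  qed
  then show ?thesis using assms(2) by (auto simp: contraction_def)
qed

text \<open>By \<open>peirce_homotopy_bar\<close> the faces other than the first contribute minus
  the projection. The first face contributes \<open>f\<close> and a term that cancels the first face
  of the differential of the contraction. In degree 0 there is nothing below to contract to.\<close>

lemma contraction_diff:
  assumes f: "f \<in> hochschild_cochains A n" and xs: "set xs \<subseteq> carrier A" "length xs = n"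
  shows "contraction n (hochschild_diff A n f) xs +
    (if n = 0 then 0 else hochschild_diff A (n - 1) (contraction (n - 1) f) xs) = f xs - projection n f xs"
proof -
  have ml: "multilinear A A f" using f by (simp add: hochschild_cochains_iff)
  note [simp] = hochschild_cochains_mem[OF f]
  have df: "hochschild_diff A n f \<in> hochschild_cochains A (Suc n)" by (rule hochschild_diff_closed[OF f])
  have bm: "self.brr g ys \<in> carrier A" if "multilinear A A g" "set ys \<subseteq> carrier A" for g ys
    using multilinear_mem[OF self.multilinear_bar[OF that(1)] that(2)] .
  have hm: "ph g i ys \<in> carrier A" if "multilinear A A g" "set ys \<subseteq> carrier A" for g ys i
    using multilinear_mem[OF multilinear_peirce_homotopy[OF that(1)] that(2)] .
  have ppm: "pp f i xs \<in> carrier A" for i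
    using peirce_homotopy_bar[OF ml xs(1), of i] hm[OF self.multilinear_bar[OF ml] xs(1), of i]
      bm[OF multilinear_peirce_homotopy[OF ml] xs(1), of i] by (metis add_mem minus_minus uminus_mem)
  have lead: "lead (mul A) f ys \<in> carrier A" if "set ys \<subseteq> carrier A" for ys
    using that by (cases ys) auto
  have 1: "ph (hochschild_diff A n f) i xs = ph (lead (mul A) f) i xs + ph (self.brr f) i xs" for i
    unfolding peirce_homotopy_add[symmetric]
    by (rule peirce_homotopy_cong) (use hochschild_diff_apply[OF f] xs in auto)
  have "contraction n (hochschild_diff A n f) xs = (\<Sum>i\<in>UNIV. mul A (e i) (ph (lead (mul A) f) i xs + ph (self.brr f) i xs))"
    unfolding contraction_apply[OF df xs(1)] 1 ..
  also have "\<dots> = (\<Sum>i\<in>UNIV. mul A (e i) (ph (lead (mul A) f) i xs)) + (\<Sum>i\<in>UNIV. mul A (e i) (ph (self.brr f) i xs))"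
    unfolding sum.distrib[symmetric]
    using hm[OF multilinear_lead[OF ml] xs(1)] hm[OF self.multilinear_bar[OF ml] xs(1)]
    by (intro sum.cong) (auto simp: mul_add_right)
  finally have c: "contraction n (hochschild_diff A n f) xs =
    (\<Sum>i\<in>UNIV. mul A (e i) (ph (lead (mul A) f) i xs)) + (\<Sum>i\<in>UNIV. mul A (e i) (ph (self.brr f) i xs))" .
  have p: "projection n f xs = (\<Sum>i\<in>UNIV. mul A (e i) (pp f i xs))"
    using xs by (simp add: projection_def)
  show ?thesis
  proof (cases xs)
    case Nil
    then have "n = 0" using xs by simp
    moreover have "(\<Sum>i\<in>UNIV. mul A (e i) (mul A (e i) (f []))) = f []"
      using sum_idem_left[of "f []"] by (simp add: mul_assoc[symmetric])
    moreover have "(\<Sum>i\<in>UNIV. mul A (e i) (- mul A (f []) (e i))) = - (\<Sum>i\<in>UNIV. mul A (e i) (mul A (f []) (e i)))"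
      unfolding sum_negf[symmetric] by (intro sum.cong) (auto simp: mul_minus_right)
    ultimately show ?thesis unfolding c p using Nil by simp
  next
    case (Cons x ys)
    then obtain m where m: "n = Suc m" using xs by (cases n) auto
    have x: "x \<in> carrier A" "set ys \<subseteq> carrier A" using Cons xs by auto
    have cf: "contraction m f \<in> hochschild_cochains A m" using contraction_closed f m by simp
    have sub: "contraction m f zs = (\<Sum>i\<in>UNIV. mul A (e i) (ph f i zs))" if "set zs \<subseteq> carrier A" for zs
      using contraction_apply[of f m zs] f m that by simp
    have 2: "hochschild_diff A m (contraction m f) xs
       = mul A x (contraction m f ys) + self.brr (contraction m f) xs"
      using hochschild_diff_apply[OF cf, of xs] xs by (simp add: Cons)
    have "self.brr (contraction m f) xs = self.brr (\<lambda>zs. \<Sum>i\<in>UNIV. mul A (e i) (ph f i zs)) xs"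
      by (rule self.bar_cong) (use sub xs in auto)
    also have "\<dots> = (\<Sum>i\<in>UNIV. self.brr (\<lambda>zs. mul A (e i) (ph f i zs)) xs)"
      using hm[OF ml] xs by (intro self.bar_sum) auto
    also have "\<dots> = (\<Sum>i\<in>UNIV. mul A (e i) (self.brr (ph f i) xs))"
      using hm[OF ml] xs by (intro sum.cong self.bar_comm) (auto simp: mul_diff_right mul_assoc)
    finally have 3: "self.brr (contraction m f) xs = (\<Sum>i\<in>UNIV. mul A (e i) (self.brr (ph f i) xs))" .
    have "(\<Sum>i\<in>UNIV. mul A (e i) (ph (self.brr f) i xs)) + (\<Sum>i\<in>UNIV. mul A (e i) (self.brr (ph f i) xs))
      = (\<Sum>i\<in>UNIV. mul A (e i) (ph (self.brr f) i xs + self.brr (ph f i) xs))"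
      unfolding sum.distrib[symmetric]
      using hm[OF self.multilinear_bar[OF ml] xs(1)] bm[OF multilinear_peirce_homotopy[OF ml] xs(1)]
      by (intro sum.cong) (auto simp: mul_add_right)
    also have "\<dots> = - projection n f xs"
      unfolding p peirce_homotopy_bar[OF ml xs(1)] sum_negf[symmetric]
      using ppm by (intro sum.cong) (auto simp: mul_minus_right)
    finally have 4: "(\<Sum>i\<in>UNIV. mul A (e i) (ph (self.brr f) i xs)) + (\<Sum>i\<in>UNIV. mul A (e i) (self.brr (ph f i) xs))
      = - projection n f xs" .
    let ?z = "\<lambda>i j. mul A (mul A (e i) x) (e j)"
    have hfm: "ph f j ys \<in> carrier A" for j using hm[OF ml x(2)] .
    \<comment> \<open>The leading entry seen by the first face is \<open>e i\<close> in the first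
      term of the homotopy and \<open>e i x e j\<close> in the others.\<close>
    have 5: "ph (lead (mul A) f) i xs = mul A (e i) (f xs) - (\<Sum>j\<in>UNIV. mul A (?z i j) (ph f j ys))" for i
    proof -
      have hmul: "ph (\<lambda>zs. mul A a (g zs)) j zs = mul A a (ph g j zs)"
        if "a \<in> carrier A" "multilinear A A g" "set zs \<subseteq> carrier A" for a g j zs
        using that
      proof (induction zs arbitrary: g j)
        case (Cons w ws)
        have gm: "multilinear A A (\<lambda>zs. g (mul A (mul A (e j) w) (e k) # zs))" for k
          by (rule multilinear_Cons) (use Cons.prems in auto)
        have h: "ph (\<lambda>zs. g (mul A (mul A (e j) w) (e k) # zs)) k ws \<in> carrier A" for k
          using hm[OF gm] Cons.prems by simp
        have "ph (\<lambda>zs. mul A a (g (mul A (mul A (e j) w) (e k) # zs))) k ws =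
            mul A a (ph (\<lambda>zs. g (mul A (mul A (e j) w) (e k) # zs)) k ws)" for k
          using Cons.IH[OF Cons.prems(1) gm] Cons.prems(3) by simp
        moreover have "g (e j # w # ws) \<in> carrier A" using multilinear_mem[OF Cons.prems(2)] Cons.prems by simp
        ultimately show ?case using Cons.prems h by (simp add: mul_diff_right mul_sum_right sum_mem)
      qed simp
      show ?thesis using Cons x hmul[OF _ ml x(2)] by simp
    qed
    have "(\<Sum>i\<in>UNIV. mul A (e i) (ph (lead (mul A) f) i xs)) =
      (\<Sum>i\<in>UNIV. mul A (e i) (f xs) - (\<Sum>j\<in>UNIV. mul A (e i) (mul A x (mul A (e j) (ph f j ys)))))"
    proof (rule sum.cong[OF refl])
      fix i
      have "mul A (e i) (\<Sum>j\<in>UNIV. mul A (?z i j) (ph f j ys)) = (\<Sum>j\<in>UNIV. mul A (e i) (mul A (?z i j) (ph f j ys)))"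
        using x hfm by (intro mul_sum_right) auto
      also have "\<dots> = (\<Sum>j\<in>UNIV. mul A (e i) (mul A x (mul A (e j) (ph f j ys))))"
        using x hfm by (intro sum.cong) (simp_all add: mul_assoc[symmetric])
      finally show "mul A (e i) (ph (lead (mul A) f) i xs)
        = mul A (e i) (f xs) - (\<Sum>j\<in>UNIV. mul A (e i) (mul A x (mul A (e j) (ph f j ys))))"
        unfolding 5 using x hfm by (simp add: mul_diff_right sum_mem mul_assoc[symmetric])
    qed
    also have "\<dots> = f xs - (\<Sum>i\<in>UNIV. \<Sum>j\<in>UNIV. mul A (e i) (mul A x (mul A (e j) (ph f j ys))))"
      by (simp add: sum_subtractf sum_idem_left)
    also have "(\<Sum>i\<in>UNIV. \<Sum>j\<in>UNIV. mul A (e i) (mul A x (mul A (e j) (ph f j ys))))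
      = (\<Sum>j\<in>UNIV. mul A x (mul A (e j) (ph f j ys)))"
      using x hfm by (subst sum.swap) (simp add: sum_idem_left)
    also have "\<dots> = mul A x (contraction m f ys)"
      unfolding sub[OF x(2)] using x hfm by (intro mul_sum_right[symmetric]) auto
    finally have 6: "(\<Sum>i\<in>UNIV. mul A (e i) (ph (lead (mul A) f) i xs)) = f xs - mul A x (contraction m f ys)" .
    show ?thesis unfolding c 6 using 2 3 4 m by simp
  qed
qed

lemma projection_eq:
  assumes f: "f \<in> hochschild_cochains A n"
  shows "projection n f = f - contraction n (hochschild_diff A n f)
    - (if n = 0 then 0 else hochschild_diff A (n - 1) (contraction (n - 1) f))"
proof (rule ext)
  fix xs
  show "projection n f xs = (f - contraction n (hochschild_diff A n f)
    - (if n = 0 then 0 else hochschild_diff A (n - 1) (contraction (n - 1) f))) xs"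
  proof (cases "length xs = n \<and> set xs \<subseteq> carrier A")
    case True
    then show ?thesis using contraction_diff[OF f, of xs] by (auto simp: algebra_simps)
  next
    case False
    then have "f xs = 0" "contraction n (hochschild_diff A n f) xs = 0" "projection n f xs = 0"
      using f by (auto simp: hochschild_cochains_iff contraction_def projection_def)
    moreover have "hochschild_diff A (n - 1) (contraction (n - 1) f) xs = 0" if "n \<noteq> 0"
      using False that by (auto simp: hochschild_diff_def)
    ultimately show ?thesis by simp
  qed
qed

text \<open>A map of the form \<open>1 - h d - d h\<close> commutes with \<open>d\<close>: both
  composites are \<open>d - d h d\<close>.\<close>

lemma projection_diff:
  assumes f: "f \<in> hochschild_cochains A n"
  shows "hochschild_diff A n (projection n f) = projection (Suc n) (hochschild_diff A n f)"
proof -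
  let ?s = "\<lambda>c (f :: 'a list \<Rightarrow> 'a) xs. scal A c (f xs)" and ?d = "hochschild_diff A"
  have vs: "vector_space ?s" by (rule vector_space_fun[OF vector_space_scal])
  interpret F: vector_space ?s by (rule vs)
  note sub = hochschild_cochains_subspace[of n]
  note diff = linear_on_diff[OF vs vs sub hochschild_diff_linear]
  let ?h = "contraction n (?d n f)" and ?r = "if n = 0 then 0 else ?d (n - 1) (contraction (n - 1) f)"
  have df: "?d n f \<in> hochschild_cochains A (Suc n)" by (rule hochschild_diff_closed[OF f])
  have h: "?h \<in> hochschild_cochains A n" by (rule contraction_closed[OF df])
  have r: "?r \<in> hochschild_cochains A n"
    using f F.subspace_0[OF sub] hochschild_diff_closed[OF contraction_closed, of f "n - 1"] by auto
  have z0: "?d n 0 = 0" by (rule linear_on_0[OF vs vs sub hochschild_diff_linear])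
  have r0: "?d n ?r = 0"
    using z0 hochschild_diff_diff[OF contraction_closed, of f "n - 1"] f by auto
  have c0: "contraction (Suc n) 0 = 0"
    using peirce_homotopy_scal[of 0 0] by (auto simp: contraction_def fun_eq_iff zero_fun_def)
  have "?d n (projection n f) = ?d n f - ?d n ?h"
    unfolding projection_eq[OF f] using diff[OF f h] diff[OF F.subspace_diff[OF sub f h] r] r0 by simp
  moreover have "projection (Suc n) (?d n f) = ?d n f - ?d n ?h"
    using projection_eq[OF df] hochschild_diff_diff[OF f] c0 by simp
  ultimately show ?thesis by simp
qed

text \<open>For a cocycle with vanishing projection the homotopy formula reads
  \<open>f = d h f\<close>, and \<open>f = 0\<close> in degree 0.\<close>

lemma coboundary_if_projection_0:
  assumes f: "f \<in> hochschild_cochains A n" "hochschild_diff A n f = 0" "projection n f = 0"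
  shows "f \<in> coboundaries (hochschild_cochains A) (hochschild_diff A) n"
proof -
  have c0: "contraction n 0 = 0"
    using peirce_homotopy_scal[of 0 0] by (auto simp: contraction_def fun_eq_iff zero_fun_def)
  have "f = (if n = 0 then 0 else hochschild_diff A (n - 1) (contraction (n - 1) f))"
    using projection_eq[OF f(1)] f(2,3) c0 by simp
  then show ?thesis
    using contraction_closed[of f "n - 1"] f(1) by (cases n) (auto simp: coboundaries_def)
qed

end

section \<open>Bimodules and triangular algebras\<close>

text \<open>The actions are parameters, so that any bimodule can be inserted; by
  \<open>triangular_algebra_eq\<close> the given algebra is the case where they come from the tensor
  product.\<close>

definition tri_alg :: "('k::field, 'a::ab_group_add) alg \<Rightarrow> ('k, 'x::ab_group_add, 'z) vspace_scheme
    \<Rightarrow> ('k, 'b::ab_group_add) alg \<Rightarrow> ('a \<Rightarrow> 'x \<Rightarrow> 'x) \<Rightarrow> ('x \<Rightarrow> 'b \<Rightarrow> 'x) \<Rightarrow> ('k, 'a \<times> 'x \<times> 'b) alg" where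
  "tri_alg A X B l r =
    \<lparr>carrier = carrier A \<times> carrier X \<times> carrier B,
     scal = (\<lambda>c (a, n, b). (scal A c a, scal X c n, scal B c b)),
     mul = (\<lambda>(a, n, b) (a', n', b'). (mul A a a', l a n' + r n b', mul B b b')),
     idt = (idt A, 0, idt B)\<rparr>"

text \<open>The arguments that the inner faces pass to a map. The last face is kept apart, since on
  words it can leave the set on which two maps are known to agree.\<close>

fun bar_faces :: "('a \<Rightarrow> 'a \<Rightarrow> 'a) \<Rightarrow> 'a list \<Rightarrow> 'a list set" where
  "bar_faces \<mu> [] = {}"
| "bar_faces \<mu> [x] = {}"
| "bar_faces \<mu> (x # y # ys) = insert (\<mu> x y # ys) ((#) x ` bar_faces \<mu> (y # ys))"

lemma bar_cong_faces:
  assumes "\<And>ys. ys \<in> bar_faces \<mu> xs \<Longrightarrow> f ys = g ys"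
    and "xs \<noteq> [] \<Longrightarrow> \<rho> (f (butlast xs)) (last xs) = \<rho> (g (butlast xs)) (last xs)"
  shows "bar \<mu> \<rho> f xs = bar \<mu> \<rho> g xs"
  using assms
proof (induction xs arbitrary: f g rule: induct_list012)
  case (3 x y zs)
  have "bar \<mu> \<rho> (\<lambda>zs. f (x # zs)) (y # zs) = bar \<mu> \<rho> (\<lambda>zs. g (x # zs)) (y # zs)"
    by (rule "3.IH"(2)) (use "3.prems" in auto)
  then show ?case using "3.prems"(1)[of "\<mu> x y # zs"] by simp
qed simp_all

text \<open>Used with \<open>J\<close> the inclusion of \<open>A\<close> or \<open>B\<close> into
  the triangular algebra, or the identity, and with \<open>p\<close> a component of the values, the
  identity or a map compatible with right actions. The second conjunct is there for the
  induction.\<close>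

lemma bar_natural:
  assumes "\<And>x y. x \<in> S \<Longrightarrow> y \<in> S \<Longrightarrow> \<mu> x y \<in> S \<and> \<mu>' (J x) (J y) = J (\<mu> x y)"
    and "p 0 = 0" "\<And>u v. u \<in> U \<Longrightarrow> v \<in> U \<Longrightarrow> p (u - v) = p u - p v" "\<And>u. u \<in> U \<Longrightarrow> p (- u) = - p u"
    and "\<And>u x. u \<in> U \<Longrightarrow> x \<in> S \<Longrightarrow> p (\<rho>' u (J x)) = \<rho> (p u) x"
    and "\<And>ys. set ys \<subseteq> S \<Longrightarrow> f (map J ys) \<in> U" "set xs \<subseteq> S"
    and "\<And>u v. u \<in> U \<Longrightarrow> v \<in> U \<Longrightarrow> - u - v \<in> U" "\<And>u x. u \<in> U \<Longrightarrow> x \<in> S \<Longrightarrow> - \<rho>' u (J x) \<in> U"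
    and "\<And>u x. u \<in> U \<Longrightarrow> x \<in> S \<Longrightarrow> \<rho>' u (J x) \<in> U" "\<And>u. u \<in> U \<Longrightarrow> - u \<in> U"
  shows "p (bar \<mu>' \<rho>' f (map J xs)) = bar \<mu> \<rho> (\<lambda>ys. p (f (map J ys))) xs
    \<and> (xs \<noteq> [] \<longrightarrow> bar \<mu>' \<rho>' f (map J xs) \<in> U)"
  using assms(6,7)
proof (induction xs arbitrary: f rule: induct_list012)
  case 1
  then show ?case using assms(2) by simp
next
  case (2 x)
  then have "x \<in> S" "f [] \<in> U" using "2.prems"(1)[of "[]"] by auto
  then show ?case
    using assms(4)[of "\<rho>' (f []) (J x)"] assms(5)[of "f []" x] assms(9)[of "f []" x] assms(10)[of "f []" x]
    by simp
next
  case (3 x y zs)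
  let ?f = "\<lambda>zs. f (J x # zs)"
  have f: "?f (map J ys) \<in> U" if "set ys \<subseteq> S" for ys using "3.prems"(1)[of "x # ys"] "3.prems"(2) that by simp
  have IH: "p (bar \<mu>' \<rho>' ?f (map J (y # zs))) = bar \<mu> \<rho> (\<lambda>ys. p (?f (map J ys))) (y # zs)"
    "bar \<mu>' \<rho>' ?f (map J (y # zs)) \<in> U"
    using "3.IH"(2)[of ?f] f "3.prems"(2) by auto
  have xy: "\<mu> x y \<in> S" "\<mu>' (J x) (J y) = J (\<mu> x y)" using assms(1)[of x y] "3.prems"(2) by auto
  then have m: "f (J (\<mu> x y) # map J zs) \<in> U" using "3.prems"(1)[of "\<mu> x y # zs"] "3.prems"(2) by simp
  have "p (- f (J (\<mu> x y) # map J zs) - bar \<mu>' \<rho>' ?f (map J (y # zs)))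
    = - p (f (J (\<mu> x y) # map J zs)) - p (bar \<mu>' \<rho>' ?f (map J (y # zs)))"
    using assms(3)[of "- f (J (\<mu> x y) # map J zs)"] assms(4,11) m IH(2) by simp
  then show ?case using IH xy assms(8)[OF m IH(2)] by simp
qed

locale bimodule = A: kalgebra A + B: kalgebra B + X: kspace X + right: right_module B X r
  for A :: "('k::field, 'a::ab_group_add) alg" and B :: "('k, 'b::ab_group_add) alg"
    and X :: "('k, 'x::ab_group_add, 'z) vspace_scheme"
    and l :: "'a \<Rightarrow> 'x \<Rightarrow> 'x" and r :: "'x \<Rightarrow> 'b \<Rightarrow> 'x" +
  assumes lact_mem [simp]: "\<lbrakk>a \<in> carrier A; x \<in> carrier X\<rbrakk> \<Longrightarrow> l a x \<in> carrier X"
    and lact_mul: "\<lbrakk>a \<in> carrier A; a' \<in> carrier A; x \<in> carrier X\<rbrakk> \<Longrightarrow> l (mul A a a') x = l a (l a' x)"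
    and lact_idt: "x \<in> carrier X \<Longrightarrow> l (idt A) x = x"
    and ract_idt: "x \<in> carrier X \<Longrightarrow> r x (idt B) = x"
    and lact_add_left: "\<lbrakk>a \<in> carrier A; a' \<in> carrier A; x \<in> carrier X\<rbrakk> \<Longrightarrow> l (a + a') x = l a x + l a' x"
    and lact_add_right: "\<lbrakk>a \<in> carrier A; x \<in> carrier X; y \<in> carrier X\<rbrakk> \<Longrightarrow> l a (x + y) = l a x + l a y"
    and lact_scal_left: "\<lbrakk>a \<in> carrier A; x \<in> carrier X\<rbrakk> \<Longrightarrow> l (scal A c a) x = scal X c (l a x)"
    and lact_scal_right: "\<lbrakk>a \<in> carrier A; x \<in> carrier X\<rbrakk> \<Longrightarrow> l a (scal X c x) = scal X c (l a x)"
    and lact_ract: "\<lbrakk>a \<in> carrier A; x \<in> carrier X; b \<in> carrier B\<rbrakk> \<Longrightarrow> r (l a x) b = l a (r x b)"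
begin

declare A.mul_closed [simp] B.mul_closed [simp] A.idt_closed [simp] B.idt_closed [simp]

lemma lact_0_left [simp]: "x \<in> carrier X \<Longrightarrow> l 0 x = 0"
  using lact_scal_left[of 0 x 0] by simp

lemma lact_0_right [simp]: "a \<in> carrier A \<Longrightarrow> l a 0 = 0"
  using lact_scal_right[of a 0 0] by simp

lemma lact_minus_right: "a \<in> carrier A \<Longrightarrow> x \<in> carrier X \<Longrightarrow> l a (- x) = - l a x"
  using lact_scal_right[of a x "-1"] by simp

abbreviation "T \<equiv> tri_alg A X B l r"

lemma carrier_T [simp]: "(a, x, b) \<in> carrier T \<longleftrightarrow> a \<in> carrier A \<and> x \<in> carrier X \<and> b \<in> carrier B"
  and scal_T [simp]: "scal T c (a, x, b) = (scal A c a, scal X c x, scal B c b)"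
  and mul_T [simp]: "mul T (a, x, b) (a', x', b') = (mul A a a', l a x' + r x b', mul B b b')"
  and idt_T: "idt T = (idt A, 0, idt B)"
  by (simp_all add: tri_alg_def)

lemma carrier_T_0 [simp]: "a \<in> carrier A \<Longrightarrow> (a, 0) \<in> carrier T" "b \<in> carrier B \<Longrightarrow> (0, 0, b) \<in> carrier T"
  "x \<in> carrier X \<Longrightarrow> (0, x, 0) \<in> carrier T"
  using carrier_T[of a 0 0] by (simp_all add: zero_prod_def)

lemma image_LA [simp]: "(\<lambda>a. (a, 0, 0)) ` S \<subseteq> carrier T \<longleftrightarrow> S \<subseteq> carrier A"
  and image_LB [simp]: "(\<lambda>b. (0, 0, b)) ` S' \<subseteq> carrier T \<longleftrightarrow> S' \<subseteq> carrier B"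
  by (auto simp: image_subset_iff)

lemma fst_T [simp]: "t \<in> carrier T \<Longrightarrow> fst t \<in> carrier A"
  and fst_snd_T [simp]: "t \<in> carrier T \<Longrightarrow> fst (snd t) \<in> carrier X"
  and snd_snd_T [simp]: "t \<in> carrier T \<Longrightarrow> snd (snd t) \<in> carrier B"
  and fst_scal_T [simp]: "fst (scal T c t) = scal A c (fst t)"
  and fst_snd_scal_T [simp]: "fst (snd (scal T c t)) = scal X c (fst (snd t))"
  and snd_snd_scal_T [simp]: "snd (snd (scal T c t)) = scal B c (snd (snd t))"
  by (cases t; simp)+

lemma tri_kspace: "kspace T"
proof -
  have "vector_space (scal T)"
    by unfold_locales
      (auto simp: A.scale_right_distrib A.scale_left_distrib B.scale_right_distrib B.scale_left_distrib
        X.scale_right_distrib X.scale_left_distrib)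
  then interpret vector_space "scal T" .
  show ?thesis
    by unfold_locales (auto intro!: subspaceI simp: zero_prod_def)
qed

lemma tri_kalgebra: "kalgebra T"
proof -
  interpret kspace T by (rule tri_kspace)
  show ?thesis
    by unfold_locales
      (auto simp: idt_T A.mul_assoc B.mul_assoc A.mul_idt_left A.mul_idt_right B.mul_idt_left B.mul_idt_right
        A.mul_add_left A.mul_add_right B.mul_add_left B.mul_add_right lact_add_left lact_add_right
        right.ract_add_left right.ract_add_right A.mul_scal_left A.mul_scal_right B.mul_scal_left B.mul_scal_right
        lact_scal_left lact_scal_right right.ract_scal_left right.ract_scal_right lact_mul right.ract_mul
        lact_ract lact_idt ract_idt X.scale_right_distrib zero_prod_def)
qed

lemma tri_fin_dim:
  assumes "fin_dim A" "fin_dim B" "fin_dim X"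
  shows "fin_dim T"
proof -
  interpret T: kspace T by (rule tri_kspace)
  obtain SA where SA: "finite SA" "A.span SA = carrier A" using assms(1) by (auto simp: fin_dim_def)
  obtain SB where SB: "finite SB" "B.span SB = carrier B" using assms(2) by (auto simp: fin_dim_def)
  obtain SX where SX: "finite SX" "X.span SX = carrier X" using assms(3) by (auto simp: fin_dim_def)
  let ?S = "(\<lambda>a. (a, 0, 0)) ` SA \<union> (\<lambda>x. (0, x, 0)) ` SX \<union> (\<lambda>b. (0, 0, b)) ` SB"
  have a: "(a, 0, 0) \<in> T.span ?S" if "a \<in> A.span SA" for a
    using that
  proof (induction rule: A.span_induct_alt)
    case base show ?case using T.span_zero[of ?S] by (simp add: zero_prod_def)
  next
    case (step c x y)
    have "(scal A c x + y, 0, 0) = scal T c (x, 0, 0) + (y, 0, 0)" by simp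
    moreover have "(x, 0, 0) \<in> T.span ?S" using step(1) by (intro T.span_base) auto
    ultimately show ?case using T.span_add[OF T.span_scale step(2)] by metis
  qed
  have x: "(0, x, 0) \<in> T.span ?S" if "x \<in> X.span SX" for x
    using that
  proof (induction rule: X.span_induct_alt)
    case base show ?case using T.span_zero[of ?S] by (simp add: zero_prod_def)
  next
    case (step c x y)
    have "(0, scal X c x + y, 0) = scal T c (0, x, 0) + (0, y, 0)" by simp
    moreover have "(0, x, 0) \<in> T.span ?S" using step(1) by (intro T.span_base) auto
    ultimately show ?case using T.span_add[OF T.span_scale step(2)] by metis
  qed
  have b: "(0, 0, b) \<in> T.span ?S" if "b \<in> B.span SB" for b
    using that
  proof (induction rule: B.span_induct_alt)
    case base show ?case using T.span_zero[of ?S] by (simp add: zero_prod_def)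
  next
    case (step c x y)
    have "(0, 0, scal B c x + y) = scal T c (0, 0, x) + (0, 0, y)" by simp
    moreover have "(0, 0, x) \<in> T.span ?S" using step(1) by (intro T.span_base) auto
    ultimately show ?case using T.span_add[OF T.span_scale step(2)] by metis
  qed
  have sp: "T.span ?S = carrier T"
  proof (rule T.span_subspace[OF _ _ T.subspace_carrier])
    show "?S \<subseteq> carrier T"
      using A.span_superset[of SA] B.span_superset[of SB] X.span_superset[of SX] SA(2) SB(2) SX(2) by auto
    show "carrier T \<subseteq> T.span ?S"
    proof
      fix t assume "t \<in> carrier T"
      then obtain u v w where t: "t = (u, v, w)" "u \<in> carrier A" "v \<in> carrier X" "w \<in> carrier B"
        by (cases t) auto
      have "t = (u, 0, 0) + (0, v, 0) + (0, 0, w)" using t by simp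
      then show "t \<in> T.span ?S"
        using T.span_add[OF T.span_add[OF a x] b, of u v w] t SA(2) SB(2) SX(2) by metis
    qed
  qed
  have "finite ?S" using SA(1) SB(1) SX(1) by simp
  with sp show ?thesis unfolding fin_dim_def by (intro exI[of _ ?S] conjI)
qed

end

lemma triangular_algebra_eq:
  "triangular_algebra A N B = tri_alg A N B (left_act A B N) (right_act A B N)"
  by (simp add: triangular_algebra_def tri_alg_def)

section \<open>Cochains that are linear in the bimodule variable\<close>

abbreviation LA :: "'a \<Rightarrow> 'a \<times> 'x::zero \<times> 'b::zero" where "LA a \<equiv> (a, 0, 0)"
abbreviation LX :: "'x \<Rightarrow> 'a::zero \<times> 'x \<times> 'b::zero" where "LX x \<equiv> (0, x, 0)"
abbreviation LB :: "'b \<Rightarrow> 'a::zero \<times> 'x::zero \<times> 'b" where "LB b \<equiv> (0, 0, b)"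

definition word :: "'a list \<Rightarrow> 'x \<Rightarrow> 'b list \<Rightarrow> ('a::zero \<times> 'x::zero \<times> 'b::zero) list" where
  "word as x bs = map LA as @ LX x # map LB bs"

lemma word_simps [simp]:
  "word [] x bs = LX x # map LB bs" "word (a # as) x bs = LA a # word as x bs"
  by (simp_all add: word_def)

lemma word_not_Nil [simp]: "word as x bs \<noteq> []"
  by (simp add: word_def)

lemma length_word [simp]: "length (word as x bs) = Suc (length as + length bs)"
  by (simp add: word_def)

definition tri_multilinear ::
  "('k::field, 'a::ab_group_add) alg \<Rightarrow> ('k, 'x::ab_group_add, 'y) vspace_scheme \<Rightarrow> ('k, 'b::ab_group_add) alg
    \<Rightarrow> ('k, 'n::ab_group_add, 'z) vspace_scheme \<Rightarrow> ('a list \<Rightarrow> 'x \<Rightarrow> 'b list \<Rightarrow> 'n) \<Rightarrow> bool" where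
  "tri_multilinear A X B N f \<longleftrightarrow>
    (\<forall>x\<in>carrier X. \<forall>bs. set bs \<subseteq> carrier B \<longrightarrow> multilinear A N (\<lambda>as. f as x bs)) \<and>
    (\<forall>x\<in>carrier X. \<forall>as. set as \<subseteq> carrier A \<longrightarrow> multilinear B N (\<lambda>bs. f as x bs)) \<and>
    (\<forall>as bs. set as \<subseteq> carrier A \<longrightarrow> set bs \<subseteq> carrier B \<longrightarrow>
      linear_on (scal X) (scal N) (carrier X) (\<lambda>x. f as x bs))"

text \<open>The bimodule entry counts towards the degree, so the lowest nonzero cochains have degree 1.\<close>

definition tri_cochains ::
  "('k::field, 'a::ab_group_add) alg \<Rightarrow> ('k, 'x::ab_group_add, 'y) vspace_scheme \<Rightarrow> ('k, 'b::ab_group_add) alg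
    \<Rightarrow> ('k, 'n::ab_group_add, 'z) vspace_scheme \<Rightarrow> nat \<Rightarrow> ('a list \<Rightarrow> 'x \<Rightarrow> 'b list \<Rightarrow> 'n) set" where
  "tri_cochains A X B N n = {f. tri_multilinear A X B N f \<and>
    (\<forall>as x bs. \<not> (set as \<subseteq> carrier A \<and> x \<in> carrier X \<and> set bs \<subseteq> carrier B \<and> Suc (length as + length bs) = n)
      \<longrightarrow> f as x bs = 0)}"

text \<open>
  The multilinear map on words over \<open>T\<close> determined by \<open>f\<close>: the sum over the position from which the
  bimodule entry is taken, with entries of \<open>A\<close> before it and of \<open>B\<close> after it.
\<close>

fun unfold_word :: "('a list \<Rightarrow> 'x \<Rightarrow> 'b list \<Rightarrow> 'n) \<Rightarrow> ('a \<times> 'x \<times> 'b) list \<Rightarrow> 'n::ab_group_add" where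
  "unfold_word f [] = 0"
| "unfold_word f (t # ts) = f [] (fst (snd t)) (map (snd \<circ> snd) ts) + unfold_word (\<lambda>as. f (fst t # as)) ts"

lemma tri_multilinear_mem:
  "tri_multilinear A X B N f \<Longrightarrow> set as \<subseteq> carrier A \<Longrightarrow> x \<in> carrier X \<Longrightarrow> set bs \<subseteq> carrier B \<Longrightarrow> f as x bs \<in> carrier N"
  using multilinear_mem[of A N "\<lambda>as. f as x bs" as] by (simp add: tri_multilinear_def)

lemma tri_multilinear_Cons:
  assumes "tri_multilinear A X B N f" "a \<in> carrier A"
  shows "tri_multilinear A X B N (\<lambda>as. f (a # as))"
  using assms multilinear_Cons[of A N "\<lambda>as. f as x bs" a for x bs]
  unfolding tri_multilinear_def by auto

lemma tri_multilinear_linear: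
  "tri_multilinear A X B N f \<Longrightarrow> set as \<subseteq> carrier A \<Longrightarrow> set bs \<subseteq> carrier B \<Longrightarrow>
    linear_on (scal X) (scal N) (carrier X) (\<lambda>x. f as x bs)"
  by (simp add: tri_multilinear_def)

locale bimodule_pair = X: bimodule A B X lX rX + N: bimodule A B N lN rN
  for A :: "('k::field, 'a::ab_group_add) alg" and B :: "('k, 'b::ab_group_add) alg"
    and X :: "('k, 'x::ab_group_add, 'y) vspace_scheme" and lX rX
    and N :: "('k, 'n::ab_group_add, 'z) vspace_scheme" and lN rN
begin

abbreviation "T \<equiv> tri_alg A X B lX rX"

sublocale T: kalgebra T by (rule X.tri_kalgebra)

text \<open>\<open>T\<close> projects onto \<open>A\<close> and onto \<open>B\<close>, so
  \<open>N\<close> is a \<open>T\<close>-bimodule with left action through \<open>A\<close> and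
  right action through \<open>B\<close>. Thus maps \<open>A^p x X x B^q -> N\<close> can be treated
  as Hochschild cochains of \<open>T\<close> with values in \<open>N\<close>.\<close>

definition actR :: "'n \<Rightarrow> 'a \<times> 'x \<times> 'b \<Rightarrow> 'n" where "actR n t = rN n (snd (snd t))"
definition actL :: "'a \<times> 'x \<times> 'b \<Rightarrow> 'n \<Rightarrow> 'n" where "actL t n = lN (fst t) n"

sublocale TN: right_module T N actR
  by unfold_locales
    (auto simp: actR_def N.right.ract_mul N.right.ract_add_left N.right.ract_add_right N.right.ract_scal_left
      N.right.ract_scal_right)

abbreviation "tri_ml \<equiv> tri_multilinear A X B N"

lemma set_word: "set as \<subseteq> carrier A \<Longrightarrow> x \<in> carrier X \<Longrightarrow> set bs \<subseteq> carrier B \<Longrightarrow> set (word as x bs) \<subseteq> carrier T"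
  by (auto simp: word_def)

lemma set_word_iff: "set (word as x bs) \<subseteq> carrier T \<longleftrightarrow> set as \<subseteq> carrier A \<and> x \<in> carrier X \<and> set bs \<subseteq> carrier B"
  by (auto simp: word_def image_subset_iff)

lemma tri_multilinear_word:
  assumes "multilinear T N F"
  shows "tri_ml (\<lambda>as x bs. F (word as x bs))"
  unfolding tri_multilinear_def
proof (intro conjI ballI allI impI)
  note mem = multilinear_mem[OF assms set_word]
  fix x bs assume x: "x \<in> carrier X" and bs: "set bs \<subseteq> carrier B"
  show "multilinear A N (\<lambda>as. F (word as x bs))"
  proof (rule multilinearI, goal_cases)
    case (1 as) then show ?case using mem x bs by blast
  next
    case (2 xs ys a a')
    then show ?case
      using multilinear_add[OF assms, of "map LA xs" "word ys x bs" "LA a" "LA a'"] set_word[OF _ x bs, of ys]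
      by (auto simp: word_def)
  next
    case (3 xs ys a c)
    then show ?case
      using multilinear_scal[OF assms, of "map LA xs" "word ys x bs" "LA a" c] set_word[OF _ x bs, of ys]
      by (auto simp: word_def)
  qed
next
  note mem = multilinear_mem[OF assms set_word]
  fix x as assume x: "x \<in> carrier X" and as: "set as \<subseteq> carrier A"
  have w: "word as x (xs @ b # ys) = word as x xs @ LB b # map LB ys" for xs b ys by (simp add: word_def)
  show "multilinear B N (\<lambda>bs. F (word as x bs))"
  proof (rule multilinearI, goal_cases)
    case (1 as) then show ?case using mem x as by blast
  next
    case (2 xs ys a a')
    then show ?case
      using multilinear_add[OF assms, of "word as x xs" "map LB ys" "LB a" "LB a'"] set_word[OF as x]
      by (auto simp: w)
  next
    case (3 xs ys a c)
    then show ?case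
      using multilinear_scal[OF assms, of "word as x xs" "map LB ys" "LB a" c] set_word[OF as x]
      by (auto simp: w)
  qed
next
  fix as bs assume as: "set as \<subseteq> carrier A" and bs: "set bs \<subseteq> carrier B"
  then have s: "set (map LA as) \<subseteq> carrier T" "set (map LB bs) \<subseteq> carrier T" by auto
  show "linear_on (scal X) (scal N) (carrier X) (\<lambda>x. F (word as x bs))"
    unfolding linear_on_def word_def
    using multilinear_add[OF assms s, of "LX _" "LX _"] multilinear_scal[OF assms s, of "LX _"] by auto
qed

lemma unfold_word_cong:
  assumes "\<And>as x bs. set as \<subseteq> carrier A \<Longrightarrow> x \<in> carrier X \<Longrightarrow> set bs \<subseteq> carrier B \<Longrightarrow> f as x bs = g as x bs"
    and "set ts \<subseteq> carrier T"
  shows "unfold_word f ts = unfold_word g ts"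
  using assms
proof (induction ts arbitrary: f g)
  case (Cons t ts)
  obtain a x b where t: "t = (a, x, b)" by (cases t) auto
  then have axb: "a \<in> carrier A" "x \<in> carrier X" using Cons.prems(2) by auto
  have "unfold_word (\<lambda>as. f (a # as)) ts = unfold_word (\<lambda>as. g (a # as)) ts"
    by (rule Cons.IH) (use Cons.prems axb in auto)
  moreover have "set (map (snd \<circ> snd) ts) \<subseteq> carrier B" using Cons.prems(2) by auto
  ultimately show ?case using Cons.prems(1)[of "[]" x "map (snd \<circ> snd) ts"] axb t by (simp add: o_def)
qed simp

lemma unfold_word_add: "unfold_word (\<lambda>as x bs. f as x bs + g as x bs) ts = unfold_word f ts + unfold_word g ts"
  by (induction ts arbitrary: f g) (simp_all add: o_def)

lemma unfold_word_scal: "unfold_word (\<lambda>as x bs. scal N c (f as x bs)) ts = scal N c (unfold_word f ts)"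
  by (induction ts arbitrary: f) (simp_all add: o_def N.X.scale_right_distrib)

lemma unfold_word_zero: "unfold_word (\<lambda>as x bs. 0 :: 'n) ts = 0"
  by (induction ts) simp_all

lemma map_B_mem: "set ts \<subseteq> carrier T \<Longrightarrow> set (map (snd \<circ> snd) ts) \<subseteq> carrier B"
proof
  fix b assume "set ts \<subseteq> carrier T" "b \<in> set (map (snd \<circ> snd) ts)"
  then obtain t where "t \<in> carrier T" "b = snd (snd t)" unfolding set_map o_def by blast
  then show "b \<in> carrier B" using X.snd_snd_T by simp
qed

text \<open>An entry of \<open>T\<close> enters the summand at its own position through its
  \<open>X\<close>-part, the summands of later positions through its \<open>A\<close>-part and those
  of earlier positions through its \<open>B\<close>-part; \<open>f\<close> is linear in
  each.\<close>

lemma multilinear_unfold_word: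
  assumes "tri_ml f"
  shows "multilinear T N (unfold_word f)"
proof (rule multilinearI)
  fix xs assume "set xs \<subseteq> carrier T"
  then show "unfold_word f xs \<in> carrier N"
    using assms
  proof (induction xs arbitrary: f)
    case (Cons t ts)
    have t: "fst t \<in> carrier A" "fst (snd t) \<in> carrier X" using Cons.prems by (simp_all add: X.fst_T X.fst_snd_T)
    have "f [] (fst (snd t)) (map (snd \<circ> snd) ts) \<in> carrier N"
      using tri_multilinear_mem[OF Cons.prems(2)] t(2) map_B_mem[of ts] Cons.prems(1) by simp
    then show ?case using Cons.IH[OF _ tri_multilinear_Cons[OF Cons.prems(2) t(1)]] Cons.prems(1) by simp
  qed simp
next
  fix xs ys t u
  assume "set xs \<subseteq> carrier T" "set ys \<subseteq> carrier T" and tu: "t \<in> carrier T" "u \<in> carrier T"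
  then show "unfold_word f (xs @ (t + u) # ys) = unfold_word f (xs @ t # ys) + unfold_word f (xs @ u # ys)"
    using assms
  proof (induction xs arbitrary: f)
    case Nil
    obtain a x b where t: "t = (a, x, b)" by (cases t) auto
    obtain a' x' b' where u: "u = (a', x', b')" by (cases u) auto
    have c: "a \<in> carrier A" "x \<in> carrier X" "a' \<in> carrier A" "x' \<in> carrier X" using tu t u by auto
    have bs: "set (map (snd \<circ> snd) ys) \<subseteq> carrier B" using map_B_mem[OF Nil(2)] .
    have h: "f ((a + a') # as) x bs = f (a # as) x bs + f (a' # as) x bs"
      if "set as \<subseteq> carrier A" "x \<in> carrier X" "set bs \<subseteq> carrier B" for as x bs
      using multilinear_Cons_add[of A N "\<lambda>as. f as x bs" as a a'] Nil(5) that c by (auto simp: tri_multilinear_def)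
    have "unfold_word (\<lambda>as. f ((a + a') # as)) ys = unfold_word (\<lambda>as x bs. f (a # as) x bs + f (a' # as) x bs) ys"
      by (rule unfold_word_cong) (use h Nil(2) in auto)
    moreover have "f [] (x + x') (map (snd \<circ> snd) ys) = f [] x (map (snd \<circ> snd) ys) + f [] x' (map (snd \<circ> snd) ys)"
      using linear_on_add[OF tri_multilinear_linear[OF Nil(5), of "[]"]] bs c by simp
    ultimately show ?case using t u by (simp add: unfold_word_add)
  next
    case (Cons v xs)
    have v: "fst v \<in> carrier A" "fst (snd v) \<in> carrier X" using Cons.prems by (simp_all add: X.fst_T X.fst_snd_T)
    have "f [] (fst (snd v)) (map (snd \<circ> snd) (xs @ (t + u) # ys)) =
      f [] (fst (snd v)) (map (snd \<circ> snd) (xs @ t # ys)) + f [] (fst (snd v)) (map (snd \<circ> snd) (xs @ u # ys))"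
      using multilinear_add[of B N "f [] (fst (snd v))" "map (snd \<circ> snd) xs" "map (snd \<circ> snd) ys" "snd (snd t)" "snd (snd u)"]
        Cons.prems v map_B_mem[of xs] map_B_mem[of ys] map_B_mem[of "[t, u]"] by (auto simp: tri_multilinear_def)
    then show ?case using Cons.IH[of "\<lambda>as. f (fst v # as)"] tri_multilinear_Cons[OF Cons.prems(5) v(1)] Cons.prems
      by simp
  qed
next
  fix xs ys t c
  assume "set xs \<subseteq> carrier T" "set ys \<subseteq> carrier T" and tu: "t \<in> carrier T"
  then show "unfold_word f (xs @ scal T c t # ys) = scal N c (unfold_word f (xs @ t # ys))"
    using assms
  proof (induction xs arbitrary: f)
    case Nil
    obtain a x b where t: "t = (a, x, b)" by (cases t) auto
    have c: "a \<in> carrier A" "x \<in> carrier X" using tu t by auto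
    have bs: "set (map (snd \<circ> snd) ys) \<subseteq> carrier B" using map_B_mem[OF Nil(2)] .
    have h: "f (scal A c a # as) x bs = scal N c (f (a # as) x bs)"
      if "set as \<subseteq> carrier A" "x \<in> carrier X" "set bs \<subseteq> carrier B" for as x bs
      using multilinear_Cons_scal[of A N "\<lambda>as. f as x bs" as a] Nil(4) that c by (auto simp: tri_multilinear_def)
    have "unfold_word (\<lambda>as. f (scal A c a # as)) ys = unfold_word (\<lambda>as x bs. scal N c (f (a # as) x bs)) ys"
      by (rule unfold_word_cong) (use h Nil(2) in auto)
    moreover have "f [] (scal X c x) (map (snd \<circ> snd) ys) = scal N c (f [] x (map (snd \<circ> snd) ys))"
      using linear_on_scale[OF tri_multilinear_linear[OF Nil(4), of "[]"]] bs c by simp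
    ultimately show ?case using t by (simp add: unfold_word_scal N.X.scale_right_distrib)
  next
    case (Cons v xs)
    have v: "fst v \<in> carrier A" "fst (snd v) \<in> carrier X" using Cons.prems by (simp_all add: X.fst_T X.fst_snd_T)
    have s: "snd (snd (scal T c t)) = scal B c (snd (snd t))" by (cases t) simp
    have "f [] (fst (snd v)) (map (snd \<circ> snd) (xs @ scal T c t # ys)) =
      scal N c (f [] (fst (snd v)) (map (snd \<circ> snd) (xs @ t # ys)))"
      using multilinear_scal[of B N "f [] (fst (snd v))" "map (snd \<circ> snd) xs" "map (snd \<circ> snd) ys" "snd (snd t)" c]
        Cons.prems v map_B_mem[of xs] map_B_mem[of ys] map_B_mem[of "[t]"] by (auto simp: tri_multilinear_def s)
    then show ?case using Cons.IH[of "\<lambda>as. f (fst v # as)"] tri_multilinear_Cons[OF Cons.prems(4) v(1)] Cons.prems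
      by (simp add: N.X.scale_right_distrib)
  qed
qed

text \<open>Only the summand at the letter from \<open>X\<close> survives: letters before it have
  \<open>X\<close>-part 0, and in the later summands this letter is used through its
  \<open>A\<close>-part, which is 0.\<close>

lemma unfold_word_word:
  assumes "tri_ml f" "set as \<subseteq> carrier A" "x \<in> carrier X" "set bs \<subseteq> carrier B"
  shows "unfold_word f (word as x bs) = f as x bs"
  using assms
proof (induction as arbitrary: f)
  case Nil
  have h: "f (0 # as) x bs = 0" if "set as \<subseteq> carrier A" "x \<in> carrier X" "set bs \<subseteq> carrier B" for as x bs
    using multilinear_Cons_scal[of A N "\<lambda>as. f as x bs" as 0 0] Nil that by (auto simp: tri_multilinear_def)
  have "unfold_word (\<lambda>as. f (0 # as)) (map LB bs) = unfold_word (\<lambda>as x bs. 0) (map LB bs :: ('a \<times> 'x \<times> 'b) list)"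
    by (rule unfold_word_cong) (use h Nil in auto)
  then show ?case by (simp add: unfold_word_zero o_def)
next
  case (Cons a as)
  have "linear_on (scal X) (scal N) (carrier X) (\<lambda>u. f [] u (map (snd \<circ> snd) (word as x bs)))"
    by (rule tri_multilinear_linear[OF Cons.prems(1)]) (use set_word[of as x bs] map_B_mem[of "word as x bs"] Cons.prems in auto)
  from linear_on_scale[OF this, of 0 0]
  have "f [] 0 (map (snd \<circ> snd) (word as x bs)) = 0" by simp
  then show ?case using Cons.IH[OF tri_multilinear_Cons[OF Cons.prems(1)]] Cons.prems by simp
qed

lemma faces_map_B: "ts \<in> bar_faces (mul T) (map LB bs) \<Longrightarrow> set bs \<subseteq> carrier B \<Longrightarrow>
    \<exists>bs'. ts = map LB bs' \<and> set bs' \<subseteq> carrier B"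
proof (induction bs arbitrary: ts rule: induct_list012)
  case (3 b b' bs)
  from "3.prems"(1) consider "ts = LB (mul B b b') # map LB bs"
    | us where "us \<in> bar_faces (mul T) (map LB (b' # bs))" "ts = LB b # us"
    using "3.prems"(2) by auto
  then show ?case
  proof cases
    case 1
    then show ?thesis using "3.prems"(2) by (intro exI[of _ "mul B b b' # bs"]) auto
  next
    case 2
    then obtain bs' where "us = map LB bs'" "set bs' \<subseteq> carrier B" using "3.IH"(2) "3.prems"(2) by auto
    then show ?thesis using 2 "3.prems"(2) by (intro exI[of _ "b # bs'"]) auto
  qed
qed simp_all

text \<open>Merging neighbours keeps the shape of a word: letters of one algebra multiply among
  themselves, and the letter from \<open>X\<close> absorbs its neighbours through the
  actions.\<close>

lemma faces_word: "ts \<in> bar_faces (mul T) (word as x bs) \<Longrightarrow>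
  set as \<subseteq> carrier A \<Longrightarrow> x \<in> carrier X \<Longrightarrow> set bs \<subseteq> carrier B \<Longrightarrow>
    \<exists>as' x' bs'. ts = word as' x' bs' \<and> set as' \<subseteq> carrier A \<and> x' \<in> carrier X \<and> set bs' \<subseteq> carrier B"
proof (induction as arbitrary: ts)
  case Nil
  show ?case
  proof (cases bs)
    case Nil
    then show ?thesis using Nil.prems by simp
  next
    case (Cons b bs')
    then consider "ts = LX (rX x b) # map LB bs'" | us where "us \<in> bar_faces (mul T) (map LB bs)" "ts = LX x # us"
      using Nil.prems by auto
    then show ?thesis
    proof cases
      case 1
      then show ?thesis using Nil.prems Cons by (intro exI[of _ "[]"] exI[of _ "rX x b"] exI[of _ bs']) auto
    next
      case 2
      then obtain cs where "us = map LB cs" "set cs \<subseteq> carrier B" using faces_map_B Nil.prems by metis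
      then show ?thesis using Nil.prems 2 by (intro exI[of _ "[]"] exI[of _ x] exI[of _ cs]) auto
    qed
  qed
next
  case (Cons a as)
  have ne: "bar_faces (mul T) (LA a # word as x bs) =
    insert (mul T (LA a) (hd (word as x bs)) # tl (word as x bs)) ((#) (LA a) ` bar_faces (mul T) (word as x bs))"
    using word_not_Nil[of as x bs] by (cases "word as x bs") auto
  from Cons.prems(1) consider "ts = mul T (LA a) (hd (word as x bs)) # tl (word as x bs)"
    | us where "us \<in> bar_faces (mul T) (word as x bs)" "ts = LA a # us"
    by (auto simp: ne)
  then show ?case
  proof cases
    case 1
    show ?thesis
    proof (cases as)
      case Nil
      then show ?thesis using 1 Cons.prems by (intro exI[of _ "[]"] exI[of _ "lX a x"] exI[of _ bs]) auto
    next
      case (Cons a' as')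
      then show ?thesis using 1 Cons.prems by (intro exI[of _ "mul A a a' # as'"] exI[of _ x] exI[of _ bs]) auto
    qed
  next
    case 2
    then obtain as' x' bs' where "us = word as' x' bs'" "set as' \<subseteq> carrier A" "x' \<in> carrier X" "set bs' \<subseteq> carrier B"
      using Cons.IH[of us] Cons.prems by auto
    then show ?thesis using 2 Cons.prems by (intro exI[of _ "a # as'"] exI[of _ x'] exI[of _ bs']) auto
  qed
qed

lemma bar_word_cong:
  assumes "\<And>as x bs. set as \<subseteq> carrier A \<Longrightarrow> x \<in> carrier X \<Longrightarrow> set bs \<subseteq> carrier B \<Longrightarrow>
      F (word as x bs) = G (word as x bs)"
    and "F (map LA as) \<in> carrier N" "G (map LA as) \<in> carrier N"
    and w: "set as \<subseteq> carrier A" "x \<in> carrier X" "set bs \<subseteq> carrier B"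
  shows "TN.brr F (word as x bs) = TN.brr G (word as x bs)"
proof (rule bar_cong_faces)
  show "F ys = G ys" if "ys \<in> bar_faces (mul T) (word as x bs)" for ys
    using faces_word[OF that w] assms(1) by blast
  show "actR (F (butlast (word as x bs))) (last (word as x bs)) = actR (G (butlast (word as x bs))) (last (word as x bs))"
  proof (cases bs rule: rev_cases)
    \<comment> \<open>The last face drops the letter from \<open>X\<close> and leaves a list that is
      not a word. It contributes nothing, because the \<open>B\<close>-part of that letter is
      0.\<close>
    case Nil
    then show ?thesis using assms(2,3) by (simp add: word_def actR_def)
  next
    case (snoc bs' b)
    then have "butlast (word as x bs) = word as x bs'" by (simp add: word_def butlast_append)
    then show ?thesis using assms(1)[of as x bs'] w snoc by simp
  qed
qed

text \<open>The Hochschild differential over \<open>T\<close> of the extension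
  \<open>unfold_word f\<close>, with values in \<open>N\<close>, read off on words.
  \<open>tri_bar_Cons\<close>, \<open>tri_bar_Nil\<close> and \<open>lead_word\<close> make it
  explicit.\<close>

definition tri_diff :: "('a list \<Rightarrow> 'x \<Rightarrow> 'b list \<Rightarrow> 'n) \<Rightarrow> 'a list \<Rightarrow> 'x \<Rightarrow> 'b list \<Rightarrow> 'n" where
  "tri_diff f = (\<lambda>as x bs. if set as \<subseteq> carrier A \<and> x \<in> carrier X \<and> set bs \<subseteq> carrier B
    then lead actL (unfold_word f) (word as x bs) + TN.brr (unfold_word f) (word as x bs) else 0)"

abbreviation "cochains \<equiv> tri_cochains A X B N"

lemma cochains_iff: "f \<in> cochains n \<longleftrightarrow> tri_ml f \<and>
    (\<forall>as x bs. \<not> (set as \<subseteq> carrier A \<and> x \<in> carrier X \<and> set bs \<subseteq> carrier B \<and> Suc (length as + length bs) = n)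
      \<longrightarrow> f as x bs = 0)"
  by (simp add: tri_cochains_def)

lemma cochains_mem: "f \<in> cochains n \<Longrightarrow> f as x bs \<in> carrier N"
  using tri_multilinear_mem[of A X B N f as x bs] cochains_iff[of f n] by (metis N.X.zero_mem)

lemma multilinear_lead_N:
  assumes "multilinear T N F"
  shows "multilinear T N (lead actL F)"
proof (rule multilinearI, goal_cases)
  case (1 xs)
  then show ?case using multilinear_mem[OF assms] by (cases xs) (auto simp: actL_def)
next
  case (2 xs ys x y)
  then show ?case using multilinear_mem[OF assms] multilinear_add[OF assms, of "tl xs" ys x y]
    by (cases xs) (auto simp: actL_def N.lact_add_left N.lact_add_right)
next
  case (3 xs ys x c)
  then show ?case using multilinear_mem[OF assms] multilinear_scal[OF assms, of "tl xs" ys x c]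
    by (cases xs) (auto simp: actL_def N.lact_scal_left N.lact_scal_right)
qed

lemma tri_multilinear_cong:
  assumes "tri_ml f" and "\<And>as x bs. set as \<subseteq> carrier A \<Longrightarrow> x \<in> carrier X \<Longrightarrow> set bs \<subseteq> carrier B \<Longrightarrow> g as x bs = f as x bs"
  shows "tri_ml g"
  using assms unfolding tri_multilinear_def multilinear_def linear_on_def by simp

lemma tri_multilinear_diff:
  assumes "tri_ml f"
  shows "tri_ml (tri_diff f)"
proof -
  have "multilinear T N (\<lambda>ts. lead actL (unfold_word f) ts + TN.brr (unfold_word f) ts)"
    by (intro TN.multilinear_plus multilinear_lead_N TN.multilinear_bar multilinear_unfold_word assms)
  from tri_multilinear_word[OF this] show ?thesis
    by (rule tri_multilinear_cong) (simp add: tri_diff_def)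
qed

lemma tri_diff_closed:
  assumes "f \<in> cochains n"
  shows "tri_diff f \<in> cochains (Suc n)"
  unfolding cochains_iff
proof (intro conjI allI impI)
  show "tri_ml (tri_diff f)" using assms by (intro tri_multilinear_diff) (simp add: cochains_iff)
  fix as x bs
  assume a: "\<not> (set as \<subseteq> carrier A \<and> x \<in> carrier X \<and> set bs \<subseteq> carrier B \<and> Suc (length as + length bs) = Suc n)"
  show "tri_diff f as x bs = 0"
  proof (cases "set as \<subseteq> carrier A \<and> x \<in> carrier X \<and> set bs \<subseteq> carrier B")
    case True
    have z: "unfold_word f ts = 0" if "set ts \<subseteq> carrier T" "length ts \<noteq> n" for ts
      using that assms
    proof -
      have "\<forall>as x bs. Suc (length as + length bs) \<noteq> n \<longrightarrow> f as x bs = 0" using assms by (simp add: cochains_iff)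
      then show ?thesis using that(2)
      proof (induction ts arbitrary: f n)
        case (Cons t ts)
        have "unfold_word (\<lambda>as. f (fst t # as)) ts = 0"
        proof (cases n)
          \<comment> \<open>A degree 0 has no predecessor for the induction hypothesis, but then
            \<open>f\<close> vanishes altogether.\<close>
          case 0
          then have "(\<lambda>as. f (fst t # as)) = (\<lambda>as x bs. 0)" using Cons.prems(1) by (simp add: fun_eq_iff)
          then show ?thesis by (simp add: unfold_word_zero)
        next
          case (Suc m)
          then show ?thesis using Cons.IH[of m] Cons.prems by simp
        qed
        then show ?case using Cons.prems by simp
      qed simp
    qed
    have l: "length (word as x bs) \<noteq> Suc n" using True a by simp
    have w: "set (word as x bs) \<subseteq> carrier T" using set_word True by blast
    have "TN.brr (unfold_word f) (word as x bs) = TN.brr (\<lambda>_. 0) (word as x bs)"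
      by (rule TN.bar_cong) (use z l w in auto)
    moreover have "lead actL (unfold_word f) (word as x bs) = 0"
    proof (cases "word as x bs")
      case (Cons t ts)
      then have "unfold_word f ts = 0" using z l w by auto
      moreover have "fst t \<in> carrier A" using w Cons by (auto simp: tri_alg_def)
      ultimately show ?thesis using Cons by (simp add: actL_def)
    qed simp
    ultimately show ?thesis using TN.bar_zero[OF w] by (simp add: tri_diff_def)
  qed (auto simp: tri_diff_def)
qed

text \<open>\<open>unfold_word (tri_diff f)\<close> agrees with the full differential
  \<open>?G\<close> on words only. This suffices for a second differential on a word: its faces are
  words, except at the ends, where the zero parts of the letter from \<open>X\<close> kill the
  contribution.\<close>

lemma tri_diff_diff:
  assumes "f \<in> cochains n"
  shows "tri_diff (tri_diff f) = 0"
proof (intro ext)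
  fix as x bs
  let ?F = "unfold_word f"
  let ?G = "\<lambda>ts. lead actL ?F ts + TN.brr ?F ts"
  have f: "tri_ml f" using assms by (simp add: cochains_iff)
  have F: "multilinear T N ?F" by (rule multilinear_unfold_word[OF f])
  have G: "multilinear T N ?G"
    by (intro TN.multilinear_plus multilinear_lead_N TN.multilinear_bar F)
  show "tri_diff (tri_diff f) as x bs = 0 as x bs"
  proof (cases "set as \<subseteq> carrier A \<and> x \<in> carrier X \<and> set bs \<subseteq> carrier B")
    case True
    then have w: "set (word as x bs) \<subseteq> carrier T" using set_word by blast
    have d: "multilinear T N (unfold_word (tri_diff f))"
      by (rule multilinear_unfold_word[OF tri_multilinear_diff[OF f]])
    have e: "unfold_word (tri_diff f) (word as x bs) = ?G (word as x bs)"
      if "set as \<subseteq> carrier A" "x \<in> carrier X" "set bs \<subseteq> carrier B" for as x bs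
      using unfold_word_word[OF tri_multilinear_diff[OF f] that] that by (simp add: tri_diff_def)
    have "set (map LA as) \<subseteq> carrier T" using True by auto
    then have "TN.brr (unfold_word (tri_diff f)) (word as x bs) = TN.brr ?G (word as x bs)"
      using e True multilinear_mem[OF d] multilinear_mem[OF G] by (intro bar_word_cong) auto
    moreover have "lead actL (unfold_word (tri_diff f)) (word as x bs) = lead actL ?G (word as x bs)"
    proof (cases as)
      case Nil
      have "set (map LB bs) \<subseteq> carrier T" using True by auto
      then show ?thesis using Nil multilinear_mem[OF d] multilinear_mem[OF G] by (simp add: actL_def)
    next
      case (Cons a as')
      then show ?thesis using e[of as' x bs] True by simp
    qed
    moreover have "lead actL ?G (word as x bs) + TN.brr ?G (word as x bs) = 0"
      using multilinear_mem[OF F] w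
      by (intro TN.lead_bar_lead_bar)
        (auto simp: actL_def actR_def N.lact_mul N.lact_add_right N.lact_ract)
    ultimately show ?thesis unfolding tri_diff_def[of "tri_diff f"] using True by simp
  qed (auto simp: tri_diff_def)
qed

text \<open>The first letter from \<open>A\<close> is merged with its right neighbour, which is the
  letter from \<open>X\<close> when no other letter from \<open>A\<close> is left. Later
  computations use these recursions in place of products in \<open>T\<close>.\<close>

lemma tri_bar_Cons:
  assumes "tri_ml f" "a \<in> carrier A" "set as \<subseteq> carrier A" "x \<in> carrier X" "set bs \<subseteq> carrier B"
  shows "TN.brr (unfold_word f) (word (a # as) x bs) =
    - (case as of [] \<Rightarrow> f [] (lX a x) bs | a' # as' \<Rightarrow> f (mul A a a' # as') x bs)
    - TN.brr (unfold_word (\<lambda>as. f (a # as))) (word as x bs)"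
proof -
  have "TN.brr (unfold_word f) (LA a # word as x bs) =
    - unfold_word f (mul T (LA a) (hd (word as x bs)) # tl (word as x bs))
    - TN.brr (\<lambda>ts. unfold_word f (LA a # ts)) (word as x bs)"
    by (simp add: TN.bar_Cons_fun)
  moreover have "unfold_word f (mul T (LA a) (hd (word as x bs)) # tl (word as x bs)) =
    (case as of [] \<Rightarrow> f [] (lX a x) bs | a' # as' \<Rightarrow> f (mul A a a' # as') x bs)"
  proof (cases as)
    case Nil
    then show ?thesis using unfold_word_word[OF assms(1), of "[]" "lX a x" bs] assms by (simp del: unfold_word.simps)
  next
    case (Cons a' as')
    then show ?thesis using unfold_word_word[OF assms(1), of "mul A a a' # as'" x bs] assms by (simp del: unfold_word.simps)
  qed
  moreover have "TN.brr (\<lambda>ts. unfold_word f (LA a # ts)) (word as x bs) = TN.brr (unfold_word (\<lambda>as. f (a # as))) (word as x bs)"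
  proof (rule bar_word_cong)
    have s: "set (LA a # map LA as) \<subseteq> carrier T" "set (map LA as) \<subseteq> carrier T" using assms by auto
    show "unfold_word f (LA a # map LA as) \<in> carrier N" "unfold_word (\<lambda>as. f (a # as)) (map LA as) \<in> carrier N"
      using multilinear_mem[OF multilinear_unfold_word[OF assms(1)] s(1)]
        multilinear_mem[OF multilinear_unfold_word[OF tri_multilinear_Cons[OF assms(1,2)]] s(2)] by auto
    fix as x bs assume a: "set as \<subseteq> carrier A" "x \<in> carrier X" "set bs \<subseteq> carrier B"
    show "unfold_word f (LA a # word as x bs) = unfold_word (\<lambda>as. f (a # as)) (word as x bs)"
      using unfold_word_word[OF assms(1), of "a # as" x bs] unfold_word_word[OF tri_multilinear_Cons[OF assms(1,2)] a] a assms
      by (simp del: unfold_word.simps)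
  qed (use assms in auto)
  ultimately show ?thesis by (simp del: unfold_word.simps)
qed

text \<open>Once no letter from \<open>A\<close> is left, \<open>bar\<close> over \<open>T\<close>
  becomes \<open>bar\<close> over \<open>B\<close> on the tail; its sign comes from passing the
  letter from \<open>X\<close>.\<close>

lemma tri_bar_Nil:
  assumes "tri_ml f" "x \<in> carrier X" "set bs \<subseteq> carrier B"
  shows "TN.brr (unfold_word f) (word [] x bs) =
    (case bs of [] \<Rightarrow> 0 | b # bs' \<Rightarrow> - f [] (rX x b) bs') - N.right.brr (f [] x) bs"
proof (cases bs)
  case Nil
  then show ?thesis by (simp add: actR_def)
next
  case (Cons b bs')
  then have b: "b \<in> carrier B" "set bs' \<subseteq> carrier B" using assms by auto
  have "TN.brr (unfold_word f) (word [] x bs) = - unfold_word f (word [] (rX x b) bs') - TN.brr (\<lambda>ts. unfold_word f (LX x # ts)) (map LB bs)"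
    using Cons b assms(2) by simp
  also have "unfold_word f (word [] (rX x b) bs') = f [] (rX x b) bs'"
    using assms b by (intro unfold_word_word) auto
  also have "TN.brr (\<lambda>ts. unfold_word f (LX x # ts)) (map LB bs) = N.right.brr (\<lambda>ys. unfold_word f (LX x # map LB ys)) bs"
    using bar_natural[where S = "carrier B" and J = LB and p = id and U = "carrier N"
        and \<mu> = "mul B" and \<mu>' = "mul T" and \<rho> = rN and \<rho>' = actR and f = "\<lambda>ts. unfold_word f (LX x # ts)" and xs = bs]
      multilinear_mem[OF multilinear_unfold_word[OF assms(1)], of "LX x # map LB _"] assms
    by (auto simp: actR_def image_subset_iff)
  also have "\<dots> = N.right.brr (f [] x) bs"
  proof (rule N.right.bar_cong)
    fix ys assume "set ys \<subseteq> carrier B"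
    then show "unfold_word f (LX x # map LB ys) = f [] x ys"
      using unfold_word_word[OF assms(1), of "[]" x ys] assms(2) by (simp del: unfold_word.simps)
  qed (rule assms(3))
  finally show ?thesis using Cons by simp
qed

lemma lead_word:
  assumes "tri_ml f" "set as \<subseteq> carrier A" "x \<in> carrier X" "set bs \<subseteq> carrier B"
  shows "lead actL (unfold_word f) (word as x bs) = (case as of [] \<Rightarrow> 0 | a # as' \<Rightarrow> lN a (f as' x bs))"
proof (cases as)
  case Nil
  have "unfold_word f (map LB bs) \<in> carrier N"
    using multilinear_mem[OF multilinear_unfold_word[OF assms(1)], of "map LB bs"] assms by auto
  then show ?thesis using Nil by (simp add: actL_def)
next
  case (Cons a as')
  then show ?thesis using unfold_word_word[OF assms(1), of as' x bs] assms by (simp add: actL_def)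
qed

lemma subspace_cochains: "module.subspace (\<lambda>c f as x bs. scal N c (f as x bs)) (cochains n)"
proof -
  have "vector_space (\<lambda>c (f :: 'a list \<Rightarrow> 'x \<Rightarrow> 'b list \<Rightarrow> 'n) as x bs. scal N c (f as x bs))"
    by (intro vector_space_fun N.X.vector_space_scal)
  then interpret F: vector_space "\<lambda>c (f :: 'a list \<Rightarrow> 'x \<Rightarrow> 'b list \<Rightarrow> 'n) as x bs. scal N c (f as x bs)" .
  interpret AN: kspace_pair A N ..
  show ?thesis
  proof (rule F.subspaceI)
    show "0 \<in> cochains n"
      by (auto simp: cochains_iff tri_multilinear_def linear_on_def intro: AN.multilinear_zero_map N.right.multilinear_zero_map)
  next
    fix f g assume "f \<in> cochains n" "g \<in> cochains n"
    then show "f + g \<in> cochains n"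
      by (auto simp: cochains_iff tri_multilinear_def linear_on_def N.X.scale_right_distrib
        intro: AN.multilinear_plus N.right.multilinear_plus)
  next
    fix c f assume "f \<in> cochains n"
    then show "(\<lambda>as x bs. scal N c (f as x bs)) \<in> cochains n"
      by (auto simp: cochains_iff tri_multilinear_def linear_on_def N.X.scale_right_distrib mult.commute
        intro: AN.multilinear_scaled N.right.multilinear_scaled)
  qed
qed

lemma vector_space_cochains: "vector_space (\<lambda>c (f :: 'a list \<Rightarrow> 'x \<Rightarrow> 'b list \<Rightarrow> 'n) as x bs. scal N c (f as x bs))"
  by (intro vector_space_fun N.X.vector_space_scal)

lemma linear_tri_diff:
  "linear_on (\<lambda>c f as x bs. scal N c (f as x bs)) (\<lambda>c f as x bs. scal N c (f as x bs)) (cochains n) tri_diff"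
  unfolding linear_on_def
proof (intro conjI ballI allI ext)
  fix f g as x bs assume f: "f \<in> cochains n" and g: "g \<in> cochains n"
  have F: "unfold_word f ts \<in> carrier N" "unfold_word g ts \<in> carrier N" if "set ts \<subseteq> carrier T" for ts
    using f g multilinear_mem[OF multilinear_unfold_word that] by (simp_all add: cochains_iff)
  show "tri_diff (f + g) as x bs = (tri_diff f + tri_diff g) as x bs"
  proof (cases "set as \<subseteq> carrier A \<and> x \<in> carrier X \<and> set bs \<subseteq> carrier B")
    case True
    then have w: "set (word as x bs) \<subseteq> carrier T" using set_word by blast
    have u: "unfold_word (f + g) = (\<lambda>ts. unfold_word f ts + unfold_word g ts)"
      by (rule ext) (simp add: plus_fun_def unfold_word_add)
    have "lead actL (\<lambda>ts. unfold_word f ts + unfold_word g ts) (word as x bs) =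
      lead actL (unfold_word f) (word as x bs) + lead actL (unfold_word g) (word as x bs)"
    proof (cases "word as x bs")
      case (Cons t ts)
      then have "fst t \<in> carrier A" "set ts \<subseteq> carrier T" using w by (auto simp: tri_alg_def)
      then show ?thesis using Cons F by (simp add: actL_def N.lact_add_right)
    qed simp
    then show ?thesis
      using True TN.bar_add[of "unfold_word f" "unfold_word g", OF _ _ w] F by (simp add: tri_diff_def u)
  qed (auto simp: tri_diff_def)
next
  fix c f as x bs assume f: "f \<in> cochains n"
  have F: "unfold_word f ts \<in> carrier N" if "set ts \<subseteq> carrier T" for ts
    using f multilinear_mem[OF multilinear_unfold_word that] by (simp add: cochains_iff)
  show "tri_diff (\<lambda>as x bs. scal N c (f as x bs)) as x bs = scal N c (tri_diff f as x bs)"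
  proof (cases "set as \<subseteq> carrier A \<and> x \<in> carrier X \<and> set bs \<subseteq> carrier B")
    case True
    then have w: "set (word as x bs) \<subseteq> carrier T" using set_word by blast
    have u: "unfold_word (\<lambda>as x bs. scal N c (f as x bs)) = (\<lambda>ts. scal N c (unfold_word f ts))"
      using unfold_word_scal by blast
    have "lead actL (\<lambda>ts. scal N c (unfold_word f ts)) (word as x bs) =
      scal N c (lead actL (unfold_word f) (word as x bs))"
    proof (cases "word as x bs")
      case (Cons t ts)
      then have "fst t \<in> carrier A" "set ts \<subseteq> carrier T" using w by (auto simp: tri_alg_def)
      then show ?thesis using Cons F by (simp add: actL_def N.lact_scal_right)
    qed simp
    then show ?thesis
      using True TN.bar_scal[of "unfold_word f", OF _ w] F by (simp add: tri_diff_def u N.X.scale_right_distrib)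
  qed (auto simp: tri_diff_def)
qed

text \<open>Values on spanning vectors determine a cochain. The arguments are released in turn: the
  entry from \<open>X\<close>, then those from \<open>A\<close>, then those from
  \<open>B\<close>.\<close>

lemma findim_cochains:
  assumes "fin_dim A" "fin_dim B" "fin_dim X" "fin_dim N"
  shows "findim (\<lambda>c f as x bs. scal N c (f as x bs)) (cochains n)"
proof -
  obtain SA where SA: "finite SA" "X.A.span SA = carrier A" using assms(1) by (auto simp: fin_dim_def)
  obtain SB where SB: "finite SB" "X.B.span SB = carrier B" using assms(2) by (auto simp: fin_dim_def)
  obtain SX where SX: "finite SX" "X.X.span SX = carrier X" using assms(3) by (auto simp: fin_dim_def)
  interpret AN: kspace_pair A N ..
  have sub: "SA \<subseteq> carrier A" "SB \<subseteq> carrier B" "SX \<subseteq> carrier X"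
    using SA(2) SB(2) SX(2) X.A.span_superset X.B.span_superset X.X.span_superset by blast+
  let ?Y = "{as. set as \<subseteq> SA \<and> length as \<le> n} \<times> SX \<times> {bs. set bs \<subseteq> SB \<and> length bs \<le> n}"
  show ?thesis
  proof (rule findim_by_values[OF vector_space_cochains N.X.vector_space_scal subspace_cochains
        N.X.findim_carrier[OF assms(4)], where Y = ?Y and ev = "\<lambda>f (as, x, bs). f as x bs"])
    show "finite ?Y" using SA(1) SB(1) SX(1) by (intro finite_cartesian_product finite_lists_length_le)
    show "linear_on (\<lambda>c f as x bs. scal N c (f as x bs)) (scal N) (cochains n) (\<lambda>f. case y of (as, x, bs) \<Rightarrow> f as x bs)" for y
      by (auto simp: linear_on_def split: prod.split)
    show "(case y of (as, x, bs) \<Rightarrow> f as x bs) \<in> carrier N" if "f \<in> cochains n" for f y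
      using cochains_mem[OF that] by (auto split: prod.split)
    fix f assume f: "f \<in> cochains n" and 0: "\<And>y. y \<in> ?Y \<Longrightarrow> (case y of (as, x, bs) \<Rightarrow> f as x bs) = 0"
    have m: "tri_ml f" using f by (simp add: cochains_iff)
    have 1: "f as x bs = 0" if "set as \<subseteq> SA" "x \<in> SX" "set bs \<subseteq> SB" for as x bs
    proof (cases "Suc (length as + length bs) = n")
      case True
      then show ?thesis using 0[of "(as, x, bs)"] that by auto
    qed (use f in \<open>auto simp: cochains_iff\<close>)
    have 2: "f as x bs = 0" if as: "set as \<subseteq> SA" and x: "x \<in> carrier X" and bs: "set bs \<subseteq> SB" for as x bs
    proof -
      have l: "linear_on (scal X) (scal N) (carrier X) (\<lambda>x. f as x bs)"
        using tri_multilinear_linear[OF m] as bs sub by blast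
      have "x \<in> X.X.span SX" using x SX(2) by simp
      then have "x \<in> carrier X \<and> f as x bs = 0"
      proof (induction rule: X.X.span_induct_alt)
        case base
        show ?case using linear_on_scale[OF l, of 0 0] by simp
      next
        case (step c u v)
        then show ?case using linear_on_add[OF l, of "scal X c u" v] linear_on_scale[OF l, of u c] 1[OF as _ bs, of u] sub by auto
      qed
      then show ?thesis by simp
    qed
    have 3: "f as x bs = 0" if as: "set as \<subseteq> carrier A" and x: "x \<in> carrier X" and bs: "set bs \<subseteq> SB" for as x bs
    proof -
      have "multilinear A N (\<lambda>as. f as x bs)" using m x bs sub by (auto simp: tri_multilinear_def)
      then show ?thesis using AN.multilinear_eq_0[OF _ SA(2) _ as, of "\<lambda>as. f as x bs"] 2[OF _ x bs] by blast
    qed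
    have 4: "f as x bs = 0" if as: "set as \<subseteq> carrier A" and x: "x \<in> carrier X" and bs: "set bs \<subseteq> carrier B" for as x bs
    proof -
      have "multilinear B N (f as x)" using m x as by (auto simp: tri_multilinear_def)
      then show ?thesis using N.right.multilinear_eq_0[OF _ SB(2) _ bs, of "f as x"] 3[OF as x] by blast
    qed
    show "f = 0"
    proof (intro ext)
      fix as x bs
      show "f as x bs = 0 as x bs"
      proof (cases "set as \<subseteq> carrier A \<and> x \<in> carrier X \<and> set bs \<subseteq> carrier B")
        case True
        then show ?thesis using 4 by simp
      next
        case False
        then have "f as x bs = 0" using f unfolding cochains_iff by blast
        then show ?thesis by simp
      qed
    qed
  qed
qed

lemma tri_complex:
  assumes "fin_dim A" "fin_dim B" "fin_dim X" "fin_dim N"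
  shows "cochain_complex (\<lambda>c f as x bs. scal N c (f as x bs)) cochains (\<lambda>_. tri_diff)"
  using vector_space_cochains findim_cochains[OF assms] linear_tri_diff tri_diff_closed tri_diff_diff
  by (intro cochain_complex.intro)

end

text \<open>A degreewise image of a complex is a complex. For the map \<open>restr\<close>, this
  replaces a verification that the glued differential of \<open>model\<close> squares to
  zero.\<close>

lemma (in cochain_map) codomain_complex:
  assumes surj: "\<And>w n. w \<in> D n \<Longrightarrow> \<exists>f\<in>C n. \<phi> f = w"
  shows "cochain_complex t D \<epsilon>"
proof (rule cochain_complex.intro)
  have vt: "vector_space t" by unfold_locales
  show "vector_space t" by (rule vt)
  fix n
  have im: "\<phi> ` C n = D n" using surj map_closed by (auto simp: image_iff)
  show "findim t (D n)" using findim_image(1)[OF dom.vs vt dom.findim_cochains linear_map] im by metis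
  show "linear_on t t (D n) (\<epsilon> n)"
    unfolding linear_on_def
  proof (intro conjI ballI allI)
    fix x y assume "x \<in> D n" "y \<in> D n"
    then obtain a b where ab: "a \<in> C n" "b \<in> C n" "x = \<phi> a" "y = \<phi> b" using surj by metis
    have "a + b \<in> C n" using module.subspace_add[OF vector_space_module[OF dom.vs] dom.subspace_cochains] ab by blast
    then have "\<epsilon> n (\<phi> (a + b)) = \<phi> (\<delta> n (a + b))" by (simp add: map_diff)
    also have "\<dots> = \<phi> (\<delta> n a) + \<phi> (\<delta> n b)"
      using ab linear_on_add[OF linear_map[of "Suc n"], of "\<delta> n a" "\<delta> n b"]
      by (simp add: linear_on_add[OF dom.linear_diff] dom.diff_closed)
    finally show "\<epsilon> n (x + y) = \<epsilon> n x + \<epsilon> n y"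
      using ab by (simp add: linear_on_add[OF linear_map] map_diff)
  next
    fix c x assume "x \<in> D n"
    then obtain a where ab: "a \<in> C n" "x = \<phi> a" using surj by metis
    have "s c a \<in> C n" using module.subspace_scale[OF vector_space_module[OF dom.vs] dom.subspace_cochains] ab by blast
    then have "\<epsilon> n (\<phi> (s c a)) = \<phi> (\<delta> n (s c a))" by (simp add: map_diff)
    also have "\<dots> = t c (\<phi> (\<delta> n a))"
      using ab linear_on_scale[OF linear_map[of "Suc n"], of "\<delta> n a"]
      by (simp add: linear_on_scale[OF dom.linear_diff] dom.diff_closed)
    finally show "\<epsilon> n (t c x) = t c (\<epsilon> n x)"
      using ab by (simp add: linear_on_scale[OF linear_map] map_diff)
  qed
  fix f assume "f \<in> D n"
  then obtain a where a: "a \<in> C n" "f = \<phi> a" using surj by metis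
  then show "\<epsilon> n f \<in> D (Suc n)" using map_diff map_closed dom.diff_closed by metis
  have "\<epsilon> (Suc n) (\<epsilon> n f) = \<phi> (\<delta> (Suc n) (\<delta> n a))" using a by (simp add: map_diff dom.diff_closed)
  then show "\<epsilon> (Suc n) (\<epsilon> n f) = 0" using a by (simp add: dom.diff_diff map_0)
qed

section \<open>The Hochschild complex of a triangular algebra\<close>

locale triangular = bimodule A B X l r
  for A :: "('k::field, 'a::ab_group_add) alg" and B :: "('k, 'b::ab_group_add) alg"
    and X :: "('k, 'x::ab_group_add, 'z) vspace_scheme" and l r
begin

sublocale D: bimodule_pair A B X l r X l r ..

sublocale HA: hochschild_algebra A ..
sublocale HB: hochschild_algebra B ..

definition peirce_idem :: "bool \<Rightarrow> 'a \<times> 'x \<times> 'b" where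
  "peirce_idem i = (if i then (idt A, 0, 0) else (0, 0, idt B))"

lemma UNIV_bool_sum: "(\<Sum>i\<in>UNIV. h i) = h True + (h False :: 'c::ab_group_add)"
  by (simp add: UNIV_bool add.commute)

lemma idempotents: "algebra_with_idempotents T peirce_idem"
proof -
  interpret kalgebra T by (rule tri_kalgebra)
  show ?thesis
  proof
    show "peirce_idem i \<in> carrier T" for i by (simp add: peirce_idem_def)
    show "mul T (peirce_idem i) (peirce_idem i) = peirce_idem i" for i
      using mul_T[of "idt A" 0 0 "idt A" 0 0] mul_T[of 0 0 "idt B" 0 0 "idt B"]
      by (simp add: peirce_idem_def A.mul_idt_left B.mul_idt_left)
    show "(\<Sum>i\<in>UNIV. peirce_idem i) = idt T"
      by (simp add: UNIV_bool_sum peirce_idem_def idt_T)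
  qed
qed

sublocale H: algebra_with_idempotents T peirce_idem by (rule idempotents)

definition model :: "nat \<Rightarrow> (('a list \<Rightarrow> 'a) \<times> ('b list \<Rightarrow> 'b) \<times> ('a list \<Rightarrow> 'x \<Rightarrow> 'b list \<Rightarrow> 'x)) set" where
  "model n = hochschild_cochains A n \<times> hochschild_cochains B n \<times> D.cochains n"

definition model_scal where
  "model_scal = (\<lambda>c (p :: ('a list \<Rightarrow> 'a) \<times> ('b list \<Rightarrow> 'b) \<times> ('a list \<Rightarrow> 'x \<Rightarrow> 'b list \<Rightarrow> 'x)).
    ((\<lambda>as. scal A c (fst p as)), (\<lambda>bs. scal B c (fst (snd p) bs)), (\<lambda>as x bs. scal X c (snd (snd p) as x bs))))"

text \<open>The two faces in which the letter from \<open>X\<close> multiplies a value whose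
  arguments all lie in one algebra: the last face, when no letter from \<open>B\<close> follows,
  with sign \<open>(-1)^(length as + 1)\<close>, and the first face, when no letter from
  \<open>A\<close> precedes, with sign \<open>+\<close>. \<open>D.tri_diff\<close> does not contain
  them, since its values have only an \<open>X\<close>-part.\<close>

definition glue :: "('a list \<Rightarrow> 'a) \<Rightarrow> ('b list \<Rightarrow> 'b) \<Rightarrow> 'a list \<Rightarrow> 'x \<Rightarrow> 'b list \<Rightarrow> 'x" where
  "glue fA fB as x bs = (if set as \<subseteq> carrier A \<and> x \<in> carrier X \<and> set bs \<subseteq> carrier B then
    (if bs = [] then (if even (length as) then - l (fA as) x else l (fA as) x) else 0) +
    (if as = [] then r x (fB bs) else 0) else 0)"

definition model_diff where
  "model_diff n p = (hochschild_diff A n (fst p), hochschild_diff B n (fst (snd p)),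
    (\<lambda>as x bs. D.tri_diff (snd (snd p)) as x bs + glue (fst p) (fst (snd p)) as x bs))"

definition restr :: "(('a \<times> 'x \<times> 'b) list \<Rightarrow> 'a \<times> 'x \<times> 'b)
    \<Rightarrow> ('a list \<Rightarrow> 'a) \<times> ('b list \<Rightarrow> 'b) \<times> ('a list \<Rightarrow> 'x \<Rightarrow> 'b list \<Rightarrow> 'x)" where
  "restr f = ((\<lambda>as. fst (f (map LA as))), (\<lambda>bs. snd (snd (f (map LB bs)))), (\<lambda>as x bs. fst (snd (f (word as x bs)))))"

text \<open>A section of \<open>restr\<close>; composed with \<open>restr\<close> it turns out to be
  the Peirce projection, see \<open>projection_eq_extend\<close>.\<close>

definition extend :: "nat \<Rightarrow> ('a list \<Rightarrow> 'a) \<times> ('b list \<Rightarrow> 'b) \<times> ('a list \<Rightarrow> 'x \<Rightarrow> 'b list \<Rightarrow> 'x)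
    \<Rightarrow> ('a \<times> 'x \<times> 'b) list \<Rightarrow> 'a \<times> 'x \<times> 'b" where
  "extend n p = (\<lambda>ts. if length ts = n \<and> set ts \<subseteq> carrier T then
    (fst p (map fst ts), unfold_word (snd (snd p)) ts, fst (snd p) (map (snd \<circ> snd) ts)) else 0)"

lemma vector_space_model: "vector_space model_scal"
  using vector_space_prod[OF vector_space_fun[OF A.vector_space_scal]
      vector_space_prod[OF vector_space_fun[OF B.vector_space_scal] D.vector_space_cochains]]
  by (simp add: model_scal_def)

lemma multilinear_components:
  assumes "multilinear T T f"
  shows "multilinear T A (\<lambda>ts. fst (f ts))" "multilinear T X (\<lambda>ts. fst (snd (f ts)))" "multilinear T B (\<lambda>ts. snd (snd (f ts)))"
proof -
  show "multilinear T A (\<lambda>ts. fst (f ts))"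
  proof (rule multilinearI, goal_cases)
    case (1 xs) then show ?case using multilinear_mem[OF assms 1] by simp
  next
    case (2 xs ys x y) then show ?case using multilinear_add[OF assms 2] by simp
  next
    case (3 xs ys x c) then show ?case using multilinear_scal[OF assms 3] by simp
  qed
  show "multilinear T X (\<lambda>ts. fst (snd (f ts)))"
  proof (rule multilinearI, goal_cases)
    case (1 xs) then show ?case using multilinear_mem[OF assms 1] by simp
  next
    case (2 xs ys x y) then show ?case using multilinear_add[OF assms 2] by simp
  next
    case (3 xs ys x c) then show ?case using multilinear_scal[OF assms 3] by simp
  qed
  show "multilinear T B (\<lambda>ts. snd (snd (f ts)))"
  proof (rule multilinearI, goal_cases)
    case (1 xs) then show ?case using multilinear_mem[OF assms 1] by simp
  next
    case (2 xs ys x y) then show ?case using multilinear_add[OF assms 2] by simp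
  next
    case (3 xs ys x c) then show ?case using multilinear_scal[OF assms 3] by simp
  qed
qed

lemma multilinear_map_LA:
  assumes "multilinear T U F"
  shows "multilinear A U (\<lambda>as. F (map LA as))"
proof (rule multilinearI, goal_cases)
  case (1 xs) then show ?case using multilinear_mem[OF assms] by simp
next
  case (2 xs ys x y)
  then show ?case using multilinear_add[OF assms, of "map LA xs" "map LA ys" "LA x" "LA y"] by simp
next
  case (3 xs ys x c)
  then show ?case using multilinear_scal[OF assms, of "map LA xs" "map LA ys" "LA x" c] by simp
qed

lemma multilinear_map_LB:
  assumes "multilinear T U F"
  shows "multilinear B U (\<lambda>bs. F (map LB bs))"
proof (rule multilinearI, goal_cases)
  case (1 xs) then show ?case using multilinear_mem[OF assms] by simp
next
  case (2 xs ys x y)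
  then show ?case using multilinear_add[OF assms, of "map LB xs" "map LB ys" "LB x" "LB y"] by simp
next
  case (3 xs ys x c)
  then show ?case using multilinear_scal[OF assms, of "map LB xs" "map LB ys" "LB x" c] by simp
qed

section \<open>Restriction to and extension from the Peirce components\<close>

lemma restr_closed:
  assumes "f \<in> hochschild_cochains T n"
  shows "restr f \<in> model n"
proof -
  have f: "multilinear T T f" and z: "\<And>ts. \<not> (length ts = n \<and> set ts \<subseteq> carrier T) \<Longrightarrow> f ts = 0"
    using assms by (auto simp: H.hochschild_cochains_iff)
  note m = multilinear_components[OF f]
  have "(\<lambda>as. fst (f (map LA as))) \<in> hochschild_cochains A n"
    using multilinear_map_LA[OF m(1)] z by (simp add: HA.hochschild_cochains_iff)
  moreover have "(\<lambda>bs. snd (snd (f (map LB bs)))) \<in> hochschild_cochains B n"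
    using multilinear_map_LB[OF m(3)] z by (simp add: HB.hochschild_cochains_iff)
  moreover have "(\<lambda>as x bs. fst (snd (f (word as x bs)))) \<in> D.cochains n"
    unfolding D.cochains_iff
  proof (intro conjI allI impI)
    show "D.tri_ml (\<lambda>as x bs. fst (snd (f (word as x bs))))" by (rule D.tri_multilinear_word[OF m(2)])
    fix as x bs
    assume "\<not> (set as \<subseteq> carrier A \<and> x \<in> carrier X \<and> set bs \<subseteq> carrier B \<and> Suc (length as + length bs) = n)"
    then have "\<not> (length (word as x bs) = n \<and> set (word as x bs) \<subseteq> carrier T)"
      unfolding D.set_word_iff length_word by blast
    then show "fst (snd (f (word as x bs))) = 0" using z by simp
  qed
  ultimately show ?thesis by (simp add: model_def restr_def)
qed

lemma extend_closed:
  assumes "p \<in> model n"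
  shows "extend n p \<in> hochschild_cochains T n"
proof -
  obtain fA fB fN where p: "p = (fA, fB, fN)" by (cases p) auto
  have f: "multilinear A A fA" "multilinear B B fB" "D.tri_ml fN"
    using assms by (auto simp: p model_def HA.hochschild_cochains_iff HB.hochschild_cochains_iff D.cochains_iff)
  note m = D.multilinear_unfold_word[OF f(3)]
  have mA: "set (map fst ts) \<subseteq> carrier A" if "set ts \<subseteq> carrier T" for ts :: "('a \<times> 'x \<times> 'b) list"
  proof
    fix a assume "a \<in> set (map fst ts)"
    then obtain t where "t \<in> carrier T" "a = fst t" using \<open>set ts \<subseteq> carrier T\<close> unfolding set_map by blast
    then show "a \<in> carrier A" using fst_T by simp
  qed
  note mB = D.map_B_mem
  have "multilinear T T (\<lambda>ts. (fA (map fst ts), unfold_word fN ts, fB (map (snd \<circ> snd) ts)))"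
  proof (rule multilinearI, goal_cases)
    case (1 xs)
    then show ?case using multilinear_mem[OF f(1) mA] multilinear_mem[OF f(2) mB] multilinear_mem[OF m] by simp
  next
    case (2 xs ys x y)
    then show ?case
      using multilinear_add[OF f(1), of "map fst xs" "map fst ys" "fst x" "fst y"] mA[of xs] mA[of ys]
        multilinear_add[OF f(2), of "map (snd \<circ> snd) xs" "map (snd \<circ> snd) ys" "snd (snd x)" "snd (snd y)"] mB[of xs] mB[of ys]
        multilinear_add[OF m 2] by simp
  next
    case (3 xs ys x c)
    then show ?case
      using multilinear_scal[OF f(1), of "map fst xs" "map fst ys" "fst x" c] mA[of xs] mA[of ys]
        multilinear_scal[OF f(2), of "map (snd \<circ> snd) xs" "map (snd \<circ> snd) ys" "snd (snd x)" c] mB[of xs] mB[of ys]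
        multilinear_scal[OF m 3] by simp
  qed
  then show ?thesis
    unfolding H.hochschild_cochains_iff extend_def p
    by (intro conjI) (auto intro: D.T.self.multilinear_truncate)
qed

lemma restr_extend:
  assumes "p \<in> model n"
  shows "restr (extend n p) = p"
proof -
  obtain fA fB fN where p: "p = (fA, fB, fN)" by (cases p) auto
  have f: "fA \<in> hochschild_cochains A n" "fB \<in> hochschild_cochains B n" "fN \<in> D.cochains n"
    using assms by (auto simp: p model_def)
  have "fst (extend n p (map LA as)) = fA as" for as
    using f(1) by (auto simp: extend_def p o_def HA.hochschild_cochains_iff)
  moreover have "snd (snd (extend n p (map LB bs))) = fB bs" for bs
    using f(2) by (auto simp: extend_def p o_def HB.hochschild_cochains_iff)
  moreover have "fst (snd (extend n p (word as x bs))) = fN as x bs" for as x bs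
  proof (cases "length (word as x bs) = n \<and> set (word as x bs) \<subseteq> carrier T")
    case True
    then show ?thesis using f(3) D.unfold_word_word[of fN as x bs]
      by (simp add: extend_def p D.set_word_iff D.cochains_iff)
  next
    case False
    then have "fN as x bs = 0" using f(3) unfolding D.cochains_iff D.set_word_iff length_word by blast
    then show ?thesis using False by (auto simp: extend_def)
  qed
  ultimately show ?thesis by (simp add: restr_def p)
qed

lemma bar_map_LB:
  assumes "multilinear T T f" "set bs \<subseteq> carrier B"
  shows "fst (snd (D.T.self.brr f (map LB bs))) = right.brr (\<lambda>ys. fst (snd (f (map LB ys)))) bs"
    and "snd (snd (D.T.self.brr f (map LB bs))) = B.self.brr (\<lambda>ys. snd (snd (f (map LB ys)))) bs"
  using bar_natural[where S = "carrier B" and J = LB and p = "\<lambda>t. fst (snd t)" and U = "carrier T"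
        and \<mu> = "mul B" and \<mu>' = "mul T" and \<rho> = r and \<rho>' = "mul T" and f = f and xs = bs]
    bar_natural[where S = "carrier B" and J = LB and p = "\<lambda>t. snd (snd t)" and U = "carrier T"
        and \<mu> = "mul B" and \<mu>' = "mul T" and \<rho> = "mul B" and \<rho>' = "mul T" and f = f and xs = bs]
    multilinear_mem[OF assms(1)] assms(2) D.T.self.ract_mem
  by (auto split: prod.splits)

lemma bar_map_LA:
  assumes "multilinear T T f" "set as \<subseteq> carrier A"
  shows "fst (D.T.self.brr f (map LA as)) = A.self.brr (\<lambda>ys. fst (f (map LA ys))) as"
  using bar_natural[where S = "carrier A" and J = LA and p = fst and U = "carrier T"
        and \<mu> = "mul A" and \<mu>' = "mul T" and \<rho> = "mul A" and \<rho>' = "mul T" and f = f and xs = as]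
    multilinear_mem[OF assms(1)] assms(2) D.T.self.ract_mem
  by (auto split: prod.splits)

lemma bar_map_LB_TN:
  assumes "multilinear T X F" "set bs \<subseteq> carrier B"
  shows "D.TN.brr F (map LB bs) = right.brr (\<lambda>ys. F (map LB ys)) bs"
  using bar_natural[where S = "carrier B" and J = LB and p = id and U = "carrier X"
        and \<mu> = "mul B" and \<mu>' = "mul T" and \<rho> = r and \<rho>' = D.actR and f = F and xs = bs]
    multilinear_mem[OF assms(1)] assms(2)
  by (auto simp: D.actR_def)

text \<open>Taking \<open>X\<close>-parts commutes with every face except the last one when no
  letter from \<open>B\<close> follows: there the letter from \<open>X\<close> is multiplied by the
  \<open>A\<close>-part of the value. Each letter from \<open>A\<close> removed by the induction
  reverses the sign.\<close>

lemma bar_word: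
  assumes "multilinear T T f" "set as \<subseteq> carrier A" "x \<in> carrier X" "set bs \<subseteq> carrier B"
  shows "fst (snd (D.T.self.brr f (word as x bs))) = D.TN.brr (\<lambda>ts. fst (snd (f ts))) (word as x bs)
    + (if bs = [] then (if even (length as) then - l (fst (f (map LA as))) x else l (fst (f (map LA as))) x) else 0)"
  using assms(1,2)
proof (induction as arbitrary: f)
  case Nil
  show ?case
  proof (cases bs)
    case bs: Nil
    have "f [] \<in> carrier T" using multilinear_mem[OF Nil(1), of "[]"] by simp
    then obtain a n b where f: "f [] = (a, n, b)" "a \<in> carrier A" "n \<in> carrier X" "b \<in> carrier B"
      by (cases "f []") auto
    then show ?thesis using bs assms(3) by (simp add: D.actR_def)
  next
    case (Cons b bs')
    have g: "multilinear T T (\<lambda>ts. f (LX x # ts))" using multilinear_Cons[OF Nil(1), of "LX x"] assms(3) by simp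
    have g2: "multilinear T X (\<lambda>ts. fst (snd (f (LX x # ts))))" using multilinear_components(2)[OF g] .
    show ?thesis
      using bar_map_LB(1)[OF g assms(4)] bar_map_LB_TN[OF g2 assms(4)] Cons by simp
  qed
next
  case (Cons a as)
  have g: "multilinear T T (\<lambda>ts. f (LA a # ts))" using multilinear_Cons[OF Cons.prems(1), of "LA a"] Cons.prems by simp
  show ?case
    using Cons.IH[OF g] Cons.prems(2)
    by (simp add: D.T.self.bar_Cons_fun D.TN.bar_Cons_fun)
qed

text \<open>Only the \<open>X\<close>-component is not componentwise: its last face supplies the
  \<open>A\<close>-term of \<open>glue\<close> by \<open>bar_word\<close>, and its first face
  supplies the \<open>B\<close>-term.\<close>

lemma restr_diff:
  assumes f: "f \<in> hochschild_cochains T n"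
  shows "restr (hochschild_diff T n f) = model_diff n (restr f)"
proof -
  have ml: "multilinear T T f" using f by (simp add: H.hochschild_cochains_iff)
  have r: "restr f \<in> model n" by (rule restr_closed[OF f])
  let ?fA = "\<lambda>as. fst (f (map LA as))" and ?fB = "\<lambda>bs. snd (snd (f (map LB bs)))"
    and ?fN = "\<lambda>as x bs. fst (snd (f (word as x bs)))"
  have rA: "?fA \<in> hochschild_cochains A n" and rB: "?fB \<in> hochschild_cochains B n" and rN: "?fN \<in> D.cochains n"
    using r by (auto simp: model_def restr_def)
  note mem = multilinear_mem[OF ml]
  have "fst (hochschild_diff T n f (map LA as)) = hochschild_diff A n ?fA as" for as
  proof (cases "set as \<subseteq> carrier A")
    case True
    have "fst (lead (mul T) f (map LA as)) = lead (mul A) ?fA as"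
      by (cases as) (auto split: prod.splits simp: tri_alg_def)
    then show ?thesis
      using H.hochschild_diff_apply[OF f, of "map LA as"] HA.hochschild_diff_apply[OF rA True] True
        bar_map_LA[OF ml True] by simp
  qed (auto simp: hochschild_diff_def)
  moreover have "snd (snd (hochschild_diff T n f (map LB bs))) = hochschild_diff B n ?fB bs" for bs
  proof (cases "set bs \<subseteq> carrier B")
    case True
    have "snd (snd (lead (mul T) f (map LB bs))) = lead (mul B) ?fB bs"
      by (cases bs) (auto split: prod.splits simp: tri_alg_def)
    then show ?thesis
      using H.hochschild_diff_apply[OF f, of "map LB bs"] HB.hochschild_diff_apply[OF rB True] True
        bar_map_LB(2)[OF ml True] by simp
  qed (auto simp: hochschild_diff_def)
  moreover have "fst (snd (hochschild_diff T n f (word as x bs))) = D.tri_diff ?fN as x bs + glue ?fA ?fB as x bs" for as x bs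
  proof (cases "set as \<subseteq> carrier A \<and> x \<in> carrier X \<and> set bs \<subseteq> carrier B")
    case True
    then have w: "set (word as x bs) \<subseteq> carrier T" by (simp add: D.set_word_iff)
    have N: "D.tri_ml ?fN" using rN by (simp add: D.cochains_iff)
    note uw = D.unfold_word_word[OF N]
    have "D.TN.brr (\<lambda>ts. fst (snd (f ts))) (word as x bs) = D.TN.brr (unfold_word ?fN) (word as x bs)"
    proof (rule D.bar_word_cong)
      have s: "set (map LA as) \<subseteq> carrier T" using True by simp
      show "fst (snd (f (map LA as))) \<in> carrier X" using mem[OF s] by simp
      show "unfold_word ?fN (map LA as) \<in> carrier X" using multilinear_mem[OF D.multilinear_unfold_word[OF N] s] .
    qed (use uw True in auto)
    moreover have "fst (snd (lead (mul T) f (word as x bs))) = lead D.actL (unfold_word ?fN) (word as x bs)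
      + (if as = [] then r x (?fB bs) else 0)"
    proof (cases as)
      case Nil
      have "f (map LB bs) \<in> carrier T" using mem[of "map LB bs"] True by simp
      then obtain a n b where fb: "f (map LB bs) = (a, n, b)" "a \<in> carrier A" "n \<in> carrier X" "b \<in> carrier B"
        by (cases "f (map LB bs)") auto
      have "unfold_word ?fN (map LB bs) \<in> carrier X"
        using multilinear_mem[OF D.multilinear_unfold_word[OF N], of "map LB bs"] True by simp
      then show ?thesis using Nil True fb by (simp add: D.actL_def)
    next
      case (Cons a as')
      have "f (word as' x bs) \<in> carrier T" using mem[of "word as' x bs"] True Cons by (simp add: D.set_word_iff)
      then obtain a' n b where fb: "f (word as' x bs) = (a', n, b)" "a' \<in> carrier A" "n \<in> carrier X" "b \<in> carrier B"
        by (cases "f (word as' x bs)") auto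
      then show ?thesis using Cons True uw[of as' x bs] by (simp add: D.actL_def)
    qed
    ultimately show ?thesis
      using H.hochschild_diff_apply[OF f w] bar_word[OF ml, of as x bs] True
      by (simp add: D.tri_diff_def glue_def)
  next
    case False
    then have "\<not> set (word as x bs) \<subseteq> carrier T" by (simp add: D.set_word_iff)
    then show ?thesis using False by (auto simp: hochschild_diff_def D.tri_diff_def glue_def)
  qed
  ultimately show ?thesis by (simp add: restr_def model_diff_def)
qed

section \<open>The Peirce projection of the triangular algebra\<close>

lemma peirce_part_zero:
  assumes "\<And>zs. set zs \<subseteq> carrier T \<Longrightarrow> f zs = 0" "set ts \<subseteq> carrier T"
  shows "H.pp f i ts = 0"
  using assms
proof (induction ts arbitrary: f i)
  case Nil
  then show ?case by simp
next
  case (Cons t ts)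
  have "H.pp (\<lambda>zs. f (mul T (mul T (peirce_idem i) t) (peirce_idem j) # zs)) j ts = 0" for j
    by (rule Cons.IH) (use Cons.prems in auto)
  then show ?case by simp
qed

lemma peirce_idem_simps: "peirce_idem True = (idt A, 0, 0)" "peirce_idem False = (0, 0, idt B)"
  by (simp_all add: peirce_idem_def)

lemma peirce_corner:
  assumes "a \<in> carrier A" "x \<in> carrier X" "b \<in> carrier B"
  shows "mul T (mul T (peirce_idem True) (a, x, b)) (peirce_idem True) = LA a"
    "mul T (mul T (peirce_idem True) (a, x, b)) (peirce_idem False) = LX x"
    "mul T (mul T (peirce_idem False) (a, x, b)) (peirce_idem True) = 0"
    "mul T (mul T (peirce_idem False) (a, x, b)) (peirce_idem False) = LB b"
  using assms mul_T[of "idt A" 0 0] mul_T[of 0 0 "idt B"]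
  by (simp_all add: peirce_idem_simps zero_prod_def A.mul_idt_left A.mul_idt_right B.mul_idt_left B.mul_idt_right lact_idt ract_idt
      del: mul_T) (simp_all add: tri_alg_def lact_idt ract_idt A.mul_idt_left A.mul_idt_right B.mul_idt_left B.mul_idt_right zero_prod_def)

text \<open>From the corner of \<open>B\<close> a chain of idempotents cannot return to that of
  \<open>A\<close>, as the lower left corner of \<open>T\<close> is 0; a single chain
  remains.\<close>

lemma peirce_part_False:
  assumes "multilinear T T f" "set ts \<subseteq> carrier T"
  shows "H.pp f False ts = mul T (f (map (LB \<circ> snd \<circ> snd) ts)) (peirce_idem False)"
  using assms
proof (induction ts arbitrary: f)
  case (Cons t ts)
  obtain a x b where t: "t = (a, x, b)" "a \<in> carrier A" "x \<in> carrier X" "b \<in> carrier B"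
    using Cons.prems by (cases t) auto
  have g: "multilinear T T (\<lambda>zs. f (LB b # zs))" using multilinear_Cons[OF Cons.prems(1), of "LB b"] t by simp
  have z: "H.pp (\<lambda>zs. f (0 # zs)) True ts = 0"
    by (rule peirce_part_zero) (use D.T.self.multilinear_Cons_0[OF Cons.prems(1)] Cons.prems in auto)
  show ?case using Cons.IH[OF g] Cons.prems z t by (simp add: UNIV_bool_sum peirce_corner)
qed simp

text \<open>A chain that starts in the corner of \<open>A\<close> stays there or switches once to
  that of \<open>B\<close>. The letter at the switch is taken from \<open>X\<close>, and the sum
  over its position is \<open>unfold_word\<close>. Membership is carried along for the
  induction.\<close>

lemma peirce_part_True:
  assumes "multilinear T T f" "set ts \<subseteq> carrier T"
  shows "mul T (peirce_idem True) (H.pp f True ts) =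
    (fst (f (map (LA \<circ> fst) ts)), unfold_word (\<lambda>as x bs. fst (snd (f (word as x bs)))) ts, 0)
    \<and> H.pp f True ts \<in> carrier T"
  using assms
proof (induction ts arbitrary: f)
  case Nil
  have "f [] \<in> carrier T" using multilinear_mem[OF Nil(1), of "[]"] by simp
  then obtain a n b where f: "f [] = (a, n, b)" "a \<in> carrier A" "n \<in> carrier X" "b \<in> carrier B"
    by (cases "f []") auto
  then show ?case
    by (simp add: peirce_idem_simps tri_alg_def A.mul_idt_left A.mul_idt_right)
next
  case (Cons t ts)
  obtain a x b where t: "t = (a, x, b)" "a \<in> carrier A" "x \<in> carrier X" "b \<in> carrier B"
    using Cons.prems by (cases t) auto
  have g: "multilinear T T (\<lambda>zs. f (LA a # zs))" using multilinear_Cons[OF Cons.prems(1), of "LA a"] t by simp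
  have g2: "multilinear T T (\<lambda>zs. f (LX x # zs))" using multilinear_Cons[OF Cons.prems(1), of "LX x"] t by simp
  have ts: "set ts \<subseteq> carrier T" using Cons.prems by simp
  let ?v = "f (LX x # map (LB \<circ> snd \<circ> snd) ts)"
  have s: "set (map (LB \<circ> snd \<circ> snd) ts) \<subseteq> carrier T" using D.map_B_mem[OF ts] by (auto simp: image_subset_iff)
  have "?v \<in> carrier T" using multilinear_mem[OF g2 s] .
  then obtain a' n' b' where v: "?v = (a', n', b')" "a' \<in> carrier A" "n' \<in> carrier X" "b' \<in> carrier B"
    by (cases "?v") auto
  have e: "mul T (peirce_idem True) (mul T ?v (peirce_idem False)) = (0, n', 0)"
    using v by (simp add: peirce_idem_simps tri_alg_def lact_idt ract_idt)
  have pF: "H.pp (\<lambda>zs. f (LX x # zs)) False ts = mul T ?v (peirce_idem False)"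
    using peirce_part_False[OF g2 ts] .
  have pFm: "mul T ?v (peirce_idem False) \<in> carrier T" using v by (intro D.T.mul_closed H.idem_mem) auto
  note IH = Cons.IH[OF g ts]
  have "H.pp f True (t # ts) = H.pp (\<lambda>zs. f (LA a # zs)) True ts + mul T ?v (peirce_idem False)"
    using t pF by (simp add: UNIV_bool_sum peirce_corner)
  moreover have "mul T (peirce_idem True) (H.pp (\<lambda>zs. f (LA a # zs)) True ts + mul T ?v (peirce_idem False))
    = mul T (peirce_idem True) (H.pp (\<lambda>zs. f (LA a # zs)) True ts) + (0, n', 0)"
    using D.T.mul_add_right[of "peirce_idem True"] IH pFm e by simp
  moreover have "map (LB \<circ> snd \<circ> snd) ts = map LB (map (snd \<circ> snd) ts)" by (simp add: o_def)
  ultimately show ?case using IH t v pFm by (simp add: o_def add.commute)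
qed

lemma projection_eq_extend:
  assumes f: "f \<in> hochschild_cochains T n"
  shows "H.projection n f = extend n (restr f)"
proof (rule ext)
  fix ts
  show "H.projection n f ts = extend n (restr f) ts"
  proof (cases "length ts = n \<and> set ts \<subseteq> carrier T")
    case True
    have ml: "multilinear T T f" using f by (simp add: H.hochschild_cochains_iff)
    have ts: "set ts \<subseteq> carrier T" using True by simp
    have s: "set (map (LB \<circ> snd \<circ> snd) ts) \<subseteq> carrier T" using D.map_B_mem[OF ts] by (auto simp: image_subset_iff)
    let ?v = "f (map (LB \<circ> snd \<circ> snd) ts)"
    have "?v \<in> carrier T" using multilinear_mem[OF ml s] .
    then obtain a' n' b' where v: "?v = (a', n', b')" "a' \<in> carrier A" "n' \<in> carrier X" "b' \<in> carrier B"
      by (cases "?v") auto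
    have "mul T (peirce_idem False) (H.pp f False ts) = (0, 0, b')"
      unfolding peirce_part_False[OF ml ts] using v
      by (simp add: peirce_idem_simps tri_alg_def B.mul_idt_left B.mul_idt_right ract_idt)
    then have "H.projection n f ts = (fst (f (map (LA \<circ> fst) ts)), unfold_word (\<lambda>as x bs. fst (snd (f (word as x bs)))) ts, 0) + (0, 0, b')"
      using True peirce_part_True[OF ml ts] by (simp add: H.projection_def UNIV_bool_sum)
    then show ?thesis using True v by (simp add: extend_def restr_def o_def)
  qed (auto simp: H.projection_def extend_def)
qed

lemma extend_zero: "extend n 0 = 0"
proof (rule ext)
  fix ts :: "('a \<times> 'x \<times> 'b) list"
  have "unfold_word (0 :: 'a list \<Rightarrow> 'x \<Rightarrow> 'b list \<Rightarrow> 'x) ts = 0"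
    using D.unfold_word_zero by (simp add: zero_fun_def)
  then show "extend n 0 ts = 0 ts" by (simp add: extend_def zero_prod_def)
qed

context
  assumes fin: "fin_dim A" "fin_dim B" "fin_dim X"
begin

lemma restr_cochain_map:
  "cochain_map (\<lambda>c f xs. scal T c (f xs)) (hochschild_cochains T) (hochschild_diff T) model_scal model model_diff restr"
proof -
  interpret C: cochain_complex "\<lambda>c f xs. scal T c (f xs)" "hochschild_cochains T" "hochschild_diff T"
    by (rule H.hochschild_complex[OF tri_fin_dim[OF fin]])
  interpret M: vector_space model_scal by (rule vector_space_model)
  show ?thesis
  proof
    show "linear_on (\<lambda>c f xs. scal T c (f xs)) model_scal (hochschild_cochains T n) restr" for n
      by (simp add: linear_on_def restr_def model_scal_def fun_eq_iff)
  qed (simp_all add: restr_closed restr_diff)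
qed

lemma model_complex: "cochain_complex model_scal model model_diff"
proof -
  interpret cochain_map "\<lambda>c f xs. scal T c (f xs)" "hochschild_cochains T" "hochschild_diff T" model_scal model model_diff restr
    by (rule restr_cochain_map)
  show ?thesis
    by (rule codomain_complex) (use extend_closed restr_extend in blast)
qed

text \<open>A cocycle killed by \<open>restr\<close> has projection 0, hence is a coboundary by the
  contraction; surjectivity, also on cocycles, comes from \<open>extend\<close>.\<close>

lemma HH_dim_eq_model: "HH_dim T n = cohomology_dim model_scal model model_diff n"
proof -
  interpret cochain_map "\<lambda>c f xs. scal T c (f xs)" "hochschild_cochains T" "hochschild_diff T" model_scal model model_diff restr
    by (rule restr_cochain_map)
  show ?thesis
    unfolding HH_dim_def
  proof (rule cohomology_dim_eq_if_acyclic_kernel)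
    show "\<exists>f\<in>hochschild_cochains T n. restr f = w" if "w \<in> model n" for w n
      using that extend_closed restr_extend by blast
    show "\<exists>f\<in>hochschild_cochains T n. hochschild_diff T n f = 0 \<and> restr f = w"
      if w: "w \<in> model n" "model_diff n w = 0" for w n
    proof -
      let ?f = "extend n w"
      have f: "?f \<in> hochschild_cochains T n" "restr ?f = w"
        using w extend_closed restr_extend by auto
      \<comment> \<open>\<open>?f\<close> is fixed by the projection, which commutes with the
        differential. Hence the differential of \<open>?f\<close> is again an extension, namely that
        of \<open>model_diff n w\<close>, which is 0.\<close>
      have "hochschild_diff T n ?f = hochschild_diff T n (H.projection n ?f)"
        using projection_eq_extend[OF f(1)] f(2) by simp
      also have "\<dots> = H.projection (Suc n) (hochschild_diff T n ?f)"
        by (rule H.projection_diff[OF f(1)])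
      also have "\<dots> = extend (Suc n) (restr (hochschild_diff T n ?f))"
        by (rule projection_eq_extend[OF H.hochschild_diff_closed[OF f(1)]])
      also have "\<dots> = 0" using restr_diff[OF f(1)] f(2) w(2) by (simp add: extend_zero)
      finally show ?thesis using f by blast
    qed
    show "f \<in> coboundaries (hochschild_cochains T) (hochschild_diff T) n"
      if "f \<in> hochschild_cochains T n" "hochschild_diff T n f = 0" "restr f = 0" for f n
      using that projection_eq_extend[of f n] by (intro H.coboundary_if_projection_0) (simp_all add: extend_zero)
  qed
qed

end

end

section \<open>Naturality of the bimodule cochains\<close>

definition tri_pull :: "('k::field, 'y::ab_group_add, 'z) vspace_scheme \<Rightarrow> ('y \<Rightarrow> 'x) \<Rightarrow> ('n \<Rightarrow> 'p::zero)
    \<Rightarrow> ('a list \<Rightarrow> 'x \<Rightarrow> 'b list \<Rightarrow> 'n) \<Rightarrow> 'a list \<Rightarrow> 'y \<Rightarrow> 'b list \<Rightarrow> 'p" where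
  "tri_pull Y J p f = (\<lambda>as y bs. if y \<in> carrier Y then p (f as (J y) bs) else 0)"

text \<open>Linear maps alone already preserve cochains; this form serves for sections and
  projections that ignore the actions. \<open>tri_pullback\<close> adds the actions and with them
  compatibility with the differential.\<close>

locale tri_linear_pullback = S: bimodule_pair A B X lX rX N lN rN + S': bimodule_pair A B Y lY rY P lP rP
  for A :: "('k::field, 'a::ab_group_add) alg" and B :: "('k, 'b::ab_group_add) alg"
    and X :: "('k, 'x::ab_group_add, 'x1) vspace_scheme" and lX rX
    and N :: "('k, 'n::ab_group_add, 'n1) vspace_scheme" and lN rN
    and Y :: "('k, 'y::ab_group_add, 'y1) vspace_scheme" and lY rY
    and P :: "('k, 'p::ab_group_add, 'p1) vspace_scheme" and lP rP +
  fixes J :: "'y \<Rightarrow> 'x" and p :: "'n \<Rightarrow> 'p"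
  assumes J_mem [simp]: "y \<in> carrier Y \<Longrightarrow> J y \<in> carrier X"
    and J_linear: "linear_on (scal Y) (scal X) (carrier Y) J"
    and p_mem [simp]: "n \<in> carrier N \<Longrightarrow> p n \<in> carrier P"
    and p_linear: "linear_on (scal N) (scal P) (carrier N) p"
begin

abbreviation "pull \<equiv> tri_pull Y J p"

lemma p_0 [simp]: "p 0 = 0"
  by (rule linear_on_0[OF S.N.X.vector_space_scal S'.N.X.vector_space_scal S.N.X.subspace_carrier p_linear])

lemma p_minus: "n \<in> carrier N \<Longrightarrow> p (- n) = - p n"
  by (rule linear_on_minus[OF S.N.X.vector_space_scal S'.N.X.vector_space_scal p_linear])

lemma p_diff: "n \<in> carrier N \<Longrightarrow> n' \<in> carrier N \<Longrightarrow> p (n - n') = p n - p n'"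
  by (rule linear_on_diff[OF S.N.X.vector_space_scal S'.N.X.vector_space_scal S.N.X.subspace_carrier p_linear])

lemma p_add: "n \<in> carrier N \<Longrightarrow> n' \<in> carrier N \<Longrightarrow> p (n + n') = p n + p n'"
  by (rule linear_on_add[OF p_linear])

lemma p_scal: "n \<in> carrier N \<Longrightarrow> p (scal N c n) = scal P c (p n)"
  by (rule linear_on_scale[OF p_linear])

lemma multilinear_p:
  assumes "multilinear V N g"
  shows "multilinear V P (\<lambda>xs. p (g xs))"
proof (rule multilinearI, goal_cases)
  case (1 xs)
  then show ?case using multilinear_mem[OF assms] by simp
next
  case (2 xs ys x y)
  have "set (xs @ x # ys) \<subseteq> carrier V" "set (xs @ y # ys) \<subseteq> carrier V" using 2 by auto
  then show ?case using multilinear_add[OF assms 2] multilinear_mem[OF assms] by (simp add: p_add)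
next
  case (3 xs ys x c)
  have "set (xs @ x # ys) \<subseteq> carrier V" using 3 by auto
  then show ?case using multilinear_scal[OF assms 3] multilinear_mem[OF assms] by (simp add: p_scal)
qed

lemma tri_multilinear_pull:
  assumes "S.tri_ml f"
  shows "S'.tri_ml (pull f)"
  unfolding tri_multilinear_def
proof (intro conjI ballI allI impI)
  fix y bs assume "y \<in> carrier Y" "set bs \<subseteq> carrier B"
  then show "multilinear A P (\<lambda>as. pull f as y bs)"
    using assms multilinear_p[of A "\<lambda>as. f as (J y) bs"] by (simp add: tri_pull_def tri_multilinear_def)
next
  fix y as assume "y \<in> carrier Y" "set as \<subseteq> carrier A"
  then show "multilinear B P (pull f as y)"
    using assms multilinear_p[of B "f as (J y)"] by (simp add: tri_pull_def tri_multilinear_def)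
next
  fix as bs assume as: "set as \<subseteq> carrier A" and bs: "set bs \<subseteq> carrier B"
  have l: "linear_on (scal X) (scal N) (carrier X) (\<lambda>x. f as x bs)"
    by (rule tri_multilinear_linear[OF assms as bs])
  note m = tri_multilinear_mem[OF assms as _ bs]
  show "linear_on (scal Y) (scal P) (carrier Y) (\<lambda>y. pull f as y bs)"
    unfolding linear_on_def tri_pull_def
    using linear_on_add[OF J_linear] linear_on_scale[OF J_linear] linear_on_add[OF l] linear_on_scale[OF l] m
    by (simp add: p_add p_scal)
qed

lemma pull_closed:
  assumes "f \<in> S.cochains n"
  shows "pull f \<in> S'.cochains n"
  unfolding S'.cochains_iff
proof (intro conjI allI impI)
  have f: "S.tri_ml f" using assms by (simp add: S.cochains_iff)
  then show "S'.tri_ml (pull f)" by (rule tri_multilinear_pull)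
  fix as y bs
  assume a: "\<not> (set as \<subseteq> carrier A \<and> y \<in> carrier Y \<and> set bs \<subseteq> carrier B \<and> Suc (length as + length bs) = n)"
  show "pull f as y bs = 0"
  proof (cases "y \<in> carrier Y")
    case True
    then have "\<not> (set as \<subseteq> carrier A \<and> J y \<in> carrier X \<and> set bs \<subseteq> carrier B \<and> Suc (length as + length bs) = n)"
      using a J_mem by blast
    then have "f as (J y) bs = 0" using assms unfolding S.cochains_iff by blast
    then show ?thesis by (simp add: tri_pull_def)
  qed (simp add: tri_pull_def)
qed

lemma linear_pull:
  "linear_on (\<lambda>c f as x bs. scal N c (f as x bs)) (\<lambda>c f as x bs. scal P c (f as x bs)) (S.cochains n) pull"
  unfolding linear_on_def
  by (intro conjI ballI allI ext) (simp_all add: tri_pull_def p_add p_scal S.cochains_mem)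

end

locale tri_pullback = tri_linear_pullback A B X lX rX N lN rN Y lY rY P lP rP J p
  for A :: "('k::field, 'a::ab_group_add) alg" and B :: "('k, 'b::ab_group_add) alg"
    and X :: "('k, 'x::ab_group_add, 'x1) vspace_scheme" and lX rX
    and N :: "('k, 'n::ab_group_add, 'n1) vspace_scheme" and lN rN
    and Y :: "('k, 'y::ab_group_add, 'y1) vspace_scheme" and lY rY
    and P :: "('k, 'p::ab_group_add, 'p1) vspace_scheme" and lP rP
    and J :: "'y \<Rightarrow> 'x" and p :: "'n \<Rightarrow> 'p" +
  assumes J_lact: "a \<in> carrier A \<Longrightarrow> y \<in> carrier Y \<Longrightarrow> J (lY a y) = lX a (J y)"
    and J_ract: "b \<in> carrier B \<Longrightarrow> y \<in> carrier Y \<Longrightarrow> J (rY y b) = rX (J y) b"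
    and p_lact: "a \<in> carrier A \<Longrightarrow> n \<in> carrier N \<Longrightarrow> p (lN a n) = lP a (p n)"
    and p_ract: "b \<in> carrier B \<Longrightarrow> n \<in> carrier N \<Longrightarrow> p (rN n b) = rP (p n) b"
begin

text \<open>Follows the recursions \<open>tri_bar_Cons\<close> and \<open>tri_bar_Nil\<close>, where
  the actions on the bimodule variable and the right action on values are the only places at which
  \<open>J\<close> and \<open>p\<close> must be moved.\<close>

lemma pull_bar:
  assumes "S.tri_ml f" "set as \<subseteq> carrier A" "y \<in> carrier Y" "set bs \<subseteq> carrier B"
  shows "S'.TN.brr (unfold_word (pull f)) (word as y bs) = p (S.TN.brr (unfold_word f) (word as (J y) bs))"
  using assms(1,2)
proof (induction as arbitrary: f)
  case Nil
  have b: "S'.N.right.brr (pull f [] y) bs = p (S.N.right.brr (f [] (J y)) bs)"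
  proof -
    have "multilinear B N (f [] (J y))" using Nil(1) assms(3) by (simp add: tri_multilinear_def)
    then have "p (bar (mul B) rN (f [] (J y)) (map id bs)) = bar (mul B) rP (\<lambda>ys. p (f [] (J y) (map id ys))) bs"
      using bar_natural[where S = "carrier B" and J = id and p = p and U = "carrier N"
        and \<mu> = "mul B" and \<mu>' = "mul B" and \<rho> = rP and \<rho>' = rN and f = "f [] (J y)" and xs = bs]
        multilinear_mem[of B N "f [] (J y)"] assms(4) by (auto simp: p_diff p_minus p_ract)
    then show ?thesis using assms(3) by (simp add: tri_pull_def)
  qed
  have bm: "S.N.right.brr (f [] (J y)) bs \<in> carrier N"
    using tri_multilinear_mem[OF Nil(1)] assms(3,4) by (intro S.N.right.bar_mem) auto
  have fm: "f [] (rX (J y) b) bs' \<in> carrier N" if "bs = b # bs'" for b bs'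
    using tri_multilinear_mem[OF Nil(1)] assms(3,4) that by simp
  show ?case
    unfolding S'.tri_bar_Nil[OF tri_multilinear_pull[OF Nil(1)] assms(3,4)] S.tri_bar_Nil[OF Nil(1) J_mem[OF assms(3)] assms(4)] b
    using bm fm assms(3,4) by (cases bs) (simp_all add: p_diff p_minus tri_pull_def J_ract)
next
  case (Cons a as)
  have a: "a \<in> carrier A" "set as \<subseteq> carrier A" using Cons.prems by auto
  have f': "S.tri_ml (\<lambda>as. f (a # as))" by (rule tri_multilinear_Cons[OF Cons.prems(1) a(1)])
  have "S.TN.brr (unfold_word (\<lambda>as. f (a # as))) (word as (J y) bs) \<in> carrier N"
    using multilinear_mem[OF S.TN.multilinear_bar[OF S.multilinear_unfold_word[OF f']] S.set_word] a assms(3,4) by simp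
  moreover have "(case as of [] \<Rightarrow> f [] (lX a (J y)) bs | a' # as' \<Rightarrow> f (mul A a a' # as') (J y) bs) \<in> carrier N"
    using tri_multilinear_mem[OF Cons.prems(1)] a assms(3,4) by (cases as) auto
  moreover have "(case as of [] \<Rightarrow> pull f [] (lY a y) bs | a' # as' \<Rightarrow> pull f (mul A a a' # as') y bs)
    = p (case as of [] \<Rightarrow> f [] (lX a (J y)) bs | a' # as' \<Rightarrow> f (mul A a a' # as') (J y) bs)"
    using a assms(3) by (cases as) (simp_all add: tri_pull_def J_lact)
  moreover have "(\<lambda>as. pull f (a # as)) = pull (\<lambda>as. f (a # as))" by (simp add: tri_pull_def)
  ultimately show ?case
    unfolding S'.tri_bar_Cons[OF tri_multilinear_pull[OF Cons.prems(1)] a assms(3,4)]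
      S.tri_bar_Cons[OF Cons.prems(1) a J_mem[OF assms(3)] assms(4)]
    using Cons.IH[OF f' a(2)] by (simp add: p_diff p_minus)
qed

lemma pull_diff:
  assumes "f \<in> S.cochains n"
  shows "S'.tri_diff (pull f) = pull (S.tri_diff f)"
proof (intro ext)
  fix as y bs
  have f: "S.tri_ml f" using assms by (simp add: S.cochains_iff)
  show "S'.tri_diff (pull f) as y bs = pull (S.tri_diff f) as y bs"
  proof (cases "set as \<subseteq> carrier A \<and> y \<in> carrier Y \<and> set bs \<subseteq> carrier B")
    case True
    then have c: "set as \<subseteq> carrier A" "y \<in> carrier Y" "set bs \<subseteq> carrier B" by auto
    have "S.TN.brr (unfold_word f) (word as (J y) bs) \<in> carrier N"
      using multilinear_mem[OF S.TN.multilinear_bar[OF S.multilinear_unfold_word[OF f]] S.set_word] c by simp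
    moreover have "(case as of [] \<Rightarrow> 0 | a # as' \<Rightarrow> lN a (f as' (J y) bs)) \<in> carrier N"
      using tri_multilinear_mem[OF f] c by (cases as) auto
    moreover have "(case as of [] \<Rightarrow> 0 | a # as' \<Rightarrow> lP a (pull f as' y bs)) = p (case as of [] \<Rightarrow> 0 | a # as' \<Rightarrow> lN a (f as' (J y) bs))"
      using tri_multilinear_mem[OF f] c by (cases as) (auto simp: tri_pull_def p_lact)
    ultimately show ?thesis
      using c unfolding S'.tri_diff_def S.tri_diff_def
      by (simp add: tri_pull_def[of Y J p "S.tri_diff f" for Y] S'.lead_word[OF tri_multilinear_pull[OF f]]
          S.lead_word[OF f] pull_bar[OF f] p_add) (simp add: tri_pull_def S.lead_word[OF f] p_add)
  next
    case False
    then show ?thesis by (auto simp: S'.tri_diff_def S.tri_diff_def tri_pull_def)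
  qed
qed

end

section \<open>Matrix entries\<close>

locale matrix_power = M: triangular A B M lM rM + Pw: triangular A B Pw lP rP
  for A :: "('k::field, 'a::ab_group_add) alg" and B :: "('k, 'b::ab_group_add) alg"
    and M :: "('k, 'm::ab_group_add, 'z) vspace_scheme" and lM rM
    and Pw :: "('k, nat \<Rightarrow> 'm, 'y) vspace_scheme" and lP rP +
  fixes m :: nat
  assumes m_pos: "m \<ge> 1"
    and carrier_Pw: "carrier Pw = {f. (\<forall>i<m. f i \<in> carrier M) \<and> (\<forall>i\<ge>m. f i = 0)}"
    and scal_Pw: "scal Pw c f = (\<lambda>i. scal M c (f i))"
    and lact_Pw: "a \<in> carrier A \<Longrightarrow> f \<in> carrier Pw \<Longrightarrow> lP a f = (\<lambda>i. if i < m then lM a (f i) else 0)"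
    and ract_Pw: "b \<in> carrier B \<Longrightarrow> f \<in> carrier Pw \<Longrightarrow> rP f b = (\<lambda>i. if i < m then rM (f i) b else 0)"
    and fin: "fin_dim A" "fin_dim B" "fin_dim M" "fin_dim Pw"
begin

definition iota :: "nat \<Rightarrow> 'm \<Rightarrow> nat \<Rightarrow> 'm" where
  "iota j x = (\<lambda>k. if k = j then x else 0)"

lemma iota_mem: "j < m \<Longrightarrow> x \<in> carrier M \<Longrightarrow> iota j x \<in> carrier Pw"
  by (auto simp: iota_def carrier_Pw)

lemma Pw_nth: "f \<in> carrier Pw \<Longrightarrow> f i \<in> carrier M"
  by (cases "i < m") (auto simp: carrier_Pw)

lemma linear_iota: "linear_on (scal M) (scal Pw) V (iota j)"
  by (auto simp: linear_on_def iota_def scal_Pw fun_eq_iff)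

lemma linear_nth: "linear_on (scal Pw) (scal M) V (\<lambda>f. f i)"
  by (auto simp: linear_on_def scal_Pw)

lemma iota_lact: "j < m \<Longrightarrow> a \<in> carrier A \<Longrightarrow> x \<in> carrier M \<Longrightarrow> iota j (lM a x) = lP a (iota j x)"
  using iota_mem[of j x] by (auto simp: lact_Pw iota_def fun_eq_iff)

lemma iota_ract: "j < m \<Longrightarrow> b \<in> carrier B \<Longrightarrow> x \<in> carrier M \<Longrightarrow> iota j (rM x b) = rP (iota j x) b"
  using iota_mem[of j x] by (auto simp: ract_Pw iota_def fun_eq_iff)

text \<open>Entry \<open>(i, j)\<close> is a pullback along the \<open>j\<close>-th inclusion
  followed by the \<open>i\<close>-th projection. Both are bimodule maps, so taking entries commutes
  with \<open>tri_diff\<close>.\<close>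

lemma entry_pullback: "i < m \<Longrightarrow> j < m \<Longrightarrow> tri_pullback A B Pw lP rP Pw lP rP M lM rM M lM rM (iota j) (\<lambda>f. f i)"
  by (intro_locales, unfold_locales)
    (simp_all add: iota_mem linear_iota iota_lact iota_ract Pw_nth linear_nth lact_Pw ract_Pw)

lemma unit_pullback: "i < m \<Longrightarrow> j < m \<Longrightarrow> tri_pullback A B M lM rM M lM rM Pw lP rP Pw lP rP (\<lambda>f. f j) (iota i)"
  by (intro_locales, unfold_locales)
    (simp_all add: iota_mem linear_iota iota_lact iota_ract Pw_nth linear_nth lact_Pw ract_Pw)

abbreviation entry :: "nat \<Rightarrow> nat \<Rightarrow> ('a list \<Rightarrow> (nat \<Rightarrow> 'm) \<Rightarrow> 'b list \<Rightarrow> nat \<Rightarrow> 'm) \<Rightarrow> 'a list \<Rightarrow> 'm \<Rightarrow> 'b list \<Rightarrow> 'm"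
  where "entry i j \<equiv> tri_pull M (iota j) (\<lambda>f. f i)"
abbreviation unit_matrix :: "nat \<Rightarrow> nat \<Rightarrow> ('a list \<Rightarrow> 'm \<Rightarrow> 'b list \<Rightarrow> 'm) \<Rightarrow> 'a list \<Rightarrow> (nat \<Rightarrow> 'm) \<Rightarrow> 'b list \<Rightarrow> nat \<Rightarrow> 'm"
  where "unit_matrix i j \<equiv> tri_pull Pw (\<lambda>f. f j) (iota i)"

lemma entry_unit:
  assumes "g \<in> M.D.cochains n"
  shows "entry i j (unit_matrix i' j' g) = (if i = i' \<and> j = j' \<and> j < m then g else 0)"
proof (intro ext)
  fix as x bs
  have z: "g as y bs = 0" if "y \<notin> carrier M" for y using assms that by (auto simp: M.D.cochains_iff)
  have z0: "g as 0 bs = 0"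
  proof (cases "set as \<subseteq> carrier A \<and> set bs \<subseteq> carrier B")
    case True
    then have "linear_on (scal M) (scal M) (carrier M) (\<lambda>x. g as x bs)"
      using assms by (auto simp: M.D.cochains_iff intro: tri_multilinear_linear)
    from linear_on_scale[OF this, of 0 0] show ?thesis by simp
  next
    case False
    then show ?thesis using assms unfolding M.D.cochains_iff by blast
  qed
  show "entry i j (unit_matrix i' j' g) as x bs = (if i = i' \<and> j = j' \<and> j < m then g else 0) as x bs"
  proof (cases "x \<in> carrier M \<and> iota j x \<in> carrier Pw")
    case True
    then show ?thesis
    proof (cases "j < m")
      case False
      \<comment> \<open>For \<open>j >= m\<close> the vector \<open>iota j x\<close> lies in the
        power only if \<open>x = 0\<close>, and then both sides vanish.\<close>
      then have "x = 0" using True by (auto simp: carrier_Pw iota_def dest: spec[of _ j])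
      then show ?thesis using z0 False by (simp add: tri_pull_def iota_def)
    qed (auto simp: tri_pull_def iota_def z0)
  next
    case False
    then show ?thesis using z z0 iota_mem[of j x] by (auto simp: tri_pull_def iota_def)
  qed
qed

section \<open>Separation of the corner entry from the other entries\<close>

definition index_set :: "(nat \<times> nat) set" where
  "index_set = ({..<m} \<times> {..<m}) - {(0, 0)}"

lemma finite_index_set: "finite index_set" and card_index_set: "int (card index_set) = (int m)\<^sup>2 - 1"
proof -
  show "finite index_set" by (simp add: index_set_def)
  have "card index_set = m * m - 1"
    unfolding index_set_def using m_pos by (subst card_Diff_singleton) auto
  moreover have "m * m \<ge> 1" using m_pos by simp
  ultimately show "int (card index_set) = (int m)\<^sup>2 - 1" by (simp add: power2_eq_square of_nat_diff)
qed

definition corner where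
  "corner p = (fst p, fst (snd p), entry 0 0 (snd (snd p)))"

definition off_corner where
  "off_corner p = (\<lambda>(i, j). if (i, j) \<in> index_set then
      entry i j (snd (snd p)) - (if i = j then entry 0 0 (snd (snd p)) else 0) else 0)"

abbreviation "sM \<equiv> \<lambda>c (f :: 'a list \<Rightarrow> 'm \<Rightarrow> 'b list \<Rightarrow> 'm) as x bs. scal M c (f as x bs)"

lemma entry_add: "entry i j (f + g) = entry i j f + entry i j g"
  by (auto simp: tri_pull_def fun_eq_iff)

lemma entry_scal: "entry i j (\<lambda>as x bs. scal Pw c (f as x bs)) = (\<lambda>as x bs. scal M c (entry i j f as x bs))"
  by (auto simp: tri_pull_def fun_eq_iff scal_Pw)

lemma entry_glue:
  assumes "i < m" "j < m" "fA \<in> hochschild_cochains A n" "fB \<in> hochschild_cochains B n"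
  shows "entry i j (Pw.glue fA fB) = (if i = j then M.glue fA fB else 0)"
proof (intro ext)
  fix as x bs
  have mem: "fA as \<in> carrier A" "fB bs \<in> carrier B" for as bs
    using M.HA.hochschild_cochains_mem[OF assms(3)] M.HB.hochschild_cochains_mem[OF assms(4)] by auto
  show "entry i j (Pw.glue fA fB) as x bs = (if i = j then M.glue fA fB else 0) as x bs"
  proof (cases "x \<in> carrier M")
    case True
    have "lP (fA as) (iota j x) i = (if i = j then lM (fA as) x else 0)"
      "rP (iota j x) (fB bs) i = (if i = j then rM x (fB bs) else 0)" for as bs
      using iota_mem[OF assms(2) True] mem assms(1) True by (auto simp: lact_Pw ract_Pw iota_def)
    then show ?thesis using True iota_mem[OF assms(2) True]
      by (cases "i = j") (simp_all add: tri_pull_def Pw.glue_def M.glue_def)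
  qed (simp add: tri_pull_def M.glue_def)
qed

lemma entry_closed: "i < m \<Longrightarrow> j < m \<Longrightarrow> f \<in> Pw.D.cochains n \<Longrightarrow> entry i j f \<in> M.D.cochains n"
  by (rule tri_linear_pullback.pull_closed[OF tri_pullback.axioms(1)[OF entry_pullback]])

lemma entry_diff: "i < m \<Longrightarrow> j < m \<Longrightarrow> f \<in> Pw.D.cochains n \<Longrightarrow> entry i j (Pw.D.tri_diff f) = M.D.tri_diff (entry i j f)"
  by (rule tri_pullback.pull_diff[OF entry_pullback, symmetric])

lemma index_setD: "(i, j) \<in> index_set \<Longrightarrow> i < m \<and> j < m"
  by (auto simp: index_set_def)

lemma corner_map: "cochain_map Pw.model_scal Pw.model Pw.model_diff M.model_scal M.model M.model_diff corner"
proof -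
  interpret C: cochain_complex Pw.model_scal Pw.model Pw.model_diff by (rule Pw.model_complex[OF fin(1,2,4)])
  interpret D: vector_space M.model_scal by (rule M.vector_space_model)
  show ?thesis
  proof
    show "linear_on Pw.model_scal M.model_scal (Pw.model n) corner" for n
      by (auto simp: linear_on_def corner_def entry_add Pw.model_scal_def M.model_scal_def entry_scal)
    show "corner f \<in> M.model n" if "f \<in> Pw.model n" for f n
      using that m_pos entry_closed[of 0 0] by (auto simp: corner_def Pw.model_def M.model_def)
    fix f n assume "f \<in> Pw.model n"
    then obtain fA fB fN where f: "f = (fA, fB, fN)" "fA \<in> hochschild_cochains A n" "fB \<in> hochschild_cochains B n"
      "fN \<in> Pw.D.cochains n" by (auto simp: Pw.model_def)
    have "entry 0 0 (Pw.D.tri_diff fN + Pw.glue fA fB) = M.D.tri_diff (entry 0 0 fN) + M.glue fA fB"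
      using entry_add entry_diff[of 0 0 fN n] entry_glue[of 0 0 fA n fB] f m_pos by simp
    then show "corner (Pw.model_diff n f) = M.model_diff n (corner f)"
      by (simp add: corner_def Pw.model_diff_def M.model_diff_def f plus_fun_def)
  qed
qed

lemma off_corner_map: "cochain_map Pw.model_scal Pw.model Pw.model_diff
  (\<lambda>c F i. sM c (F i)) (\<lambda>n. power_space index_set (M.D.cochains n)) (\<lambda>n F i. M.D.tri_diff (F i)) off_corner"
proof -
  interpret C: cochain_complex Pw.model_scal Pw.model Pw.model_diff by (rule Pw.model_complex[OF fin(1,2,4)])
  interpret G: cochain_complex sM M.D.cochains "\<lambda>_. M.D.tri_diff" by (rule M.D.tri_complex[OF fin(1,2,3,3)])
  have "vector_space (\<lambda>c (F :: nat \<times> nat \<Rightarrow> _) i. sM c (F i))" by (rule vector_space_fun[OF G.vs])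
  then interpret D: vector_space "\<lambda>c (F :: nat \<times> nat \<Rightarrow> _) i. sM c (F i)" .
  interpret GV: vector_space sM by (rule G.vs)
  show ?thesis
  proof
    show "linear_on Pw.model_scal (\<lambda>c F i. sM c (F i)) (Pw.model n) off_corner" for n
      unfolding linear_on_def off_corner_def
      by (auto simp: entry_add Pw.model_scal_def entry_scal fun_eq_iff M.X.scale_right_diff_distrib)
    fix f n assume "f \<in> Pw.model n"
    then obtain fA fB fN where f: "f = (fA, fB, fN)" "fA \<in> hochschild_cochains A n" "fB \<in> hochschild_cochains B n"
      "fN \<in> Pw.D.cochains n" by (auto simp: Pw.model_def)
    have m: "0 < m" using m_pos by simp
    have mem: "entry i j fN - (if i = j then entry 0 0 fN else 0) \<in> M.D.cochains n" if "(i, j) \<in> index_set" for i j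
      using index_setD[OF that] entry_closed[OF _ _ f(4)] m
      by (intro GV.subspace_diff[OF G.subspace_cochains]) (auto intro: G.zero_cochain)
    show "off_corner f \<in> power_space index_set (M.D.cochains n)"
      unfolding power_space_def mem_Collect_eq
    proof (intro conjI ballI allI impI)
      fix ij assume "ij \<in> index_set"
      then show "off_corner f ij \<in> M.D.cochains n"
        using mem[of "fst ij" "snd ij"] by (cases ij) (simp only: off_corner_def f prod.case fst_conv snd_conv if_True)
    next
      fix ij assume "ij \<notin> index_set"
      then show "off_corner f ij = 0" by (cases ij) (simp add: off_corner_def)
    qed
    show "off_corner (Pw.model_diff n f) = (\<lambda>i. M.D.tri_diff (off_corner f i))"
    proof (rule ext)
      fix ij :: "nat \<times> nat"
      obtain i j where ij: "ij = (i, j)" by (cases ij) auto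
      show "off_corner (Pw.model_diff n f) ij = M.D.tri_diff (off_corner f ij)"
      proof (cases "(i, j) \<in> index_set")
        case True
        have c: "i < m" "j < m" using index_setD[OF True] by auto
        have e: "entry i j (Pw.D.tri_diff fN + Pw.glue fA fB) = M.D.tri_diff (entry i j fN) + (if i = j then M.glue fA fB else 0)"
          if "i < m" "j < m" for i j
          using entry_add entry_diff[OF that f(4)] entry_glue[OF that f(2,3)] by simp
        have "M.D.tri_diff (entry i j fN - (if i = j then entry 0 0 fN else 0)) =
           M.D.tri_diff (entry i j fN) - M.D.tri_diff (if i = j then entry 0 0 fN else 0)"
          using entry_closed[OF _ _ f(4)] m c G.zero_cochain
          by (intro linear_on_diff[OF G.vs G.vs G.subspace_cochains G.linear_diff[of n]]) auto
        moreover have "off_corner (Pw.model_diff n f) ij = entry i j (Pw.D.tri_diff fN + Pw.glue fA fB)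
           - (if i = j then entry 0 0 (Pw.D.tri_diff fN + Pw.glue fA fB) else 0)"
          using True by (simp add: off_corner_def ij f Pw.model_diff_def plus_fun_def)
        ultimately show ?thesis
          using True e[OF c] e[OF m m] G.diff_0 by (cases "i = j") (simp_all add: off_corner_def ij f)
      next
        case False
        then show ?thesis using G.diff_0 by (simp add: off_corner_def ij)
      qed
    qed
  qed
qed

text \<open>A vector of the power is the sum of its \<open>iota j (x j)\<close>, so linearity in the
  bimodule entry reduces the claim to the columns.\<close>

lemma entries_eq_0:
  assumes f: "f \<in> Pw.D.cochains n" and 0: "\<And>i j. i < m \<Longrightarrow> j < m \<Longrightarrow> entry i j f = 0"
  shows "f = 0"
proof (intro ext)
  fix as x bs i
  show "f as x bs i = 0 as x bs i"
  proof (cases "set as \<subseteq> carrier A \<and> x \<in> carrier Pw \<and> set bs \<subseteq> carrier B")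
    case True
    have lin: "linear_on (scal Pw) (scal Pw) (carrier Pw) (\<lambda>x. f as x bs)"
      using f True by (auto simp: Pw.D.cochains_iff intro: tri_multilinear_linear)
    have xm: "x k \<in> carrier M" for k using True Pw_nth by blast
    have z: "f as (iota j (x j)) bs = 0" if "j < m" for j
    proof (rule ext)
      fix i
      have "f as (iota j (x j)) bs \<in> carrier Pw" by (rule Pw.D.cochains_mem[OF f])
      moreover have "f as (iota j (x j)) bs i = 0" if "i < m"
        using fun_cong[OF fun_cong[OF fun_cong[OF 0[OF that \<open>j < m\<close>], of as], of "x j"], of bs] xm by (simp add: tri_pull_def)
      ultimately show "f as (iota j (x j)) bs i = 0 i" by (cases "i < m") (auto simp: carrier_Pw)
    qed
    have "(\<Sum>j\<in>J. iota j (x j)) \<in> carrier Pw \<and> f as (\<Sum>j\<in>J. iota j (x j)) bs = 0" if "finite J" "J \<subseteq> {..<m}" for J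
      using that
    proof (induction J rule: finite_induct)
      case empty
      show ?case
        using linear_on_0[OF Pw.X.vector_space_scal Pw.X.vector_space_scal Pw.X.subspace_carrier lin] Pw.X.zero_mem
        by (simp add: zero_fun_def)
    next
      case (insert j J)
      let ?S = "\<Sum>j\<in>J. iota j (x j)"
      have S: "?S \<in> carrier Pw" "f as ?S bs = 0" "j < m" using insert by auto
      have j: "iota j (x j) \<in> carrier Pw" using iota_mem[OF S(3) xm] .
      have "f as (iota j (x j) + ?S) bs = f as (iota j (x j)) bs + f as ?S bs"
        by (rule linear_on_add[OF lin j S(1)])
      also have "\<dots> = 0" unfolding z[OF S(3)] S(2) by (rule add_0)
      finally show ?case
        unfolding sum.insert[OF insert(1,2)] using Pw.X.add_mem[OF j S(1)] by blast
    qed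
    moreover have "(\<Sum>j<m. iota j (x j)) = x"
    proof (rule ext)
      fix k
      have "(\<Sum>j<m. iota j (x j)) k = (\<Sum>j<m. iota j (x j) k)" by (induction m) simp_all
      also have "\<dots> = (if k < m then x k else 0)" by (simp add: iota_def)
      also have "\<dots> = x k" using True by (auto simp: carrier_Pw)
      finally show "(\<Sum>j<m. iota j (x j)) k = x k" .
    qed
    ultimately show ?thesis by (metis finite_lessThan order_refl zero_fun_apply)
  next
    case False
    then have "f as x bs = 0" using f unfolding Pw.D.cochains_iff by blast
    then show ?thesis by simp
  qed
qed

lemma entries_surj:
  assumes E: "\<And>i j. i < m \<Longrightarrow> j < m \<Longrightarrow> E i j \<in> M.D.cochains n"
  shows "\<exists>f\<in>Pw.D.cochains n. \<forall>i<m. \<forall>j<m. entry i j f = E i j"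
proof -
  interpret V: vector_space "\<lambda>c (f :: 'a list \<Rightarrow> (nat \<Rightarrow> 'm) \<Rightarrow> 'b list \<Rightarrow> nat \<Rightarrow> 'm) as x bs. scal Pw c (f as x bs)" by (rule Pw.D.vector_space_cochains)
  let ?f = "\<Sum>i<m. \<Sum>j<m. unit_matrix i j (E i j)"
  have "?f \<in> Pw.D.cochains n"
    using tri_linear_pullback.pull_closed[OF tri_pullback.axioms(1)[OF unit_pullback] E]
    by (intro V.subspace_sum[OF Pw.D.subspace_cochains]) auto
  moreover have "entry i j ?f = E i j" if "i < m" "j < m" for i j
  proof -
    have e0: "entry i j 0 = 0" by (auto simp: tri_pull_def fun_eq_iff)
    have s: "entry i j (sum h I) = (\<Sum>k\<in>I. entry i j (h k))" for h :: "nat \<Rightarrow> 'a list \<Rightarrow> (nat \<Rightarrow> 'm) \<Rightarrow> 'b list \<Rightarrow> nat \<Rightarrow> 'm" and I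
      by (induction I rule: infinite_finite_induct) (simp_all only: sum.infinite sum.empty sum.insert e0 entry_add not_False_eq_True)
    have "entry i j ?f = (\<Sum>i'<m. \<Sum>j'<m. entry i j (unit_matrix i' j' (E i' j')))"
      by (simp add: s)
    also have "\<dots> = (\<Sum>i'<m. \<Sum>j'<m. if i' = i then (if j' = j then E i j else 0) else 0)"
      using that by (intro sum.cong) (auto simp: entry_unit[OF E])
    also have "\<dots> = (\<Sum>i'<m. if i' = i then (\<Sum>j'<m. if j' = j then E i j else 0) else 0)"
      by (intro sum.cong) auto
    also have "\<dots> = E i j" using that by simp
    finally show ?thesis .
  qed
  ultimately show ?thesis by blast
qed

theorem HH_dim_power:
  "HH_dim Pw.T n = HH_dim M.T n + card index_set * cohomology_dim sM M.D.cochains (\<lambda>_. M.D.tri_diff) n"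
proof -
  interpret C: cochain_complex Pw.model_scal Pw.model Pw.model_diff by (rule Pw.model_complex[OF fin(1,2,4)])
  interpret M: cochain_complex M.model_scal M.model M.model_diff by (rule M.model_complex[OF fin(1,2,3)])
  interpret G: cochain_complex sM M.D.cochains "\<lambda>_. M.D.tri_diff" by (rule M.D.tri_complex[OF fin(1,2,3,3)])
  interpret GV: vector_space sM by (rule G.vs)
  have m: "0 < m" using m_pos by simp
  have "cohomology_dim Pw.model_scal Pw.model Pw.model_diff n = cohomology_dim M.model_scal M.model M.model_diff n +
    cohomology_dim (\<lambda>c (F :: nat \<times> nat \<Rightarrow> _) i. sM c (F i)) (\<lambda>n. power_space index_set (M.D.cochains n)) (\<lambda>n F i. M.D.tri_diff (F i)) n"
  proof (rule cohomology_dim_direct_sum[OF corner_map off_corner_map M.cochain_complex_axioms G.power_complex[OF finite_index_set]])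
    fix p n assume p: "p \<in> Pw.model n" "corner p = 0" "off_corner p = 0"
    then obtain fA fB fN where f: "p = (fA, fB, fN)" "fN \<in> Pw.D.cochains n" by (auto simp: Pw.model_def)
    have c: "fA = 0" "fB = 0" "entry 0 0 fN = 0" using p(2) by (auto simp: f corner_def zero_prod_def)
    have "entry i j fN = 0" if "i < m" "j < m" for i j
    proof (cases "(i, j) = (0, 0)")
      case False
      then have "(i, j) \<in> index_set" using that by (auto simp: index_set_def)
      then show ?thesis using fun_cong[OF p(3), of "(i, j)"] c(3) by (auto simp: off_corner_def f split: if_splits)
    qed (use c in simp)
    then show "p = 0" using entries_eq_0[OF f(2)] c f(1) by (simp add: zero_prod_def)
  next
    fix w G n assume w: "w \<in> M.model n" and G: "G \<in> power_space index_set (M.D.cochains n)"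
    obtain fA fB u where u: "w = (fA, fB, u)" "fA \<in> hochschild_cochains A n" "fB \<in> hochschild_cochains B n" "u \<in> M.D.cochains n"
      using w by (auto simp: M.model_def)
    \<comment> \<open>Inverts the passage to corner and off-corner parts: \<open>u\<close> is added
      back along the diagonal. At \<open>(0, 0)\<close> the family \<open>G\<close> has its default
      value 0, so that entry is \<open>u\<close> itself.\<close>
    let ?E = "\<lambda>i j. G (i, j) + (if i = j then u else 0)"
    have "?E i j \<in> M.D.cochains n" for i j
      using power_spaceD[OF G G.zero_cochain] u(4) G.zero_cochain
      by (intro GV.subspace_add[OF G.subspace_cochains]) auto
    then obtain fN where fN: "fN \<in> Pw.D.cochains n" "\<And>i j. i < m \<Longrightarrow> j < m \<Longrightarrow> entry i j fN = ?E i j"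
      using entries_surj[of ?E] by blast
    have G0: "G ij = 0" if "ij \<notin> index_set" for ij using G that unfolding power_space_def by blast
    have "corner (fA, fB, fN) = w" using fN(2)[OF m m] G0[of "(0, 0)"] by (simp add: corner_def u index_set_def)
    moreover have "off_corner (fA, fB, fN) = G"
    proof (rule ext)
      fix ij :: "nat \<times> nat"
      obtain i j where ij: "ij = (i, j)" by (cases ij) auto
      show "off_corner (fA, fB, fN) ij = G ij"
      proof (cases "(i, j) \<in> index_set")
        case True
        then show ?thesis using index_setD[OF True] fN(2)[of i j] fN(2)[OF m m] G0[of "(0, 0)"]
          by (auto simp: off_corner_def ij index_set_def)
      qed (simp add: off_corner_def ij G0)
    qed
    moreover have "(fA, fB, fN) \<in> Pw.model n" using u fN by (simp add: Pw.model_def)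
    ultimately show "\<exists>x\<in>Pw.model n. corner x = w \<and> off_corner x = G" by blast
  qed
  then show ?thesis
    using Pw.HH_dim_eq_model[OF fin(1,2,4)] M.HH_dim_eq_model[OF fin(1,2,3)] G.cohomology_dim_power[OF finite_index_set] by simp
qed

end

section \<open>Modules over the enveloping tensor product\<close>

lemma opposite_simps [simp]:
  "carrier (opposite B) = carrier B" "scal (opposite B) = scal B" "idt (opposite B) = idt B"
  "mul (opposite B) x y = mul B y x"
  by (simp_all add: opposite_def)

lemma (in kspace) fin_dimI: "findim (scal V) (carrier V) \<Longrightarrow> fin_dim V"
  using findim_basis[OF vector_space_scal] unfolding fin_dim_def by metis

section \<open>The algebra structure on the tensor product of \<open>A\<close> with the opposite of
  \<open>B\<close>\<close>

locale tensor_algebra = A: kalgebra A + B: kalgebra B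
  for A :: "('k::field, 'a::ab_group_add) alg" and B :: "('k, 'b::ab_group_add) alg"
begin

declare A.mul_closed [simp] B.mul_closed [simp] A.idt_closed [simp] B.idt_closed [simp]

abbreviation "R \<equiv> tensor_product A (opposite B)"
abbreviation "pt \<equiv> pure_tensor A (opposite B)"
abbreviation "bil \<equiv> bilinear_form A (opposite B)"

lemma scal_R: "scal R = (\<lambda>c \<phi> w. c * \<phi> w)"
  and carrier_R: "carrier R = module.span (\<lambda>c \<phi> w. c * \<phi> w) {pt a b | a b. a \<in> carrier A \<and> b \<in> carrier B}"
  and idt_R: "idt R = pt (idt A) (idt B)"
  and mul_R: "mul R \<phi> \<psi> = (\<lambda>w. if bil w then \<phi> (\<lambda>a b. \<psi> (\<lambda>a' b'. w (mul A a a') (mul B b' b))) else 0)"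
  by (simp_all add: tensor_product_def cong: if_cong)

lemma vector_space_R: "vector_space (scal R)"
  unfolding scal_R by unfold_locales (simp_all add: fun_eq_iff algebra_simps)

interpretation VR: vector_space "scal R" by (rule vector_space_R)

lemma span_R: "carrier R = VR.span {pt a b | a b. a \<in> carrier A \<and> b \<in> carrier B}"
  unfolding carrier_R scal_R ..

lemma R_kspace: "kspace R"
  by unfold_locales (simp add: span_R)

sublocale R: kspace R by (rule R_kspace)

lemma pt_mem [simp]: "a \<in> carrier A \<Longrightarrow> b \<in> carrier B \<Longrightarrow> pt a b \<in> carrier R"
  unfolding span_R by (intro VR.span_base) auto

lemma pt_add_left: "a \<in> carrier A \<Longrightarrow> a' \<in> carrier A \<Longrightarrow> b \<in> carrier B \<Longrightarrow> pt (a + a') b = pt a b + pt a' b"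
  and pt_add_right: "a \<in> carrier A \<Longrightarrow> b \<in> carrier B \<Longrightarrow> b' \<in> carrier B \<Longrightarrow> pt a (b + b') = pt a b + pt a b'"
  and pt_scal_left: "a \<in> carrier A \<Longrightarrow> b \<in> carrier B \<Longrightarrow> pt (scal A c a) b = scal R c (pt a b)"
  and pt_scal_right: "a \<in> carrier A \<Longrightarrow> b \<in> carrier B \<Longrightarrow> pt a (scal B c b) = scal R c (pt a b)"
  by (auto simp: pure_tensor_def scal_R bilinear_form_def fun_eq_iff)

lemma R_induct [consumes 1, case_names zero step]:
  assumes "\<phi> \<in> carrier R" "P 0"
    and "\<And>c a b \<psi>. a \<in> carrier A \<Longrightarrow> b \<in> carrier B \<Longrightarrow> \<psi> \<in> carrier R \<Longrightarrow> P \<psi> \<Longrightarrow> P (scal R c (pt a b) + \<psi>)"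
  shows "P \<phi>"
proof -
  have "\<phi> \<in> VR.span {pt a b | a b. a \<in> carrier A \<and> b \<in> carrier B}" using assms(1) span_R by simp
  then have "\<phi> \<in> carrier R \<and> P \<phi>"
    by (rule VR.span_induct_alt[where h = "\<lambda>\<phi>. \<phi> \<in> carrier R \<and> P \<phi>"]) (use assms(2,3) in auto)
  then show ?thesis ..
qed

lemma R_linear_ext:
  assumes "vector_space s" "linear_on (scal R) s (carrier R) h" "linear_on (scal R) s (carrier R) h'"
    and "\<And>a b. a \<in> carrier A \<Longrightarrow> b \<in> carrier B \<Longrightarrow> h (pt a b) = h' (pt a b)" "\<phi> \<in> carrier R"
  shows "h \<phi> = h' \<phi>"
  using assms(5)
proof (induction rule: R_induct)
  case zero
  show "h 0 = h' 0"
    using linear_on_0[OF vector_space_R assms(1) R.subspace_carrier assms(2)]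
      linear_on_0[OF vector_space_R assms(1) R.subspace_carrier assms(3)] by simp
next
  case (step c a b \<psi>)
  then show "h (scal R c (pt a b) + \<psi>) = h' (scal R c (pt a b) + \<psi>)"
    using linear_on_add[OF assms(2), of "scal R c (pt a b)" \<psi>] linear_on_add[OF assms(3), of "scal R c (pt a b)" \<psi>]
      linear_on_scale[OF assms(2), of "pt a b" c] linear_on_scale[OF assms(3), of "pt a b" c] assms(4)
    by simp
qed

lemma bil_add_left: "bil w \<Longrightarrow> x \<in> carrier A \<Longrightarrow> x' \<in> carrier A \<Longrightarrow> y \<in> carrier B \<Longrightarrow> w (x + x') y = w x y + w x' y"
  and bil_add_right: "bil w \<Longrightarrow> x \<in> carrier A \<Longrightarrow> y \<in> carrier B \<Longrightarrow> y' \<in> carrier B \<Longrightarrow> w x (y + y') = w x y + w x y'"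
  and bil_scal_left: "bil w \<Longrightarrow> x \<in> carrier A \<Longrightarrow> y \<in> carrier B \<Longrightarrow> w (scal A c x) y = c * w x y"
  and bil_scal_right: "bil w \<Longrightarrow> x \<in> carrier A \<Longrightarrow> y \<in> carrier B \<Longrightarrow> w x (scal B c y) = c * w x y"
  by (simp_all add: bilinear_form_def)

lemma bil_add: "bil w \<Longrightarrow> bil w' \<Longrightarrow> bil (\<lambda>a b. w a b + w' a b)"
  and bil_scal: "bil w \<Longrightarrow> bil (\<lambda>a b. c * w a b)"
  unfolding bilinear_form_def by (simp_all add: algebra_simps)

text \<open>Elements of \<open>R\<close> are functions of the form \<open>w\<close>; additivity in
  \<open>w\<close> is not built into their type and holds because \<open>R\<close> is spanned by
  evaluations.\<close>

lemma R_add: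
  assumes "\<phi> \<in> carrier R" "bil w" "bil w'"
  shows "\<phi> (\<lambda>a b. w a b + w' a b) = \<phi> w + \<phi> w'"
  using assms(1)
  by (induction rule: R_induct) (simp_all add: scal_R pure_tensor_def assms bil_add algebra_simps)

lemma R_scal:
  assumes "\<phi> \<in> carrier R" "bil w"
  shows "\<phi> (\<lambda>a b. c * w a b) = c * \<phi> w"
  using assms(1)
  by (induction rule: R_induct) (simp_all add: scal_R pure_tensor_def assms bil_scal algebra_simps)

text \<open>Forms live on whole types and may differ outside the carriers; combinations of
  evaluations at carrier elements do not see this.\<close>

lemma R_cong:
  assumes "\<phi> \<in> carrier R" "bil w" "bil w'" "\<And>a b. a \<in> carrier A \<Longrightarrow> b \<in> carrier B \<Longrightarrow> w a b = w' a b"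
  shows "\<phi> w = \<phi> w'"
  using assms(1) by (induction rule: R_induct) (simp_all add: scal_R pure_tensor_def assms)

lemma bil_translate:
  assumes "bil w" "a \<in> carrier A" "b \<in> carrier B"
  shows "bil (\<lambda>a' b'. w (mul A a a') (mul B b' b))"
  using assms unfolding bilinear_form_def
  by (simp add: A.mul_add_right A.mul_scal_right B.mul_add_left B.mul_scal_left)

text \<open>A pure tensor is 0 at anything that is not bilinear, so the formula for the product
  yields the expected value only because the inner expression is again a bilinear form.\<close>

lemma bil_shift:
  assumes "bil w" "\<psi> \<in> carrier R"
  shows "bil (\<lambda>a b. \<psi> (\<lambda>a' b'. w (mul A a a') (mul B b' b)))"
  unfolding bilinear_form_def
proof (intro conjI ballI allI)
  let ?w = "\<lambda>a b a' b'. w (mul A a a') (mul B b' b)"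
  note t = bil_translate[OF assms(1)]
  fix a a2 b assume c: "a \<in> carrier A" "a2 \<in> carrier A" "b \<in> carrier (opposite B)"
  have "\<psi> (?w (a + a2) b) = \<psi> (\<lambda>a' b'. ?w a b a' b' + ?w a2 b a' b')"
    by (rule R_cong[OF assms(2)]; (intro bil_add t)?; insert c assms(1); simp add: A.mul_add_left bil_add_left)
  then show "\<psi> (?w (a + a2) b) = \<psi> (?w a b) + \<psi> (?w a2 b)"
    using R_add[OF assms(2) t t, of a b a2 b] c by simp
next
  let ?w = "\<lambda>a b a' b'. w (mul A a a') (mul B b' b)"
  note t = bil_translate[OF assms(1)]
  fix a b b2 assume c: "a \<in> carrier A" "b \<in> carrier (opposite B)" "b2 \<in> carrier (opposite B)"
  have "\<psi> (?w a (b + b2)) = \<psi> (\<lambda>a' b'. ?w a b a' b' + ?w a b2 a' b')"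
    by (rule R_cong[OF assms(2)]; (intro bil_add t)?; insert c assms(1); simp add: B.mul_add_right bil_add_right)
  then show "\<psi> (?w a (b + b2)) = \<psi> (?w a b) + \<psi> (?w a b2)"
    using R_add[OF assms(2) t t, of a b a b2] c by simp
next
  let ?w = "\<lambda>a b a' b'. w (mul A a a') (mul B b' b)"
  note t = bil_translate[OF assms(1)]
  fix k a b assume c: "a \<in> carrier A" "b \<in> carrier (opposite B)"
  have "\<psi> (?w (scal A k a) b) = \<psi> (\<lambda>a' b'. k * ?w a b a' b')"
    by (rule R_cong[OF assms(2)]; (intro bil_scal t)?; insert c assms(1); simp add: A.mul_scal_left bil_scal_left)
  then show "\<psi> (?w (scal A k a) b) = k * \<psi> (?w a b)"
    using R_scal[OF assms(2) t, of a b k] c by simp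
  have "\<psi> (?w a (scal B k b)) = \<psi> (\<lambda>a' b'. k * ?w a b a' b')"
    by (rule R_cong[OF assms(2)]; (intro bil_scal t)?; insert c assms(1); simp add: B.mul_scal_right bil_scal_right)
  then show "\<psi> (?w a (scal (opposite B) k b)) = k * \<psi> (?w a b)"
    using R_scal[OF assms(2) t, of a b k] c by simp
qed

lemma mul_pt_pt:
  assumes "a \<in> carrier A" "b \<in> carrier B" "a' \<in> carrier A" "b' \<in> carrier B"
  shows "mul R (pt a b) (pt a' b') = pt (mul A a a') (mul B b' b)"
proof (rule ext)
  fix w
  show "mul R (pt a b) (pt a' b') w = pt (mul A a a') (mul B b' b) w"
  proof (cases "bil w")
    case True
    let ?v = "\<lambda>a b. pt a' b' (\<lambda>a' b'. w (mul A a a') (mul B b' b))"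
    have "bil ?v" using bil_shift[OF True] assms by simp
    then have "mul R (pt a b) (pt a' b') w = ?v a b" using True by (simp add: mul_R pure_tensor_def[of _ _ a b])
    also have "\<dots> = w (mul A a a') (mul B b' b)"
      using bil_translate[OF True assms(1,2)] by (simp add: pure_tensor_def)
    finally show ?thesis using True by (simp add: pure_tensor_def)
  qed (simp add: mul_R pure_tensor_def)
qed

lemma mul_R_add_left: "mul R (\<phi> + \<phi>') \<psi> = mul R \<phi> \<psi> + mul R \<phi>' \<psi>"
  and mul_R_scal_left: "mul R (scal R c \<phi>) \<psi> = scal R c (mul R \<phi> \<psi>)"
  by (auto simp: mul_R scal_R fun_eq_iff)

lemma mul_R_add_right:
  assumes "\<phi> \<in> carrier R" "\<psi> \<in> carrier R" "\<psi>' \<in> carrier R"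
  shows "mul R \<phi> (\<psi> + \<psi>') = mul R \<phi> \<psi> + mul R \<phi> \<psi>'"
  using R_add[OF assms(1) bil_shift[OF _ assms(2)] bil_shift[OF _ assms(3)]]
  by (auto simp: mul_R fun_eq_iff)

lemma mul_R_scal_right:
  assumes "\<phi> \<in> carrier R" "\<psi> \<in> carrier R"
  shows "mul R \<phi> (scal R c \<psi>) = scal R c (mul R \<phi> \<psi>)"
  using R_scal[OF assms(1) bil_shift[OF _ assms(2)]]
  by (auto simp: mul_R scal_R fun_eq_iff)

lemma mul_R_0_left: "mul R 0 \<psi> = 0"
  by (auto simp: mul_R fun_eq_iff)

lemma mul_R_0_right: "\<phi> \<in> carrier R \<Longrightarrow> mul R \<phi> 0 = 0"
  using mul_R_scal_right[of \<phi> 0 0] by simp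

lemma mul_R_closed:
  assumes "\<phi> \<in> carrier R" "\<psi> \<in> carrier R"
  shows "mul R \<phi> \<psi> \<in> carrier R"
proof -
  have 1: "mul R (pt a b) \<psi> \<in> carrier R" if ab: "a \<in> carrier A" "b \<in> carrier B" for a b
    using assms(2)
    by (rule R_induct[where P = "\<lambda>\<psi>. mul R (pt a b) \<psi> \<in> carrier R"])
      (simp_all add: mul_R_0_right mul_R_add_right mul_R_scal_right mul_pt_pt ab)
  show ?thesis
    using assms(1)
    by (rule R_induct[where P = "\<lambda>\<phi>. mul R \<phi> \<psi> \<in> carrier R"])
      (simp_all add: mul_R_0_left mul_R_add_left mul_R_scal_left 1)
qed

lemma linear_mul_left: "\<phi> \<in> carrier R \<Longrightarrow> linear_on (scal R) (scal R) (carrier R) (mul R \<phi>)"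
  by (simp add: linear_on_def mul_R_add_right mul_R_scal_right)

lemma linear_mul_right: "linear_on (scal R) (scal R) V (\<lambda>\<phi>. mul R \<phi> \<psi>)"
  by (simp add: linear_on_def mul_R_add_left mul_R_scal_left)

text \<open>Associativity is reduced by linearity to pure tensors in one argument at a time, the
  third argument first.\<close>

lemma R_kalgebra: "kalgebra R"
proof
  show "mul R x y \<in> carrier R" if "x \<in> carrier R" "y \<in> carrier R" for x y
    using that by (rule mul_R_closed)
  show "idt R \<in> carrier R" by (simp add: idt_R)
  fix x assume x: "x \<in> carrier R"
  show "mul R (idt R) x = x"
    by (rule R_linear_ext[OF vector_space_R linear_mul_left _ _ x])
      (simp_all add: idt_R linear_on_def mul_pt_pt A.mul_idt_left B.mul_idt_right)
  show "mul R x (idt R) = x"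
    by (rule R_linear_ext[OF vector_space_R linear_mul_right _ _ x])
      (simp_all add: idt_R linear_on_def mul_pt_pt A.mul_idt_right B.mul_idt_left)
next
  fix x y z assume xyz: "x \<in> carrier R" "y \<in> carrier R" "z \<in> carrier R"
  have 1: "mul R (mul R (pt a b) (pt a' b')) z = mul R (pt a b) (mul R (pt a' b') z)"
    if "a \<in> carrier A" "b \<in> carrier B" "a' \<in> carrier A" "b' \<in> carrier B" for a b a' b'
    by (rule R_linear_ext[OF vector_space_R linear_mul_left _ _ xyz(3)])
      (use that in \<open>simp_all add: linear_on_def mul_R_closed mul_R_add_right mul_R_scal_right mul_pt_pt A.mul_assoc B.mul_assoc\<close>)
  have 2: "mul R (mul R (pt a b) y) z = mul R (pt a b) (mul R y z)" if "a \<in> carrier A" "b \<in> carrier B" for a b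
    by (rule R_linear_ext[OF vector_space_R _ _ _ xyz(2), where h = "\<lambda>y. mul R (mul R (pt a b) y) z"])
      (use that xyz in \<open>simp_all add: linear_on_def mul_R_closed mul_R_add_right mul_R_scal_right mul_R_add_left mul_R_scal_left 1\<close>)
  show "mul R (mul R x y) z = mul R x (mul R y z)"
    by (rule R_linear_ext[OF vector_space_R _ _ _ xyz(1), where h = "\<lambda>x. mul R (mul R x y) z"])
      (use xyz in \<open>simp_all add: linear_on_def mul_R_closed mul_R_add_left mul_R_scal_left 2\<close>)
qed (simp_all add: mul_R_add_left mul_R_add_right mul_R_scal_left mul_R_scal_right)

sublocale R: kalgebra R by (rule R_kalgebra)

lemma R_fin_dim:
  assumes "fin_dim A" "fin_dim B"
  shows "fin_dim R"
proof -
  obtain SA where SA: "finite SA" "A.span SA = carrier A" using assms(1) by (auto simp: fin_dim_def)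
  obtain SB where SB: "finite SB" "B.span SB = carrier B" using assms(2) by (auto simp: fin_dim_def)
  have sub: "SA \<subseteq> carrier A" "SB \<subseteq> carrier B" using SA(2) SB(2) A.span_superset B.span_superset by blast+
  let ?S = "(\<lambda>(a, b). pt a b) ` (SA \<times> SB)"
  have 1: "pt a b \<in> VR.span ?S" if a: "a \<in> SA" and b: "b \<in> carrier B" for a b
  proof -
    have "b \<in> B.span SB" using b SB by simp
    then have "b \<in> carrier B \<and> pt a b \<in> VR.span ?S"
    proof (induction rule: B.span_induct_alt)
      case base
      have "pt a (scal B 0 0) = scal R 0 (pt a 0)" using a sub by (intro pt_scal_right) auto
      then show "0 \<in> carrier B \<and> pt a 0 \<in> VR.span ?S" using VR.span_zero[of ?S] by simp
    next
      case (step c x y)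
      have "pt a x \<in> VR.span ?S" using a step(1) by (intro VR.span_base) auto
      then show "scal B c x + y \<in> carrier B \<and> pt a (scal B c x + y) \<in> VR.span ?S"
        using step a sub VR.span_add[OF VR.span_scale[of "pt a x" ?S c], of "pt a y"]
        by (auto simp: pt_add_right pt_scal_right subset_iff)
    qed
    then show ?thesis ..
  qed
  have 2: "pt a b \<in> VR.span ?S" if a: "a \<in> carrier A" and b: "b \<in> carrier B" for a b
  proof -
    have "a \<in> A.span SA" using a SA by simp
    then have "a \<in> carrier A \<and> pt a b \<in> VR.span ?S"
    proof (induction rule: A.span_induct_alt)
      case base
      have "pt (scal A 0 0) b = scal R 0 (pt 0 b)" using b by (intro pt_scal_left) auto
      then show "0 \<in> carrier A \<and> pt 0 b \<in> VR.span ?S" using VR.span_zero[of ?S] by simp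
    next
      case (step c x y)
      have "pt x b \<in> VR.span ?S" using 1 b step(1) by auto
      then show "scal A c x + y \<in> carrier A \<and> pt (scal A c x + y) b \<in> VR.span ?S"
        using step b sub VR.span_add[OF VR.span_scale[of "pt x b" ?S c], of "pt y b"]
        by (auto simp: pt_add_left pt_scal_left subset_iff)
    qed
    then show ?thesis ..
  qed
  have "VR.span ?S = carrier R"
  proof
    show "VR.span ?S \<subseteq> carrier R"
      using sub by (intro VR.span_minimal[OF _ R.subspace_carrier]) (auto simp: subset_iff)
    show "carrier R \<subseteq> VR.span ?S"
      unfolding span_R by (intro VR.span_minimal) (use 2 in auto)
  qed
  moreover have "finite ?S" using SA(1) SB(1) by simp
  ultimately show ?thesis unfolding fin_dim_def by blast
qed

end

section \<open>Regular modules, powers, and bimodules from modules over the tensor product\<close>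

lemma regular_module_lmodule: "kalgebra R \<Longrightarrow> lmodule R (regular_module R)"
  unfolding lmodule_def lmodule_axioms_def kalgebra_def kalgebra_axioms_def kspace_def kspace_axioms_def regular_module_def
  by simp

lemma module_power_kspace:
  fixes M :: "('k::field, 'r, 'c::ab_group_add) lmod"
  assumes "kspace M"
  shows "kspace (module_power M m)"
proof -
  interpret kspace M by fact
  have v: "vector_space (\<lambda>c (f :: nat \<Rightarrow> 'c) i. scal M c (f i))" by (rule vector_space_fun[OF vector_space_scal])
  then interpret F: vector_space "\<lambda>c (f :: nat \<Rightarrow> 'c) i. scal M c (f i)" .
  have "F.subspace (carrier (module_power M m))"
    by (rule F.subspaceI) (auto simp: module_power_def)
  then show ?thesis using v by (simp add: kspace_def kspace_axioms_def module_power_def)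
qed

lemma module_power_lmodule:
  assumes "lmodule R M"
  shows "lmodule R (module_power M m)"
proof -
  interpret M: lmodule R M by fact
  interpret P: kspace "module_power M m" by (rule module_power_kspace) unfold_locales
  show ?thesis
    by unfold_locales
      (auto simp: module_power_def M.act_closed M.act_mul M.act_idt M.act_add_left M.act_add_right M.act_scal_left M.act_scal_right fun_eq_iff)
qed

lemma module_power_fin_dim:
  assumes "kspace M" "fin_dim M"
  shows "fin_dim (module_power M m)"
proof -
  interpret M: kspace M by fact
  interpret P: kspace "module_power M m" by (rule module_power_kspace) fact
  have "carrier (module_power M m) = power_space {..<m} (carrier M)"
    by (auto simp: module_power_def power_space_def)
  moreover have "scal (module_power M m) = (\<lambda>c f i. scal M c (f i))" by (simp add: module_power_def)
  ultimately show ?thesis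
    using power_space_dim[OF M.vector_space_scal M.findim_carrier[OF assms(2)], of "{..<m}"]
    by (intro P.fin_dimI) simp
qed

locale tensor_module = tensor_algebra A B + M: lmodule "tensor_product A (opposite B)" M
  for A :: "('k::field, 'a::ab_group_add) alg" and B :: "('k, 'b::ab_group_add) alg"
    and M :: "('k, ('a \<Rightarrow> 'b \<Rightarrow> 'k) \<Rightarrow> 'k, 'm::ab_group_add) lmod"
begin

text \<open>The two factorizations of \<open>a \<otimes> b\<close> into \<open>a \<otimes> 1\<close>
  and \<open>1 \<otimes> b\<close>; together they show that the two actions commute.\<close>

lemma act_pt:
  assumes "a \<in> carrier A" "b \<in> carrier B" "x \<in> carrier M"
  shows "act M (pt a b) x = left_act A B M a (right_act A B M x b)"
    "act M (pt a b) x = right_act A B M (left_act A B M a x) b"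
  using assms M.act_mul[of "pt a (idt B)" "pt (idt A) b" x] M.act_mul[of "pt (idt A) b" "pt a (idt B)" x]
  by (simp_all add: left_act_def right_act_def mul_pt_pt A.mul_idt_left A.mul_idt_right B.mul_idt_left B.mul_idt_right)

lemma tensor_bimodule: "bimodule A B M (left_act A B M) (right_act A B M)"
proof
  fix x y b b' and a a' and c :: 'k
  assume x: "x \<in> carrier M" 
  show "left_act A B M (idt A) x = x" "right_act A B M x (idt B) = x"
    using M.act_idt[OF x] by (simp_all add: left_act_def right_act_def idt_R)
  { assume b: "b \<in> carrier B"
    show "right_act A B M x b \<in> carrier M" using x b by (simp add: right_act_def M.act_closed)
    show "right_act A B M (scal M c x) b = scal M c (right_act A B M x b)"
      using x b by (simp add: right_act_def M.act_scal_right)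
    show "right_act A B M x (scal B c b) = scal M c (right_act A B M x b)"
      using x b by (simp add: right_act_def pt_scal_right M.act_scal_left)
    { assume y: "y \<in> carrier M"
      show "right_act A B M (x + y) b = right_act A B M x b + right_act A B M y b"
        using x b y by (simp add: right_act_def M.act_add_right) }
    { assume b': "b' \<in> carrier B"
      show "right_act A B M x (b + b') = right_act A B M x b + right_act A B M x b'"
        using x b b' by (simp add: right_act_def pt_add_right M.act_add_left)
      show "right_act A B M x (mul B b b') = right_act A B M (right_act A B M x b) b'"
        using x b b' M.act_mul[of "pt (idt A) b'" "pt (idt A) b" x]
        by (simp add: right_act_def mul_pt_pt A.mul_idt_left) } }
  { assume a: "a \<in> carrier A"
    show "left_act A B M a x \<in> carrier M" using x a by (simp add: left_act_def M.act_closed)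
    show "left_act A B M a (scal M c x) = scal M c (left_act A B M a x)"
      using x a by (simp add: left_act_def M.act_scal_right)
    show "left_act A B M (scal A c a) x = scal M c (left_act A B M a x)"
      using x a by (simp add: left_act_def pt_scal_left M.act_scal_left)
    { assume y: "y \<in> carrier M"
      show "left_act A B M a (x + y) = left_act A B M a x + left_act A B M a y"
        using x a y by (simp add: left_act_def M.act_add_right) }
    { assume a': "a' \<in> carrier A"
      show "left_act A B M (a + a') x = left_act A B M a x + left_act A B M a' x"
        using x a a' by (simp add: left_act_def pt_add_left M.act_add_left)
      show "left_act A B M (mul A a a') x = left_act A B M a (left_act A B M a' x)"
        using x a a' M.act_mul[of "pt a (idt B)" "pt a' (idt B)" x]
        by (simp add: left_act_def mul_pt_pt B.mul_idt_left) }
    { assume b: "b \<in> carrier B"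
      show "right_act A B M (left_act A B M a x) b = left_act A B M a (right_act A B M x b)"
        using act_pt[OF a b x] by simp } }
qed

sublocale bi: bimodule A B M "left_act A B M" "right_act A B M" by (rule tensor_bimodule)

lemma linear_act: "r \<in> carrier R \<Longrightarrow> linear_on (scal M) (scal M) (carrier M) (act M r)"
  by (simp add: linear_on_def M.act_add_right M.act_scal_right)

lemma linear_act_scalar: "x \<in> carrier M \<Longrightarrow> linear_on (scal R) (scal M) (carrier R) (\<lambda>r. act M r x)"
  by (simp add: linear_on_def M.act_add_left M.act_scal_left)

end

locale tensor_module_pair = X: tensor_module A B X + N: tensor_module A B N
  for A :: "('k::field, 'a::ab_group_add) alg" and B :: "('k, 'b::ab_group_add) alg"
    and X :: "('k, ('a \<Rightarrow> 'b \<Rightarrow> 'k) \<Rightarrow> 'k, 'x::ab_group_add) lmod"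
    and N :: "('k, ('a \<Rightarrow> 'b \<Rightarrow> 'k) \<Rightarrow> 'k, 'n::ab_group_add) lmod"
begin

abbreviation "R \<equiv> tensor_product A (opposite B)"

text \<open>\<open>module_homs\<close> asks for additivity; scalars are covered because they act
  through multiples of the unit of \<open>R\<close>.\<close>

lemma module_hom_linear:
  assumes "f \<in> module_homs R X N"
  shows "linear_on (scal X) (scal N) (carrier X) f"
proof -
  have f: "\<And>x. x \<in> carrier X \<Longrightarrow> f x \<in> carrier N"
    "\<And>x y. x \<in> carrier X \<Longrightarrow> y \<in> carrier X \<Longrightarrow> f (x + y) = f x + f y"
    "\<And>r x. r \<in> carrier R \<Longrightarrow> x \<in> carrier X \<Longrightarrow> f (act X r x) = act N r (f x)"
    using assms by (auto simp: module_homs_def)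
  have "f (scal X c x) = scal N c (f x)" if "x \<in> carrier X" for c x
    using f(3)[of "scal R c (idt R)" x] f(1)[OF that] that X.R.idt_closed
    by (simp add: X.M.act_scal_left N.M.act_scal_left X.M.act_idt N.M.act_idt)
  then show ?thesis using f(2) by (simp add: linear_on_def)
qed

text \<open>A bimodule map is \<open>R\<close>-linear because pure tensors span
  \<open>R\<close>.\<close>

lemma module_homI:
  assumes "\<And>x. x \<in> carrier X \<Longrightarrow> f x \<in> carrier N" "\<And>x. x \<notin> carrier X \<Longrightarrow> f x = 0"
    and lin: "linear_on (scal X) (scal N) (carrier X) f"
    and l: "\<And>a x. a \<in> carrier A \<Longrightarrow> x \<in> carrier X \<Longrightarrow> f (left_act A B X a x) = left_act A B N a (f x)"
    and r: "\<And>b x. b \<in> carrier B \<Longrightarrow> x \<in> carrier X \<Longrightarrow> f (right_act A B X x b) = right_act A B N (f x) b"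
  shows "f \<in> module_homs R X N"
proof -
  have "f (act X \<phi> x) = act N \<phi> (f x)" if x: "x \<in> carrier X" and \<phi>: "\<phi> \<in> carrier R" for x \<phi>
  proof (rule X.R_linear_ext[OF N.M.vector_space_scal _ N.linear_act_scalar _ \<phi>, where h = "\<lambda>\<phi>. f (act X \<phi> x)"])
    show "linear_on (scal R) (scal N) (carrier R) (\<lambda>\<phi>. f (act X \<phi> x))"
      using linear_on_add[OF lin] linear_on_scale[OF lin] x
      by (simp add: linear_on_def X.M.act_add_left X.M.act_scal_left X.M.act_closed)
    show "f x \<in> carrier N" using assms(1) x .
    show "f (act X (X.pt a b) x) = act N (X.pt a b) (f x)" if "a \<in> carrier A" "b \<in> carrier B" for a b
      using that x assms(1)[OF x] by (simp add: X.act_pt(1) N.act_pt(1) l r)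
  qed
  then show ?thesis using assms(1,2) linear_on_add[OF lin] by (auto simp: module_homs_def)
qed

lemma module_hom_acts:
  assumes "f \<in> module_homs R X N"
  shows "a \<in> carrier A \<Longrightarrow> x \<in> carrier X \<Longrightarrow> f (left_act A B X a x) = left_act A B N a (f x)"
    and "b \<in> carrier B \<Longrightarrow> x \<in> carrier X \<Longrightarrow> f (right_act A B X x b) = right_act A B N (f x) b"
  using assms X.pt_mem by (auto simp: module_homs_def left_act_def right_act_def)

sublocale D: bimodule_pair A B X "left_act A B X" "right_act A B X" N "left_act A B N" "right_act A B N" ..

end

lemma submodule_lmodule:
  assumes "lmodule R F" "module.subspace (scal F) K" "K \<subseteq> carrier F"
    and "\<And>r x. r \<in> carrier R \<Longrightarrow> x \<in> K \<Longrightarrow> act F r x \<in> K"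
  shows "lmodule R (F\<lparr>carrier := K\<rparr>)"
  using assms unfolding lmodule_def lmodule_axioms_def kspace_def kspace_axioms_def by (auto simp: subset_iff)

section \<open>Acyclicity of free modules\<close>

lemma linear_on_plus:
  assumes "vector_space t" "linear_on s t V f" "linear_on s t V g"
  shows "linear_on s t V (\<lambda>x. f x + g x)"
proof -
  interpret vector_space t by fact
  show ?thesis using assms(2,3) by (simp add: linear_on_def scale_right_distrib)
qed

lemma linear_on_scaled:
  assumes "vector_space t" "linear_on s t V f"
  shows "linear_on s t V (\<lambda>x. t c (f x))"
proof -
  interpret vector_space t by fact
  show ?thesis using assms(2) by (simp add: linear_on_def scale_right_distrib mult.commute)
qed

lemma linear_on_zero:
  assumes "vector_space t"
  shows "linear_on s t V (\<lambda>x. 0)"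
proof -
  interpret vector_space t by fact
  show ?thesis by (simp add: linear_on_def)
qed

locale free_module_pair = N: tensor_module A B N
  for A :: "('k::field, 'a::ab_group_add) alg" and B :: "('k, 'b::ab_group_add) alg"
    and N :: "('k, ('a \<Rightarrow> 'b \<Rightarrow> 'k) \<Rightarrow> 'k, 'n::ab_group_add) lmod" +
  fixes k :: nat
  assumes fin_N: "fin_dim N"
begin

abbreviation "R \<equiv> tensor_product A (opposite B)"
abbreviation "F \<equiv> free_module R k"
abbreviation "pt \<equiv> pure_tensor A (opposite B)"
abbreviation "lN \<equiv> left_act A B N"
abbreviation "rN \<equiv> right_act A B N"
abbreviation "lF \<equiv> left_act A B F"
abbreviation "rF \<equiv> right_act A B F"

sublocale F: tensor_module A B F
  by (intro tensor_module.intro N.tensor_algebra_axioms module_power_lmodule regular_module_lmodule N.R_kalgebra)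

sublocale FN: tensor_module_pair A B F N ..

abbreviation "tb f as x bs \<equiv> FN.D.TN.brr (unfold_word f) (word as x bs)"
abbreviation "tri_ml \<equiv> tri_multilinear A F B N"
abbreviation "cochains \<equiv> tri_cochains A F B N"

section \<open>Generators of a free module and linear maps out of it\<close>

definition gen :: "nat \<Rightarrow> (('a \<Rightarrow> 'b \<Rightarrow> 'k) \<Rightarrow> 'k) \<Rightarrow> nat \<Rightarrow> ('a \<Rightarrow> 'b \<Rightarrow> 'k) \<Rightarrow> 'k" where
  "gen j \<phi> = (\<lambda>i. if i = j then \<phi> else 0)"

lemma carrier_F: "carrier F = {f. (\<forall>i<k. f i \<in> carrier R) \<and> (\<forall>i\<ge>k. f i = 0)}"
  and scal_F: "scal F c f = (\<lambda>i. scal R c (f i))"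
  and act_F: "act F \<phi> f = (\<lambda>i. if i < k then mul R \<phi> (f i) else 0)"
  by (simp_all add: module_power_def regular_module_def cong: if_cong)

lemma gen_mem [simp]: "j < k \<Longrightarrow> \<phi> \<in> carrier R \<Longrightarrow> gen j \<phi> \<in> carrier F"
  by (auto simp: gen_def carrier_F)

lemma F_nth: "x \<in> carrier F \<Longrightarrow> x i \<in> carrier R"
  by (cases "i < k") (auto simp: carrier_F)

lemma gen_add: "gen j (\<phi> + \<psi>) = gen j \<phi> + gen j \<psi>"
  and gen_scal: "gen j (scal R c \<phi>) = scal F c (gen j \<phi>)"
  by (auto simp: gen_def scal_F fun_eq_iff N.scal_R)

lemma lact_gen: "j < k \<Longrightarrow> a' \<in> carrier A \<Longrightarrow> a \<in> carrier A \<Longrightarrow> b \<in> carrier B \<Longrightarrow>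
    lF a' (gen j (pt a b)) = gen j (pt (mul A a' a) b)"
  by (auto simp: left_act_def act_F gen_def fun_eq_iff N.mul_pt_pt N.B.mul_idt_right N.mul_R_0_right)

lemma ract_gen: "j < k \<Longrightarrow> b' \<in> carrier B \<Longrightarrow> a \<in> carrier A \<Longrightarrow> b \<in> carrier B \<Longrightarrow>
    rF (gen j (pt a b)) b' = gen j (pt a (mul B b b'))"
  by (auto simp: right_act_def act_F gen_def fun_eq_iff N.mul_pt_pt N.A.mul_idt_left N.mul_R_0_right)

lemma F_linear_ext:
  assumes "vector_space t" "linear_on (scal F) t (carrier F) h" "linear_on (scal F) t (carrier F) h'"
    and eq: "\<And>j a b. j < k \<Longrightarrow> a \<in> carrier A \<Longrightarrow> b \<in> carrier B \<Longrightarrow> h (gen j (pt a b)) = h' (gen j (pt a b))"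
    and x: "x \<in> carrier F"
  shows "h x = h' x"
proof -
  have 1: "h (gen j \<phi>) = h' (gen j \<phi>)" if j: "j < k" and \<phi>: "\<phi> \<in> carrier R" for j \<phi>
  proof (rule N.R_linear_ext[OF assms(1) _ _ _ \<phi>, where h = "\<lambda>\<phi>. h (gen j \<phi>)" and h' = "\<lambda>\<phi>. h' (gen j \<phi>)"])
    show "linear_on (scal R) t (carrier R) (\<lambda>\<phi>. h (gen j \<phi>))"
      using linear_on_add[OF assms(2)] linear_on_scale[OF assms(2)] j by (simp add: linear_on_def gen_add gen_scal)
    show "linear_on (scal R) t (carrier R) (\<lambda>\<phi>. h' (gen j \<phi>))"
      using linear_on_add[OF assms(3)] linear_on_scale[OF assms(3)] j by (simp add: linear_on_def gen_add gen_scal)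
  qed (rule eq[OF j])
  have 2: "(\<Sum>j\<in>J. gen j (x j)) \<in> carrier F \<and> h (\<Sum>j\<in>J. gen j (x j)) = h' (\<Sum>j\<in>J. gen j (x j))"
    if "finite J" "J \<subseteq> {..<k}" for J
    using that
  proof (induction J rule: finite_induct)
    case empty
    have "h 0 = 0" "h' 0 = 0"
      using linear_on_0[OF F.M.vector_space_scal assms(1) F.M.subspace_carrier] assms(2,3) by blast+
    then show ?case unfolding sum.empty using F.M.zero_mem by presburger
  next
    case (insert j J)
    let ?S = "\<Sum>j\<in>J. gen j (x j)"
    have S: "?S \<in> carrier F" "h ?S = h' ?S" "j < k" using insert by auto
    have j: "gen j (x j) \<in> carrier F" using gen_mem[OF S(3) F_nth[OF x]] .
    show ?case
      unfolding sum.insert[OF insert(1,2)] linear_on_add[OF assms(2) j S(1)] linear_on_add[OF assms(3) j S(1)]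
      using F.M.add_mem[OF j S(1)] S(2) 1[OF S(3) F_nth[OF x]] by presburger
  qed
  have "(\<Sum>j<k. gen j (x j)) = x"
  proof (rule ext)
    fix i
    have "(\<Sum>j\<in>J. gen j (x j)) i = (\<Sum>j\<in>J. gen j (x j) i)" if "finite J" for J
      using that by (induction J rule: finite_induct) (simp_all only: sum.empty sum.insert zero_fun_apply plus_fun_apply not_False_eq_True)
    then have "(\<Sum>j<k. gen j (x j)) i = (\<Sum>j<k. gen j (x j) i)" by blast
    also have "\<dots> = (if i < k then x i else 0)" by (simp add: gen_def)
    also have "\<dots> = x i" using x by (auto simp: carrier_F)
    finally show "(\<Sum>j<k. gen j (x j)) i = x i" .
  qed
  then show ?thesis using 2[of "{..<k}"] by simp
qed

definition bilinear_map :: "('a \<Rightarrow> 'b \<Rightarrow> 'n) \<Rightarrow> bool" where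
  "bilinear_map G \<longleftrightarrow> (\<forall>a\<in>carrier A. \<forall>b\<in>carrier B. G a b \<in> carrier N) \<and>
    (\<forall>b\<in>carrier B. linear_on (scal A) (scal N) (carrier A) (\<lambda>a. G a b)) \<and>
    (\<forall>a\<in>carrier A. linear_on (scal B) (scal N) (carrier B) (G a))"

definition basis_N :: "'n set" where
  "basis_N = (SOME S. finite S \<and> N.M.independent S \<and> N.M.span S = carrier N)"

lemma basis_N: "finite basis_N" "N.M.independent basis_N" "N.M.span basis_N = carrier N"
proof -
  obtain S where "finite S \<and> N.M.independent S \<and> N.M.span S = carrier N"
    using findim_basis[OF N.M.vector_space_scal N.M.findim_carrier[OF fin_N]] by metis
  then show "finite basis_N" "N.M.independent basis_N" "N.M.span basis_N = carrier N"
    unfolding basis_N_def by (metis (mono_tags, lifting) someI)+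
qed

text \<open>
  \<open>lift_bilinear G\<close> is the linear map on \<open>R\<^sup>k\<close> sending \<open>a \<otimes> b\<close> in the \<open>j\<close>-th summand to \<open>G j a b\<close>.
  Since tensors are functionals on scalar bilinear forms, they are evaluated at the coordinates of \<open>G\<close>.
\<close>

definition lift_bilinear :: "(nat \<Rightarrow> 'a \<Rightarrow> 'b \<Rightarrow> 'n) \<Rightarrow> (nat \<Rightarrow> ('a \<Rightarrow> 'b \<Rightarrow> 'k) \<Rightarrow> 'k) \<Rightarrow> 'n" where
  "lift_bilinear G x = (\<Sum>j<k. \<Sum>v\<in>basis_N. scal N (x j (\<lambda>a b. N.M.representation basis_N (G j a b) v)) v)"

lemma linear_lift: "linear_on (scal F) (scal N) V (lift_bilinear G)"
  by (simp add: linear_on_def lift_bilinear_def scal_F N.scal_R N.M.scale_left_distrib N.M.scale_sum_right sum.distrib)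

lemma lift_mem: "lift_bilinear G x \<in> carrier N"
proof -
  have "v \<in> carrier N" if "v \<in> basis_N" for v using that basis_N(3) N.M.span_superset by blast
  then show ?thesis unfolding lift_bilinear_def by (intro N.M.sum_mem N.M.scal_mem) auto
qed

text \<open>Each coordinate of \<open>G j\<close> in the basis of \<open>N\<close> is a scalar
  bilinear form, at which the pure tensor can be evaluated; the coordinates add up to
  \<open>G j a b\<close>.\<close>

lemma lift_gen:
  assumes G: "bilinear_map (G j)" and j: "j < k" and ab: "a \<in> carrier A" "b \<in> carrier B"
  shows "lift_bilinear G (gen j (pt a b)) = G j a b"
proof -
  let ?w = "\<lambda>v a b. N.M.representation basis_N (G j a b) v"
  note add = N.M.representation_add[OF basis_N(2), unfolded basis_N(3)]
  note scal = N.M.representation_scale[OF basis_N(2), unfolded basis_N(3)]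
  have mem: "G j a b \<in> carrier N" if "a \<in> carrier A" "b \<in> carrier B" for a b
    using G that by (simp add: bilinear_map_def)
  have lA: "linear_on (scal A) (scal N) (carrier A) (\<lambda>a. G j a b)" if "b \<in> carrier B" for b
    using G that by (simp add: bilinear_map_def)
  have lB: "linear_on (scal B) (scal N) (carrier B) (G j a)" if "a \<in> carrier A" for a
    using G that by (simp add: bilinear_map_def)
  have "bilinear_form A (opposite B) (?w v)" for v
    unfolding bilinear_form_def opposite_simps
    using linear_on_add[OF lA] linear_on_scale[OF lA] linear_on_add[OF lB] linear_on_scale[OF lB] mem
    by (simp add: add scal)
  then have "pt a b (?w v) = ?w v a b" for v by (simp add: pure_tensor_def)
  then have "(\<Sum>v\<in>basis_N. scal N (gen j (pt a b) i (\<lambda>a b. N.M.representation basis_N (G i a b) v)) v) =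
      (if i = j then (\<Sum>v\<in>basis_N. scal N (?w v a b) v) else 0)" for i
    by (simp add: gen_def)
  then have "lift_bilinear G (gen j (pt a b)) = (\<Sum>v\<in>basis_N. scal N (?w v a b) v)"
    unfolding lift_bilinear_def using j by simp
  also have "\<dots> = G j a b"
    using N.M.sum_representation_eq[OF basis_N(2), of "G j a b" basis_N] mem[OF ab] basis_N by simp
  finally show ?thesis .
qed

text \<open>The sign \<open>(-1)^n\<close>; in \<open>hA\<close> it accounts for the
  \<open>n\<close> letters in front of the one that is moved out of the generator.\<close>

definition sg :: "nat \<Rightarrow> 'n \<Rightarrow> 'n" where "sg n v = (if even n then v else - v)"

text \<open>
  The contracting homotopies move the factor \<open>a\<close> (for \<open>hA\<close>) or \<open>b\<close> (for \<open>hB\<close>) of a generator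
  \<open>a \<otimes> b\<close> into the adjacent argument list; \<open>hA\<close> reduces a cocycle to one without entries from \<open>A\<close>,
  to which \<open>hB\<close> applies.
\<close>

definition hA :: "('a list \<Rightarrow> (nat \<Rightarrow> ('a \<Rightarrow> 'b \<Rightarrow> 'k) \<Rightarrow> 'k) \<Rightarrow> 'b list \<Rightarrow> 'n) \<Rightarrow> 'a list \<Rightarrow> (nat \<Rightarrow> ('a \<Rightarrow> 'b \<Rightarrow> 'k) \<Rightarrow> 'k) \<Rightarrow> 'b list \<Rightarrow> 'n" where
  "hA f as x bs = (if set as \<subseteq> carrier A \<and> x \<in> carrier F \<and> set bs \<subseteq> carrier B
    then sg (length as) (lift_bilinear (\<lambda>j a b. f (as @ [a]) (gen j (pt (idt A) b)) bs) x) else 0)"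

definition hB :: "('a list \<Rightarrow> (nat \<Rightarrow> ('a \<Rightarrow> 'b \<Rightarrow> 'k) \<Rightarrow> 'k) \<Rightarrow> 'b list \<Rightarrow> 'n) \<Rightarrow> 'a list \<Rightarrow> (nat \<Rightarrow> ('a \<Rightarrow> 'b \<Rightarrow> 'k) \<Rightarrow> 'k) \<Rightarrow> 'b list \<Rightarrow> 'n" where
  "hB f as x bs = (if as = [] \<and> x \<in> carrier F \<and> set bs \<subseteq> carrier B
    then lift_bilinear (\<lambda>j a b. f [] (gen j (pt a (idt B))) (b # bs)) x else 0)"

lemma sg_Suc: "sg (Suc n) v = - sg n v"
  by (simp add: sg_def)

lemma sg_mem: "v \<in> carrier N \<Longrightarrow> sg n v \<in> carrier N"
  by (simp add: sg_def)

lemma linear_sg: "linear_on s (scal N) V h \<Longrightarrow> linear_on s (scal N) V (\<lambda>x. sg n (h x))"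
  using linear_on_scaled[OF N.M.vector_space_scal, of s V h "-1"] by (cases "even n") (simp_all add: sg_def)

section \<open>The homotopies map cochains to cochains\<close>

lemma bilinear_hA:
  assumes "tri_ml f" "set as \<subseteq> carrier A" "set bs \<subseteq> carrier B" "j < k"
  shows "bilinear_map (\<lambda>a b. f (as @ [a]) (gen j (pt (idt A) b)) bs)"
  unfolding bilinear_map_def
proof (intro conjI ballI)
  fix b assume b: "b \<in> carrier B"
  then have "multilinear A N (\<lambda>as. f as (gen j (pt (idt A) b)) bs)"
    using assms by (simp add: tri_multilinear_def)
  from multilinear_add[OF this, of as "[]"] multilinear_scal[OF this, of as "[]"]
  show "linear_on (scal A) (scal N) (carrier A) (\<lambda>a. f (as @ [a]) (gen j (pt (idt A) b)) bs)"
    using assms by (simp add: linear_on_def)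
next
  fix a assume a: "a \<in> carrier A"
  have l: "linear_on (scal F) (scal N) (carrier F) (\<lambda>x. f (as @ [a]) x bs)"
    by (rule tri_multilinear_linear[OF assms(1)]) (use a assms in auto)
  show "linear_on (scal B) (scal N) (carrier B) (\<lambda>b. f (as @ [a]) (gen j (pt (idt A) b)) bs)"
    unfolding linear_on_def
    using linear_on_add[OF l] linear_on_scale[OF l] assms(4)
    by (simp add: N.pt_add_right N.pt_scal_right gen_add gen_scal)
qed (use assms in \<open>auto intro!: tri_multilinear_mem[OF assms(1)]\<close>)

lemma bilinear_hB:
  assumes "tri_ml f" "set bs \<subseteq> carrier B" "j < k"
  shows "bilinear_map (\<lambda>a b. f [] (gen j (pt a (idt B))) (b # bs))"
  unfolding bilinear_map_def
proof (intro conjI ballI)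
  fix a assume a: "a \<in> carrier A"
  then have "multilinear B N (f [] (gen j (pt a (idt B))))"
    using assms by (simp add: tri_multilinear_def)
  from multilinear_Cons_add[OF this] multilinear_Cons_scal[OF this]
  show "linear_on (scal B) (scal N) (carrier B) (\<lambda>b. f [] (gen j (pt a (idt B))) (b # bs))"
    using assms by (simp add: linear_on_def)
next
  fix b assume b: "b \<in> carrier B"
  have l: "linear_on (scal F) (scal N) (carrier F) (\<lambda>x. f [] x (b # bs))"
    by (rule tri_multilinear_linear[OF assms(1)]) (use b assms in auto)
  show "linear_on (scal A) (scal N) (carrier A) (\<lambda>a. f [] (gen j (pt a (idt B))) (b # bs))"
    unfolding linear_on_def
    using linear_on_add[OF l] linear_on_scale[OF l] assms(3)
    by (simp add: N.pt_add_left N.pt_scal_left gen_add gen_scal)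
qed (use assms in \<open>auto intro!: tri_multilinear_mem[OF assms(1)]\<close>)

lemma hA_gen:
  assumes "tri_ml f" "set as \<subseteq> carrier A" "set bs \<subseteq> carrier B" "j < k" "a \<in> carrier A" "b \<in> carrier B"
  shows "hA f as (gen j (pt a b)) bs = sg (length as) (f (as @ [a]) (gen j (pt (idt A) b)) bs)"
  unfolding hA_def using assms lift_gen[where G = "\<lambda>j a b. f (as @ [a]) (gen j (pt (idt A) b)) bs", OF bilinear_hA[OF assms(1-4)], of a b] by simp

lemma hB_gen:
  assumes "tri_ml f" "set bs \<subseteq> carrier B" "j < k" "a \<in> carrier A" "b \<in> carrier B"
  shows "hB f [] (gen j (pt a b)) bs = f [] (gen j (pt a (idt B))) (b # bs)"
  unfolding hB_def using assms lift_gen[where G = "\<lambda>j a b. f [] (gen j (pt a (idt B))) (b # bs)", OF bilinear_hB[OF assms(1-3)], of a b] by simp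

lemma linear_hA: "set as \<subseteq> carrier A \<Longrightarrow> set bs \<subseteq> carrier B \<Longrightarrow> linear_on (scal F) (scal N) (carrier F) (\<lambda>x. hA f as x bs)"
  using linear_sg[OF linear_lift[of "carrier F"]] F.M.add_mem F.M.scal_mem unfolding linear_on_def hA_def by simp

lemma linear_hB: "set bs \<subseteq> carrier B \<Longrightarrow> linear_on (scal F) (scal N) (carrier F) (\<lambda>x. hB f [] x bs)"
  using linear_lift[of "carrier F"] F.M.add_mem F.M.scal_mem unfolding linear_on_def hB_def by simp

lemma hA_mem: "hA f as x bs \<in> carrier N"
  by (simp add: hA_def lift_mem sg_mem)

lemma hB_mem: "hB f as x bs \<in> carrier N"
  by (simp add: hB_def lift_mem)

lemmas vsN = N.M.vector_space_scal

lemma tri_multilinear_hA: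
  assumes f: "tri_ml f"
  shows "tri_ml (hA f)"
  unfolding tri_multilinear_def
proof (intro conjI ballI allI impI)
  fix x bs assume x: "x \<in> carrier F" and bs: "set bs \<subseteq> carrier B"
  have m: "multilinear A N (\<lambda>as. f as (gen j (pt (idt A) b)) bs)" if "j < k" "b \<in> carrier B" for j b
    using f that bs by (simp add: tri_multilinear_def)
  show "multilinear A N (\<lambda>as. hA f as x bs)"
  proof (rule multilinearI, goal_cases)
    case 1 show ?case by (rule hA_mem)
  next
    case (2 xs ys a a')
    have s: "set (xs @ (a + a') # ys) \<subseteq> carrier A" "set (xs @ a # ys) \<subseteq> carrier A" "set (xs @ a' # ys) \<subseteq> carrier A"
      using 2 by auto
    show ?case
    proof (rule F_linear_ext[OF vsN linear_hA[OF s(1) bs] linear_on_plus[OF vsN linear_hA[OF s(2) bs] linear_hA[OF s(3) bs]] _ x])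
      fix j u v assume uv: "j < k" "u \<in> carrier A" "v \<in> carrier B"
      show "hA f (xs @ (a + a') # ys) (gen j (pt u v)) bs =
        hA f (xs @ a # ys) (gen j (pt u v)) bs + hA f (xs @ a' # ys) (gen j (pt u v)) bs"
        unfolding hA_gen[OF f s(1) bs uv] hA_gen[OF f s(2) bs uv] hA_gen[OF f s(3) bs uv]
        using multilinear_add[OF m, of j v xs "ys @ [u]" a a'] uv 2 by (simp add: sg_def)
    qed
  next
    case (3 xs ys a c)
    have s: "set (xs @ scal A c a # ys) \<subseteq> carrier A" "set (xs @ a # ys) \<subseteq> carrier A"
      using 3 by auto
    show ?case
    proof (rule F_linear_ext[OF vsN linear_hA[OF s(1) bs] linear_on_scaled[OF vsN linear_hA[OF s(2) bs]] _ x])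
      fix j u v assume uv: "j < k" "u \<in> carrier A" "v \<in> carrier B"
      show "hA f (xs @ scal A c a # ys) (gen j (pt u v)) bs = scal N c (hA f (xs @ a # ys) (gen j (pt u v)) bs)"
        unfolding hA_gen[OF f s(1) bs uv] hA_gen[OF f s(2) bs uv]
        using multilinear_scal[OF m, of j v xs "ys @ [u]" a c] uv 3 by (simp add: sg_def)
    qed
  qed
next
  fix x as assume x: "x \<in> carrier F" and as: "set as \<subseteq> carrier A"
  have m: "multilinear B N (f (as @ [u]) (gen j (pt (idt A) b)))" if "j < k" "b \<in> carrier B" "u \<in> carrier A" for j b u
    using f that as by (simp add: tri_multilinear_def)
  show "multilinear B N (hA f as x)"
  proof (rule multilinearI, goal_cases)
    case 1 show ?case by (rule hA_mem)
  next
    case (2 xs ys a a')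
    have s: "set (xs @ (a + a') # ys) \<subseteq> carrier B" "set (xs @ a # ys) \<subseteq> carrier B" "set (xs @ a' # ys) \<subseteq> carrier B"
      using 2 by auto
    show ?case
    proof (rule F_linear_ext[OF vsN linear_hA[OF as s(1)] linear_on_plus[OF vsN linear_hA[OF as s(2)] linear_hA[OF as s(3)]] _ x])
      fix j u v assume uv: "j < k" "u \<in> carrier A" "v \<in> carrier B"
      show "hA f as (gen j (pt u v)) (xs @ (a + a') # ys) =
        hA f as (gen j (pt u v)) (xs @ a # ys) + hA f as (gen j (pt u v)) (xs @ a' # ys)"
        unfolding hA_gen[OF f as s(1) uv] hA_gen[OF f as s(2) uv] hA_gen[OF f as s(3) uv]
        using multilinear_add[OF m, of j v u xs ys a a'] uv 2 by (simp add: sg_def)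
    qed
  next
    case (3 xs ys a c)
    have s: "set (xs @ scal B c a # ys) \<subseteq> carrier B" "set (xs @ a # ys) \<subseteq> carrier B"
      using 3 by auto
    show ?case
    proof (rule F_linear_ext[OF vsN linear_hA[OF as s(1)] linear_on_scaled[OF vsN linear_hA[OF as s(2)]] _ x])
      fix j u v assume uv: "j < k" "u \<in> carrier A" "v \<in> carrier B"
      show "hA f as (gen j (pt u v)) (xs @ scal B c a # ys) = scal N c (hA f as (gen j (pt u v)) (xs @ a # ys))"
        unfolding hA_gen[OF f as s(1) uv] hA_gen[OF f as s(2) uv]
        using multilinear_scal[OF m, of j v u xs ys a c] uv 3 by (simp add: sg_def)
    qed
  qed
qed (rule linear_hA)

lemma tri_multilinear_hB:
  assumes f: "tri_ml f"
  shows "tri_ml (hB f)"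
  unfolding tri_multilinear_def
proof (intro conjI ballI allI impI)
  fix x bs assume x: "x \<in> carrier F" and bs: "set bs \<subseteq> carrier B"
  show "multilinear A N (\<lambda>as. hB f as x bs)"
    by (rule multilinearI) (rule hB_mem, simp_all add: hB_def)
next
  fix x and as :: "'a list" assume x: "x \<in> carrier F" and as: "set as \<subseteq> carrier A"
  have m: "multilinear B N (f [] (gen j (pt u (idt B))))" if "j < k" "u \<in> carrier A" for j u
    using f that as by (simp add: tri_multilinear_def)
  show "multilinear B N (hB f as x)"
  proof (cases "as = []")
    case False
    then have "hB f as x = (\<lambda>bs. 0)" by (simp add: hB_def fun_eq_iff)
    then show ?thesis using N.bi.right.multilinear_zero_map by simp
  next
    case as: True
    show ?thesis
      unfolding as
    proof (rule multilinearI, goal_cases)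
      case 1 show ?case by (rule hB_mem)
    next
      case (2 xs ys a a')
      have s: "set (xs @ (a + a') # ys) \<subseteq> carrier B" "set (xs @ a # ys) \<subseteq> carrier B" "set (xs @ a' # ys) \<subseteq> carrier B"
        using 2 by auto
      show ?case
      proof (rule F_linear_ext[OF vsN linear_hB[OF s(1)] linear_on_plus[OF vsN linear_hB[OF s(2)] linear_hB[OF s(3)]] _ x])
        fix j u v assume uv: "j < k" "u \<in> carrier A" "v \<in> carrier B"
        show "hB f [] (gen j (pt u v)) (xs @ (a + a') # ys) =
          hB f [] (gen j (pt u v)) (xs @ a # ys) + hB f [] (gen j (pt u v)) (xs @ a' # ys)"
          unfolding hB_gen[OF f s(1) uv] hB_gen[OF f s(2) uv] hB_gen[OF f s(3) uv]
          using multilinear_add[OF m, of j u "v # xs" ys a a'] uv 2 by simp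
      qed
    next
      case (3 xs ys a c)
      have s: "set (xs @ scal B c a # ys) \<subseteq> carrier B" "set (xs @ a # ys) \<subseteq> carrier B"
        using 3 by auto
      show ?case
      proof (rule F_linear_ext[OF vsN linear_hB[OF s(1)] linear_on_scaled[OF vsN linear_hB[OF s(2)]] _ x])
        fix j u v assume uv: "j < k" "u \<in> carrier A" "v \<in> carrier B"
        show "hB f [] (gen j (pt u v)) (xs @ scal B c a # ys) = scal N c (hB f [] (gen j (pt u v)) (xs @ a # ys))"
          unfolding hB_gen[OF f s(1) uv] hB_gen[OF f s(2) uv]
          using multilinear_scal[OF m, of j u "v # xs" ys a c] uv 3 by simp
      qed
    qed
  qed
next
  fix as bs assume bs: "set bs \<subseteq> carrier B"
  show "linear_on (scal F) (scal N) (carrier F) (\<lambda>x. hB f as x bs)"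
  proof (cases "as = []")
    case True
    then show ?thesis using linear_hB[OF bs] by simp
  next
    case False
    then show ?thesis using linear_on_zero[OF vsN] by (simp add: hB_def)
  qed
qed

lemma hA_closed:
  assumes "f \<in> cochains (Suc n)"
  shows "hA f \<in> cochains n"
  unfolding FN.D.cochains_iff
proof (intro conjI allI impI)
  have f: "tri_ml f" using assms by (simp add: FN.D.cochains_iff)
  then show "tri_ml (hA f)" by (rule tri_multilinear_hA)
  fix as x bs
  assume a: "\<not> (set as \<subseteq> carrier A \<and> x \<in> carrier F \<and> set bs \<subseteq> carrier B \<and> Suc (length as + length bs) = n)"
  show "hA f as x bs = 0"
  proof (cases "set as \<subseteq> carrier A \<and> x \<in> carrier F \<and> set bs \<subseteq> carrier B")
    case True
    then have c: "set as \<subseteq> carrier A" "set bs \<subseteq> carrier B" "x \<in> carrier F" by auto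
    have "f (as @ [u]) y bs = 0" for u y
      using assms a True by (auto simp: FN.D.cochains_iff)
    then show ?thesis
      using hA_gen[OF f c(1,2)] by (intro F_linear_ext[OF vsN linear_hA[OF c(1,2)] linear_on_zero[OF vsN] _ c(3)]) (simp add: sg_def)
  qed (auto simp: hA_def)
qed

lemma hB_closed:
  assumes "f \<in> cochains (Suc n)"
  shows "hB f \<in> cochains n"
  unfolding FN.D.cochains_iff
proof (intro conjI allI impI)
  have f: "tri_ml f" using assms by (simp add: FN.D.cochains_iff)
  then show "tri_ml (hB f)" by (rule tri_multilinear_hB)
  fix as x bs
  assume a: "\<not> (set as \<subseteq> carrier A \<and> x \<in> carrier F \<and> set bs \<subseteq> carrier B \<and> Suc (length as + length bs) = n)"
  show "hB f as x bs = 0"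
  proof (cases "as = [] \<and> x \<in> carrier F \<and> set bs \<subseteq> carrier B")
    case True
    then have c: "set bs \<subseteq> carrier B" "x \<in> carrier F" by auto
    have "f [] y (u # bs) = 0" for u y
      using assms a True by (auto simp: FN.D.cochains_iff)
    then have "hB f [] x bs = 0"
      using hB_gen[OF f c(1)] by (intro F_linear_ext[OF vsN linear_hB[OF c(1)] linear_on_zero[OF vsN] _ c(2)]) simp
    then show ?thesis using True by simp
  qed (auto simp: hB_def)
qed

lemma tb_minus:
  assumes "tri_ml f" "set as \<subseteq> carrier A" "x \<in> carrier F" "set bs \<subseteq> carrier B"
  shows "tb (\<lambda>as x bs. - f as x bs) as x bs = - tb f as x bs"
proof -
  have "unfold_word (\<lambda>as x bs. - f as x bs) = (\<lambda>ts. - unfold_word f ts)"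
    using FN.D.unfold_word_scal[of "-1" f] by (simp add: fun_eq_iff)
  then show ?thesis
    using FN.D.TN.bar_minus[of "unfold_word f" "word as x bs"] multilinear_mem[OF FN.D.multilinear_unfold_word[OF assms(1)]]
      FN.D.set_word[OF assms(2-4)] by simp
qed

lemma tb_zero:
  assumes "set as \<subseteq> carrier A" "x \<in> carrier F" "set bs \<subseteq> carrier B"
  shows "tb (\<lambda>as x bs. 0 :: 'n) as x bs = 0"
proof -
  have "unfold_word (\<lambda>as x bs. 0 :: 'n) = (\<lambda>ts :: ('a \<times> (nat \<Rightarrow> ('a \<Rightarrow> 'b \<Rightarrow> 'k) \<Rightarrow> 'k) \<times> 'b) list. 0)"
    using FN.D.unfold_word_zero by (intro ext)
  then show ?thesis using FN.D.TN.bar_zero[OF FN.D.set_word[OF assms]] by simp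
qed

text \<open>The homotopy formula for the faces other than the first. The letter \<open>a\<close>
  stands last among those of \<open>A\<close>, and the face that merges it with
  \<open>1 \<otimes> b\<close> restores \<open>a \<otimes> b\<close>; the remaining faces cancel
  against those of \<open>hA f\<close>.\<close>

lemma tb_hA:
  assumes "tri_ml f" "set as \<subseteq> carrier A" "set bs \<subseteq> carrier B" "j < k" "a \<in> carrier A" "b \<in> carrier B"
  shows "sg (length as) (tb f (as @ [a]) (gen j (pt (idt A) b)) bs) + tb (hA f) as (gen j (pt a b)) bs
    = - f as (gen j (pt a b)) bs"
proof -
  \<comment> \<open>Quantified over \<open>f\<close>, because the induction step applies the claim
    to \<open>f\<close> with its first letter fixed; the generator and \<open>bs\<close> do not
    change.\<close>
  define P where "P as \<longleftrightarrow> (\<forall>f. tri_ml f \<longrightarrow>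
    sg (length as) (tb f (as @ [a]) (gen j (pt (idt A) b)) bs) + tb (hA f) as (gen j (pt a b)) bs
    = - f as (gen j (pt a b)) bs)" for as
  have "P as" using assms(2)
  proof (induction as)
    case Nil
    show ?case unfolding P_def
    proof (intro allI impI)
      fix f assume f: "tri_ml f"
      let ?x = "gen j (pt a b)" and ?y = "gen j (pt (idt A) b)"
      have c: "?x \<in> carrier F" "?y \<in> carrier F" using assms by auto
      have f': "tri_ml (\<lambda>as. f (a # as))" by (rule tri_multilinear_Cons[OF f assms(5)])
      have "tb f [a] ?y bs = - f [] ?x bs - tb (\<lambda>as. f (a # as)) [] ?y bs"
        using FN.D.tri_bar_Cons[OF f assms(5) _ c(2) assms(3), of "[]"] lact_gen[of j a "idt A" b] assms
        by (simp add: N.A.mul_idt_right del: word_simps)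
      moreover have "tb (hA f) [] ?x bs = tb (\<lambda>as. f (a # as)) [] ?y bs"
      proof -
        have "N.bi.right.brr (hA f [] ?x) bs = N.bi.right.brr (f [a] ?y) bs"
          by (rule N.bi.right.bar_cong) (use hA_gen[OF f, of "[]" _ j a b] assms in \<open>auto simp: sg_def\<close>)
        moreover have "hA f [] (rF ?x c) cs = f [a] (rF ?y c) cs" if "bs = c # cs" for c cs
          using hA_gen[OF f, of "[]" cs j a "mul B b c"] that assms
          by (simp add: ract_gen sg_def)
        ultimately show ?thesis
          unfolding FN.D.tri_bar_Nil[OF tri_multilinear_hA[OF f] c(1) assms(3)] FN.D.tri_bar_Nil[OF f' c(2) assms(3)]
          by (cases bs) simp_all
      qed
      ultimately show "sg (length []) (tb f ([] @ [a]) (gen j (pt (idt A) b)) bs) + tb (hA f) [] (gen j (pt a b)) bs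
        = - f [] (gen j (pt a b)) bs" by (simp add: sg_def del: word_simps)
    qed
  next
    case (Cons a' as)
    show ?case unfolding P_def
    proof (intro allI impI)
      fix f assume f: "tri_ml f"
      let ?x = "gen j (pt a b)" and ?y = "gen j (pt (idt A) b)"
      let ?F = "\<lambda>as. f (a' # as)"
      have c: "?x \<in> carrier F" "?y \<in> carrier F" "a' \<in> carrier A" "set as \<subseteq> carrier A" "set (as @ [a]) \<subseteq> carrier A"
        using assms Cons.prems by auto
      have F: "tri_ml ?F" by (rule tri_multilinear_Cons[OF f c(3)])
      have IH: "sg (length as) (tb ?F (as @ [a]) ?y bs) + tb (hA ?F) as ?x bs = - f (a' # as) ?x bs"
        using Cons.IH[OF c(4)] F unfolding P_def by blast
      let ?c1 = "case as @ [a] of [] \<Rightarrow> f [] (lF a' ?y) bs | u # us \<Rightarrow> f (mul A a' u # us) ?y bs"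
      let ?c2 = "case as of [] \<Rightarrow> hA f [] (lF a' ?x) bs | u # us \<Rightarrow> hA f (mul A a' u # us) ?x bs"
      have 1: "tb f (a' # as @ [a]) ?y bs = - ?c1 - tb ?F (as @ [a]) ?y bs"
        by (rule FN.D.tri_bar_Cons[OF f c(3) c(5) c(2) assms(3)])
      \<comment> \<open>One more letter in front reverses the sign of \<open>hA\<close>, which
        compensates the sign in \<open>tri_bar_Cons\<close>.\<close>
      have "(\<lambda>as. hA f (a' # as)) = (\<lambda>as x bs. - hA ?F as x bs)"
        using c(3) by (auto simp: hA_def sg_Suc fun_eq_iff)
      then have 2: "tb (hA f) (a' # as) ?x bs = - ?c2 + tb (hA ?F) as ?x bs"
        using FN.D.tri_bar_Cons[OF tri_multilinear_hA[OF f] c(3) c(4) c(1) assms(3)]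
          tb_minus[OF tri_multilinear_hA[OF F] c(4) c(1) assms(3)] by simp
      have 3: "sg (length as) ?c1 = ?c2"
      proof (cases as)
        case Nil
        then show ?thesis
          using hA_gen[OF f _ assms(3,4), of "[]" "mul A a' a" b] lact_gen[of j a' a b] assms c by (simp add: sg_def)
      next
        case as: (Cons u us)
        then show ?thesis
          using hA_gen[OF f _ assms(3,4), of "mul A a' u # us" a b] assms c by simp
      qed
      have "sg (length (a' # as)) (tb f ((a' # as) @ [a]) ?y bs) = sg (length as) ?c1 + sg (length as) (tb ?F (as @ [a]) ?y bs)"
        unfolding append_Cons 1 by (simp add: sg_def)
      then show "sg (length (a' # as)) (tb f ((a' # as) @ [a]) (gen j (pt (idt A) b)) bs) + tb (hA f) (a' # as) (gen j (pt a b)) bs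
        = - f (a' # as) (gen j (pt a b)) bs" unfolding 2 using IH 3 by (simp del: word_simps append_Cons)
    qed
  qed
  then show ?thesis using assms(1) unfolding P_def by blast
qed

text \<open>The two homotopies are applied in succession, not added: \<open>hB\<close> is a
  contraction only for a cocycle that is \<open>A\<close>-linear in the module variable, and the
  correction by \<open>hA\<close> produces such a cocycle.\<close>

theorem free_acyclic:
  assumes f: "f \<in> cochains (Suc n)" "FN.D.tri_diff f = 0" and n: "n \<ge> 1"
  shows "\<exists>g\<in>cochains n. FN.D.tri_diff g = f"
proof -
  let ?d = "FN.D.tri_diff"
  note vsC = FN.D.vector_space_cochains
  interpret C: vector_space "\<lambda>c (f :: 'a list \<Rightarrow> (nat \<Rightarrow> ('a \<Rightarrow> 'b \<Rightarrow> 'k) \<Rightarrow> 'k) \<Rightarrow> 'b list \<Rightarrow> 'n) as x bs. scal N c (f as x bs)"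
    by (rule vsC)
  note sub = FN.D.subspace_cochains
  have fm: "tri_ml f" using f by (simp add: FN.D.cochains_iff)
  have hA: "hA f \<in> cochains n" by (rule hA_closed[OF f(1)])
  \<comment> \<open>The sign is \<open>+\<close> because in \<open>tb_hA\<close> the homotopy yields
    minus the identity.\<close>
  let ?g = "f + ?d (hA f)"
  have g: "?g \<in> cochains (Suc n)" by (intro C.subspace_add[OF sub] f FN.D.tri_diff_closed hA)
  then have gm: "tri_ml ?g" by (simp add: FN.D.cochains_iff)
  have dg: "?d ?g = 0"
    using linear_on_add[OF FN.D.linear_tri_diff f(1) FN.D.tri_diff_closed[OF hA]] f(2) FN.D.tri_diff_diff[OF hA] by simp
  have df: "(case as of [] \<Rightarrow> 0 | a # as' \<Rightarrow> lN a (h as' x bs)) + tb h as x bs = 0"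
    if "tri_ml h" "?d h = 0" "set as \<subseteq> carrier A" "x \<in> carrier F" "set bs \<subseteq> carrier B" for h as x bs
    using fun_cong[OF fun_cong[OF fun_cong[OF that(2)]], of as x bs] that(3-5) FN.D.lead_word[OF that(1,3-5)]
    by (simp add: FN.D.tri_diff_def)
  have g0: "?g (a' # as) = (\<lambda>x bs. 0)" if a': "a' \<in> carrier A" for a' as
  proof (intro ext)
    fix x bs
    show "?g (a' # as) x bs = 0"
    proof (cases "set as \<subseteq> carrier A \<and> x \<in> carrier F \<and> set bs \<subseteq> carrier B")
      case False
      then have "\<not> (set (a' # as) \<subseteq> carrier A \<and> x \<in> carrier F \<and> set bs \<subseteq> carrier B \<and> Suc (length (a' # as) + length bs) = Suc n)"
        by auto
      then show ?thesis using g unfolding FN.D.cochains_iff by blast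
    next
      case True
      then have c: "set as \<subseteq> carrier A" "x \<in> carrier F" "set bs \<subseteq> carrier B" "set (a' # as) \<subseteq> carrier A" using a' by auto
      show ?thesis
      proof (rule F_linear_ext[OF vsN tri_multilinear_linear[OF gm c(4) c(3)] linear_on_zero[OF vsN] _ c(2)])
        fix j a b assume ab: "j < k" "a \<in> carrier A" "b \<in> carrier B"
        let ?x = "gen j (pt a b)" and ?y = "gen j (pt (idt A) b)"
        let ?v = "f (as @ [a]) ?y bs"
        have xy: "?x \<in> carrier F" "?y \<in> carrier F" using ab by auto
        have s: "set ((a' # as) @ [a]) \<subseteq> carrier A" using c ab by auto
        have v: "?v \<in> carrier N" using tri_multilinear_mem[OF fm _ xy(2) c(3), of "as @ [a]"] c ab by simp
        have 1: "lN a' ?v + tb f ((a' # as) @ [a]) ?y bs = 0"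
          using df[OF fm f(2) s xy(2) c(3)] by simp
        have 2: "?d (hA f) (a' # as) ?x bs = lN a' (hA f as ?x bs) + tb (hA f) (a' # as) ?x bs"
          using FN.D.lead_word[OF tri_multilinear_hA[OF fm] c(4) xy(1) c(3)] c xy by (simp add: FN.D.tri_diff_def)
        have 3: "sg (length (a' # as)) (tb f ((a' # as) @ [a]) ?y bs) + tb (hA f) (a' # as) ?x bs = - f (a' # as) ?x bs"
          by (rule tb_hA[OF fm c(4) c(3) ab])
        have 4: "lN a' (hA f as ?x bs) = sg (length as) (lN a' ?v)"
          using hA_gen[OF fm c(1) c(3) ab] a' v by (simp add: sg_def N.bi.lact_minus_right)
        have "tb f ((a' # as) @ [a]) ?y bs = - lN a' ?v" using 1 by (simp add: eq_neg_iff_add_eq_0 add.commute)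
        then have "sg (length (a' # as)) (tb f ((a' # as) @ [a]) ?y bs) = sg (length as) (lN a' ?v)"
          by (simp add: sg_def)
        then show "?g (a' # as) ?x bs = 0" using 2 3 4 by (simp add: eq_neg_iff_add_eq_0 algebra_simps)
      qed
    qed
  qed
  \<comment> \<open>The cocycle condition with one letter from \<open>A\<close>: its terms that keep
    such a letter vanish by \<open>g0\<close>, and the two terms left over express
    \<open>A\<close>-linearity.\<close>
  have gA: "lN a' (?g [] x bs) = ?g [] (lF a' x) bs" if "a' \<in> carrier A" "x \<in> carrier F" "set bs \<subseteq> carrier B" for a' x bs
  proof -
    have z: "(\<lambda>as. ?g (a' # as)) = (\<lambda>as x bs. 0)" using g0[OF that(1)] by blast
    have "tb ?g [a'] x bs = - ?g [] (lF a' x) bs"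
      using FN.D.tri_bar_Cons[OF gm that(1) _ that(2,3), of "[]"] tb_zero[of "[]", OF _ that(2,3)]
      unfolding z by (simp del: word_simps plus_fun_apply)
    then show ?thesis using df[OF gm dg, of "[a']" x bs] that by (simp del: word_simps plus_fun_apply)
  qed
  have hB: "hB ?g \<in> cochains n" by (rule hB_closed[OF g])
  have hm: "tri_ml (hB ?g)" by (rule tri_multilinear_hB[OF gm])
  have gmem: "?g as x bs \<in> carrier N" for as x bs by (rule FN.D.cochains_mem[OF g])
  define G where "G = ?g"
  note gs = gm[folded G_def] dg[folded G_def] g0[folded G_def] gA[folded G_def] hm[folded G_def] g[folded G_def] gmem[folded G_def] hB[folded G_def]
  have key: "?d (hB G) as x bs = - G as x bs" for as x bs
  proof (cases "set as \<subseteq> carrier A \<and> x \<in> carrier F \<and> set bs \<subseteq> carrier B")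
    case False
    then have "\<not> (set as \<subseteq> carrier A \<and> x \<in> carrier F \<and> set bs \<subseteq> carrier B \<and> Suc (length as + length bs) = Suc n)"
      by auto
    then have "G as x bs = 0" using gs(6) unfolding FN.D.cochains_iff by blast
    then show ?thesis using False by (auto simp: FN.D.tri_diff_def)
  next
    case True
    then have c: "set as \<subseteq> carrier A" "x \<in> carrier F" "set bs \<subseteq> carrier B" by auto
    have dl: "linear_on (scal F) (scal N) (carrier F) (\<lambda>x. ?d (hB G) as x bs)"
      by (rule tri_multilinear_linear[OF FN.D.tri_multilinear_diff[OF gs(5)] c(1,3)])
    have gl: "linear_on (scal F) (scal N) (carrier F) (\<lambda>x. - G as x bs)"
      using linear_on_scaled[OF vsN tri_multilinear_linear[OF gs(1) c(1,3)], of "-1"] by simp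
    show ?thesis
    proof (rule F_linear_ext[OF vsN dl gl _ c(2)])
      fix j a b assume ab: "j < k" "a \<in> carrier A" "b \<in> carrier B"
      let ?x = "gen j (pt a b)" and ?y = "gen j (pt a (idt B))"
      have xy: "?x \<in> carrier F" "?y \<in> carrier F" using ab by auto
      have d: "?d (hB G) as ?x bs = (case as of [] \<Rightarrow> 0 | a # as' \<Rightarrow> lN a (hB G as' ?x bs)) + tb (hB G) as ?x bs"
        using FN.D.lead_word[OF gs(5) c(1) xy(1) c(3)] c xy by (simp add: FN.D.tri_diff_def)
      have hz: "(\<lambda>as. hB G (u # as)) = (\<lambda>as x bs. 0)" for u
        by (intro ext) (simp add: hB_def)
      show "?d (hB G) as ?x bs = - G as ?x bs"
      proof (cases as)
        case as: Nil
        show ?thesis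
        proof (cases bs)
          case Nil
          \<comment> \<open>This is where \<open>n >= 1\<close> matters: cocycles of degree 1 are
            module homomorphisms, and a nonzero one is not a coboundary.\<close>
          have "Suc (length as + length bs) \<noteq> Suc n" using n as Nil by simp
          then have "G as ?x bs = 0" using gs(6) unfolding FN.D.cochains_iff by blast
          then show ?thesis using d as Nil FN.D.tri_bar_Nil[OF gs(5) xy(1) c(3)] by (simp del: word_simps)
        next
          case (Cons u us)
          have u: "u \<in> carrier B" "set us \<subseteq> carrier B" using c Cons by auto
          have e1: "hB G [] (rF ?x u) us = G [] ?y (mul B b u # us)"
            using hB_gen[OF gs(1) u(2) ab(1,2), of "mul B b u"] ract_gen[of j u a b] ab u by simp
          have e2: "N.bi.right.brr (hB G [] ?x) bs = N.bi.right.brr (\<lambda>ys. G [] ?y (b # ys)) bs"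
            by (rule N.bi.right.bar_cong) (use hB_gen[OF gs(1) _ ab] c in auto)
          have "tb G [] ?y (b # bs) = 0"
            using df[OF gs(1,2), of "[]" ?y "b # bs"] xy c ab by simp
          moreover have "rF ?y b = ?x" using ract_gen[of j b a "idt B"] ab by (simp add: N.B.mul_idt_left)
          ultimately have "- G [] ?x bs - N.bi.right.brr (G [] ?y) (b # bs) = 0"
            using FN.D.tri_bar_Nil[OF gs(1) xy(2), of "b # bs"] c ab by (simp del: word_simps bar.simps)
          moreover have "N.bi.right.brr (G [] ?y) (b # bs) = - G [] ?y (mul B b u # us) - N.bi.right.brr (\<lambda>ys. G [] ?y (b # ys)) bs"
            by (simp add: Cons)
          ultimately have e3: "N.bi.right.brr (\<lambda>ys. G [] ?y (b # ys)) bs = G [] ?x bs - G [] ?y (mul B b u # us)"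
            by (simp add: algebra_simps)
          have "tb (hB G) [] ?x bs = - hB G [] (rF ?x u) us - N.bi.right.brr (hB G [] ?x) bs"
            using FN.D.tri_bar_Nil[OF gs(5) xy(1) c(3)] Cons by (simp del: word_simps bar.simps)
          then show ?thesis using d as unfolding e1 e2 e3 by (simp del: word_simps)
        qed
      next
        case as: (Cons a' as')
        have a': "a' \<in> carrier A" "set as' \<subseteq> carrier A" using c as by auto
        have t: "tb (hB G) as ?x bs = - (case as' of [] \<Rightarrow> hB G [] (lF a' ?x) bs | u # us \<Rightarrow> hB G (mul A a' u # us) ?x bs)"
          using FN.D.tri_bar_Cons[OF gs(5) a'(1) a'(2) xy(1) c(3)] tb_zero[OF a'(2) xy(1) c(3)]
          unfolding hz as by (simp del: word_simps)
        have G0: "G as ?x bs = 0" using gs(3)[OF a'(1)] as by simp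
        show ?thesis
        proof (cases as')
          case Nil
          \<comment> \<open>By \<open>A\<close>-linearity the first face cancels against the face
            that merges \<open>a'\<close> into the generator.\<close>
          have "lN a' (hB G [] ?x bs) = hB G [] (lF a' ?x) bs"
            using hB_gen[OF gs(1) c(3) ab] hB_gen[OF gs(1) c(3) ab(1) _ ab(3), of "mul A a' a"]
              gs(4)[OF a'(1) xy(2), of "b # bs"] lact_gen[of j a' a b] lact_gen[of j a' a "idt B"] ab a' c by simp
          then show ?thesis using d t G0 as Nil by (simp del: word_simps)
        next
          case (Cons u us)
          then show ?thesis using d t G0 as a' by (simp add: hB_def del: word_simps)
        qed
      qed
    qed
  qed
  have "?d (hB G) = - G" using key by (intro ext) simp
  then have "f = - ?d (hB G) - ?d (hA f)" by (simp add: G_def)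
  also have "\<dots> = ?d (- hB G - hA f)"
    using linear_on_diff[OF vsC vsC sub FN.D.linear_tri_diff C.subspace_neg[OF sub gs(8)] hA]
      linear_on_minus[OF vsC vsC FN.D.linear_tri_diff gs(8)] by simp
  finally have "?d (- hB G - hA f) = f" by simp
  moreover have "- hB G - hA f \<in> cochains n" by (intro C.subspace_diff[OF sub] C.subspace_neg[OF sub] gs(8) hA)
  ultimately show ?thesis by blast
qed

end

section \<open>Dimension shifting\<close>

abbreviation hom_scal :: "('k, 'n, 'z) vspace_scheme \<Rightarrow> 'k \<Rightarrow> ('x \<Rightarrow> 'n) \<Rightarrow> 'x \<Rightarrow> 'n" where
  "hom_scal N \<equiv> (\<lambda>c f x. scal N c (f x))"

abbreviation tri_scal :: "('k, 'n, 'z) vspace_scheme \<Rightarrow> 'k \<Rightarrow> ('a list \<Rightarrow> 'x \<Rightarrow> 'b list \<Rightarrow> 'n) \<Rightarrow> 'a list \<Rightarrow> 'x \<Rightarrow> 'b list \<Rightarrow> 'n" where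
  "tri_scal N \<equiv> (\<lambda>c f as x bs. scal N c (f as x bs))"

context tensor_module_pair
begin

abbreviation "tri_cocycles \<equiv> cocycles D.cochains (\<lambda>_. D.tri_diff)"
abbreviation "tri_coboundaries \<equiv> coboundaries D.cochains (\<lambda>_. D.tri_diff)"

definition tri_cohomology_dim :: "nat \<Rightarrow> nat" where
  "tri_cohomology_dim n = cohomology_dim (tri_scal N) D.cochains (\<lambda>_. D.tri_diff) n"

lemma module_homs_0: "f \<in> module_homs R X N \<Longrightarrow> f 0 = 0"
  by (rule linear_on_0[OF X.M.vector_space_scal N.M.vector_space_scal X.M.subspace_carrier module_hom_linear])

lemma kernel_lmodule:
  assumes "f \<in> module_homs R X N"
  shows "lmodule R (X\<lparr>carrier := {x \<in> carrier X. f x = 0}\<rparr>)"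
proof (rule submodule_lmodule[OF X.M.lmodule_axioms])
  show "module.subspace (scal X) {x \<in> carrier X. f x = 0}"
    by (rule subspace_linear_kernel[OF X.M.vector_space_scal N.M.vector_space_scal X.M.subspace_carrier module_hom_linear[OF assms]])
next
  fix r x assume "r \<in> carrier R" "x \<in> {x \<in> carrier X. f x = 0}"
  then show "act X r x \<in> {x \<in> carrier X. f x = 0}"
    using assms X.M.act_closed[of r x]
      linear_on_0[OF N.M.vector_space_scal N.M.vector_space_scal N.M.subspace_carrier N.linear_act[of r]]
    by (auto simp: module_homs_def)
qed auto

lemma kernel_fin_dim:
  assumes "f \<in> module_homs R X N" "fin_dim X"
  shows "fin_dim (X\<lparr>carrier := {x \<in> carrier X. f x = 0}\<rparr>)"
proof -
  interpret K: lmodule R "X\<lparr>carrier := {x \<in> carrier X. f x = 0}\<rparr>" by (rule kernel_lmodule[OF assms(1)])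
  show ?thesis
    using findim_mono[OF X.M.findim_carrier[OF assms(2)], of "{x \<in> carrier X. f x = 0}"] K.subspace_carrier
    by (intro K.fin_dimI) simp
qed

lemma vector_space_homs: "vector_space (hom_scal N)"
  by (rule vector_space_fun[OF N.M.vector_space_scal])

section \<open>Degree 1: cocycles as module homomorphisms\<close>

definition value_at :: "('a list \<Rightarrow> 'x \<Rightarrow> 'b list \<Rightarrow> 'n) \<Rightarrow> 'x \<Rightarrow> 'n" where
  "value_at f = (\<lambda>x. f [] x [])"

lemma linear_value_at: "linear_on (tri_scal N) (hom_scal N) V value_at"
  by (auto simp: linear_on_def value_at_def fun_eq_iff)

lemma tri_bar_Nil_Nil: "D.tri_ml f \<Longrightarrow> x \<in> carrier X \<Longrightarrow> D.TN.brr (unfold_word f) (word [] x []) = 0"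
  using D.tri_bar_Nil[of f x "[]"] by (simp del: word_simps)

lemma tri_diff_one_A:
  assumes "D.tri_ml f" "a \<in> carrier A" "x \<in> carrier X"
  shows "D.tri_diff f [a] x [] = left_act A B N a (f [] x []) - f [] (left_act A B X a x) []"
  using D.tri_bar_Cons[OF assms(1,2) _ assms(3), of "[]" "[]"] tri_bar_Nil_Nil[OF tri_multilinear_Cons[OF assms(1,2)] assms(3)]
    D.lead_word[OF assms(1), of "[a]" x "[]"] assms
  by (simp add: D.tri_diff_def del: word_simps)

lemma tri_diff_one_B:
  assumes "D.tri_ml f" "b \<in> carrier B" "x \<in> carrier X"
  shows "D.tri_diff f [] x [b] = right_act A B N (f [] x []) b - f [] (right_act A B X x b) []"
  using D.tri_bar_Nil[OF assms(1,3), of "[b]"] D.lead_word[OF assms(1), of "[]" x "[b]"] assms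
  by (simp add: D.tri_diff_def del: word_simps)

lemma cocycle_one_value:
  assumes "f \<in> tri_cocycles 1"
  shows "value_at f \<in> module_homs R X N"
proof -
  have f: "D.tri_ml f" and fc: "f \<in> D.cochains 1" and d: "D.tri_diff f = 0"
    using assms by (auto simp: cocycles_def D.cochains_iff)
  have d0: "D.tri_diff f as x bs = 0" for as x bs using d by simp
  show ?thesis
  proof (rule module_homI)
    show "value_at f x \<in> carrier N" for x using D.cochains_mem[OF fc] by (simp add: value_at_def)
    show "value_at f x = 0" if "x \<notin> carrier X" for x using fc that by (simp add: value_at_def D.cochains_iff)
    show "linear_on (scal X) (scal N) (carrier X) (value_at f)"
      using tri_multilinear_linear[OF f, of "[]" "[]"] by (simp add: value_at_def)
    show "value_at f (left_act A B X a x) = left_act A B N a (value_at f x)" if "a \<in> carrier A" "x \<in> carrier X" for a x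
      using tri_diff_one_A[OF f that] d0[of "[a]" x "[]"] by (simp add: value_at_def)
    show "value_at f (right_act A B X x b) = right_act A B N (value_at f x) b" if "b \<in> carrier B" "x \<in> carrier X" for b x
      using tri_diff_one_B[OF f that] d0[of "[]" x "[b]"] by (simp add: value_at_def)
  qed
qed

lemma value_at_inj:
  assumes "f \<in> D.cochains 1" "value_at f = 0"
  shows "f = 0"
proof (intro ext)
  fix as x bs
  show "f as x bs = 0 as x bs"
  proof (cases "as = [] \<and> bs = []")
    case True
    then show ?thesis using fun_cong[OF assms(2), of x] by (simp add: value_at_def)
  next
    case False
    then have "Suc (length as + length bs) \<noteq> 1" by auto
    then have "f as x bs = 0" using assms(1) unfolding D.cochains_iff by blast
    then show ?thesis by simp
  qed
qed

lemma value_at_surj: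
  assumes h: "h \<in> module_homs R X N"
  shows "\<exists>f\<in>tri_cocycles 1. value_at f = h"
proof -
  define f where "f = (\<lambda>(as :: 'a list) x (bs :: 'b list). if as = [] \<and> bs = [] then h x else 0)"
  have hm: "h x \<in> carrier N" for x using h by (cases "x \<in> carrier X") (auto simp: module_homs_def)
  have f: "D.tri_ml f"
    unfolding tri_multilinear_def
  proof (intro conjI ballI allI impI)
    fix x bs show "multilinear A N (\<lambda>as. f as x bs)" by (rule multilinearI) (simp_all add: f_def hm)
  next
    fix x as show "multilinear B N (f as x)" by (rule multilinearI) (simp_all add: f_def hm)
  next
    fix as :: "'a list" and bs :: "'b list"
    show "linear_on (scal X) (scal N) (carrier X) (\<lambda>x. f as x bs)"
      using module_hom_linear[OF h] linear_on_zero[OF N.M.vector_space_scal]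
      by (cases "as = [] \<and> bs = []") (auto simp: f_def)
  qed
  have fc: "f \<in> D.cochains 1"
    unfolding D.cochains_iff using f h by (auto simp: f_def module_homs_def)
  have "D.tri_diff f as x bs = 0" for as x bs
  proof (cases "set as \<subseteq> carrier A \<and> x \<in> carrier X \<and> set bs \<subseteq> carrier B \<and> Suc (length as + length bs) = Suc 1")
    case True
    \<comment> \<open>In degree 2 there is one letter besides the bimodule entry, so the cocycle
      condition splits into compatibility with either action.\<close>
    then consider a where "as = [a]" "bs = []" | b where "as = []" "bs = [b]"
      by (cases as; cases bs) (auto simp: length_Suc_conv)
    then show ?thesis
    proof cases
      case 1
      then show ?thesis using tri_diff_one_A[OF f, of a x] True module_hom_acts(1)[OF h, of a x] by (simp add: f_def)
    next
      case 2
      then show ?thesis using tri_diff_one_B[OF f, of b x] True module_hom_acts(2)[OF h, of b x] by (simp add: f_def)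
    qed
  next
    case False
    then show ?thesis using D.tri_diff_closed[OF fc] unfolding D.cochains_iff by blast
  qed
  then have "D.tri_diff f = 0" by (intro ext) simp
  then have "f \<in> tri_cocycles 1" using fc by (simp add: cocycles_def)
  moreover have "value_at f = h" by (simp add: value_at_def f_def)
  ultimately show ?thesis by blast
qed

lemma value_at_image: "value_at ` tri_cocycles 1 = module_homs R X N"
  using cocycle_one_value value_at_surj by auto

lemma cochains_zero: "D.cochains 0 = {0}"
proof -
  have "f = 0" if "f \<in> D.cochains 0" for f
  proof (intro ext)
    fix as x bs
    have "f as x bs = 0" using that unfolding D.cochains_iff by blast
    then show "f as x bs = 0 as x bs" by simp
  qed
  moreover have "0 \<in> D.cochains 0"
    by (rule module.subspace_0[OF vector_space_module[OF D.vector_space_cochains] D.subspace_cochains])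
  ultimately show ?thesis by blast
qed

end

locale fin_module_pair = tensor_module_pair A B X N
  for A :: "('k::field, 'a::ab_group_add) alg" and B :: "('k, 'b::ab_group_add) alg"
    and X :: "('k, ('a \<Rightarrow> 'b \<Rightarrow> 'k) \<Rightarrow> 'k, 'x::ab_group_add) lmod"
    and N :: "('k, ('a \<Rightarrow> 'b \<Rightarrow> 'k) \<Rightarrow> 'k, 'n::ab_group_add) lmod" +
  assumes fin: "fin_dim A" "fin_dim B" "fin_dim X" "fin_dim N"
begin

sublocale C: cochain_complex "tri_scal N" D.cochains "\<lambda>_. D.tri_diff"
  by (rule D.tri_complex[OF fin])

lemma findim_homs: "findim (hom_scal N) (module_homs R X N)"
  using findim_image(1)[OF C.vs vector_space_homs C.findim_cocycles linear_value_at, of 1] value_at_image by simp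

lemma dim_homs: "vector_space.dim (hom_scal N) (module_homs R X N) = vector_space.dim (tri_scal N) (tri_cocycles 1)"
  by (rule dim_bij[OF C.vs vector_space_homs C.findim_cocycles linear_value_at _ value_at_image])
    (auto simp: cocycles_def intro: value_at_inj)

lemma tri_cohomology_dim_0: "tri_cohomology_dim 0 = 0"
proof -
  have "tri_cocycles 0 = {0}" using cochains_zero C.diff_0 by (auto simp: cocycles_def)
  then show ?thesis by (simp add: tri_cohomology_dim_def cohomology_dim_eq dim_zero[OF C.vs])
qed

lemma tri_cohomology_dim_1: "tri_cohomology_dim 1 = vector_space.dim (hom_scal N) (module_homs R X N)"
proof -
  have "tri_coboundaries 1 = {0}" using cochains_zero C.diff_0 by (simp add: coboundaries_def)
  then show ?thesis by (simp add: tri_cohomology_dim_def cohomology_dim_eq dim_zero[OF C.vs] dim_homs)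
qed

end

text \<open>Preimages are chosen on a basis of the image. The section ignores the module structure
  and serves to extend and to descend cochains.\<close>

lemma linear_section:
  assumes "vector_space s" "vector_space t" "module.subspace s V" "linear_on s t V f"
  obtains \<sigma> where "linear_on t s (f ` V) \<sigma>" "\<And>y. y \<in> f ` V \<Longrightarrow> \<sigma> y \<in> V \<and> f (\<sigma> y) = y"
proof -
  interpret p: vector_space_pair t s using assms(1,2) by (simp add: vector_space_pair_def)
  have im: "p.vs1.subspace (f ` V)" by (rule subspace_linear_image[OF assms])
  obtain S where S: "S \<subseteq> f ` V" "p.vs1.independent S" "f ` V \<subseteq> p.vs1.span S"
    by (rule p.vs1.maximal_independent_subset[of "f ` V"])
  define pre where "pre y = (SOME x. x \<in> V \<and> f x = y)" for y
  have pre: "pre y \<in> V \<and> f (pre y) = y" if "y \<in> S" for y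
    unfolding pre_def by (rule someI_ex) (use S(1) that in auto)
  obtain g where g: "Vector_Spaces.linear t s g" "\<forall>y\<in>S. g y = pre y"
    using p.linear_independent_extend[OF S(2)] by blast
  interpret g: Vector_Spaces.linear t s g by fact
  have "y \<in> f ` V \<and> g y \<in> V \<and> f (g y) = y" if "y \<in> p.vs1.span S" for y
    using that
  proof (rule p.vs1.span_induct_alt)
    show "0 \<in> f ` V \<and> g 0 \<in> V \<and> f (g 0) = 0"
      using p.vs1.subspace_0[OF im] p.vs2.subspace_0[OF assms(3)] linear_on_0[OF assms] by (simp add: g.zero)
  next
    fix c x y assume x: "x \<in> S" and y: "y \<in> f ` V \<and> g y \<in> V \<and> f (g y) = y"
    have gx: "g x \<in> V" "f (g x) = x" using g(2) pre x by auto
    have sx: "s c (g x) \<in> V" using p.vs2.subspace_scale[OF assms(3) gx(1)] .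
    have "f (s c (g x) + g y) = t c x + y"
      using linear_on_add[OF assms(4) sx] linear_on_scale[OF assms(4) gx(1)] y gx by simp
    moreover have "t c x + y \<in> f ` V"
      using p.vs1.subspace_add[OF im p.vs1.subspace_scale[OF im]] x S(1) y by blast
    ultimately show "t c x + y \<in> f ` V \<and> g (t c x + y) \<in> V \<and> f (g (t c x + y)) = t c x + y"
      using p.vs2.subspace_add[OF assms(3) sx] y by (simp add: g.add g.scale)
  qed
  then have "g y \<in> V \<and> f (g y) = y" if "y \<in> f ` V" for y using that S(3) by blast
  moreover have "linear_on t s (f ` V) g" by (simp add: linear_on_def g.add g.scale)
  ultimately show ?thesis using that by blast
qed

text \<open>
  A short exact sequence \<open>0 \<rightarrow> K \<rightarrow> F \<rightarrow> X \<rightarrow> 0\<close>. Degree \<open>n + 1\<close> of the cochains corresponds to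
  \<open>Ext\<^sup>n\<close>, so acyclicity of \<open>F\<close> means exactness in degrees at least 2.
\<close>

locale acyclic_cover = N: tensor_module A B N + F: tensor_module A B F + X: tensor_module A B X
  for A :: "('k::field, 'a::ab_group_add) alg" and B :: "('k, 'b::ab_group_add) alg"
    and N :: "('k, ('a \<Rightarrow> 'b \<Rightarrow> 'k) \<Rightarrow> 'k, 'n::ab_group_add) lmod"
    and F :: "('k, ('a \<Rightarrow> 'b \<Rightarrow> 'k) \<Rightarrow> 'k, 'f::ab_group_add) lmod"
    and X :: "('k, ('a \<Rightarrow> 'b \<Rightarrow> 'k) \<Rightarrow> 'k, 'x::ab_group_add) lmod" +
  fixes e :: "'f \<Rightarrow> 'x"
  assumes e_hom: "e \<in> module_homs (tensor_product A (opposite B)) F X"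
    and e_surj: "e ` carrier F = carrier X"
    and fin: "fin_dim A" "fin_dim B" "fin_dim N" "fin_dim F" "fin_dim X"
    and acyclic: "\<And>f n. n \<ge> 1 \<Longrightarrow> f \<in> tri_cochains A F B N (Suc n) \<Longrightarrow>
      bimodule_pair.tri_diff A B F (left_act A B F) (right_act A B F) (left_act A B N) (right_act A B N) f = 0 \<Longrightarrow>
      \<exists>g\<in>tri_cochains A F B N n.
        bimodule_pair.tri_diff A B F (left_act A B F) (right_act A B F) (left_act A B N) (right_act A B N) g = f"
begin

definition K :: "('k, ('a \<Rightarrow> 'b \<Rightarrow> 'k) \<Rightarrow> 'k, 'f) lmod" where
  "K = F\<lparr>carrier := {x \<in> carrier F. e x = 0}\<rparr>"

lemma K_simps [simp]: "carrier K = {x \<in> carrier F. e x = 0}" "scal K = scal F" "act K = act F"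
  "left_act A B K = left_act A B F" "right_act A B K = right_act A B F"
  by (simp_all add: K_def left_act_def right_act_def fun_eq_iff)

sublocale FX: tensor_module_pair A B F X ..

lemma e_linear: "linear_on (scal F) (scal X) (carrier F) e"
  by (rule FX.module_hom_linear[OF e_hom])

sublocale K: tensor_module A B K
  unfolding K_def by (intro tensor_module.intro N.tensor_algebra_axioms FX.kernel_lmodule[OF e_hom])

lemma K_fin_dim: "fin_dim K"
  unfolding K_def by (rule FX.kernel_fin_dim[OF e_hom fin(4)])

sublocale KN: fin_module_pair A B K N by (intro_locales, unfold_locales) (rule fin K_fin_dim)+
sublocale FN: fin_module_pair A B F N by (intro_locales, unfold_locales) (rule fin)+
sublocale XN: fin_module_pair A B X N by (intro_locales, unfold_locales) (rule fin)+

section \<open>Restriction to the kernel and inflation from the quotient\<close>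

abbreviation resK :: "('a list \<Rightarrow> 'f \<Rightarrow> 'b list \<Rightarrow> 'n) \<Rightarrow> 'a list \<Rightarrow> 'f \<Rightarrow> 'b list \<Rightarrow> 'n" where
  "resK \<equiv> tri_pull K (\<lambda>x. x) (\<lambda>x. x)"
abbreviation infl :: "('a list \<Rightarrow> 'x \<Rightarrow> 'b list \<Rightarrow> 'n) \<Rightarrow> 'a list \<Rightarrow> 'f \<Rightarrow> 'b list \<Rightarrow> 'n" where
  "infl \<equiv> tri_pull F e (\<lambda>x. x)"

lemma linear_id: "linear_on s s V (\<lambda>x. x)"
  by (simp add: linear_on_def)

lemma res_pullback: "tri_pullback A B F (left_act A B F) (right_act A B F) N (left_act A B N) (right_act A B N)
  K (left_act A B F) (right_act A B F) N (left_act A B N) (right_act A B N) (\<lambda>x. x) (\<lambda>x. x)"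
proof (intro tri_pullback.intro tri_linear_pullback.intro tri_linear_pullback_axioms.intro tri_pullback_axioms.intro linear_id)
  show "bimodule_pair A B F (left_act A B F) (right_act A B F) N (left_act A B N) (right_act A B N)"
    by (rule FN.D.bimodule_pair_axioms)
  show "bimodule_pair A B K (left_act A B F) (right_act A B F) N (left_act A B N) (right_act A B N)"
    using KN.D.bimodule_pair_axioms by simp
qed (simp_all add: linear_id)

lemma infl_pullback: "tri_pullback A B X (left_act A B X) (right_act A B X) N (left_act A B N) (right_act A B N)
  F (left_act A B F) (right_act A B F) N (left_act A B N) (right_act A B N) e (\<lambda>x. x)"
proof (intro tri_pullback.intro tri_linear_pullback.intro tri_linear_pullback_axioms.intro tri_pullback_axioms.intro linear_id
    e_linear FN.D.bimodule_pair_axioms XN.D.bimodule_pair_axioms FX.module_hom_acts[OF e_hom])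
  show "e y \<in> carrier X" if "y \<in> carrier F" for y using that e_surj by blast
qed (assumption | rule refl)+

lemmas res_linear_pullback = tri_pullback.axioms(1)[OF res_pullback]
lemmas infl_linear_pullback = tri_pullback.axioms(1)[OF infl_pullback]
lemmas res_closed = tri_linear_pullback.pull_closed[OF res_linear_pullback]
lemmas infl_closed = tri_linear_pullback.pull_closed[OF infl_linear_pullback]
lemmas res_linear = tri_linear_pullback.linear_pull[OF res_linear_pullback]
lemmas infl_linear = tri_linear_pullback.linear_pull[OF infl_linear_pullback]
lemmas res_diff = tri_pullback.pull_diff[OF res_pullback]
lemmas infl_diff = tri_pullback.pull_diff[OF infl_pullback]

abbreviation "CF \<equiv> tri_cochains A F B N"
abbreviation "CK \<equiv> tri_cochains A K B N"
abbreviation "CX \<equiv> tri_cochains A X B N"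

lemma section_exists: "\<exists>\<sigma>. linear_on (scal X) (scal F) (carrier X) \<sigma> \<and> (\<forall>x\<in>carrier X. \<sigma> x \<in> carrier F \<and> e (\<sigma> x) = x)"
  using linear_section[OF F.M.vector_space_scal X.M.vector_space_scal F.M.subspace_carrier e_linear] e_surj by metis

text \<open>With a linear section \<open>\<sigma>\<close> of \<open>e\<close>, the map
  \<open>x - \<sigma> (e x)\<close> is a linear projection of \<open>F\<close> onto
  \<open>K\<close>, along which a cochain extends. The extension is one of cochains, not of
  cocycles.\<close>

lemma res_surj:
  assumes g: "g \<in> CK n"
  shows "\<exists>f\<in>CF n. resK f = g"
proof -
  obtain \<sigma> where \<sigma>: "linear_on (scal X) (scal F) (carrier X) \<sigma>"
    "\<And>x. x \<in> carrier X \<Longrightarrow> \<sigma> x \<in> carrier F \<and> e (\<sigma> x) = x" using section_exists by blast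
  have \<sigma>0: "\<sigma> 0 = 0" by (rule linear_on_0[OF X.M.vector_space_scal F.M.vector_space_scal X.M.subspace_carrier \<sigma>(1)])
  let ?\<rho> = "\<lambda>x. x - \<sigma> (e x)"
  have em: "e x \<in> carrier X" if "x \<in> carrier F" for x using that e_surj by blast
  have "e (x - \<sigma> (e x)) = 0" if "x \<in> carrier F" for x
    using linear_on_diff[OF F.M.vector_space_scal X.M.vector_space_scal F.M.subspace_carrier e_linear that] \<sigma>(2)[OF em[OF that]] by simp
  then have \<rho>: "?\<rho> x \<in> carrier K" if "x \<in> carrier F" for x using that \<sigma>(2)[OF em[OF that]] by simp
  have "linear_on (scal F) (scal K) (carrier F) ?\<rho>"
    unfolding linear_on_def
    using linear_on_add[OF e_linear] linear_on_scale[OF e_linear] linear_on_add[OF \<sigma>(1)] linear_on_scale[OF \<sigma>(1)] em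
    by (simp add: F.M.scale_right_diff_distrib)
  then have pull: "tri_linear_pullback A B K (left_act A B F) (right_act A B F) N (left_act A B N) (right_act A B N)
    F (left_act A B F) (right_act A B F) N (left_act A B N) (right_act A B N) ?\<rho> (\<lambda>x. x)"
    using \<rho> by (intro tri_linear_pullback.intro tri_linear_pullback_axioms.intro FN.D.bimodule_pair_axioms
      tri_linear_pullback.axioms(2)[OF res_linear_pullback] linear_id)
  have "resK (tri_pull F ?\<rho> (\<lambda>x. x) g) = g"
  proof (intro ext)
    fix as x bs
    show "resK (tri_pull F ?\<rho> (\<lambda>x. x) g) as x bs = g as x bs"
    proof (cases "x \<in> carrier K")
      case False
      then have "g as x bs = 0" using g unfolding KN.D.cochains_iff by blast
      then show ?thesis using False by (auto simp: tri_pull_def)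
    qed (simp add: tri_pull_def \<sigma>0)
  qed
  then show ?thesis using tri_linear_pullback.pull_closed[OF pull g] by blast
qed

lemma res_infl:
  assumes g: "g \<in> CX n"
  shows "resK (infl g) = 0"
proof (intro ext)
  fix as x bs
  have "g as 0 bs = 0"
  proof (cases "set as \<subseteq> carrier A \<and> set bs \<subseteq> carrier B")
    case True
    then have "linear_on (scal X) (scal N) (carrier X) (\<lambda>x. g as x bs)"
      using g by (intro tri_multilinear_linear) (auto simp: XN.D.cochains_iff)
    from linear_on_scale[OF this, of 0 0] show ?thesis by simp
  next
    case False
    then show ?thesis using g unfolding XN.D.cochains_iff by blast
  qed
  then show "resK (infl g) as x bs = 0 as x bs" by (simp add: tri_pull_def)
qed

lemma infl_inj:
  assumes g: "g \<in> CX n" and 0: "infl g = 0"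
  shows "g = 0"
proof (intro ext)
  fix as x bs
  show "g as x bs = 0 as x bs"
  proof (cases "x \<in> carrier X")
    case True
    then obtain y where "y \<in> carrier F" "x = e y" using e_surj by blast
    then show ?thesis using fun_cong[OF fun_cong[OF fun_cong[OF 0]], of as y bs] by (simp add: tri_pull_def)
  next
    case False
    then have "g as x bs = 0" using g unfolding XN.D.cochains_iff by blast
    then show ?thesis by simp
  qed
qed

text \<open>Composition with a linear section of \<open>e\<close> descends the cochain to
  \<open>X\<close>; inflation gives it back because \<open>x\<close> and
  \<open>\<sigma> (e x)\<close> differ by an element of \<open>K\<close>.\<close>

lemma ker_res:
  assumes f: "f \<in> CF n" and 0: "resK f = 0"
  shows "\<exists>g\<in>CX n. infl g = f"
proof -
  obtain \<sigma> where \<sigma>: "linear_on (scal X) (scal F) (carrier X) \<sigma>"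
    "\<And>x. x \<in> carrier X \<Longrightarrow> \<sigma> x \<in> carrier F \<and> e (\<sigma> x) = x" using section_exists by blast
  have em: "e x \<in> carrier X" if "x \<in> carrier F" for x using that e_surj by blast
  have pull: "tri_linear_pullback A B F (left_act A B F) (right_act A B F) N (left_act A B N) (right_act A B N)
    X (left_act A B X) (right_act A B X) N (left_act A B N) (right_act A B N) \<sigma> (\<lambda>x. x)"
    using \<sigma> by (intro tri_linear_pullback.intro tri_linear_pullback_axioms.intro FN.D.bimodule_pair_axioms
      XN.D.bimodule_pair_axioms linear_id) auto
  have "infl (tri_pull X \<sigma> (\<lambda>x. x) f) = f"
  proof (intro ext)
    fix as x bs
    show "infl (tri_pull X \<sigma> (\<lambda>x. x) f) as x bs = f as x bs"
    proof (cases "set as \<subseteq> carrier A \<and> x \<in> carrier F \<and> set bs \<subseteq> carrier B")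
      case True
      then have x: "x \<in> carrier F" by simp
      have l: "linear_on (scal F) (scal N) (carrier F) (\<lambda>x. f as x bs)"
        using f True by (intro tri_multilinear_linear) (auto simp: FN.D.cochains_iff)
      have s: "\<sigma> (e x) \<in> carrier F" using \<sigma>(2)[OF em[OF x]] by simp
      have "e (x - \<sigma> (e x)) = 0"
        using linear_on_diff[OF F.M.vector_space_scal X.M.vector_space_scal F.M.subspace_carrier e_linear x s] \<sigma>(2)[OF em[OF x]] by simp
      then have "f as (x - \<sigma> (e x)) bs = 0"
        using fun_cong[OF fun_cong[OF fun_cong[OF 0]], of as "x - \<sigma> (e x)" bs] x s by (simp add: tri_pull_def)
      then show ?thesis
        using linear_on_diff[OF F.M.vector_space_scal N.M.vector_space_scal F.M.subspace_carrier l x s] x em[OF x]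
        by (simp add: tri_pull_def)
    next
      case False
      then have z: "f as x bs = 0" using f unfolding FN.D.cochains_iff by blast
      show ?thesis
      proof (cases "x \<in> carrier F")
        case True
        then have "\<not> (set as \<subseteq> carrier A \<and> set bs \<subseteq> carrier B)" using False by blast
        then have "f as (\<sigma> (e x)) bs = 0" using f unfolding FN.D.cochains_iff by blast
        then show ?thesis using True z by (simp add: tri_pull_def)
      qed (simp add: tri_pull_def z)
    qed
  qed
  then show ?thesis using tri_linear_pullback.pull_closed[OF pull f] by blast
qed

abbreviation "dimN \<equiv> vector_space.dim (tri_scal N)"

lemma dim_infl: "V \<subseteq> CX n \<Longrightarrow> findim (tri_scal N) V \<Longrightarrow> dimN (infl ` V) = dimN V"
  by (rule dim_inj_image[OF XN.C.vs FN.C.vs _ linear_on_subset[OF infl_linear]]) (auto intro: infl_inj)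

text \<open>Cochains on \<open>F\<close> whose differential vanishes on \<open>K\<close> are counted
  twice. Restriction to \<open>K\<close> has as kernel the cochains on \<open>X\<close> and as image
  the cocycles on \<open>K\<close>. The differential has as kernel the cocycles on \<open>F\<close>
  and as image, by acyclicity, the cocycles on \<open>X\<close> one degree higher.\<close>

lemma dim_shift:
  assumes n: "n \<ge> 1"
  shows "dimN (KN.tri_cocycles n) + dimN (CX n) = dimN (XN.tri_cocycles (Suc n)) + dimN (FN.tri_cocycles n)"
proof -
  have lin: "linear_on (tri_scal N) (tri_scal N) (CF n) (\<lambda>f. resK (FN.D.tri_diff f))"
    unfolding linear_on_def
    using linear_on_add[OF FN.C.linear_diff[of n]] linear_on_scale[OF FN.C.linear_diff[of n]]
      linear_on_add[OF res_linear[of "Suc n"]] linear_on_scale[OF res_linear[of "Suc n"]] FN.C.diff_closed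
    by simp
  let ?W = "{f \<in> CF n. resK (FN.D.tri_diff f) = 0}"
  have W: "findim (tri_scal N) ?W"
    by (rule findim_mono[OF FN.C.findim_cochains[of n] subspace_linear_kernel[OF FN.C.vs KN.C.vs FN.C.subspace_cochains lin]]) auto
  have r0: "resK 0 = 0" by (auto simp: tri_pull_def fun_eq_iff)
  have d0: "FN.D.tri_diff 0 = 0" "XN.D.tri_diff 0 = 0" "KN.D.tri_diff 0 = 0" using FN.C.diff_0 XN.C.diff_0 KN.C.diff_0 by auto
  have i0: "infl 0 = 0" by (auto simp: tri_pull_def fun_eq_iff)
  have "dimN ?W = dimN {f \<in> ?W. resK f = 0} + dimN (resK ` ?W)"
    by (rule findim_image(2)[OF FN.C.vs KN.C.vs W linear_on_subset[OF res_linear[of n]]]) auto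
  moreover have "{f \<in> ?W. resK f = 0} = infl ` CX n"
  proof (intro set_eqI iffI)
    fix f assume "f \<in> {f \<in> ?W. resK f = 0}"
    then show "f \<in> infl ` CX n" using ker_res[of f n] by auto
  next
    fix f assume "f \<in> infl ` CX n"
    then obtain g where g: "g \<in> CX n" "f = infl g" by auto
    then show "f \<in> {f \<in> ?W. resK f = 0}"
      using infl_closed[OF g(1)] res_infl[OF g(1)] infl_diff[OF g(1)] res_infl[OF XN.D.tri_diff_closed[OF g(1)]] by simp
  qed
  moreover have "resK ` ?W = KN.tri_cocycles n"
  proof (intro set_eqI iffI)
    fix g assume "g \<in> resK ` ?W"
    then obtain f where f: "f \<in> CF n" "resK (FN.D.tri_diff f) = 0" "g = resK f" by auto
    then show "g \<in> KN.tri_cocycles n" using res_closed[OF f(1)] res_diff[OF f(1)] by (simp add: cocycles_def)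
  next
    fix g assume g: "g \<in> KN.tri_cocycles n"
    then obtain f where f: "f \<in> CF n" "resK f = g" using res_surj[of g n] by (auto simp: cocycles_def)
    then show "g \<in> resK ` ?W" using res_diff[OF f(1)] g by (auto simp: cocycles_def)
  qed
  ultimately have 1: "dimN ?W = dimN (CX n) + dimN (KN.tri_cocycles n)"
    using dim_infl[OF order_refl XN.C.findim_cochains] by simp
  have "dimN ?W = dimN {f \<in> ?W. FN.D.tri_diff f = 0} + dimN (FN.D.tri_diff ` ?W)"
    by (rule findim_image(2)[OF FN.C.vs FN.C.vs W linear_on_subset[OF FN.C.linear_diff[of n]]]) auto
  moreover have "{f \<in> ?W. FN.D.tri_diff f = 0} = FN.tri_cocycles n" using r0 by (auto simp: cocycles_def)
  moreover have "FN.D.tri_diff ` ?W = infl ` XN.tri_cocycles (Suc n)"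
  proof (intro set_eqI iffI)
    fix h assume "h \<in> FN.D.tri_diff ` ?W"
    then obtain f where f: "f \<in> CF n" "resK (FN.D.tri_diff f) = 0" "h = FN.D.tri_diff f" by auto
    then obtain g where g: "g \<in> CX (Suc n)" "infl g = h" using ker_res[OF FN.D.tri_diff_closed[OF f(1)]] by auto
    have "infl (XN.D.tri_diff g) = 0" using infl_diff[OF g(1)] g(2) f(3) FN.D.tri_diff_diff[OF f(1)] by simp
    then have "XN.D.tri_diff g = 0" by (rule infl_inj[OF XN.D.tri_diff_closed[OF g(1)]])
    then show "h \<in> infl ` XN.tri_cocycles (Suc n)" using g by (auto simp: cocycles_def)
  next
    fix h assume "h \<in> infl ` XN.tri_cocycles (Suc n)"
    then obtain g where g: "g \<in> CX (Suc n)" "XN.D.tri_diff g = 0" "h = infl g" by (auto simp: cocycles_def)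
    have "FN.D.tri_diff h = 0" using infl_diff[OF g(1)] g i0 by simp
    then obtain f where f: "f \<in> CF n" "FN.D.tri_diff f = h"
      using acyclic[OF n infl_closed[OF g(1)]] g(3) by auto
    then show "h \<in> FN.D.tri_diff ` ?W" using res_infl[OF g(1)] g(3) by (intro image_eqI[of _ _ f]) simp_all
  qed
  moreover have "dimN (infl ` XN.tri_cocycles (Suc n)) = dimN (XN.tri_cocycles (Suc n))"
    by (rule dim_infl[where n="Suc n", OF _ XN.C.findim_cocycles]) (auto simp: cocycles_def)
  ultimately show ?thesis using 1 by simp
qed

lemma dim_res_cocycles:
  "dimN (FN.tri_cocycles n) = dimN (XN.tri_cocycles n) + dimN (resK ` FN.tri_cocycles n)"
proof -
  have i0: "infl 0 = 0" by (auto simp: tri_pull_def fun_eq_iff)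
  have sub: "FN.tri_cocycles n \<subseteq> CF n" "XN.tri_cocycles n \<subseteq> CX n" by (auto simp: cocycles_def)
  have "{f \<in> FN.tri_cocycles n. resK f = 0} = infl ` XN.tri_cocycles n"
  proof (intro set_eqI iffI)
    fix f assume f: "f \<in> {f \<in> FN.tri_cocycles n. resK f = 0}"
    then obtain g where g: "g \<in> CX n" "infl g = f" using ker_res[of f n] by (auto simp: cocycles_def)
    have "infl (XN.D.tri_diff g) = 0" using infl_diff[OF g(1)] g(2) f by (simp add: cocycles_def)
    then have "XN.D.tri_diff g = 0" by (rule infl_inj[OF XN.D.tri_diff_closed[OF g(1)]])
    then show "f \<in> infl ` XN.tri_cocycles n" using g by (auto simp: cocycles_def)
  next
    fix f assume "f \<in> infl ` XN.tri_cocycles n"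
    then obtain g where g: "g \<in> CX n" "XN.D.tri_diff g = 0" "f = infl g" by (auto simp: cocycles_def)
    then show "f \<in> {f \<in> FN.tri_cocycles n. resK f = 0}"
      using infl_closed[OF g(1)] res_infl[OF g(1)] infl_diff[OF g(1)] i0 by (simp add: cocycles_def)
  qed
  then show ?thesis
    using findim_image(2)[OF FN.C.vs KN.C.vs FN.C.findim_cocycles linear_on_subset[OF res_linear sub(1)]]
      dim_infl[OF sub(2) XN.C.findim_cocycles] by simp
qed

text \<open>In these degrees every cocycle on \<open>F\<close> is a coboundary, and restriction is
  onto for cochains. In degree 1 this fails in general, so \<open>cohomology_dim_2\<close> treats
  that case separately.\<close>

lemma res_cocycles:
  assumes n: "n \<ge> 1"
  shows "resK ` FN.tri_cocycles (Suc n) = KN.tri_coboundaries (Suc n)"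
proof (intro set_eqI iffI)
  fix h assume "h \<in> resK ` FN.tri_cocycles (Suc n)"
  then obtain f where f: "f \<in> CF (Suc n)" "FN.D.tri_diff f = 0" "h = resK f" by (auto simp: cocycles_def)
  then obtain g where g: "g \<in> CF n" "FN.D.tri_diff g = f" using acyclic[OF n] by blast
  then have "h = KN.D.tri_diff (resK g)" using res_diff[OF g(1)] f by simp
  then show "h \<in> KN.tri_coboundaries (Suc n)" using res_closed[OF g(1)] by (simp add: coboundaries_def)
next
  fix h assume "h \<in> KN.tri_coboundaries (Suc n)"
  then obtain k where k: "k \<in> CK n" "h = KN.D.tri_diff k" by (auto simp: coboundaries_def)
  obtain g where g: "g \<in> CF n" "resK g = k" using res_surj[OF k(1)] by blast
  have "FN.D.tri_diff g \<in> FN.tri_cocycles (Suc n)"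
    using FN.D.tri_diff_closed[OF g(1)] FN.D.tri_diff_diff[OF g(1)] by (simp add: cocycles_def)
  moreover have "h = resK (FN.D.tri_diff g)" using res_diff[OF g(1)] g(2) k(2) by simp
  ultimately show "h \<in> resK ` FN.tri_cocycles (Suc n)" by blast
qed

text \<open>The connecting map in numbers: degree \<open>n + 1\<close> on \<open>X\<close> is the
  space of cocycles on \<open>K\<close> modulo restricted cocycles from \<open>F\<close>.
  Rank-nullity for the differential on \<open>X\<close>, together with
  \<open>dim_res_cocycles\<close>, eliminates the other terms of \<open>dim_shift\<close>.\<close>

lemma cohomology_dim_shift_aux:
  assumes n: "n \<ge> 1"
  shows "XN.tri_cohomology_dim (Suc n) = dimN (KN.tri_cocycles n) - dimN (resK ` FN.tri_cocycles n)"
  using dim_shift[OF n] dim_res_cocycles[of n] XN.C.dim_cochains[of n] XN.C.dim_coboundaries_le[of "Suc n"]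
  unfolding XN.tri_cohomology_dim_def cohomology_dim_eq by simp

lemma cohomology_dim_shift: "XN.tri_cohomology_dim (Suc (Suc (Suc n))) = KN.tri_cohomology_dim (Suc (Suc n))"
  using cohomology_dim_shift_aux[of "Suc (Suc n)"] res_cocycles[of "Suc n"]
  unfolding KN.tri_cohomology_dim_def cohomology_dim_eq by simp

definition res_hom :: "('f \<Rightarrow> 'n) \<Rightarrow> 'f \<Rightarrow> 'n" where
  "res_hom h = (\<lambda>x. if x \<in> carrier K then h x else 0)"

text \<open>This is \<open>Ext^1(X, N)\<close> as the cokernel of
  \<open>Hom(F, N) -> Hom(K, N)\<close>, with homomorphisms in the place of cocycles of degree
  1.\<close>

lemma cohomology_dim_2:
  "XN.tri_cohomology_dim 2 = vector_space.dim (hom_scal N) (module_homs (tensor_product A (opposite B)) K N)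
    - vector_space.dim (hom_scal N) (res_hom ` module_homs (tensor_product A (opposite B)) F N)"
proof -
  have sub: "resK ` FN.tri_cocycles 1 \<subseteq> CK 1"
    using res_closed by (auto simp: cocycles_def)
  have s1: "FN.tri_cocycles 1 \<subseteq> CF 1" by (auto simp: cocycles_def)
  have fd: "findim (tri_scal N) (resK ` FN.tri_cocycles 1)"
    by (rule findim_image(1)[OF FN.C.vs KN.C.vs FN.C.findim_cocycles linear_on_subset[OF res_linear s1]])
  have "vector_space.dim (hom_scal N) (KN.value_at ` resK ` FN.tri_cocycles 1) = dimN (resK ` FN.tri_cocycles 1)"
    by (rule dim_inj_image[OF KN.C.vs KN.vector_space_homs fd KN.linear_value_at])
      (use sub KN.value_at_inj in blast)
  moreover have "KN.value_at ` resK ` FN.tri_cocycles 1 = res_hom ` FN.value_at ` FN.tri_cocycles 1"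
    by (simp add: image_image KN.value_at_def FN.value_at_def res_hom_def tri_pull_def)
  ultimately show ?thesis
    using cohomology_dim_shift_aux[of 1] FN.value_at_image KN.dim_homs by (simp add: numeral_2_eq_2)
qed

section \<open>Left exactness of Hom along the cover\<close>

lemma homs_precomp:
  "(\<lambda>g. g \<circ> e) ` module_homs (tensor_product A (opposite B)) X N =
    {f \<in> module_homs (tensor_product A (opposite B)) F N. \<forall>x\<in>carrier K. f x = 0}" (is "?L = ?H")
proof (intro set_eqI iffI)
  fix f assume "f \<in> ?L"
  then obtain g where "g \<in> module_homs (tensor_product A (opposite B)) X N" "f = g \<circ> e" by auto
  then show "f \<in> ?H" using e_hom XN.module_homs_0[of g] by (auto simp: module_homs_def)
next
  fix f assume f: "f \<in> ?H"
  then have fh: "f \<in> module_homs (tensor_product A (opposite B)) F N" by simp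
  have lin: "linear_on (scal F) (scal N) (carrier F) f" by (rule FN.module_hom_linear[OF fh])
  \<comment> \<open>Any preimage will do, as \<open>f\<close> vanishes on the kernel of
    \<open>e\<close>; the properties of \<open>g\<close> are then read off from
    \<open>g (e x) = f x\<close>.\<close>
  define lift where "lift y = (SOME x. x \<in> carrier F \<and> e x = y)" for y
  define g where "g y = (if y \<in> carrier X then f (lift y) else 0)" for y
  have lift: "lift y \<in> carrier F \<and> e (lift y) = y" if "y \<in> carrier X" for y
    unfolding lift_def by (rule someI_ex) (metis e_surj that imageE)
  have em: "e x \<in> carrier X" if "x \<in> carrier F" for x using that e_surj by blast
  have ge: "g (e x) = f x" if x: "x \<in> carrier F" for x
  proof -
    note l = lift[OF em[OF x]]
    have "e (lift (e x) - x) = 0"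
      using linear_on_diff[OF F.M.vector_space_scal X.M.vector_space_scal F.M.subspace_carrier e_linear _ x] l by simp
    then have "f (lift (e x) - x) = 0" using f l x F.M.subspace_diff[OF F.M.subspace_carrier] by simp
    then show ?thesis
      using linear_on_diff[OF F.M.vector_space_scal N.M.vector_space_scal F.M.subspace_carrier lin _ x] l em[OF x]
      by (simp add: g_def)
  qed
  have "g \<in> module_homs (tensor_product A (opposite B)) X N"
    unfolding module_homs_def
  proof (intro CollectI conjI ballI allI impI)
    show "g y \<in> carrier N" if "y \<in> carrier X" for y using lift[OF that] fh that by (simp add: g_def module_homs_def)
    show "g y = 0" if "y \<notin> carrier X" for y using that by (simp add: g_def)
    show "g (y + z) = g y + g z" if yz: "y \<in> carrier X" "z \<in> carrier X" for y z
    proof -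
      note l = lift[OF yz(1)] lift[OF yz(2)]
      have "g (e (lift y + lift z)) = g (e (lift y)) + g (e (lift z))"
        using conjunct1[OF l(1)] conjunct1[OF l(2)] F.M.subspace_add[OF F.M.subspace_carrier] linear_on_add[OF lin] by (simp add: ge)
      then show ?thesis using l linear_on_add[OF e_linear] by simp
    qed
    show "g (act X r y) = act N r (g y)" if r: "r \<in> carrier (tensor_product A (opposite B))" and y: "y \<in> carrier X" for r y
    proof -
      note l = lift[OF y]
      have "g (e (act F r (lift y))) = act N r (g (e (lift y)))"
        using conjunct1[OF l] F.M.act_closed[OF r] r fh by (simp add: ge module_homs_def)
      then show ?thesis using l e_hom r by (simp add: module_homs_def)
    qed
  qed
  moreover have "g \<circ> e = f"
  proof
    fix x show "(g \<circ> e) x = f x"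
      using ge e_hom fh lift[of 0] f FN.module_homs_0[OF fh] X.M.subspace_0[OF X.M.subspace_carrier]
      by (cases "x \<in> carrier F") (auto simp: module_homs_def g_def)
  qed
  ultimately show "f \<in> ?L" by blast
qed

text \<open>Precomposition is injective, because \<open>e\<close> reaches all of the carrier of
  \<open>X\<close> and the maps in \<open>V\<close> are 0 outside it.\<close>

lemma dim_precomp:
  assumes "findim (hom_scal N) V" "\<And>g x. g \<in> V \<Longrightarrow> x \<notin> carrier X \<Longrightarrow> g x = 0"
  shows "vector_space.dim (hom_scal N) ((\<lambda>g. g \<circ> e) ` V) = vector_space.dim (hom_scal N) V"
proof (rule dim_inj_image[OF XN.vector_space_homs FN.vector_space_homs assms(1)])
  show "linear_on (hom_scal N) (hom_scal N) V (\<lambda>g. g \<circ> e)" by (auto simp: linear_on_def fun_eq_iff)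
  fix g assume g: "g \<in> V" "g \<circ> e = 0"
  show "g = 0"
  proof
    fix x show "g x = 0 x"
    proof (cases "x \<in> carrier X")
      case True
      then obtain y where "x = e y" using e_surj by blast
      then show ?thesis using fun_cong[OF g(2), of y] by simp
    qed (simp add: assms(2)[OF g(1)])
  qed
qed

lemma findim_res_hom: "findim (hom_scal N) (res_hom ` module_homs (tensor_product A (opposite B)) F N)"
  by (rule findim_image(1)[OF FN.vector_space_homs KN.vector_space_homs FN.findim_homs])
    (auto simp: linear_on_def res_hom_def fun_eq_iff)

end

section \<open>Ext as the cohomology of two-sided cochains\<close>

lemma (in lmodule) act_0_right: "r \<in> carrier R \<Longrightarrow> act M r 0 = 0"
  using act_add_right[of r 0 0] subspace_0[OF subspace_carrier] by simp

lemma (in lmodule) act_sum: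
  assumes "r \<in> carrier R" "finite I" "\<And>i. i \<in> I \<Longrightarrow> x i \<in> carrier M"
  shows "act M r (\<Sum>i\<in>I. x i) = (\<Sum>i\<in>I. act M r (x i))"
  using assms(2,3)
proof (induction I rule: finite_induct)
  case (insert j I)
  have "(\<Sum>i\<in>I. x i) \<in> carrier M" using insert.prems by (intro subspace_sum[OF subspace_carrier]) auto
  then show ?case unfolding sum.insert[OF insert.hyps]
    using insert.prems insert.IH by (simp add: act_add_right[OF assms(1)])
qed (simp add: act_0_right assms(1))

text \<open>One free generator for each vector of a finite spanning set over the field; it spans
  over \<open>R\<close> all the more, scalars being multiples of the unit.\<close>

lemma free_cover:
  assumes "kalgebra R" "lmodule R X" "fin_dim X"
  shows "\<exists>k. \<exists>e\<in>module_homs R (free_module R k) X. e ` carrier (free_module R k) = carrier X"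
proof -
  interpret R: kalgebra R by fact
  interpret X: lmodule R X by fact
  obtain S where S: "finite S" "X.span S = carrier X" using assms(3) by (auto simp: fin_dim_def)
  obtain ss where ss: "set ss = S" "distinct ss" using finite_distinct_list[OF S(1)] by blast
  let ?k = "length ss"
  let ?F = "free_module R ?k"
  have sm: "ss ! i \<in> carrier X" if "i < ?k" for i
    using that ss(1) S(2) X.span_superset[of S] nth_mem[OF that] by blast
  have F: "carrier ?F = {f. (\<forall>i<?k. f i \<in> carrier R) \<and> (\<forall>i\<ge>?k. f i = 0)}"
    "act ?F = (\<lambda>r f i. if i < ?k then mul R r (f i) else 0)"
    by (simp_all add: module_power_def regular_module_def cong: if_cong)
  define e where "e f = (if f \<in> carrier ?F then \<Sum>i<?k. act X (f i) (ss ! i) else 0)" for f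
  have mem: "(\<Sum>i<?k. act X (f i) (ss ! i)) \<in> carrier X" if "f \<in> carrier ?F" for f
    using that sm X.act_closed by (intro X.subspace_sum[OF X.subspace_carrier]) (auto simp: F)
  have "e \<in> module_homs R ?F X"
    unfolding module_homs_def
  proof (intro CollectI conjI ballI allI impI)
    show "e f \<in> carrier X" if "f \<in> carrier ?F" for f using mem that by (simp add: e_def)
    show "e f = 0" if "f \<notin> carrier ?F" for f using that by (simp add: e_def)
    show "e (f + g) = e f + e g" if f: "f \<in> carrier ?F" "g \<in> carrier ?F" for f g
    proof -
      have "f + g \<in> carrier ?F" using f R.subspace_add[OF R.subspace_carrier] by (simp add: F)
      then show ?thesis using f sm by (simp add: e_def F X.act_add_left sum.distrib)
    qed
    show "e (act ?F r f) = act X r (e f)" if r: "r \<in> carrier R" and f: "f \<in> carrier ?F" for r f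
    proof -
      have "act ?F r f \<in> carrier ?F" using f r R.mul_closed by (simp add: F)
      then have "e (act ?F r f) = (\<Sum>i<?k. act X (mul R r (f i)) (ss ! i))" by (simp add: e_def F(2))
      also have "\<dots> = (\<Sum>i<?k. act X r (act X (f i) (ss ! i)))"
        using f r sm by (intro sum.cong) (auto simp: F X.act_mul)
      also have "\<dots> = act X r (\<Sum>i<?k. act X (f i) (ss ! i))"
        using f r sm X.act_closed by (subst X.act_sum) (auto simp: F)
      finally show ?thesis using f by (simp add: e_def)
    qed
  qed
  moreover have "e ` carrier ?F = carrier X"
  proof
    show "e ` carrier ?F \<subseteq> carrier X" using mem by (auto simp: e_def)
    show "carrier X \<subseteq> e ` carrier ?F"
    proof
      fix x assume "x \<in> carrier X"
      then obtain c where c: "x = (\<Sum>v\<in>S. scal X (c v) v)" using S X.span_finite[OF S(1)] by auto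
      define f where "f i = (if i < ?k then scal R (c (ss ! i)) (idt R) else 0)" for i
      have f: "f \<in> carrier ?F" using R.subspace_scale[OF R.subspace_carrier R.idt_closed] by (simp add: F f_def)
      have "e f = (\<Sum>i<?k. scal X (c (ss ! i)) (ss ! i))"
        using f sm R.idt_closed by (auto simp: e_def f_def X.act_scal_left X.act_idt intro!: sum.cong)
      also have "\<dots> = x"
        unfolding c using sum.reindex_bij_betw[OF bij_betw_nth[OF ss(2) refl ss(1)[symmetric]]] .
      finally show "x \<in> e ` carrier ?F" using f by blast
    qed
  qed
  ultimately show ?thesis by blast
qed

context tensor_algebra
begin

lemma free_module_lmodule: "lmodule R (free_module R k)"
  by (intro module_power_lmodule regular_module_lmodule R_kalgebra)

lemma free_module_fin_dim:
  assumes "fin_dim A" "fin_dim B"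
  shows "fin_dim (free_module R k)"
proof (rule module_power_fin_dim)
  show "kspace (regular_module R)" using regular_module_lmodule[OF R_kalgebra] by (simp add: lmodule_def)
  show "fin_dim (regular_module R)" using R_fin_dim[OF assms] by (simp add: fin_dim_def regular_module_def)
qed

text \<open>Dependent choice. A state is a rank together with the submodule, of the free module of
  that rank, that the next map has to cover; it remains finite-dimensional because free modules of
  finite rank are.\<close>

theorem free_resolution_exists:
  assumes fin: "fin_dim A" "fin_dim B" and M: "lmodule R M" "fin_dim M"
  shows "\<exists>n d e. free_resolution R M n d e"
proof -
  let ?F = "free_module R"
  let ?P = "\<lambda>p. snd p \<subseteq> carrier (?F (fst p)) \<and> lmodule R (?F (fst p)\<lparr>carrier := snd p\<rparr>) \<and> fin_dim (?F (fst p)\<lparr>carrier := snd p\<rparr>)"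
  let ?Q = "\<lambda>p q d. d \<in> module_homs R (?F (fst q)) (?F (fst p)) \<and> d ` carrier (?F (fst q)) = snd p \<and>
    snd q = {x \<in> carrier (?F (fst q)). d x = 0}"
  obtain k e where e: "e \<in> module_homs R (?F k) M" "e ` carrier (?F k) = carrier M"
    using free_cover[OF R_kalgebra M] by blast
  interpret FM: tensor_module_pair A B "?F k" M
    by (intro tensor_module_pair.intro tensor_module.intro tensor_algebra_axioms free_module_lmodule M)
  have P0: "?P (k, {x \<in> carrier (?F k). e x = 0})"
    using FM.kernel_lmodule[OF e(1)] FM.kernel_fin_dim[OF e(1) free_module_fin_dim[OF fin]] by auto
  have step: "\<exists>q. ?P q \<and> (\<exists>d. ?Q p q d)" if p: "?P p" for p
  proof -
    obtain l d where d: "d \<in> module_homs R (?F l) (?F (fst p)\<lparr>carrier := snd p\<rparr>)"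
      "d ` carrier (?F l) = snd p" using free_cover[OF R_kalgebra, of "?F (fst p)\<lparr>carrier := snd p\<rparr>"] p by auto
    interpret FF: tensor_module_pair A B "?F l" "?F (fst p)"
      by (intro tensor_module_pair.intro tensor_module.intro tensor_algebra_axioms free_module_lmodule)
    have dh: "d \<in> module_homs R (?F l) (?F (fst p))" using d(1) p by (auto simp: module_homs_def)
    have "?P (l, {x \<in> carrier (?F l). d x = 0})"
      using FF.kernel_lmodule[OF dh] FF.kernel_fin_dim[OF dh free_module_fin_dim[OF fin]] by auto
    moreover have "?Q p (l, {x \<in> carrier (?F l). d x = 0}) d" using dh d(2) by simp
    ultimately show ?thesis by blast
  qed
  \<comment> \<open>The choice principle leaves its starting point open; this predicate pins it to
    the kernel of \<open>e\<close>.\<close>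
  let ?P' = "\<lambda>(i::nat) p. ?P p \<and> (i = 0 \<longrightarrow> p = (k, {x \<in> carrier (?F k). e x = 0}))"
  have "\<exists>g. \<forall>i. ?P' i (g i) \<and> (\<exists>d. ?Q (g i) (g (Suc i)) d)"
  proof (rule dependent_nat_choice)
    show "\<exists>p. ?P' 0 p" using P0 by (intro exI[of _ "(k, {x \<in> carrier (?F k). e x = 0})"]) simp
  next
    fix p i assume "?P' i p"
    then have "?P p" by (rule conjunct1)
    from step[OF this] obtain q where "?P q" "\<exists>d. ?Q p q d" by blast
    then show "\<exists>q. ?P' (Suc i) q \<and> (\<exists>d. ?Q p q d)" by (intro exI[of _ q]) simp
  qed
  then obtain g where "\<forall>i. ?P' i (g i) \<and> (\<exists>d. ?Q (g i) (g (Suc i)) d)" by (rule exE)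
  then have g: "g 0 = (k, {x \<in> carrier (?F k). e x = 0})" "\<forall>i. \<exists>d. ?Q (g i) (g (Suc i)) d" by simp_all
  obtain d where d: "\<And>i. ?Q (g i) (g (Suc i)) (d i)" using choice[OF g(2)] by blast
  have d0: "fst (g 0) = k" "snd (g 0) = {x \<in> carrier (?F k). e x = 0}" using g(1) by simp_all
  have "free_resolution R M (\<lambda>i. fst (g i)) d e"
    unfolding free_resolution_def
  proof (intro conjI allI)
    show "e \<in> module_homs R (?F (fst (g 0))) M" "e ` carrier (?F (fst (g 0))) = carrier M"
      unfolding d0 by (rule e)+
    show "d i \<in> module_homs R (?F (fst (g (Suc i)))) (?F (fst (g i)))" for i using d[of i] by (rule conjunct1)
    have im: "d i ` carrier (?F (fst (g (Suc i)))) = snd (g i)" for i using d[of i] by (elim conjE)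
    show "d 0 ` carrier (?F (fst (g 1))) = {x \<in> carrier (?F (fst (g 0))). e x = 0}"
      using im[of 0] unfolding One_nat_def d0 .
    show "d (Suc i) ` carrier (?F (fst (g (Suc (Suc i))))) = {x \<in> carrier (?F (fst (g (Suc i)))). d i x = 0}" for i
      using im[of "Suc i"] d[of i] by (elim conjE) (rule trans)
  qed
  then show ?thesis by blast
qed

end

section \<open>Syzygies of a chosen resolution\<close>

locale resolved_module = M: tensor_module A B M + N: tensor_module A B N
  for A :: "('k::field, 'a::ab_group_add) alg" and B :: "('k, 'b::ab_group_add) alg"
    and M :: "('k, ('a \<Rightarrow> 'b \<Rightarrow> 'k) \<Rightarrow> 'k, 'm::ab_group_add) lmod"
    and N :: "('k, ('a \<Rightarrow> 'b \<Rightarrow> 'k) \<Rightarrow> 'k, 'n::ab_group_add) lmod" +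
  fixes n :: "nat \<Rightarrow> nat"
    and d :: "nat \<Rightarrow> (nat \<Rightarrow> ('a \<Rightarrow> 'b \<Rightarrow> 'k) \<Rightarrow> 'k) \<Rightarrow> nat \<Rightarrow> ('a \<Rightarrow> 'b \<Rightarrow> 'k) \<Rightarrow> 'k"
    and e :: "(nat \<Rightarrow> ('a \<Rightarrow> 'b \<Rightarrow> 'k) \<Rightarrow> 'k) \<Rightarrow> 'm"
  assumes fin: "fin_dim A" "fin_dim B" "fin_dim M" "fin_dim N"
    and resolution: "free_resolution (tensor_product A (opposite B)) M n d e"
begin

abbreviation "R \<equiv> tensor_product A (opposite B)"
abbreviation "F i \<equiv> free_module R (n i)"

text \<open>Indexed by the free module that contains it: \<open>syzygy 0\<close> is the first syzygy
  of the resolved module, and \<open>d i\<close> maps \<open>F (Suc i)\<close> onto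
  \<open>syzygy i\<close>.\<close>

fun syzygy :: "nat \<Rightarrow> ('k, ('a \<Rightarrow> 'b \<Rightarrow> 'k) \<Rightarrow> 'k, nat \<Rightarrow> ('a \<Rightarrow> 'b \<Rightarrow> 'k) \<Rightarrow> 'k) lmod" where
  "syzygy 0 = F 0\<lparr>carrier := {x \<in> carrier (F 0). e x = 0}\<rparr>"
| "syzygy (Suc i) = F (Suc i)\<lparr>carrier := {x \<in> carrier (F (Suc i)). d i x = 0}\<rparr>"

lemma e_hom: "e \<in> module_homs R (F 0) M" "e ` carrier (F 0) = carrier M"
  and d_hom: "d i \<in> module_homs R (F (Suc i)) (F i)"
  using resolution by (simp_all add: free_resolution_def)

lemma d_image: "d i ` carrier (F (Suc i)) = carrier (syzygy i)"
  using resolution by (cases i) (simp_all add: free_resolution_def)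

lemma syzygy_simps: "act (syzygy i) = act (F i)" "scal (syzygy i) = scal (F i)" "carrier (syzygy i) \<subseteq> carrier (F i)"
  by (cases i; auto)+

lemma d_hom_syzygy: "d i \<in> module_homs R (F (Suc i)) (syzygy i)"
  using d_hom[of i] d_image[of i] by (auto simp: module_homs_def syzygy_simps)

lemma free_tensor_module: "tensor_module A B (free_module R k)"
  by (intro tensor_module.intro M.tensor_algebra_axioms M.free_module_lmodule)

lemma free_acyclic_cover:
  assumes "tensor_module A B X" "fin_dim X"
    "f \<in> module_homs R (free_module R k) X" "f ` carrier (free_module R k) = carrier X"
  shows "acyclic_cover A B N (free_module R k) X f"
proof -
  interpret FN: free_module_pair A B N k by unfold_locales (rule fin)
  show ?thesis
    by (intro acyclic_cover.intro acyclic_cover_axioms.intro N.tensor_module_axioms free_tensor_module assms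
      fin M.free_module_fin_dim FN.free_acyclic)
qed

lemma cover_0: "acyclic_cover A B N (F 0) M e"
  by (rule free_acyclic_cover[OF M.tensor_module_axioms fin(3) e_hom])

lemma syzygy_module: "tensor_module A B (syzygy i)" "fin_dim (syzygy i)"
proof -
  have "tensor_module A B (syzygy i) \<and> fin_dim (syzygy i)"
  proof (cases i)
    case 0
    interpret c: acyclic_cover A B N "F 0" M e by (rule cover_0)
    show ?thesis using c.K.tensor_module_axioms c.K_fin_dim by (simp add: 0 c.K_def)
  next
    case (Suc j)
    interpret FF: tensor_module_pair A B "F (Suc j)" "F j" by (intro tensor_module_pair.intro free_tensor_module)
    show ?thesis
      using FF.kernel_lmodule[OF d_hom] FF.kernel_fin_dim[OF d_hom M.free_module_fin_dim[OF fin(1,2)]]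
      by (simp add: Suc tensor_module_def M.tensor_algebra_axioms)
  qed
  then show "tensor_module A B (syzygy i)" "fin_dim (syzygy i)" by auto
qed

lemma cover_Suc: "acyclic_cover A B N (F (Suc i)) (syzygy i) (d i)"
  by (rule free_acyclic_cover[OF syzygy_module d_hom_syzygy d_image])

lemma kernel_syzygy: "acyclic_cover.K (F 0) e = syzygy 0" "acyclic_cover.K (F (Suc i)) (d i) = syzygy (Suc i)"
  by (simp_all add: acyclic_cover.K_def[OF cover_0] acyclic_cover.K_def[OF cover_Suc])

abbreviation "cohdim X \<equiv> tensor_module_pair.tri_cohomology_dim A B X N"

lemma cohdim_0: "cohdim M (Suc (Suc (Suc j))) = cohdim (syzygy 0) (Suc (Suc j))"
  using acyclic_cover.cohomology_dim_shift[OF cover_0] by (simp only: kernel_syzygy)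

lemma cohdim_Suc: "cohdim (syzygy i) (Suc (Suc (Suc j))) = cohdim (syzygy (Suc i)) (Suc (Suc j))"
  using acyclic_cover.cohomology_dim_shift[OF cover_Suc] by (simp only: kernel_syzygy)

text \<open>In terms of Ext, degree \<open>i + j + 2\<close> for the module is degree
  \<open>j + 1\<close> for its syzygy number \<open>i + 1\<close>. The final step, from
  \<open>Ext^1\<close> to homomorphisms, is \<open>cohdim_hom\<close>.\<close>

lemma cohdim_syzygy: "cohdim M (Suc (Suc (Suc (i + j)))) = cohdim (syzygy i) (Suc (Suc j))"
proof (induction i arbitrary: j)
  case 0
  show ?case using cohdim_0 by simp
next
  case (Suc i)
  then show ?case using Suc[of "Suc j"] cohdim_Suc by simp
qed

definition res :: "nat \<Rightarrow> ((nat \<Rightarrow> ('a \<Rightarrow> 'b \<Rightarrow> 'k) \<Rightarrow> 'k) \<Rightarrow> 'n) \<Rightarrow> (nat \<Rightarrow> ('a \<Rightarrow> 'b \<Rightarrow> 'k) \<Rightarrow> 'k) \<Rightarrow> 'n" where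
  "res i h = (\<lambda>x. if x \<in> carrier (syzygy i) then h x else 0)"

abbreviation "dim_hom \<equiv> vector_space.dim (hom_scal N)"

lemma res_hom_syzygy: "acyclic_cover.res_hom (F 0) e = res 0" "acyclic_cover.res_hom (F (Suc i)) (d i) = res (Suc i)"
  by (intro ext, simp only: acyclic_cover.res_hom_def[OF cover_0] acyclic_cover.res_hom_def[OF cover_Suc] kernel_syzygy res_def)+

lemma findim_res: "findim (hom_scal N) (res i ` module_homs R (F i) N)"
proof (cases i)
  case 0
  show ?thesis using acyclic_cover.findim_res_hom[OF cover_0] by (simp only: 0 res_hom_syzygy)
next
  case (Suc j)
  show ?thesis using acyclic_cover.findim_res_hom[OF cover_Suc] by (simp only: Suc res_hom_syzygy)
qed

lemma cohdim_hom:
  "cohdim M (Suc (Suc i)) = dim_hom (module_homs R (syzygy i) N) - dim_hom (res i ` module_homs R (F i) N)"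
proof (cases i)
  case 0
  show ?thesis using acyclic_cover.cohomology_dim_2[OF cover_0]
    by (simp only: 0 kernel_syzygy res_hom_syzygy numeral_2_eq_2)
next
  case (Suc j)
  show ?thesis using acyclic_cover.cohomology_dim_2[OF cover_Suc, of j] cohdim_syzygy[of j 0]
    by (simp only: Suc kernel_syzygy res_hom_syzygy numeral_2_eq_2 add_0_right)
qed

abbreviation "Ext_cocycles i \<equiv> {f \<in> module_homs R (F i) N. f \<circ> d i = 0}"

text \<open>Since \<open>d i\<close> maps onto \<open>syzygy i\<close>, vanishing of the composite
  is vanishing there. Outside the carrier \<open>d i\<close> has value 0, and
  \<open>f 0 = 0\<close>.\<close>

lemma Ext_cocycles_eq: "Ext_cocycles i = {f \<in> module_homs R (F i) N. \<forall>x\<in>carrier (syzygy i). f x = 0}"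
proof (rule Collect_cong, rule conj_cong[OF refl])
  fix f assume f: "f \<in> module_homs R (F i) N"
  interpret FN: tensor_module_pair A B "F i" N by (intro tensor_module_pair.intro free_tensor_module N.tensor_module_axioms)
  have "f (d i x) = 0" if "x \<notin> carrier (F (Suc i))" for x
  proof -
    have "d i x = 0" using d_hom[of i] that unfolding module_homs_def by blast
    then show ?thesis using FN.module_homs_0[OF f] by simp
  qed
  then have "f \<circ> d i = 0 \<longleftrightarrow> (\<forall>x\<in>carrier (F (Suc i)). f (d i x) = 0)"
    unfolding fun_eq_iff[of "f \<circ> d i"] by (metis comp_apply zero_fun_apply)
  then show "f \<circ> d i = 0 \<longleftrightarrow> (\<forall>x\<in>carrier (syzygy i). f x = 0)" unfolding d_image[symmetric] by blast
qed

lemma Ext_cocycles_0: "Ext_cocycles 0 = (\<lambda>g. g \<circ> e) ` module_homs R M N"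
  unfolding acyclic_cover.homs_precomp[OF cover_0] Ext_cocycles_eq kernel_syzygy ..

lemma Ext_cocycles_Suc: "Ext_cocycles (Suc i) = (\<lambda>g. g \<circ> d i) ` module_homs R (syzygy i) N"
  unfolding acyclic_cover.homs_precomp[OF cover_Suc] Ext_cocycles_eq kernel_syzygy ..

lemma res_precomp: "res i h \<circ> d i = h \<circ> d i" if h: "h \<in> module_homs R (F i) N"
proof
  interpret FN: tensor_module_pair A B "F i" N by (intro tensor_module_pair.intro free_tensor_module N.tensor_module_axioms)
  fix x
  have "d i x = 0" if "d i x \<notin> carrier (syzygy i)" using that d_hom_syzygy[of i] unfolding module_homs_def by blast
  then show "(res i h \<circ> d i) x = (h \<circ> d i) x" using FN.module_homs_0[OF h] by (auto simp: res_def)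
qed

lemma Ext_coboundaries: "(\<lambda>f. f \<circ> d i) ` module_homs R (F i) N = (\<lambda>g. g \<circ> d i) ` res i ` module_homs R (F i) N"
  unfolding image_image by (rule image_cong) (simp_all only: res_precomp)

text \<open>By left exactness of Hom, cocycles in degree \<open>j + 1\<close> are homomorphisms from
  \<open>syzygy j\<close>, and coboundaries are restrictions to it of homomorphisms from
  \<open>F j\<close>. Precomposition with \<open>d j\<close> preserves both dimensions, and
  \<open>cohdim_hom\<close> gives the same difference.\<close>

theorem resolution_cohomology_dim:
  "cohomology_dim (hom_scal N) (\<lambda>i. module_homs R (F i) N) (\<lambda>i f. f \<circ> d i) i = cohdim M (Suc i)"
proof (cases i)
  case 0
  interpret c: acyclic_cover A B N "F 0" M e by (rule cover_0)
  have "dim_hom (Ext_cocycles 0) = dim_hom (module_homs R M N)"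
    unfolding Ext_cocycles_0 by (rule c.dim_precomp[OF c.XN.findim_homs]) (simp add: module_homs_def)
  then show ?thesis using c.XN.tri_cohomology_dim_1
    by (simp add: 0 cohomology_dim_def dim_zero[OF c.FN.vector_space_homs])
next
  case (Suc j)
  interpret c: acyclic_cover A B N "F (Suc j)" "syzygy j" "d j" by (rule cover_Suc)
  have 1: "dim_hom (Ext_cocycles (Suc j)) = dim_hom (module_homs R (syzygy j) N)"
    unfolding Ext_cocycles_Suc by (rule c.dim_precomp[OF c.XN.findim_homs]) (simp add: module_homs_def)
  have 2: "dim_hom ((\<lambda>f. f \<circ> d j) ` module_homs R (F j) N) = dim_hom (res j ` module_homs R (F j) N)"
    unfolding Ext_coboundaries by (rule c.dim_precomp[OF findim_res]) (auto simp: res_def)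
  show ?thesis unfolding cohomology_dim_def Suc nat.case 1 2 cohdim_hom ..
qed

end

theorem Ext_dim_eq:
  assumes "tensor_module A B M" "tensor_module A B N" "fin_dim A" "fin_dim B" "fin_dim M" "fin_dim N"
  shows "Ext_dim (tensor_product A (opposite B)) M N i = tensor_module_pair.tri_cohomology_dim A B M N (Suc i)"
proof -
  let ?R = "tensor_product A (opposite B)"
  interpret M: tensor_module A B M by fact
  let ?t = "SOME t. (\<lambda>(n, d, e). free_resolution ?R M n d e) t"
  \<comment> \<open>The triple picked in \<open>Ext_dim\<close> is a resolution because some
    resolution exists.\<close>
  have "(\<lambda>(n, d, e). free_resolution ?R M n d e) ?t"
    by (rule someI_ex) (use M.free_resolution_exists[OF assms(3,4) M.M.lmodule_axioms assms(5)] in auto)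
  then obtain n d e where t: "?t = (n, d, e)" "free_resolution ?R M n d e" by (cases ?t) auto
  interpret resolved_module A B M N n d e
    by (intro resolved_module.intro resolved_module_axioms.intro assms t(2))
  show ?thesis using resolution_cohomology_dim[of i] t(1) by (simp add: Ext_dim_def)
qed

theorem mainTheorem8:
  fixes A :: "('k::field, 'a::ab_group_add) alg"
    and B :: "('k, 'b::ab_group_add) alg"
    and M :: "('k, ('a \<Rightarrow> 'b \<Rightarrow> 'k) \<Rightarrow> 'k, 'm::ab_group_add) lmod"
    and m :: nat
  assumes "kalgebra A" and "fin_dim A"
    and "kalgebra B" and "fin_dim B"
    and "lmodule (tensor_product A (opposite B)) M" and "fin_dim M"
    and "m \<ge> 1"
  shows "hilbert_poincare (triangular_algebra A (module_power M m) B) =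
    hilbert_poincare (triangular_algebra A M B) +
    fps_X * fps_const ((int m)\<^sup>2 - 1) * Ext_series (tensor_product A (opposite B)) M M"
proof -
  let ?R = "tensor_product A (opposite B)"
  let ?P = "module_power M m"
  interpret M: tensor_module A B M using assms by (simp add: tensor_module_def tensor_algebra_def)
  interpret P: tensor_module A B ?P
    by (intro tensor_module.intro M.tensor_algebra_axioms module_power_lmodule assms)
  have fP: "fin_dim ?P" by (rule module_power_fin_dim[OF M.M.kspace_axioms assms(6)])
  interpret MM: fin_module_pair A B M M by (intro_locales, unfold_locales) (rule assms)+
  interpret mp: matrix_power A B M "left_act A B M" "right_act A B M" ?P "left_act A B ?P" "right_act A B ?P" m
    by (intro matrix_power.intro matrix_power_axioms.intro triangular.intro M.tensor_bimodule P.tensor_bimodule assms fP)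
      (auto simp: module_power_def left_act_def right_act_def fun_eq_iff)
  have dim: "HH_dim (triangular_algebra A ?P B) i =
      HH_dim (triangular_algebra A M B) i + card mp.index_set * MM.tri_cohomology_dim i" for i
    using mp.HH_dim_power[of i] by (simp add: triangular_algebra_eq MM.tri_cohomology_dim_def)
  show ?thesis
  proof (rule fps_ext)
    fix i
    show "fps_nth (hilbert_poincare (triangular_algebra A ?P B)) i =
      fps_nth (hilbert_poincare (triangular_algebra A M B) + fps_X * fps_const ((int m)\<^sup>2 - 1) * Ext_series ?R M M) i"
    proof (cases i)
      \<comment> \<open>The factor \<open>t\<close> kills the constant coefficient, in accordance
        with the absence of cochains of degree 0; in degree \<open>j + 1\<close> the same factor
        turns the index into that of \<open>Ext^j\<close>.\<close>
      case 0
      then show ?thesis by (simp add: hilbert_poincare_def dim MM.tri_cohomology_dim_0 mult.assoc)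
    next
      case (Suc j)
      have "MM.tri_cohomology_dim (Suc j) = Ext_dim ?R M M j"
        by (rule Ext_dim_eq[OF M.tensor_module_axioms M.tensor_module_axioms assms(2,4,6,6), symmetric])
      then show ?thesis
        by (simp add: Suc hilbert_poincare_def Ext_series_def dim mp.card_index_set mult.assoc)
    qed
  qed
qed

end
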